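(* Fix $r\in\mathbb{N}$ and consider the Beta model with parameter $\nu>0$ or the spherical model (in which case put $\nu=0$): for $n\ge r$ let $X_1,\ldots,X_{r+1}$ be i.i.d. points in $\mathbb{R}^n$ from the model, let $\mathcal V_{n,r}$ be the $r$-dimensional volume of the simplex with these vertices and $\mathcal L_{n,r}=\log(r!\,\mathcal V_{n,r})$. Then, as $n\to\infty$, $n\mathcal L_{n,r}$ converges in the mod-$\phi$ sense with $$\eta(t)=\frac{(r+1)(t+1)}2\log((r+1)(t+1))-\frac{r(t+1)+1}2\log(r(t+1)+1)-\frac{t+1}2\log(t+1)$$ and parameter $w_n=n$, namely $$\lim_{n\to\infty}\frac{\mathbb{E}e^{tn\mathcal L_{n,r}}}{e^{n\eta(t)}}=(1+t)^{\frac{1-\nu(r+1)}2-\frac{r(r-1)}4}\left(\frac{(r+1)(t+1)}{r(t+1)+1}\right)^{\frac{\nu(r+1)-2r-1}2}$$ uniformly as long as $t$ stays in any compact subset of $\mathbb{C}\setminus(-\infty,-1]$.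
   Context: Beta model with parameter $\nu>0$: density $\pi^{-n/2}\frac{\Gamma((n+\nu)/2)}{\Gamma(\nu/2)}(1-|x|^2)^{(\nu-2)/2}$ on $\{x\in\mathbb{R}^n:|x|<1\}$. Spherical model: uniform distribution on the unit sphere of $\mathbb{R}^n$ ($n\ge2$). Mod-$\phi$ convergence: real random variables $Y_n$ converge in the mod-$\phi$ sense with $\eta$ and parameters $w_n\to+\infty$ if $\phi$ is an infinitely divisible distribution with $\int e^{tx}\phi(dx)=e^{\eta(t)}$ on an open strip $S=\{c_-<\operatorname{Re}t<c_+\}$ of the complex plane, and $\mathbb{E}e^{tY_n}/e^{w_n\eta(t)}$ converges, locally uniformly on $S$, to an analytic limit function. Logarithms and powers are principal branches. For complex $t$ at which the expectation does not converge absolutely, $\mathbb{E}e^{tY_n}$ is understood as the meromorphic continuation in $t$ of the moment generating function. *)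

theory Defs
  imports "HOL-Probability.Probability" "HOL-Complex_Analysis.Complex_Analysis"
begin

section \<open>Euclidean space of variable dimension\<close>

text \<open>
  The dimension tends to infinity, so it cannot be a type. Points of n-dimensional space are
  functions on the index set {..<n}, extended by \<^const>\<open>undefined\<close>, that is, the elements of
  the space of the following product measure (n-dimensional Lebesgue measure on the Borel sets).
\<close>

abbreviation leb :: "nat \<Rightarrow> (nat \<Rightarrow> real) measure" where
  "leb n \<equiv> PiM {..<n} (\<lambda>_. lborel)"

abbreviation enorm :: "nat \<Rightarrow> (nat \<Rightarrow> real) \<Rightarrow> real" where
  "enorm n x \<equiv> L2_set x {..<n}"


section \<open>The two models\<close>

definition beta_model :: "real \<Rightarrow> nat \<Rightarrow> (nat \<Rightarrow> real) measure" where
  "beta_model \<nu> n = density (leb n) (\<lambda>x. ennreal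
     (if enorm n x < 1
      then pi powr (- real n / 2) * (Gamma ((real n + \<nu>) / 2) / Gamma (\<nu> / 2))
             * (1 - (enorm n x)\<^sup>2) powr ((\<nu> - 2) / 2)
      else 0))"

text \<open>
  Normalised surface measure of the unit sphere: a set A of directions has measure
  vol {s a | 0 < s < 1, a in A} / vol (unit ball), i.e. it is the law of x / |x| for x uniform in
  the unit ball.
\<close>

definition spherical_model :: "nat \<Rightarrow> (nat \<Rightarrow> real) measure" where
  "spherical_model n =
     distr (uniform_measure (leb n) {x \<in> space (leb n). enorm n x < 1}) (leb n)
       (\<lambda>x. \<lambda>i\<in>{..<n}. x i / enorm n x)"


section \<open>Simplices and their volume\<close>

definition simplex_hull :: "nat \<Rightarrow> 'i set \<Rightarrow> ('i \<Rightarrow> nat \<Rightarrow> real) \<Rightarrow> (nat \<Rightarrow> real) set" where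
  "simplex_hull n I x =
     {(\<lambda>k\<in>{..<n}. \<Sum>i\<in>I. u i * x i k) | u. (\<forall>i\<in>I. 0 \<le> u i) \<and> sum u I = 1}"

definition orthonormal_frame :: "nat \<Rightarrow> nat \<Rightarrow> (nat \<Rightarrow> nat \<Rightarrow> real) \<Rightarrow> bool" where
  "orthonormal_frame n r e \<longleftrightarrow>
     (\<forall>i<r. \<forall>j<r. (\<Sum>k<n. e i k * e j k) = (if i = j then 1 else 0))"

definition flat_point ::
  "nat \<Rightarrow> nat \<Rightarrow> (nat \<Rightarrow> real) \<Rightarrow> (nat \<Rightarrow> nat \<Rightarrow> real) \<Rightarrow> (nat \<Rightarrow> real) \<Rightarrow> nat \<Rightarrow> real" where
  "flat_point n r p e c = (\<lambda>k\<in>{..<n}. p k + (\<Sum>j<r. c j * e j k))"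

text \<open>
  The r-dimensional volume of a subset S of an r-flat of n-dimensional space: the r-dimensional
  Lebesgue measure of S in Cartesian coordinates of a flat containing S. The value does not
  depend on the coordinates; if S lies in several r-flats (a degenerate simplex), it is 0.
\<close>

definition flat_volume :: "nat \<Rightarrow> nat \<Rightarrow> (nat \<Rightarrow> real) set \<Rightarrow> real" where
  "flat_volume n r S =
     (THE v. \<exists>p e. orthonormal_frame n r e
        \<and> S \<subseteq> flat_point n r p e ` space (leb r)
        \<and> v = measure (leb r) {c \<in> space (leb r). flat_point n r p e c \<in> S})"

definition log_volume :: "nat \<Rightarrow> nat \<Rightarrow> (nat \<Rightarrow> nat \<Rightarrow> real) \<Rightarrow> real" where
  "log_volume n r x = ln (fact r * flat_volume n r (simplex_hull n {1..r+1} x))"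


section \<open>Moment generating functions and mod-phi convergence\<close>

text \<open>
  \<^const>\<open>nicely_meromorphic_on\<close> fixes the values of the continuation: 0 at poles, removable
  singularities removed. The expectation converges absolutely at least on the imaginary axis,
  so the continuation is unique.
\<close>

definition mgf_continuation :: "'a measure \<Rightarrow> ('a \<Rightarrow> real) \<Rightarrow> (complex \<Rightarrow> complex) \<Rightarrow> bool" where
  "mgf_continuation M Y F \<longleftrightarrow>
     F nicely_meromorphic_on UNIV \<and>
     (\<forall>t. integrable M (\<lambda>\<omega>. exp (t * complex_of_real (Y \<omega>))) \<longrightarrow>
        F t = (LINT \<omega>|M. exp (t * complex_of_real (Y \<omega>))))"

definition ext_mgf :: "'a measure \<Rightarrow> ('a \<Rightarrow> real) \<Rightarrow> complex \<Rightarrow> complex" where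
  "ext_mgf M Y = (THE F. mgf_continuation M Y F)"

text \<open>For every m, the distribution is the law of a sum of m i.i.d. real random variables.\<close>

definition infinitely_divisible :: "real measure \<Rightarrow> bool" where
  "infinitely_divisible \<phi> \<longleftrightarrow> real_distribution \<phi> \<and>
     (\<forall>m::nat. m \<ge> 1 \<longrightarrow> (\<exists>\<mu>. real_distribution \<mu> \<and>
        distr (PiM {..<m} (\<lambda>_. \<mu>)) borel (\<lambda>x. \<Sum>i<m. x i) = \<phi>))"

definition strip :: "ereal \<Rightarrow> ereal \<Rightarrow> complex set" where
  "strip a b = {t. a < ereal (Re t) \<and> ereal (Re t) < b}"

definition mod_phi_converges ::
  "(nat \<Rightarrow> 'a measure) \<Rightarrow> (nat \<Rightarrow> 'a \<Rightarrow> real) \<Rightarrow> (complex \<Rightarrow> complex) \<Rightarrow> (nat \<Rightarrow> real)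
     \<Rightarrow> ereal \<Rightarrow> ereal \<Rightarrow> (complex \<Rightarrow> complex) \<Rightarrow> bool" where
  "mod_phi_converges M Y \<eta> w a b \<psi> \<longleftrightarrow>
     a < b \<and> filterlim w at_top sequentially \<and>
     (\<exists>\<phi>. infinitely_divisible \<phi> \<and>
        (\<forall>t\<in>strip a b. integrable \<phi> (\<lambda>x. exp (t * complex_of_real x)) \<and>
           (LINT x|\<phi>. exp (t * complex_of_real x)) = exp (\<eta> t))) \<and>
     \<psi> analytic_on strip a b \<and>
     (\<forall>K. compact K \<and> K \<subseteq> strip a b \<longrightarrow>
        uniform_limit K (\<lambda>n t. ext_mgf (M n) (Y n) t / exp (complex_of_real (w n) * \<eta> t))
          \<psi> sequentially)"


section \<open>The cumulant function and the limit function\<close>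

definition eta :: "nat \<Rightarrow> complex \<Rightarrow> complex" where
  "eta r t =
     (of_nat r + 1) * (t + 1) / 2 * Ln ((of_nat r + 1) * (t + 1))
     - (of_nat r * (t + 1) + 1) / 2 * Ln (of_nat r * (t + 1) + 1)
     - (t + 1) / 2 * Ln (t + 1)"

definition limit_fun :: "nat \<Rightarrow> real \<Rightarrow> complex \<Rightarrow> complex" where
  "limit_fun r \<nu> t =
     (1 + t) powr complex_of_real
        ((1 - \<nu> * (real r + 1)) / 2 - real r * (real r - 1) / 4)
     * ((of_nat r + 1) * (t + 1) / (of_nat r * (t + 1) + 1)) powr complex_of_real
        ((\<nu> * (real r + 1) - 2 * real r - 1) / 2)"

end

theory Submission
  imports Defs "Jordan_Normal_Form.Determinant" "HOL-Real_Asymp.Real_Asymp"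
begin

text \<open>
  The volume of the simplex is governed by the Gram determinant of its edge vectors, whose moments
  are quotients of Gamma functions. For the parallelotope spanned by the points themselves these
  moments are found by integrating out one point after the other. The Gram determinant of
  \<open>r + 1\<close> points is the one of the \<open>r\<close> edges times the squared distance of the origin from the
  affine hull of the points, and this distance is Beta distributed under the law tilted by a power
  of the simplex volume; hence the moments for the simplex. The spherical model is the limit of
  the Beta model as \<open>\<nu>\<close> tends to 0: radial projection of the Beta model to the sphere
  gives the uniform distribution and moves the points by a distance that vanishes in the mean.

  The Gamma quotient is meromorphic and therefore continues the moment generating function, and
  Stirling's formula yields the limit. For every \<open>a > 0\<close> the function \<open>exp (a * eta r t)\<close> is the
  moment generating function of a sum of a constant, a reflected Gamma variable and a reflected
  compound Poisson variable; \<open>a = 1 / m\<close> gives infinite divisibility.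
\<close>

section \<open>Continuation of moment generating functions\<close>

text \<open>Three obstacles shape the proof. The dimension is a number, not a type, so rotation
  invariance, linear substitution and radial integration are established for product measures on
  functions. The continued expectation is given by \<open>THE\<close>, which calls for existence and
  uniqueness, including agreement at boundary points of the domain of convergence. And since
  \<open>ln 0 = 0\<close>, a degenerate simplex would contribute 1 to every exponential moment, so
  almost sure positivity of the volume has to be known. It follows from the moment formula itself:
  the continued moment function is regular at 0 with value 1, whereas moments of small order tend to
  the probability of positive volume. The edges of a random simplex are dependent, which blocks
  integration point by point; the points themselves are independent with rotation invariant laws.
  This is the reason for starting with parallelotopes. The moments enter the continuation for
  exponents at least 2 only, the range in which the integrands comparing the two models are
  Lipschitz; the identity theorem supplies the rest.\<close>

lemma nicely_meromorphic_on_eqI: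
  assumes f: "f nicely_meromorphic_on A" and g: "g nicely_meromorphic_on A"
    and A: "open A" "connected A" "z0 \<in> A"
    and freq: "\<exists>\<^sub>F z in at z0. f z = g z" and x: "x \<in> A"
  shows "f x = g x"
proof -
  have mf: "f meromorphic_on A" and mg: "g meromorphic_on A"
    using f g by (auto simp: nicely_meromorphic_on_def)
  have "(\<lambda>z. f z - g z) meromorphic_on A"
    by (intro meromorphic_intros mf mg)
  then have "(\<forall>\<^sub>\<approx>z\<in>A. f z - g z = 0) \<or> (\<forall>\<^sub>\<approx>z\<in>A. f z - g z \<noteq> 0)"
    using A by (intro meromorphic_imp_constant_or_avoid)
  moreover have "\<not> (\<forall>\<^sub>\<approx>z\<in>A. f z - g z \<noteq> 0)"
    using freq A by (auto simp: eventually_cosparse_open_eq frequently_def)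
  ultimately have ev: "\<forall>\<^sub>F z in at x. f z = g z"
    using A x by (auto simp: eventually_cosparse_open_eq)
  have "is_pole f x \<longleftrightarrow> is_pole g x"
    using ev by (intro is_pole_cong) auto
  moreover have "f x = g x" if "f \<midarrow>x\<rightarrow> f x" "g \<midarrow>x\<rightarrow> g x"
  proof -
    have "f \<midarrow>x\<rightarrow> g x"
      using that(2) ev by (subst tendsto_cong[OF ev]) auto
    with that(1) show ?thesis using LIM_unique by blast
  qed
  \<comment> \<open>A finite limit excludes a pole, so both functions fall into the same case of the
    definition: at a common pole both are 0, elsewhere both equal their limit.\<close>
  moreover have "\<not> is_pole f x" if "f \<midarrow>x\<rightarrow> f x" for f :: "complex \<Rightarrow> complex"
    using that unfolding is_pole_def
    by (metis at_neq_bot not_tendsto_and_filterlim_at_infinity)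
  ultimately show ?thesis
    using f g x unfolding nicely_meromorphic_on_def by metis
qed

lemma eventually_remove_sings_eq_UNIV:
  "f meromorphic_on UNIV \<Longrightarrow> \<forall>\<^sub>F z in at x. remove_sings f z = f z"
  using eventually_remove_sings_eq[of f UNIV] by (simp add: eventually_cosparse_open_eq)

text \<open>Provides the dominating function on a vertical strip: the real exponents at its two
  edges control all exponents between, for either sign of \<open>x\<close>.\<close>

lemma exp_interpolate_le:
  fixes a b c x :: real
  assumes "a \<le> c" "c \<le> b"
  shows "exp (c * x) \<le> exp (a * x) + exp (b * x)"
proof (cases "x \<ge> 0")
  case True
  then have "exp (c * x) \<le> exp (b * x)" using assms by (simp add: mult_right_mono)
  then show ?thesis by (smt (verit) exp_ge_zero)
next
  case False
  then have "exp (c * x) \<le> exp (a * x)" using assms by (simp add: mult_right_mono_neg)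
  then show ?thesis by (smt (verit) exp_ge_zero)
qed

section \<open>Holomorphy of moment generating functions on a strip\<close>

lemma integrable_exp_between:
  fixes X :: "'a \<Rightarrow> real"
  assumes X: "X \<in> borel_measurable M"
    and ia: "integrable M (\<lambda>\<omega>. exp (a * X \<omega>))" and ib: "integrable M (\<lambda>\<omega>. exp (b * X \<omega>))"
    and t: "a \<le> Re t" "Re t \<le> b"
  shows "integrable M (\<lambda>\<omega>. exp (t * complex_of_real (X \<omega>)))"
proof (rule Bochner_Integration.integrable_bound[OF Bochner_Integration.integrable_add[OF ia ib]])
  show "AE \<omega> in M. norm (exp (t * complex_of_real (X \<omega>))) \<le> norm (exp (a * X \<omega>) + exp (b * X \<omega>))"
    using exp_interpolate_le[OF t] by (intro AE_I2) (simp add: norm_exp_eq_Re)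
qed (use X in measurable)

lemma norm_exp_minus_one_le: "norm (exp z - 1) \<le> norm z * exp (norm z)" for z :: complex
proof -
  have "norm (exp z - exp 0) \<le> exp (norm z) * norm (z - 0)"
  proof (rule field_differentiable_bound[of "cball 0 (norm z)" exp exp])
    show "norm (exp w) \<le> exp (norm z)" if "w \<in> cball 0 (norm z)" for w
      using that norm_exp[of w] by (simp add: order.trans)
  qed (auto intro!: derivative_eq_intros DERIV_subset[OF DERIV_exp])
  then show ?thesis by (simp add: mult.commute)
qed

text \<open>Differentiation under the integral sign: for small \<open>h\<close> the difference
  quotients are dominated by a fixed multiple of the two exponentials at the edges of the
  strip.\<close>

lemma mgf_has_field_derivative:
  fixes X :: "'a \<Rightarrow> real"
  assumes X[measurable]: "X \<in> borel_measurable M"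
    and ia: "integrable M (\<lambda>\<omega>. exp (a * X \<omega>))" and ib: "integrable M (\<lambda>\<omega>. exp (b * X \<omega>))"
    and t: "a < Re t" "Re t < b"
  shows "((\<lambda>t. LINT \<omega>|M. exp (t * complex_of_real (X \<omega>))) has_field_derivative
           (LINT \<omega>|M. complex_of_real (X \<omega>) * exp (t * complex_of_real (X \<omega>)))) (at t)"
proof -
  \<comment> \<open>Room \<open>2 * \<delta>\<close> on either side of \<open>Re t\<close> is used
    up as follows: one \<open>\<delta>\<close> absorbs the factor
    \<open>\<bar>X \<omega>\<bar>\<close>, because
    \<open>x \<le> exp (\<delta> * x) / \<delta>\<close>, the other one the factor
    \<open>exp (norm h * \<bar>X \<omega>\<bar>)\<close>.\<close>
  define \<delta> where "\<delta> = min (Re t - a) (b - Re t) / 2"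
  have \<delta>: "\<delta> > 0" "a \<le> Re t - 2 * \<delta>" "Re t + 2 * \<delta> \<le> b" using t by (auto simp: \<delta>_def min_def field_simps)
  let ?E = "\<lambda>t \<omega>. exp (t * complex_of_real (X \<omega>))"
  let ?g = "\<lambda>\<omega>. (2 / \<delta>) * (exp (a * X \<omega>) + exp (b * X \<omega>))"
  have int: "integrable M (?E u)" if "a \<le> Re u" "Re u \<le> b" for u
    using integrable_exp_between[OF X ia ib that] .
  have bound: "norm ((?E (t + h) \<omega> - ?E t \<omega>) / h) \<le> ?g \<omega>" if h: "norm h < \<delta>" "h \<noteq> 0" for h \<omega>
  proof -
    have "?E (t + h) \<omega> - ?E t \<omega> = ?E t \<omega> * (exp (h * X \<omega>) - 1)"
      by (simp add: algebra_simps exp_add)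
    then have "norm ((?E (t + h) \<omega> - ?E t \<omega>) / h) = exp (Re t * X \<omega>) * norm (exp (h * X \<omega>) - 1) / norm h"
      by (simp add: norm_mult norm_divide norm_exp_eq_Re)
    also have "\<dots> \<le> exp (Re t * X \<omega>) * (norm (h * X \<omega>) * exp (norm (h * X \<omega>))) / norm h"
      by (intro divide_right_mono mult_left_mono norm_exp_minus_one_le) auto
    also have "\<dots> = exp (Re t * X \<omega>) * (\<bar>X \<omega>\<bar> * exp (norm h * \<bar>X \<omega>\<bar>))"
      using h by (simp add: norm_mult)
    also have "\<dots> \<le> exp (Re t * X \<omega>) * ((exp (\<delta> * \<bar>X \<omega>\<bar>) / \<delta>) * exp (\<delta> * \<bar>X \<omega>\<bar>))"
    proof -
      have "\<delta> * \<bar>X \<omega>\<bar> \<le> exp (\<delta> * \<bar>X \<omega>\<bar>)" using exp_ge_add_one_self[of "\<delta> * \<bar>X \<omega>\<bar>"] by linarith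
      then have "\<bar>X \<omega>\<bar> \<le> exp (\<delta> * \<bar>X \<omega>\<bar>) / \<delta>" using \<delta> by (simp add: field_simps)
      moreover have "exp (norm h * \<bar>X \<omega>\<bar>) \<le> exp (\<delta> * \<bar>X \<omega>\<bar>)" using h by (simp add: mult_right_mono)
      ultimately show ?thesis using \<delta> by (intro mult_left_mono mult_mono) auto
    qed
    also have "\<dots> = exp (Re t * X \<omega> + 2 * \<delta> * \<bar>X \<omega>\<bar>) / \<delta>"
      by (simp add: exp_add[symmetric])
    also have "exp (Re t * X \<omega> + 2 * \<delta> * \<bar>X \<omega>\<bar>) \<le> exp ((Re t + 2 * \<delta>) * X \<omega>) + exp ((Re t - 2 * \<delta>) * X \<omega>)"
      by (cases "X \<omega> \<ge> 0") (auto simp: algebra_simps intro: order.trans add_increasing add_increasing2)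
    also have "\<dots> \<le> (exp (a * X \<omega>) + exp (b * X \<omega>)) + (exp (a * X \<omega>) + exp (b * X \<omega>))"
      using \<delta> t by (intro add_mono exp_interpolate_le) auto
    finally show ?thesis using \<delta> by (simp add: divide_right_mono field_simps)
  qed
  have "(\<lambda>h. ((LINT \<omega>|M. ?E (t + h) \<omega>) - (LINT \<omega>|M. ?E t \<omega>)) / h) \<midarrow>0\<rightarrow> (LINT \<omega>|M. complex_of_real (X \<omega>) * ?E t \<omega>)"
    unfolding tendsto_at_iff_sequentially
  proof (intro allI impI)
    fix h :: "nat \<Rightarrow> complex" assume h0: "\<forall>i. h i \<in> UNIV - {0}" and h: "h \<longlonglongrightarrow> 0"
    have "\<forall>\<^sub>F i in sequentially. norm (h i) < \<delta>"
      using h \<delta>(1) by (simp add: tendsto_iff dist_norm)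
    then obtain N where N: "\<And>i. i \<ge> N \<Longrightarrow> norm (h i) < \<delta>"
      by (auto simp: eventually_sequentially)
    define k where "k i = h (i + N)" for i
    have k: "k i \<noteq> 0" "norm (k i) < \<delta>" for i using N h0 by (auto simp: k_def)
    have k0: "k \<longlonglongrightarrow> 0" unfolding k_def using LIMSEQ_ignore_initial_segment[OF h] .
    have "(\<lambda>i. LINT \<omega>|M. (?E (t + k i) \<omega> - ?E t \<omega>) / k i) \<longlonglongrightarrow> (LINT \<omega>|M. complex_of_real (X \<omega>) * ?E t \<omega>)"
    proof (rule integral_dominated_convergence[where w = ?g])
      show "integrable M ?g" using ia ib by auto
      show "AE \<omega> in M. (\<lambda>i. (?E (t + k i) \<omega> - ?E t \<omega>) / k i) \<longlonglongrightarrow> complex_of_real (X \<omega>) * ?E t \<omega>"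
      proof (intro AE_I2)
        fix \<omega>
        have "((\<lambda>u. ?E u \<omega>) has_field_derivative complex_of_real (X \<omega>) * ?E t \<omega>) (at t)"
          by (auto intro!: derivative_eq_intros)
        then have "(\<lambda>h. (?E (t + h) \<omega> - ?E t \<omega>) / h) \<midarrow>0\<rightarrow> complex_of_real (X \<omega>) * ?E t \<omega>"
          by (simp add: DERIV_def)
        then show "(\<lambda>i. (?E (t + k i) \<omega> - ?E t \<omega>) / k i) \<longlonglongrightarrow> complex_of_real (X \<omega>) * ?E t \<omega>"
          using k k0 by (auto simp: tendsto_at_iff_sequentially o_def)
      qed
      show "AE \<omega> in M. norm ((?E (t + k i) \<omega> - ?E t \<omega>) / k i) \<le> ?g \<omega>" for i
        using bound k by auto
    qed measurable
    moreover have "(\<lambda>i. LINT \<omega>|M. (?E (t + k i) \<omega> - ?E t \<omega>) / k i) =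
      (\<lambda>i. ((LINT \<omega>|M. ?E (t + k i) \<omega>) - (LINT \<omega>|M. ?E t \<omega>)) / k i)"
    proof
      fix i
      have "\<bar>Re (k i)\<bar> < \<delta>" using k(2)[of i] abs_Re_le_cmod[of "k i"] by linarith
      then have "integrable M (?E (t + k i))" "integrable M (?E t)"
        using \<delta> t by (auto intro!: int)
      then show "(LINT \<omega>|M. (?E (t + k i) \<omega> - ?E t \<omega>) / k i) =
        ((LINT \<omega>|M. ?E (t + k i) \<omega>) - (LINT \<omega>|M. ?E t \<omega>)) / k i" by simp
    qed
    ultimately have "(\<lambda>i. ((LINT \<omega>|M. ?E (t + k i) \<omega>) - (LINT \<omega>|M. ?E t \<omega>)) / k i)
      \<longlonglongrightarrow> (LINT \<omega>|M. complex_of_real (X \<omega>) * ?E t \<omega>)" by (simp only:)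
    then show "((\<lambda>h. ((LINT \<omega>|M. ?E (t + h) \<omega>) - (LINT \<omega>|M. ?E t \<omega>)) / h) \<circ> h) \<longlonglongrightarrow> (LINT \<omega>|M. complex_of_real (X \<omega>) * ?E t \<omega>)"
      unfolding k_def o_def
      by (rule LIMSEQ_offset[of "\<lambda>i. ((LINT \<omega>|M. ?E (t + h i) \<omega>) - (LINT \<omega>|M. ?E t \<omega>)) / h i" N])
  qed
  then show ?thesis by (simp add: DERIV_def)
qed

lemma mgf_analytic_at:
  fixes X :: "'a \<Rightarrow> real"
  assumes X: "X \<in> borel_measurable M"
    and ia: "integrable M (\<lambda>\<omega>. exp (a * X \<omega>))" and ib: "integrable M (\<lambda>\<omega>. exp (b * X \<omega>))"
  shows "(\<lambda>t. LINT \<omega>|M. exp (t * complex_of_real (X \<omega>))) analytic_on {t. a < Re t \<and> Re t < b}"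
proof -
  have "open ({t. a < Re t} \<inter> {t. Re t < b})"
    by (intro open_Int open_halfspace_Re_gt open_halfspace_Re_lt)
  then have "open {t. a < Re t \<and> Re t < b}" by (simp add: Collect_conj_eq)
  moreover have "(\<lambda>t. LINT \<omega>|M. exp (t * complex_of_real (X \<omega>))) holomorphic_on {t. a < Re t \<and> Re t < b}"
    unfolding holomorphic_on_def field_differentiable_def
    using mgf_has_field_derivative[OF assms] has_field_derivative_at_within by blast
  ultimately show ?thesis by (simp add: analytic_on_open)
qed

section \<open>Existence and uniqueness of the continuation\<close>

lemma frequently_at_of_realI:
  assumes "\<And>x. x > a \<Longrightarrow> f (complex_of_real x) = g (complex_of_real x)" and "x0 \<ge> a"
  shows "\<exists>\<^sub>F z in at (complex_of_real x0). f z = g z"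
proof -
  have "\<exists>z. z \<noteq> complex_of_real x0 \<and> dist z (complex_of_real x0) < d \<and> f z = g z" if "d > 0" for d
    using that assms(2) assms(1)[of "x0 + d / 2"]
    by (intro exI[of _ "complex_of_real (x0 + d / 2)"]) (auto simp: dist_norm)
  then show ?thesis by (auto simp: frequently_def eventually_at)
qed

lemma integrable_exp_bounded_above:
  fixes Y :: "'a \<Rightarrow> real"
  assumes "prob_space M" and Y[measurable]: "Y \<in> borel_measurable M" and le: "AE \<omega> in M. Y \<omega> \<le> K" and b: "b \<ge> 0"
  shows "integrable M (\<lambda>\<omega>. exp (b * Y \<omega>))"
proof -
  interpret prob_space M by fact
  show ?thesis
  proof (rule integrable_const_bound)
    show "AE \<omega> in M. norm (exp (b * Y \<omega>)) \<le> exp (b * K)"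
      using le b by (auto simp: mult_left_mono)
  qed measurable
qed

text \<open>As \<open>Y\<close> is bounded above almost surely, the expectation converges for all
  positive real \<open>t\<close>. Two continuations agree there, and these points accumulate at the
  origin.\<close>

lemma mgf_continuation_unique:
  assumes M: "prob_space M" and Y[measurable]: "Y \<in> borel_measurable M" and le: "AE \<omega> in M. Y \<omega> \<le> K"
    and F: "mgf_continuation M Y F" and G: "mgf_continuation M Y G"
  shows "F = G"
proof
  fix t
  have eq: "F (complex_of_real x) = G (complex_of_real x)" if "x > 0" for x
  proof -
    have "integrable M (\<lambda>\<omega>. exp (x * Y \<omega>))"
      using integrable_exp_bounded_above[OF M Y le] that by auto
    then have "integrable M (\<lambda>\<omega>. exp (complex_of_real x * complex_of_real (Y \<omega>)))"
      by (intro integrable_exp_between[where a = x and b = x]) auto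
    then show ?thesis using F G by (auto simp: mgf_continuation_def)
  qed
  show "F t = G t"
  proof (rule nicely_meromorphic_on_eqI[where f = F and g = G and A = UNIV])
    show "\<exists>\<^sub>F z in at (complex_of_real 0). F z = G z"
      by (rule frequently_at_of_realI[of 0]) (use eq in auto)
  qed (use F G in \<open>auto simp: mgf_continuation_def\<close>)
qed

text \<open>Values on a real half line determine \<open>F\<close>, but the definition also demands
  agreement at every single \<open>t0\<close> where the expectation converges absolutely, and such a
  point may lie on the boundary of the domain of convergence. To the right of \<open>Re t0\<close>
  convergence is automatic because \<open>Y\<close> is bounded above; there the identity theorem
  applies, and \<open>t0\<close> is reached as a limit from the right.\<close>

lemma mgf_continuationI:
  assumes M: "prob_space M" and Y[measurable]: "Y \<in> borel_measurable M" and le: "AE \<omega> in M. Y \<omega> \<le> K"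
    and F: "F nicely_meromorphic_on UNIV"
    and eq: "\<And>x. x > a \<Longrightarrow> F (complex_of_real x) = (LINT \<omega>|M. exp (complex_of_real x * complex_of_real (Y \<omega>)))"
  shows "mgf_continuation M Y F"
  unfolding mgf_continuation_def
proof (intro conjI F allI impI)
  fix t0 assume int0: "integrable M (\<lambda>\<omega>. exp (t0 * complex_of_real (Y \<omega>)))"
  let ?A = "\<lambda>t. LINT \<omega>|M. exp (t * complex_of_real (Y \<omega>))"
  define \<sigma> where "\<sigma> = Re t0"
  \<comment> \<open>Large enough for the strip to contain the real point \<open>b - 1 > a\<close>,
    near which \<open>F\<close> is known, and all points \<open>t0 + q\<close> with
    \<open>0 < q \<le> 1\<close>.\<close>
  define b where "b = \<bar>\<sigma>\<bar> + \<bar>a\<bar> + 3"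
  have ia: "integrable M (\<lambda>\<omega>. exp (\<sigma> * Y \<omega>))"
    using integrable_norm[OF int0] by (simp add: norm_exp_eq_Re \<sigma>_def)
  have ib: "integrable M (\<lambda>\<omega>. exp (b * Y \<omega>))"
    using integrable_exp_bounded_above[OF M Y le] by (auto simp: b_def)
  let ?S = "{t. \<sigma> < Re t \<and> Re t < b}"
  have anA: "?A analytic_on ?S" by (rule mgf_analytic_at[OF Y ia ib])
  have S_eq: "?S = {t. \<sigma> < Re t} \<inter> {t. Re t < b}" by auto
  have S: "open ?S" "connected ?S"
    unfolding S_eq by (auto intro!: open_halfspace_Re_gt open_halfspace_Re_lt convex_connected convex_Int
      convex_halfspace_Re_gt convex_halfspace_Re_lt)
  have FA: "F t = ?A t" if "t \<in> ?S" for t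
  proof (rule nicely_meromorphic_on_eqI[where f = F and g = ?A and A = ?S])
    show "F nicely_meromorphic_on ?S" using F nicely_meromorphic_on_subset by blast
    show "?A nicely_meromorphic_on ?S" using anA analytic_on_imp_nicely_meromorphic_on by blast
    show "\<exists>\<^sub>F z in at (complex_of_real (b - 1)). F z = ?A z"
      by (rule frequently_at_of_realI[of a]) (use eq in \<open>auto simp: b_def\<close>)
  qed (use that S in \<open>auto simp: b_def\<close>)
  define s where "s k = t0 + complex_of_real (1 / (real k + 1))" for k :: nat
  have sS: "s k \<in> ?S" for k
  proof -
    define q where "q = 1 / (real k + 1)"
    have "0 < q" "q \<le> 1" by (auto simp: q_def)
    moreover have "s k = t0 + complex_of_real q" by (simp add: s_def q_def)
    ultimately show ?thesis by (auto simp: \<sigma>_def b_def)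
  qed
  have s0: "s \<longlonglongrightarrow> t0"
  proof -
    have "(\<lambda>k. complex_of_real (1 / (real k + 1))) \<longlonglongrightarrow> complex_of_real 0"
      by (intro tendsto_of_real) real_asymp
    then show ?thesis unfolding s_def by (auto intro: tendsto_eq_intros)
  qed
  have "(\<lambda>k. ?A (s k)) \<longlonglongrightarrow> ?A t0"
  proof (rule integral_dominated_convergence[where w = "\<lambda>\<omega>. exp (\<sigma> * Y \<omega>) + exp (b * Y \<omega>)"])
    show "AE \<omega> in M. (\<lambda>k. exp (s k * complex_of_real (Y \<omega>))) \<longlonglongrightarrow> exp (t0 * complex_of_real (Y \<omega>))"
      by (intro AE_I2 tendsto_intros s0)
    show "AE \<omega> in M. norm (exp (s k * complex_of_real (Y \<omega>))) \<le> exp (\<sigma> * Y \<omega>) + exp (b * Y \<omega>)" for k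
      using sS[of k] by (intro AE_I2) (auto simp: norm_exp_eq_Re intro!: exp_interpolate_le)
  qed (use ia ib in auto)
  then have lim: "(\<lambda>k. F (s k)) \<longlonglongrightarrow> ?A t0"
    using FA[OF sS] by simp
  have sat: "filterlim s (at t0) sequentially"
    using s0 by (auto simp: filterlim_at s_def intro!: always_eventually) (smt (verit) of_nat_0_le_iff of_real_1 of_real_add of_real_eq_0_iff of_real_of_nat_eq)
  \<comment> \<open>Along the sequence \<open>s\<close> the values of \<open>F\<close> have a finite
    limit, which rules out a pole.\<close>
  consider "is_pole F t0" | "F \<midarrow>t0\<rightarrow> F t0"
    using F by (auto simp: nicely_meromorphic_on_def)
  then show "F t0 = ?A t0"
  proof cases
    case 1
    then have "filterlim (\<lambda>k. F (s k)) at_infinity sequentially"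
      unfolding is_pole_def using filterlim_compose sat by blast
    then show ?thesis using lim not_tendsto_and_filterlim_at_infinity[of sequentially] by auto
  next
    case 2
    then have "(\<lambda>k. F (s k)) \<longlonglongrightarrow> F t0" using sat filterlim_compose by blast
    then show ?thesis using lim LIMSEQ_unique by blast
  qed
qed

text \<open>As \<open>s\<close> decreases to 0, \<open>D \<omega> powr s\<close> tends to the
  indicator of \<open>D \<omega> > 0\<close>, so the moments tend to the probability of this event;
  by the identity theorem they also tend to \<open>G 0 = 1\<close>. Positivity matters because
  \<open>ln 0 = 0\<close>: where \<open>D \<omega> = 0\<close>, the variable
  \<open>exp (t * ln (D \<omega>))\<close> is 1 while \<open>D \<omega> powr t\<close> is 0.\<close>

lemma AE_pos_if_moments_continuous:
  fixes D :: "'a \<Rightarrow> real"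
  assumes M: "prob_space M" and D[measurable]: "D \<in> borel_measurable M"
    and D0: "\<And>\<omega>. \<omega> \<in> space M \<Longrightarrow> 0 \<le> D \<omega>" and DB: "AE \<omega> in M. D \<omega> \<le> B"
    and G: "G meromorphic_on UNIV" and G0: "G analytic_on {0}" "G 0 = 1"
    and eq: "\<And>s. s \<ge> 2 \<Longrightarrow> G (complex_of_real s) = complex_of_real (LINT \<omega>|M. D \<omega> powr s)"
  shows "AE \<omega> in M. D \<omega> > 0"
proof -
  interpret prob_space M by fact
  let ?D = "{\<omega> \<in> space M. D \<omega> > 0}"
  \<comment> \<open>Restricted to \<open>D \<omega> > 0\<close>, the moments of \<open>D\<close> are
    exponential moments of \<open>ln (D \<omega>)\<close>. This finite measure is not yet known to
    have mass 1.\<close>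
  define N where "N = density M (\<lambda>\<omega>. indicator ?D \<omega>)"
  define B' where "B' = max 1 B"
  have [measurable]: "?D \<in> sets M" by measurable
  have N_int: "integrable N f \<longleftrightarrow> integrable M (\<lambda>\<omega>. indicator ?D \<omega> *\<^sub>R f \<omega>)"
    "integral\<^sup>L N f = (LINT \<omega>|M. indicator ?D \<omega> *\<^sub>R f \<omega>)"
    if [measurable]: "f \<in> borel_measurable M" for f :: "'a \<Rightarrow> 'b :: {banach, second_countable_topology}"
    unfolding N_def ennreal_indicator[symmetric] by (subst integrable_density integral_density; simp)+
  have powr_le: "D \<omega> powr s \<le> B' powr s" if "D \<omega> \<le> B" "0 \<le> D \<omega>" "s \<ge> 0" for s \<omega>
    using that by (intro powr_mono2) (auto simp: B'_def)
  have ind: "indicator ?D \<omega> * exp (s * ln (D \<omega>)) = D \<omega> powr s" if "\<omega> \<in> space M" for s \<omega>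
    using D0[OF that] that by (auto simp: indicator_def powr_def)
  have int: "integrable M (\<lambda>\<omega>. D \<omega> powr s)" if "s \<ge> 0" for s
  proof (rule integrable_const_bound)
    show "AE \<omega> in M. norm (D \<omega> powr s) \<le> B' powr s"
      using DB AE_space by eventually_elim (use powr_le D0 that in auto)
  qed measurable
  have iN: "integrable N (\<lambda>\<omega>. exp (s * ln (D \<omega>)))" if "s \<ge> 0" for s
    using int[OF that] by (subst N_int) (auto simp: ind cong: Bochner_Integration.integrable_cong)
  let ?A = "\<lambda>t. LINT \<omega>|N. exp (t * complex_of_real (ln (D \<omega>)))"
  let ?G = "remove_sings G"
  have A_real: "?A (complex_of_real s) = complex_of_real (LINT \<omega>|M. D \<omega> powr s)" for s
  proof -
    have "?A (complex_of_real s) = (LINT \<omega>|N. complex_of_real (exp (s * ln (D \<omega>))))"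
      by (simp add: exp_of_real[symmetric])
    also have "\<dots> = complex_of_real (LINT \<omega>|N. exp (s * ln (D \<omega>)))" by (rule integral_complex_of_real)
    also have "(LINT \<omega>|N. exp (s * ln (D \<omega>))) = (LINT \<omega>|M. D \<omega> powr s)"
      by (subst N_int) (auto simp: ind cong: Bochner_Integration.integral_cong)
    finally show ?thesis .
  qed
  have Gn: "?G nicely_meromorphic_on UNIV" using G by (rule remove_sings_nicely_meromorphic)
  have G_real: "?G (complex_of_real s) = complex_of_real (LINT \<omega>|M. D \<omega> powr s)" if s: "0 < s" for s
  proof -
    \<comment> \<open>The strip has to contain both \<open>s\<close> and 3, a point around which the
      moments are already given by \<open>G\<close>.\<close>
    let ?b = "s + 5"
    let ?S = "{t. 0 < Re t \<and> Re t < ?b}"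
    have S_eq: "?S = {t. 0 < Re t} \<inter> {t. Re t < ?b}" by auto
    have S: "open ?S" "connected ?S"
      unfolding S_eq by (auto intro!: open_halfspace_Re_gt open_halfspace_Re_lt convex_connected convex_Int
        convex_halfspace_Re_gt convex_halfspace_Re_lt)
    have "(\<lambda>\<omega>. ln (D \<omega>)) \<in> borel_measurable N" by (simp add: N_def)
    then have anA: "?A analytic_on ?S"
      using iN[of 0] iN[of ?b] s by (intro mgf_analytic_at) auto
    have freq: "\<exists>\<^sub>F z in at (complex_of_real 3). ?G z = ?A z"
    proof (rule frequently_elim1)
      show "\<exists>\<^sub>F z in at (complex_of_real 3). G z = ?A z \<and> ?G z = G z"
      proof (rule frequently_eventually_frequently)
        show "\<exists>\<^sub>F z in at (complex_of_real 3). G z = ?A z"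
          by (rule frequently_at_of_realI[of 2]) (use eq A_real in auto)
        show "\<forall>\<^sub>F z in at (complex_of_real 3). ?G z = G z"
          by (rule eventually_remove_sings_eq_UNIV[OF G])
      qed
    qed auto
    have "?G (complex_of_real s) = ?A (complex_of_real s)"
    proof (rule nicely_meromorphic_on_eqI[where f = ?G and g = ?A and A = ?S])
      show "?G nicely_meromorphic_on ?S" using Gn nicely_meromorphic_on_subset by blast
      show "?A nicely_meromorphic_on ?S" using anA analytic_on_imp_nicely_meromorphic_on by blast
    qed (use freq S s in auto)
    then show ?thesis using A_real by simp
  qed
  define s where "s k = 1 / (real k + 1)" for k :: nat
  have s: "s k > 0" "s k \<le> 1" for k by (auto simp: s_def)
  have s0: "s \<longlonglongrightarrow> 0" unfolding s_def by real_asymp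
  have "(\<lambda>k. LINT \<omega>|M. D \<omega> powr s k) \<longlonglongrightarrow> (LINT \<omega>|M. indicator ?D \<omega>)"
  proof (rule integral_dominated_convergence[where w = "\<lambda>_. B'"])
    show "AE \<omega> in M. (\<lambda>k. D \<omega> powr s k) \<longlonglongrightarrow> indicator ?D \<omega>"
    proof (intro AE_I2)
      fix \<omega> assume w: "\<omega> \<in> space M"
      show "(\<lambda>k. D \<omega> powr s k) \<longlonglongrightarrow> indicator ?D \<omega>"
      proof (cases "D \<omega> > 0")
        case True
        then have "(\<lambda>k. D \<omega> powr s k) \<longlonglongrightarrow> D \<omega> powr 0" by (intro tendsto_intros s0) auto
        then show ?thesis using True w by simp
      qed (use w D0[OF w] in \<open>auto simp: indicator_def\<close>)
    qed
    show "AE \<omega> in M. norm (D \<omega> powr s k) \<le> B'" for k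
    proof -
      have "B' powr s k \<le> B' powr 1" using s by (intro powr_mono) (auto simp: B'_def)
      also have "\<dots> = B'" by (simp add: B'_def)
      finally have le: "B' powr s k \<le> B'" .
      show ?thesis using DB AE_space
      proof eventually_elim
        case (elim \<omega>)
        then show ?case using powr_le[of \<omega> "s k"] D0 s[of k] le by simp
      qed
    qed
  qed auto
  then have "(\<lambda>k. ?G (complex_of_real (s k))) \<longlonglongrightarrow> complex_of_real (prob ?D)"
    using G_real s by (auto intro!: tendsto_of_real)
  moreover have "(\<lambda>k. ?G (complex_of_real (s k))) \<longlonglongrightarrow> ?G 0"
  proof -
    have "?G analytic_on {0}" using G0 by (intro remove_sings_analytic_on) auto
    then have "isCont ?G 0" by (rule analytic_at_imp_isCont)
    moreover have "(\<lambda>k. complex_of_real (s k)) \<longlonglongrightarrow> complex_of_real 0" using s0 by (rule tendsto_of_real)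
    ultimately show ?thesis by (auto intro: isCont_tendsto_compose)
  qed
  moreover have "?G 0 = 1" using G0 by simp
  ultimately have "complex_of_real (prob ?D) = 1" using LIMSEQ_unique by metis
  then have "prob ?D = 1" by simp
  then show ?thesis by (subst (asm) prob_Collect_eq_1) auto
qed

text \<open>The moment of \<open>D\<close> of order \<open>c * t\<close> is the exponential moment
  of \<open>Y\<close> at \<open>t\<close>, almost sure positivity of \<open>D\<close> being the
  bridge between \<open>powr\<close> and \<open>exp\<close>. \<open>remove_sings\<close> produces
  the normalised values at singularities that the definition prescribes.\<close>

lemma mgf_continuation_of_moments:
  fixes D :: "'a \<Rightarrow> real"
  assumes M: "prob_space M" and D[measurable]: "D \<in> borel_measurable M"
    and D0: "\<And>\<omega>. \<omega> \<in> space M \<Longrightarrow> 0 \<le> D \<omega>" and DB: "AE \<omega> in M. D \<omega> \<le> B"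
    and G: "G meromorphic_on UNIV" and G0: "G analytic_on {0}" "G 0 = 1"
    and eq: "\<And>s. s \<ge> 2 \<Longrightarrow> G (complex_of_real s) = complex_of_real (LINT \<omega>|M. D \<omega> powr s)"
    and Y: "\<And>\<omega>. \<omega> \<in> space M \<Longrightarrow> Y \<omega> = c * ln (D \<omega>)" and c: "c > 0"
  shows "mgf_continuation M Y (remove_sings (\<lambda>t. G (complex_of_real c * t)))"
    and "\<exists>!F. mgf_continuation M Y F"
proof -
  interpret prob_space M by fact
  have pos: "AE \<omega> in M. D \<omega> > 0"
    by (rule AE_pos_if_moments_continuous[OF M D D0 DB G G0 eq])
  have [measurable]: "Y \<in> borel_measurable M"
    by (subst measurable_cong[OF Y]) auto
  have le: "AE \<omega> in M. Y \<omega> \<le> c * ln (max 1 B)"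
    using pos DB AE_space
  proof eventually_elim
    case (elim \<omega>)
    then have "ln (D \<omega>) \<le> ln (max 1 B)" by (intro iffD2[OF ln_le_cancel_iff]) auto
    then show ?case using Y elim c by (simp add: mult_left_mono)
  qed
  let ?F = "\<lambda>t. G (complex_of_real c * t)"
  have Fm: "?F meromorphic_on UNIV"
    by (rule meromorphic_on_compose[OF G]) (auto intro!: analytic_intros)
  show cont: "mgf_continuation M Y (remove_sings ?F)"
  proof (rule mgf_continuationI[OF M _ le remove_sings_nicely_meromorphic[OF Fm]])
    fix x :: real assume x: "x > 2 / c"
    let ?E = "\<lambda>t. LINT \<omega>|M. exp (t * complex_of_real (Y \<omega>))"
    have F_real: "?F (complex_of_real u) = ?E (complex_of_real u)" if "u > 2 / c" for u
    proof -
      have "c * u \<ge> 2" using that c by (simp add: field_simps)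
      then have "?F (complex_of_real u) = complex_of_real (LINT \<omega>|M. D \<omega> powr (c * u))"
        using eq[of "c * u"] by simp
      also have "\<dots> = (LINT \<omega>|M. complex_of_real (D \<omega> powr (c * u)))" by (rule integral_complex_of_real[symmetric])
      also have "\<dots> = ?E (complex_of_real u)"
      proof (rule integral_cong_AE)
        show "AE \<omega> in M. complex_of_real (D \<omega> powr (c * u)) = exp (complex_of_real u * complex_of_real (Y \<omega>))"
          using pos AE_space by eventually_elim (auto simp: powr_def Y exp_of_real[symmetric] mult_ac)
      qed measurable
      finally show ?thesis .
    qed
    have ia: "integrable M (\<lambda>\<omega>. exp (0 * Y \<omega>))" by simp
    have ib: "integrable M (\<lambda>\<omega>. exp ((x + 1) * Y \<omega>))"
      using integrable_exp_bounded_above[OF M _ le] x c by (simp add: less_imp_le order.strict_trans1[of 0 "2/c"])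
    let ?S = "{t. 0 < Re t \<and> Re t < x + 1}"
    have S_eq: "?S = {t. 0 < Re t} \<inter> {t. Re t < x + 1}" by auto
    have S: "open ?S" "connected ?S"
      unfolding S_eq by (auto intro!: open_halfspace_Re_gt open_halfspace_Re_lt convex_connected convex_Int
        convex_halfspace_Re_gt convex_halfspace_Re_lt)
    have anE: "?E analytic_on ?S" by (rule mgf_analytic_at[OF _ ia ib]) measurable
    have x0: "x > 0" using x c by (meson divide_pos_pos less_trans zero_less_numeral)
    show "remove_sings ?F (complex_of_real x) = ?E (complex_of_real x)"
    proof (rule nicely_meromorphic_on_eqI[where f = "remove_sings ?F" and g = ?E and A = ?S])
      show "remove_sings ?F nicely_meromorphic_on ?S"
        using remove_sings_nicely_meromorphic[OF Fm] nicely_meromorphic_on_subset by blast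
      show "?E nicely_meromorphic_on ?S" using anE analytic_on_imp_nicely_meromorphic_on by blast
      show "\<exists>\<^sub>F z in at (complex_of_real x). remove_sings ?F z = ?E z"
      proof (rule frequently_elim1)
        show "\<exists>\<^sub>F z in at (complex_of_real x). ?F z = ?E z \<and> remove_sings ?F z = ?F z"
        proof (rule frequently_eventually_frequently)
          show "\<exists>\<^sub>F z in at (complex_of_real x). ?F z = ?E z"
            by (rule frequently_at_of_realI[of "2 / c"]) (use F_real x in auto)
          show "\<forall>\<^sub>F z in at (complex_of_real x). remove_sings ?F z = ?F z"
            by (rule eventually_remove_sings_eq_UNIV[OF Fm])
        qed
      qed auto
    qed (use S x0 in auto)
  qed measurable
  show "\<exists>!F. mgf_continuation M Y F"
    using cont mgf_continuation_unique[OF M _ le] by (metis \<open>Y \<in> borel_measurable M\<close>)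
qed

section \<open>Quotients of Gamma functions\<close>

text \<open>Scaling by \<open>x\<close> reduces the claim to \<open>x = 1\<close>. For large
  \<open>y\<close> the summand \<open>z\<close>, of norm at most \<open>R\<close>, is dominated; for
  bounded \<open>y\<close> the positive distance of \<open>K\<close> from the nonpositive real axis
  suffices. The linear growth in \<open>x + y\<close> later makes sums of inverse squares along
  \<open>z\<close>, \<open>z + 1\<close>, ... small.\<close>

lemma norm_sector_lower_bound:
  assumes "compact K" "K \<inter> \<real>\<^sub>\<le>\<^sub>0 = {}"
  obtains c where "c > 0" "c \<le> 1" "\<And>z x y. z \<in> K \<Longrightarrow> x > 0 \<Longrightarrow> y \<ge> 0 \<Longrightarrow>
     c * (x + y) \<le> norm (complex_of_real x * z + complex_of_real y)"
proof (cases "K = {}")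
  case True
  then show ?thesis using that[of 1] by auto
next
  case False
  have "bounded K" using assms compact_imp_bounded by blast
  then obtain R where R: "\<And>z. z \<in> K \<Longrightarrow> norm z \<le> R" by (auto simp: bounded_iff)
  then have R0: "R \<ge> 0" using False norm_ge_zero order.trans by blast
  obtain d where d: "d > 0" "\<And>z w. z \<in> K \<Longrightarrow> w \<in> \<real>\<^sub>\<le>\<^sub>0 \<Longrightarrow> d \<le> dist z w"
    using separate_compact_closed[OF assms(1) closed_nonpos_Reals_complex assms(2)] by blast
  define c where "c = min (1 / 4) (d / (2 * R + 2))"
  have c: "c > 0" "c \<le> 1" using d R0 by (auto simp: c_def)
  have c14: "c \<le> 1 / 4" and cd: "c \<le> d / (2 * R + 2)" unfolding c_def by (rule min.cobounded1 min.cobounded2)+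
  have main: "c * (1 + y) \<le> norm (z + complex_of_real y)" if z: "z \<in> K" and y: "y \<ge> 0" for z y
  proof (cases "y \<ge> 2 * R + 1")
    case True
    have "c * (1 + y) \<le> (1 / 4) * (1 + y)" using y c14 by (intro mult_right_mono) auto
    also have "\<dots> \<le> y - R" using True R0 by (simp add: field_simps)
    also have "\<dots> \<le> norm (complex_of_real y) - norm z" using R[OF z] y by simp
    also have "\<dots> \<le> norm (z + complex_of_real y)" using norm_diff_ineq[of "complex_of_real y" z] by (simp add: add.commute)
    finally show ?thesis .
  next
    case False
    have "c * (1 + y) \<le> (d / (2 * R + 2)) * (1 + y)" using y cd by (intro mult_right_mono) auto
    also have "\<dots> \<le> (d / (2 * R + 2)) * (2 * R + 2)" using False d R0 by (intro mult_left_mono) auto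
    also have "\<dots> = d" using R0 by simp
    also have "d \<le> dist z (complex_of_real (- y))" using y by (intro d z) (auto simp: complex_nonpos_Reals_iff)
    also have "\<dots> = norm (z + complex_of_real y)" by (simp add: dist_norm)
    finally show ?thesis .
  qed
  show ?thesis
  proof (rule that[OF c])
    fix z and x y :: real assume *: "z \<in> K" "x > 0" "y \<ge> 0"
    have "complex_of_real x * z + complex_of_real y = complex_of_real x * (z + complex_of_real (y / x))"
      using * by (simp add: field_simps)
    then have "norm (complex_of_real x * z + complex_of_real y) = x * norm (z + complex_of_real (y / x))"
      using * by (simp only: norm_mult norm_of_real abs_of_pos)
    also have "\<dots> \<ge> x * (c * (1 + y / x))" using * by (intro mult_left_mono main) auto
    also have "x * (c * (1 + y / x)) = c * (x + y)" using * by (simp add: field_simps)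
    finally show "c * (x + y) \<le> norm (complex_of_real x * z + complex_of_real y)" .
  qed
qed

text \<open>Stirling's approximation of the logarithm of Gamma without the constant
  \<open>ln (2 * pi) / 2\<close>.\<close>

definition stirling_exponent :: "complex \<Rightarrow> complex" where
  "stirling_exponent z = (z - 1 / 2) * Ln z - z"

definition stirling_ratio :: "complex \<Rightarrow> complex" where
  "stirling_ratio z = Gamma z / exp (stirling_exponent z)"

text \<open>The logarithm of \<open>stirling_ratio z / stirling_ratio (z + 1)\<close>. It is the
  error of the trapezoidal rule for the integral of \<open>Ln\<close> from \<open>z\<close> to
  \<open>z + 1\<close>, hence of order \<open>1 / z^2\<close>.\<close>

definition stirling_increment :: "complex \<Rightarrow> complex" where
  "stirling_increment z = (z + 1 / 2) * (Ln (z + 1) - Ln z) - 1"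

lemma norm_diff_le_on_unit_segment:
  fixes f :: "complex \<Rightarrow> complex"
  assumes "\<And>y. y \<in> closed_segment 0 1 \<Longrightarrow> (f has_field_derivative f' y) (at y)"
    and "\<And>y. y \<in> closed_segment 0 1 \<Longrightarrow> norm (f' y) \<le> B" and "y \<in> closed_segment 0 1"
  shows "norm (f y - f 0) \<le> B"
proof -
  have "norm (f y - f 0) \<le> B * norm (y - 0)"
    by (rule field_differentiable_bound[of "closed_segment 0 1"])
       (use assms in \<open>auto intro: has_field_derivative_at_within\<close>)
  also have "\<dots> \<le> B * 1"
  proof (rule mult_left_mono)
    show "norm (y - 0) \<le> 1" using assms(3) by (auto simp: closed_segment_def)
    show "0 \<le> B" using assms(2)[OF assms(3)] norm_ge_zero order.trans by blast
  qed
  finally show ?thesis by simp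
qed

lemma in_unit_segment: "y \<in> closed_segment 0 (1::complex) \<Longrightarrow> \<exists>u. y = complex_of_real u \<and> 0 \<le> u \<and> u \<le> 1"
  by (auto simp: closed_segment_def scaleR_conv_of_real)

lemma norm_stirling_increment_le:
  assumes m: "m > 0" "\<And>u. 0 \<le> u \<Longrightarrow> u \<le> 1 \<Longrightarrow> m \<le> norm (z + complex_of_real u)"
    and z: "\<And>u. 0 \<le> u \<Longrightarrow> u \<le> 1 \<Longrightarrow> z + complex_of_real u \<notin> \<real>\<^sub>\<le>\<^sub>0"
  shows "norm (stirling_increment z) \<le> 1 / m\<^sup>2"
proof -
  let ?S = "closed_segment 0 (1::complex)"
  have nz: "z + y \<noteq> 0" if "y \<in> ?S" for y using in_unit_segment[OF that] m by fastforce
  have np: "z + y \<notin> \<real>\<^sub>\<le>\<^sub>0" if "y \<in> ?S" for y using in_unit_segment[OF that] z by fastforce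
  have mle: "m \<le> norm (z + y)" if "y \<in> ?S" for y using in_unit_segment[OF that] m by fastforce
  have ny: "norm y \<le> 1" if "y \<in> ?S" for y using in_unit_segment[OF that] by fastforce
  \<comment> \<open>\<open>h 1\<close> is the increment, \<open>h\<close> and \<open>h'\<close>
    vanish at 0, and \<open>h''\<close> is explicit; the mean value bound is applied twice along the
    unit segment.\<close>
  define h where "h y = (z + y / 2) * (Ln (z + y) - Ln z) - y" for y
  define h' where "h' y = (Ln (z + y) - Ln z) / 2 - (y / 2) / (z + y)" for y
  define h'' where "h'' y = y / (2 * (z + y)\<^sup>2)" for y
  have dh: "(h has_field_derivative h' y) (at y)" if "y \<in> ?S" for y
  proof -
    have L: "((\<lambda>y. Ln (z + y)) has_field_derivative 1 / (z + y)) (at y)"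
      using np[OF that] by (auto intro!: derivative_eq_intros simp: divide_inverse)
    have "((\<lambda>y. z + y / 2) has_field_derivative 1 / 2) (at y)"
      by (auto intro!: derivative_eq_intros)
    from DERIV_diff[OF DERIV_mult[OF this DERIV_diff[OF L DERIV_const[of "Ln z"]]] DERIV_ident]
    have "(h has_field_derivative (1 / 2) * (Ln (z + y) - Ln z) + (1 / (z + y)) * (z + y / 2) - 1) (at y)"
      by (simp add: h_def[abs_def])
    moreover have "(1 / 2) * (Ln (z + y) - Ln z) + (1 / (z + y)) * (z + y / 2) - 1 = h' y"
    proof -
      have "(1 / (z + y)) * (z + y / 2) = ((z + y) - y / 2) / (z + y)" by simp
      also have "\<dots> = 1 - (y / 2) / (z + y)" unfolding diff_divide_distrib using nz[OF that] by simp
      finally show ?thesis by (simp add: h'_def)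
    qed
    ultimately show ?thesis by simp
  qed
  have dh': "(h' has_field_derivative h'' y) (at y)" if "y \<in> ?S" for y
  proof -
    have "(h' has_field_derivative 1 / (z + y) / 2 - ((1 / 2) * (z + y) - (y / 2) * 1) / ((z + y) * (z + y))) (at y)"
    proof -
      have L: "((\<lambda>y. Ln (z + y)) has_field_derivative 1 / (z + y)) (at y)"
        using np[OF that] by (auto intro!: derivative_eq_intros simp: divide_inverse)
      have "((\<lambda>y. y / 2) has_field_derivative 1 / 2) (at y)" "((\<lambda>y. z + y) has_field_derivative 1) (at y)"
        by (auto intro!: derivative_eq_intros)
      from DERIV_diff[OF DERIV_cdivide[OF DERIV_diff[OF L DERIV_const[of "Ln z"]], of 2] DERIV_divide[OF this nz[OF that]]]
      show ?thesis by (simp add: h'_def[abs_def])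
    qed
    moreover have "1 / (z + y) / 2 - ((1 / 2) * (z + y) - (y / 2) * 1) / ((z + y) * (z + y)) = h'' y"
    proof -
      have "1 / v / 2 - ((1 / 2) * v - (y / 2) * 1) / (v * v) = y / (2 * v\<^sup>2)" if "v \<noteq> 0" for v
        using that by (simp add: field_simps power2_eq_square)
      from this[OF nz[OF that]] show ?thesis by (simp add: h''_def)
    qed
    ultimately show ?thesis by simp
  qed
  have b'': "norm (h'' y) \<le> 1 / m\<^sup>2" if "y \<in> ?S" for y
  proof -
    have "norm (h'' y) = norm y / (2 * (norm (z + y))\<^sup>2)" by (simp add: h''_def norm_divide norm_mult norm_power)
    also have "\<dots> \<le> 1 / (1 * m\<^sup>2)"
      using ny[OF that] mle[OF that] m by (intro frac_le mult_mono power_mono) auto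
    finally show ?thesis by simp
  qed
  have b': "norm (h' y) \<le> 1 / m\<^sup>2" if "y \<in> ?S" for y
    using norm_diff_le_on_unit_segment[OF dh' b'' that] by (simp add: h'_def)
  have "norm (h 1 - h 0) \<le> 1 / m\<^sup>2"
    by (rule norm_diff_le_on_unit_segment[OF dh b']) auto
  then show ?thesis by (simp add: h_def stirling_increment_def)
qed

lemma stirling_ratio_plus_1:
  assumes "z \<notin> \<int>\<^sub>\<le>\<^sub>0"
  shows "stirling_ratio z = stirling_ratio (z + 1) * exp (stirling_increment z)"
proof -
  have z: "z \<noteq> 0" using assms by auto
  have "stirling_exponent (z + 1) = stirling_exponent z + stirling_increment z + Ln z"
    by (simp add: stirling_exponent_def stirling_increment_def algebra_simps)
  then show ?thesis using z Gamma_plus1[of z] assms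
    by (simp add: stirling_ratio_def exp_add add.commute)
qed

lemma stirling_ratio_plus_nat:
  assumes "z \<notin> \<int>\<^sub>\<le>\<^sub>0"
  shows "stirling_ratio z = stirling_ratio (z + of_nat N) * exp (\<Sum>k<N. stirling_increment (z + of_nat k))"
proof (induction N)
  case (Suc N)
  have "z + of_nat N \<notin> \<int>\<^sub>\<le>\<^sub>0"
  proof
    assume "z + of_nat N \<in> \<int>\<^sub>\<le>\<^sub>0"
    then obtain m where "z + of_nat N = - of_nat m" by (auto elim: nonpos_Ints_cases')
    then have "z = - of_nat (m + N)" by (simp add: algebra_simps eq_neg_iff_add_eq_0)
    then show False using assms minus_of_nat_in_nonpos_Ints[of "m + N", where 'a = complex] by simp
  qed
  from stirling_ratio_plus_1[OF this] Suc show ?case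
    by (simp add: exp_add algebra_simps)
qed auto

lemma Ln_shift_bounds:
  assumes m: "m > 0" "\<And>u. 0 \<le> u \<Longrightarrow> u \<le> 1 \<Longrightarrow> m \<le> norm (w + complex_of_real u * a)"
    and w: "\<And>u. 0 \<le> u \<Longrightarrow> u \<le> 1 \<Longrightarrow> w + complex_of_real u * a \<notin> \<real>\<^sub>\<le>\<^sub>0"
  shows "norm (Ln (w + a) - Ln w) \<le> norm a / m"
    and "norm (w * (Ln (w + a) - Ln w) - a) \<le> (norm a)\<^sup>2 / m"
proof -
  let ?S = "closed_segment 0 (1::complex)"
  have nz: "w + y * a \<noteq> 0" if "y \<in> ?S" for y using in_unit_segment[OF that] m by fastforce
  have np: "w + y * a \<notin> \<real>\<^sub>\<le>\<^sub>0" if "y \<in> ?S" for y using in_unit_segment[OF that] w by fastforce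
  have mle: "m \<le> norm (w + y * a)" if "y \<in> ?S" for y using in_unit_segment[OF that] m by fastforce
  have ny: "norm y \<le> 1" if "y \<in> ?S" for y using in_unit_segment[OF that] by fastforce
  have "norm (Ln (w + 1 * a) - Ln (w + 0 * a)) \<le> norm a / m"
  proof (rule norm_diff_le_on_unit_segment[where f' = "\<lambda>y. a / (w + y * a)"])
    show "((\<lambda>y. Ln (w + y * a)) has_field_derivative a / (w + y * a)) (at y)" if "y \<in> ?S" for y
      using np[OF that] by (auto intro!: derivative_eq_intros simp: divide_inverse)
    show "norm (a / (w + y * a)) \<le> norm a / m" if "y \<in> ?S" for y
      using mle[OF that] m by (simp add: norm_divide frac_le)
  qed auto
  then show "norm (Ln (w + a) - Ln w) \<le> norm a / m" by simp
  let ?h = "\<lambda>y. w * (Ln (w + y * a) - Ln w) - y * a"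
  have "norm (?h 1 - ?h 0) \<le> (norm a)\<^sup>2 / m"
  proof (rule norm_diff_le_on_unit_segment[where f' = "\<lambda>y. - y * a\<^sup>2 / (w + y * a)"])
    fix y assume y: "y \<in> ?S"
    have "(?h has_field_derivative w * (a / (w + y * a)) - a) (at y)"
      using np[OF y] by (auto intro!: derivative_eq_intros) (simp add: divide_inverse)
    also have "w * (a / (w + y * a)) - a = - y * a\<^sup>2 / (w + y * a)"
      using nz[OF y] by (simp add: divide_simps power2_eq_square) (simp add: algebra_simps)?
    finally show "(?h has_field_derivative - y * a\<^sup>2 / (w + y * a)) (at y)" .
    have "norm (- y * a\<^sup>2 / (w + y * a)) = norm y * (norm a)\<^sup>2 / norm (w + y * a)"
      by (simp add: norm_divide norm_mult norm_power)
    also have "\<dots> \<le> 1 * (norm a)\<^sup>2 / m"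
      using mle[OF y] m ny[OF y] by (intro frac_le mult_right_mono) auto
    finally show "norm (- y * a\<^sup>2 / (w + y * a)) \<le> (norm a)\<^sup>2 / m" by simp
  qed auto
  then show "norm (w * (Ln (w + a) - Ln w) - a) \<le> (norm a)\<^sup>2 / m" by simp
qed

text \<open>Replaces \<open>Ln (w + a)\<close> by \<open>Ln w\<close>. The first-order term of
  \<open>w * Ln (w + a)\<close> is \<open>a\<close> and cancels the \<open>- a\<close> in the
  exponent, so what is left is of order \<open>1 / norm w\<close>. Hence all shifts of one argument
  can be expanded with the same logarithm.\<close>

lemma stirling_exponent_shift_bound:
  assumes m: "m > 0" "\<And>u. 0 \<le> u \<Longrightarrow> u \<le> 1 \<Longrightarrow> m \<le> norm (w + complex_of_real u * a)"
    and w: "\<And>u. 0 \<le> u \<Longrightarrow> u \<le> 1 \<Longrightarrow> w + complex_of_real u * a \<notin> \<real>\<^sub>\<le>\<^sub>0"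
  shows "norm (stirling_exponent (w + a) - ((w + a - 1 / 2) * Ln w - w))
    \<le> ((norm a)\<^sup>2 + norm (a - 1 / 2) * norm a) / m"
proof -
  have "stirling_exponent (w + a) - ((w + a - 1 / 2) * Ln w - w)
      = (w * (Ln (w + a) - Ln w) - a) + (a - 1 / 2) * (Ln (w + a) - Ln w)"
    by (simp add: stirling_exponent_def algebra_simps)
  also have "norm \<dots> \<le> norm (w * (Ln (w + a) - Ln w) - a) + norm (a - 1 / 2) * norm (Ln (w + a) - Ln w)"
    using norm_triangle_ineq norm_mult by metis
  also have "\<dots> \<le> (norm a)\<^sup>2 / m + norm (a - 1 / 2) * (norm a / m)"
    by (intro add_mono mult_left_mono Ln_shift_bounds[OF assms]) auto
  finally show ?thesis by (simp add: add_divide_distrib)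
qed

lemma stirling_exponent_shift_tendsto:
  "(\<lambda>n. stirling_exponent (of_nat n + a) - ((of_nat n + a - 1 / 2) * Ln (of_nat n) - of_nat n)) \<longlonglongrightarrow> 0"
proof (rule Lim_null_comparison)
  let ?D = "(norm a)\<^sup>2 + norm (a - 1 / 2) * norm a"
  show "\<forall>\<^sub>F n in sequentially. norm (stirling_exponent (of_nat n + a) - ((of_nat n + a - 1 / 2) * Ln (of_nat n) - of_nat n))
     \<le> ?D / (real n - norm a)"
    using eventually_gt_at_top[of "nat \<lceil>norm a\<rceil>"]
  proof eventually_elim
    case (elim n)
    then have n: "norm a < real n" by linarith
    have ua: "norm (complex_of_real u * a) \<le> norm a" if "0 \<le> u" "u \<le> 1" for u
      using that by (simp add: norm_mult mult_left_le_one_le)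
    show ?case
    proof (rule stirling_exponent_shift_bound)
      fix u :: real assume u: "0 \<le> u" "u \<le> 1"
      show "real n - norm a \<le> norm (of_nat n + complex_of_real u * a)"
        using norm_diff_ineq[of "of_nat n :: complex" "complex_of_real u * a"] ua[OF u] by simp
      have "\<bar>Re (complex_of_real u * a)\<bar> < real n" using abs_Re_le_cmod ua[OF u] n by (meson le_less_trans order.trans)
      then have "Re (of_nat n + complex_of_real u * a) > 0" by auto
      then show "of_nat n + complex_of_real u * a \<notin> \<real>\<^sub>\<le>\<^sub>0" by (auto simp: complex_nonpos_Reals_iff)
    qed (use n in auto)
  qed
  show "(\<lambda>n. ?D / (real n - norm a)) \<longlonglongrightarrow> 0" by real_asymp
qed

text \<open>This number is \<open>sqrt (2 * pi)\<close>. It cancels in each quotient of two Gamma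
  factors, so it enters only as a nonzero constant.\<close>

definition stirling_const :: complex where
  "stirling_const = stirling_ratio 1 * exp (- (\<Sum>k. stirling_increment (1 + of_nat k)))"

lemma stirling_const_nonzero [simp]: "stirling_const \<noteq> 0"
  by (simp add: stirling_const_def stirling_ratio_def)

lemma stirling_ratio_nat_tendsto: "(\<lambda>N. stirling_ratio (1 + of_nat N)) \<longlonglongrightarrow> stirling_const"
proof -
  have "summable (\<lambda>k. stirling_increment (1 + of_nat k))"
  proof (rule summable_comparison_test)
    show "\<exists>N. \<forall>k\<ge>N. norm (stirling_increment (1 + of_nat k)) \<le> 1 / (1 + real k)\<^sup>2"
    proof (intro exI allI impI norm_stirling_increment_le)
      fix k :: nat and u :: real assume "0 \<le> u" "u \<le> 1"
      have eq: "1 + of_nat k + complex_of_real u = complex_of_real (1 + real k + u)" by simp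
      show "1 + real k \<le> norm (1 + of_nat k + complex_of_real u)"
        unfolding eq norm_of_real using \<open>0 \<le> u\<close> by simp
      show "1 + of_nat k + complex_of_real u \<notin> \<real>\<^sub>\<le>\<^sub>0"
        unfolding eq using \<open>0 \<le> u\<close> by (auto simp: complex_nonpos_Reals_iff)
    qed auto
    have "summable (\<lambda>k. 1 / real (Suc k) ^ 2)"
      using inverse_power_summable[of 2, where 'a = real] by (subst summable_Suc_iff) (simp add: inverse_eq_divide)
    then show "summable (\<lambda>k. 1 / (1 + real k)\<^sup>2)" by (simp add: add.commute)
  qed
  then have "(\<lambda>N. \<Sum>k<N. stirling_increment (1 + of_nat k)) \<longlonglongrightarrow> (\<Sum>k. stirling_increment (1 + of_nat k))"
    by (rule summable_LIMSEQ)
  then have "(\<lambda>N. stirling_ratio 1 * exp (- (\<Sum>k<N. stirling_increment (1 + of_nat k)))) \<longlonglongrightarrow> stirling_const"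
    unfolding stirling_const_def by (intro tendsto_intros)
  moreover have "stirling_ratio 1 * exp (- (\<Sum>k<N. stirling_increment (1 + of_nat k))) = stirling_ratio (1 + of_nat N)" for N
    using stirling_ratio_plus_nat[of 1 N] by (simp add: exp_minus field_simps)
  ultimately show ?thesis by simp
qed

text \<open>Gauss's limit formula compares \<open>Gamma (z + of_nat (Suc n))\<close> with
  \<open>fact n * n powr z\<close>. It carries the limit from the positive integers over to an
  arbitrary \<open>z\<close>, with the same constant.\<close>

lemma stirling_ratio_plus_nat_tendsto:
  assumes z: "z \<notin> \<int>\<^sub>\<le>\<^sub>0"
  shows "(\<lambda>n. stirling_ratio (z + of_nat n)) \<longlonglongrightarrow> stirling_const"
proof -
  let ?e = "\<lambda>a n. stirling_exponent (of_nat n + a) - ((of_nat n + a - 1 / 2) * Ln (of_nat n) - of_nat n)"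
  have G0: "Gamma z \<noteq> 0" using z by (simp add: Gamma_eq_zero_iff)
  have "(\<lambda>n. Gamma z / Gamma_series z n) \<longlonglongrightarrow> Gamma z / Gamma z"
    using G0 by (intro tendsto_intros Gamma_series_LIMSEQ)
  then have 1: "(\<lambda>n. Gamma z / Gamma_series z n) \<longlonglongrightarrow> 1" using G0 by simp
  have "(\<lambda>n. stirling_ratio (1 + of_nat n) * (Gamma z / Gamma_series z n) * exp (?e 1 n - ?e (1 + z) n)) \<longlonglongrightarrow> stirling_const * 1 * exp (0 - 0)"
    by (intro tendsto_intros 1 stirling_ratio_nat_tendsto stirling_exponent_shift_tendsto)
  then have lim: "(\<lambda>n. stirling_ratio (1 + of_nat n) * (Gamma z / Gamma_series z n) * exp (?e 1 n - ?e (1 + z) n)) \<longlonglongrightarrow> stirling_const"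
    by simp
  have "(\<lambda>n. stirling_ratio (z + of_nat (Suc n))) \<longlonglongrightarrow> stirling_const"
  proof (rule Lim_transform_eventually[OF lim])
    show "\<forall>\<^sub>F n in sequentially. stirling_ratio (1 + of_nat n) * (Gamma z / Gamma_series z n) * exp (?e 1 n - ?e (1 + z) n) = stirling_ratio (z + of_nat (Suc n))"
      using eventually_gt_at_top[of 0]
    proof eventually_elim
      case (elim n)
      have ph: "pochhammer z (Suc n) = Gamma (z + of_nat (Suc n)) / Gamma z"
        using z by (rule pochhammer_Gamma)
      have f: "fact n = Gamma (1 + of_nat n :: complex)" by (rule Gamma_fact[symmetric])
      have ln: "complex_of_real (ln (real n)) = Ln (of_nat n)"
        using elim by (simp add: Ln_of_nat)
      have E: "exp (?e 1 n - ?e (1 + z) n) = exp (stirling_exponent (1 + of_nat n)) * exp (z * Ln (of_nat n)) / exp (stirling_exponent (z + of_nat (Suc n)))"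
        by (simp add: exp_add[symmetric] exp_diff[symmetric] algebra_simps)
      have "Gamma z / Gamma_series z n = Gamma (z + of_nat (Suc n)) / (Gamma (1 + of_nat n) * exp (z * Ln (of_nat n)))"
        unfolding Gamma_series_def Suc_eq_plus1[symmetric] ph f ln using G0 by (simp del: of_nat_Suc)
      moreover have "Gamma (1 + of_nat n :: complex) \<noteq> 0" unfolding f[symmetric] by simp
      ultimately show ?case
        unfolding E stirling_ratio_def by simp
    qed
  qed
  then show ?thesis by (rule LIMSEQ_imp_Suc)
qed

lemma sum_inverse_squares_le:
  fixes x :: real
  assumes "x > 1"
  shows "(\<Sum>k<N. 1 / (x + real k)\<^sup>2) \<le> 1 / (x - 1)"
proof -
  have "(\<Sum>k<N. 1 / (x + real k)\<^sup>2) \<le> 1 / (x - 1) - 1 / (x + real N - 1)"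
  proof (induction N)
    case (Suc N)
    have "1 / (x + real N)\<^sup>2 \<le> 1 / ((x + real N - 1) * (x + real N))"
      using assms by (intro frac_le) (auto simp: power2_eq_square intro!: mult_right_mono)
    also have "\<dots> = 1 / (x + real N - 1) - 1 / (x + real N)"
      using assms by (simp add: divide_simps)
    finally show ?case using Suc by simp
  qed auto
  also have "\<dots> \<le> 1 / (x - 1)" using assms by simp
  finally show ?thesis .
qed

text \<open>Telescoping to infinity: the quotient of the ratios at \<open>z\<close> and at
  \<open>z + of_nat N\<close> is the exponential of a sum of increments, and the limit of its
  denominator is known. Under the hypothesis the ray from \<open>z\<close> to the right moves away
  from 0 linearly, so the increments add up to at most
  \<open>1 / (c\<^sup>2 * (x - 1))\<close>.\<close>

lemma stirling_ratio_bound: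
  assumes c: "c > 0" and x: "x > 1" and z: "\<And>y. y \<ge> 0 \<Longrightarrow> c * (x + y) \<le> norm (z + complex_of_real y)"
  shows "norm (stirling_ratio z / stirling_const - 1) \<le> 1 / (c\<^sup>2 * (x - 1)) * exp (1 / (c\<^sup>2 * (x - 1)))"
proof -
  let ?\<epsilon> = "1 / (c\<^sup>2 * (x - 1))"
  have np: "z + complex_of_real y \<notin> \<real>\<^sub>\<le>\<^sub>0" if y: "y \<ge> 0" for y
  proof
    assume "z + complex_of_real y \<in> \<real>\<^sub>\<le>\<^sub>0"
    then obtain v where v: "z + complex_of_real y = complex_of_real v" "v \<le> 0" by (auto elim: nonpos_Reals_cases)
    have "c * (x + (y - v)) \<le> norm (z + complex_of_real (y - v))" using v y by (intro z) auto
    also have "z + complex_of_real (y - v) = 0" using v by (simp add: algebra_simps)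
    finally have "c * (x + (y - v)) \<le> 0" by simp
    moreover have "c * (x + (y - v)) > 0" using c x v y by (intro mult_pos_pos) auto
    ultimately show False by linarith
  qed
  have zi: "z \<notin> \<int>\<^sub>\<le>\<^sub>0" using np[of 0] nonpos_Ints_subset_nonpos_Reals by auto
  let ?S = "\<lambda>N. \<Sum>k<N. stirling_increment (z + of_nat k)"
  have S: "norm (?S N) \<le> ?\<epsilon>" for N
  proof -
    have "norm (?S N) \<le> (\<Sum>k<N. 1 / (c * (x + real k))\<^sup>2)"
    proof (intro order.trans[OF norm_sum] sum_mono norm_stirling_increment_le)
      fix k :: nat and u :: real assume u: "0 \<le> u" "u \<le> 1"
      have eq: "z + of_nat k + complex_of_real u = z + complex_of_real (real k + u)" by simp
      have "c * (x + real k) \<le> c * (x + (real k + u))" using u c by (intro mult_left_mono) auto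
      also have "\<dots> \<le> norm (z + of_nat k + complex_of_real u)" unfolding eq using u by (intro z) auto
      finally show "c * (x + real k) \<le> norm (z + of_nat k + complex_of_real u)" .
      show "z + of_nat k + complex_of_real u \<notin> \<real>\<^sub>\<le>\<^sub>0" unfolding eq using u by (intro np) auto
    qed (use c x in auto)
    also have "\<dots> = (1 / c\<^sup>2) * (\<Sum>k<N. 1 / (x + real k)\<^sup>2)"
      by (simp add: sum_distrib_left power_mult_distrib)
    also have "\<dots> \<le> (1 / c\<^sup>2) * (1 / (x - 1))"
      using sum_inverse_squares_le[OF x] by (intro mult_left_mono) auto
    finally show ?thesis by simp
  qed
  have "(\<lambda>N. norm (stirling_ratio z / stirling_ratio (z + of_nat N) - 1)) \<longlonglongrightarrow> norm (stirling_ratio z / stirling_const - 1)"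
    by (intro tendsto_intros stirling_ratio_plus_nat_tendsto zi) auto
  moreover have "norm (stirling_ratio z / stirling_ratio (z + of_nat N) - 1) \<le> ?\<epsilon> * exp ?\<epsilon>" for N
  \<comment> \<open>A vanishing denominator would force a zero of Gamma at \<open>z\<close>, and
    Gamma has none.\<close>
  proof (cases "stirling_ratio (z + of_nat N) = 0")
    case True
    then have "stirling_ratio z = 0" using stirling_ratio_plus_nat[OF zi, of N] by simp
    then have "Gamma z = 0" by (simp add: stirling_ratio_def)
    then show ?thesis using zi by (simp add: Gamma_eq_zero_iff)
  next
    case False
    then have "stirling_ratio z / stirling_ratio (z + of_nat N) = exp (?S N)"
      using stirling_ratio_plus_nat[OF zi, of N] by simp
    then have "norm (stirling_ratio z / stirling_ratio (z + of_nat N) - 1) \<le> norm (?S N) * exp (norm (?S N))"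
      using norm_exp_minus_one_le by simp
    also have "\<dots> \<le> ?\<epsilon> * exp ?\<epsilon>" using S[of N] c x by (intro mult_mono) auto
    finally show ?thesis .
  qed
  ultimately show ?thesis by (meson LIMSEQ_le_const2)
qed

lemma uniform_limit_by_bound:
  fixes f :: "'b \<Rightarrow> 'c \<Rightarrow> 'd :: real_normed_vector"
  assumes "\<forall>\<^sub>F x in F. \<forall>z\<in>K. norm (f x z - l z) \<le> g x" and g: "(g \<longlongrightarrow> 0) F"
  shows "uniform_limit K f l F"
proof (rule uniform_limitI)
  fix e :: real assume "e > 0"
  then have "\<forall>\<^sub>F x in F. \<bar>g x\<bar> < e" using g by (simp add: tendsto_iff dist_norm)
  with assms(1) show "\<forall>\<^sub>F x in F. \<forall>z\<in>K. dist (f x z) (l z) < e"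
    by eventually_elim (force simp: dist_norm)
qed

text \<open>Stirling's main term is written with \<open>Ln (x * z)\<close> rather than
  \<open>Ln (x * z + a)\<close>: then factors with different shifts \<open>a\<close> share one
  logarithm and their exponents can be added.\<close>

definition gamma_quot :: "complex \<Rightarrow> real \<Rightarrow> complex \<Rightarrow> complex" where
  "gamma_quot a x z = Gamma (of_real x * z + a) / exp ((of_real x * z + a - 1 / 2) * Ln (of_real x * z) - of_real x * z)"

lemma uniform_limit_gamma_quot:
  assumes K: "compact K" "K \<inter> \<real>\<^sub>\<le>\<^sub>0 = {}"
  shows "uniform_limit K (gamma_quot a) (\<lambda>_. stirling_const) at_top"
proof -
  obtain c where c: "c > 0" "c \<le> 1" and lb: "\<And>z x y. z \<in> K \<Longrightarrow> x > 0 \<Longrightarrow> y \<ge> 0 \<Longrightarrow>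
     c * (x + y) \<le> norm (complex_of_real x * z + complex_of_real y)"
    using norm_sector_lower_bound[OF K] by blast
  \<comment> \<open>From here on the shift satisfies \<open>norm a \<le> c / 2 * x\<close>, so it
    uses up at most half of the linear growth.\<close>
  let ?X = "2 * norm a / c + 2"
  let ?D = "(norm a)\<^sup>2 + norm (a - 1 / 2) * norm a"
  define e where "e x z = stirling_exponent (of_real x * z + a) - ((of_real x * z + a - 1 / 2) * Ln (of_real x * z) - of_real x * z)" for x z
  have lb': "(c / 2) * (x + y) \<le> norm (complex_of_real x * z + complex_of_real u * a + complex_of_real y)"
    if "z \<in> K" "x \<ge> ?X" "y \<ge> 0" "0 \<le> u" "u \<le> 1" for x y z u
  proof -
    have "2 * norm a / c \<le> x" using that by simp
    then have xa: "norm a \<le> (c / 2) * x" using c by (simp add: field_simps)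
    have x0: "x > 0" using that(2) c by (smt (verit) divide_nonneg_pos norm_ge_zero)
    have "0 \<le> c * y" using c that by simp
    moreover have "(c / 2) * (x + y) = (c * x) / 2 + (c * y) / 2" "c * (x + y) = c * x + c * y" "(c / 2) * x = (c * x) / 2"
      by (simp_all add: field_simps)
    ultimately have "(c / 2) * (x + y) \<le> c * (x + y) - norm a" using xa by linarith
    also have "\<dots> \<le> norm (complex_of_real x * z + complex_of_real y) - norm (complex_of_real u * a)"
      using lb[OF that(1) x0 that(3)] that by (intro diff_mono) (auto simp: norm_mult mult_left_le_one_le)
    also have "\<dots> \<le> norm ((complex_of_real x * z + complex_of_real y) + complex_of_real u * a)" by (rule norm_diff_ineq)
    finally show ?thesis by (simp add: add_ac)
  qed
  have X: "x > 1" "x > 0" if "x \<ge> ?X" for x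
    using that c by (smt (verit) divide_nonneg_pos norm_ge_zero)+
  have ev: "\<forall>\<^sub>F x in at_top. x \<ge> ?X" by (rule eventually_ge_at_top)
  have 1: "uniform_limit K (\<lambda>x z. stirling_ratio (of_real x * z + a) / stirling_const) (\<lambda>_. 1) at_top"
  proof (rule uniform_limit_by_bound)
    let ?\<epsilon> = "\<lambda>x. 1 / ((c / 2)\<^sup>2 * (x - 1))"
    show "\<forall>\<^sub>F x in at_top. \<forall>z\<in>K. norm (stirling_ratio (of_real x * z + a) / stirling_const - 1) \<le> ?\<epsilon> x * exp (?\<epsilon> x)"
      using ev
    proof eventually_elim
      case (elim x)
      show ?case using c X[OF elim] lb'[OF _ elim, where u = 1] by (intro ballI stirling_ratio_bound) auto
    qed
    have "((\<lambda>x. 1 / (d * (x - 1)) * exp (1 / (d * (x - 1)))) \<longlongrightarrow> 0) at_top" if "d > 0" for d :: real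
      using that by real_asymp
    from this[of "(c / 2)\<^sup>2"] show "((\<lambda>x. ?\<epsilon> x * exp (?\<epsilon> x)) \<longlongrightarrow> 0) at_top" using c by simp
  qed
  have 2: "uniform_limit K (\<lambda>x z. exp (e x z)) (\<lambda>_. 1) at_top"
  proof (rule uniform_limit_by_bound)
    let ?\<epsilon> = "\<lambda>x. ?D / (c / 2 * x)"
    show "\<forall>\<^sub>F x in at_top. \<forall>z\<in>K. norm (exp (e x z) - 1) \<le> ?\<epsilon> x * exp (?\<epsilon> x)"
      using ev
    proof eventually_elim
      case (elim x)
      show ?case
      proof
        fix z assume z: "z \<in> K"
        have "norm (e x z) \<le> ?\<epsilon> x"
          unfolding e_def
        proof (rule stirling_exponent_shift_bound)
          show "0 < c / 2 * x" using c X[OF elim] by simp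
          fix u :: real assume u: "0 \<le> u" "u \<le> 1"
          show "c / 2 * x \<le> norm (complex_of_real x * z + complex_of_real u * a)"
            using lb'[OF z elim order.refl u] by simp
          show "complex_of_real x * z + complex_of_real u * a \<notin> \<real>\<^sub>\<le>\<^sub>0"
          proof
            assume "complex_of_real x * z + complex_of_real u * a \<in> \<real>\<^sub>\<le>\<^sub>0"
            then obtain v where v: "complex_of_real x * z + complex_of_real u * a = complex_of_real v" "v \<le> 0" by (auto elim: nonpos_Reals_cases)
            have "(c / 2) * (x + (- v)) \<le> norm (complex_of_real x * z + complex_of_real u * a + complex_of_real (- v))"
              using v u by (intro lb' z elim) auto
            also have "\<dots> = 0" using v by simp
            finally have "(c / 2) * (x + (- v)) \<le> 0" .
            moreover have "(c / 2) * (x + (- v)) > 0" using c X[OF elim] v by (intro mult_pos_pos) auto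
            ultimately show False by linarith
          qed
        qed
        then have "norm (e x z) * exp (norm (e x z)) \<le> ?\<epsilon> x * exp (?\<epsilon> x)"
          by (intro mult_mono order.trans[OF norm_ge_zero \<open>norm (e x z) \<le> ?\<epsilon> x\<close>]) auto
        then show "norm (exp (e x z) - 1) \<le> ?\<epsilon> x * exp (?\<epsilon> x)"
          using norm_exp_minus_one_le order.trans by blast
      qed
    qed
    have "((\<lambda>x. D / (d * x) * exp (D / (d * x))) \<longlongrightarrow> 0) at_top" if "d > 0" for d D :: real
      using that by real_asymp
    from this[of "c / 2" ?D] show "((\<lambda>x. ?\<epsilon> x * exp (?\<epsilon> x)) \<longlongrightarrow> 0) at_top" using c by simp
  qed
  have "uniform_limit K (\<lambda>x z. stirling_const * ((stirling_ratio (of_real x * z + a) / stirling_const) * exp (e x z))) (\<lambda>_. stirling_const * (1 * 1)) at_top"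
    by (intro uniform_lim_mult 1 2 uniform_limit_const) (auto simp: bounded_iff image_constant_conv)
  moreover have "stirling_const * ((stirling_ratio (of_real x * z + a) / stirling_const) * exp (e x z)) = gamma_quot a x z" for x z
    by (simp add: gamma_quot_def stirling_ratio_def e_def exp_diff)
  ultimately show ?thesis by simp
qed

section \<open>Asymptotics of the moment function\<close>

text \<open>The moment of order \<open>s\<close> of \<open>r!\<close> times the volume. The product
  and the power come from the parallelotope of \<open>r + 1\<close> points, whose factor
  \<open>i = r\<close> has cancelled against the moment of the height; the last quotient is the rest
  of that moment.\<close>

definition moment_fun :: "nat \<Rightarrow> real \<Rightarrow> nat \<Rightarrow> complex \<Rightarrow> complex" where
  "moment_fun r \<nu> n s =
     (\<Prod>i<r. Gamma ((of_nat n + s - of_nat i) / 2) / Gamma ((of_nat n - of_nat i) / 2))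
     * (Gamma ((of_nat n + of_real \<nu>) / 2) / Gamma ((of_nat n + of_real \<nu> + s) / 2)) ^ (r + 1)
     * (Gamma (((of_nat r + 1) * (of_real \<nu> + of_nat n + s) - 2 * of_nat r) / 2)
        / Gamma (((of_nat r + 1) * (of_real \<nu> + of_nat n) - 2 * of_nat r + of_nat r * s) / 2))"

lemma Ln_times_pos_real:
  "x > 0 \<Longrightarrow> z \<noteq> 0 \<Longrightarrow> Ln (of_real x * z) = of_real (ln x) + Ln z"
  by (simp add: Ln_times_of_real Ln_of_real)

lemma Im_mult_self_Ln: "z \<notin> \<real>\<^sub>\<le>\<^sub>0 \<Longrightarrow> \<bar>Im (Ln z)\<bar> < pi"
  using Im_Ln_less_pi[of z] mpi_less_Im_Ln[of z] nonpos_Reals_zero_I by (metis abs_less_iff minus_less_iff)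

text \<open>\<open>z\<close> and \<open>\<rho> * z + 1\<close> never lie on opposite sides of the
  real axis, so their arguments do not have opposite signs and the difference of the arguments stays
  in the principal range.\<close>

lemma Ln_divide_affine:
  fixes \<rho> :: real
  assumes z: "z \<notin> \<real>\<^sub>\<le>\<^sub>0" and \<rho>: "\<rho> \<ge> 0"
  defines "w \<equiv> of_real \<rho> * z + 1"
  shows "w \<notin> \<real>\<^sub>\<le>\<^sub>0" and "Ln (of_real (\<rho> + 1) * z / w) = Ln (of_real (\<rho> + 1) * z) - Ln w"
proof -
  show w: "w \<notin> \<real>\<^sub>\<le>\<^sub>0"
  proof (cases "Im w = 0")
    case True
    then have "\<rho> = 0 \<or> Im z = 0" by (simp add: w_def)
    then show ?thesis
    proof
      assume "Im z = 0"
      then have "Re z > 0" using z by (auto simp: complex_nonpos_Reals_iff)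
      then have "Re w > 0" using \<rho> by (simp add: w_def add_nonneg_pos)
      then show ?thesis by (auto simp: complex_nonpos_Reals_iff)
    qed (auto simp: w_def complex_nonpos_Reals_iff)
  qed (auto simp: complex_nonpos_Reals_iff)
  have nz: "z \<noteq> 0" "w \<noteq> 0" using z w by auto
  have z': "of_real (\<rho> + 1) * z \<noteq> 0" using \<rho> nz by (simp add: complex_eq_iff) 
  have ImLn: "Im (Ln (of_real (\<rho> + 1) * z)) = Im (Ln z)"
    using Ln_times_pos_real[of "\<rho> + 1" z] \<rho> nz by simp
  have lt: "-pi < Im (Ln z)" "Im (Ln z) < pi" "-pi < Im (Ln w)" "Im (Ln w) < pi"
    using Im_mult_self_Ln[OF z] Im_mult_self_Ln[OF w] by auto
  have sgn: "(0 \<le> Im (Ln z) \<and> 0 \<le> Im (Ln w)) \<or> (Im (Ln z) \<le> 0 \<and> Im (Ln w) \<le> 0)"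
  proof (cases "Im z \<ge> 0")
    case True
    then have "Im w \<ge> 0" using \<rho> by (simp add: w_def)
    then show ?thesis using True Im_Ln_pos_le[OF nz(1)] Im_Ln_pos_le[OF nz(2)] by simp
  next
    case False
    have "Im (Ln z) < 0" using Im_Ln_pos_le[OF nz(1)] False lt by linarith
    moreover have "Im (Ln w) \<le> 0"
    proof (cases "\<rho> = 0")
      case False
      then have "Im w < 0" using \<rho> \<open>\<not> Im z \<ge> 0\<close> by (simp add: w_def mult_pos_neg)
      then show ?thesis using Im_Ln_pos_le[OF nz(2)] lt by linarith
    qed (simp add: w_def)
    ultimately show ?thesis by simp
  qed
  then have b: "-pi < Im (Ln z - Ln w)" "Im (Ln z - Ln w) \<le> pi" using lt by auto
  have "exp (Ln (of_real (\<rho> + 1) * z) - Ln w) = of_real (\<rho> + 1) * z / w"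
    unfolding exp_diff exp_Ln[OF z'] exp_Ln[OF nz(2)] ..
  then have "Ln (of_real (\<rho> + 1) * z / w) = Ln (exp (Ln (of_real (\<rho> + 1) * z) - Ln w))" by simp
  also have "\<dots> = Ln (of_real (\<rho> + 1) * z) - Ln w"
    using b ImLn by (intro Ln_exp) auto
  finally show "Ln (of_real (\<rho> + 1) * z / w) = Ln (of_real (\<rho> + 1) * z) - Ln w" .
qed

lemma gamma_quot_numerator:
  "Gamma (of_real x * z + a) = gamma_quot a x z * exp ((of_real x * z + a - 1 / 2) * Ln (of_real x * z) - of_real x * z)"
  by (simp add: gamma_quot_def)

lemma sum_lessThan_half: "(\<Sum>i<r. ((A :: complex) - of_nat i / 2)) = of_nat r * A - of_nat r * (of_nat r - 1) / 4"
  by (induction r) (auto simp: algebra_simps add_divide_distrib diff_divide_distrib)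

text \<open>The exponents in Stirling's formula are collected separately, so that only the quotients
  with limit 1 need an estimate.\<close>

lemma moment_fun_eq_limit_fun:
  fixes r n :: nat and \<nu> :: real and t :: complex
  assumes t: "t \<notin> complex_of_real ` {..-1}" and n: "n > 0"
  defines "N \<equiv> real n / 2" and "z \<equiv> 1 + t"
  defines "b \<equiv> complex_of_real (((real r + 1) * \<nu> - 2 * real r) / 2)"
  shows "moment_fun r \<nu> n (of_nat n * t) / exp (of_nat n * eta r t) =
    (\<Prod>i<r. gamma_quot (- of_nat i / 2) N z / gamma_quot (- of_nat i / 2) N 1)
     * (gamma_quot (of_real \<nu> / 2) N 1 / gamma_quot (of_real \<nu> / 2) N z) ^ (r + 1)
     * (gamma_quot b N (of_real (real r + 1) * z) / gamma_quot b N (of_real (real r) * z + 1))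
     * limit_fun r \<nu> t"
proof -
  define w where "w = of_real (real r) * z + 1"
  have z: "z \<notin> \<real>\<^sub>\<le>\<^sub>0"
  proof
    assume "z \<in> \<real>\<^sub>\<le>\<^sub>0"
    then obtain v where "z = complex_of_real v" "v \<le> 0" by (auto elim: nonpos_Reals_cases)
    then have "t = complex_of_real (v - 1)" "v - 1 \<in> {..-1}" by (auto simp: z_def algebra_simps)
    then show False using t by blast
  qed
  note w = Ln_divide_affine[OF z, of "real r", folded w_def]
  have nz: "z \<noteq> 0" "w \<noteq> 0" using z w(1) by auto
  have N: "N > 0" using n by (simp add: N_def)
  define L where "L = complex_of_real (ln N)"
  define l where "l = Ln z"
  define m where "m = Ln w"
  define q where "q = complex_of_real (ln (real r + 1))"
  define M where "M = complex_of_real N"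
  define \<rho> where "\<rho> = (of_nat r :: complex)"
  have nM: "of_nat n = 2 * M" by (simp add: M_def N_def)
  have Ln: "Ln (M * z) = L + l" "Ln (M * 1) = L" "Ln (M * w) = L + m" "Ln (M * (of_real (real r + 1) * z)) = L + q + l"
      "Ln (of_real (real r + 1) * z) = q + l"
  proof -
    have rz: "of_real (real r + 1) * z \<noteq> 0" using nz by (simp add: complex_eq_iff)
    show 5: "Ln (of_real (real r + 1) * z) = q + l"
      unfolding q_def l_def by (intro Ln_times_pos_real nz) simp
    show "Ln (M * z) = L + l" "Ln (M * w) = L + m"
      unfolding M_def L_def l_def m_def by (intro Ln_times_pos_real N nz)+
    show "Ln (M * 1) = L" using Ln_times_pos_real[OF N, of 1] by (simp add: M_def L_def)
    show "Ln (M * (of_real (real r + 1) * z)) = L + q + l"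
      using Ln_times_pos_real[OF N rz] 5 by (simp add: M_def L_def)
  qed
  let ?E = "\<lambda>a z. (M * z + a - 1 / 2) * Ln (M * z) - M * z"
  have G: "Gamma (M * z + a) = gamma_quot a N z * exp (?E a z)" for a z
    unfolding M_def by (rule gamma_quot_numerator)
  define P where "P = (\<Prod>i<r. gamma_quot (- of_nat i / 2) N z / gamma_quot (- of_nat i / 2) N 1)"
  define Q where "Q = (gamma_quot (of_real \<nu> / 2) N 1 / gamma_quot (of_real \<nu> / 2) N z) ^ (r + 1)"
  define R where "R = gamma_quot b N (of_real (real r + 1) * z) / gamma_quot b N w"
  have 1: "(\<Prod>i<r. Gamma ((of_nat n + of_nat n * t - of_nat i) / 2) / Gamma ((of_nat n - of_nat i) / 2))
      = P * exp (\<Sum>i<r. ?E (- of_nat i / 2) z - ?E (- of_nat i / 2) 1)"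
  proof -
    have "(\<Prod>i<r. Gamma ((of_nat n + of_nat n * t - of_nat i) / 2) / Gamma ((of_nat n - of_nat i) / 2))
      = (\<Prod>i<r. gamma_quot (- of_nat i / 2) N z / gamma_quot (- of_nat i / 2) N 1 * exp (?E (- of_nat i / 2) z - ?E (- of_nat i / 2) 1))"
    proof (rule prod.cong)
      fix i
      have "(of_nat n + of_nat n * t - of_nat i) / 2 = M * z + (- of_nat i / 2)"
        "(of_nat n - of_nat i) / 2 = M * 1 + (- of_nat i / 2)"
        unfolding nM z_def by (auto simp: field_simps)
      then show "Gamma ((of_nat n + of_nat n * t - of_nat i) / 2) / Gamma ((of_nat n - of_nat i) / 2) =
         gamma_quot (- of_nat i / 2) N z / gamma_quot (- of_nat i / 2) N 1 * exp (?E (- of_nat i / 2) z - ?E (- of_nat i / 2) 1)"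
        by (simp only: G exp_diff times_divide_times_eq)
    qed simp
    also have "\<dots> = P * exp (\<Sum>i<r. ?E (- of_nat i / 2) z - ?E (- of_nat i / 2) 1)"
      by (simp only: prod.distrib P_def exp_sum finite_lessThan)
    finally show ?thesis .
  qed
  have 2: "(Gamma ((of_nat n + of_real \<nu>) / 2) / Gamma ((of_nat n + of_real \<nu> + of_nat n * t) / 2)) ^ (r + 1)
      = Q * exp ((\<rho> + 1) * (?E (of_real \<nu> / 2) 1 - ?E (of_real \<nu> / 2) z))"
  proof -
    have e: "(of_nat n + of_real \<nu>) / 2 = M * 1 + of_real \<nu> / 2"
        "(of_nat n + of_real \<nu> + of_nat n * t) / 2 = M * z + of_real \<nu> / 2"
        unfolding nM z_def by (auto simp: field_simps)
    have p: "exp ((\<rho> + 1) * x) = exp x ^ (r + 1)" for x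
      using exp_of_nat_mult[of "r + 1" x] by (simp add: \<rho>_def add.commute)
    show ?thesis unfolding e G p Q_def power_mult_distrib[symmetric] exp_diff times_divide_times_eq ..
  qed
  have 3: "Gamma (((of_nat r + 1) * (of_real \<nu> + of_nat n + of_nat n * t) - 2 * of_nat r) / 2)
        / Gamma (((of_nat r + 1) * (of_real \<nu> + of_nat n) - 2 * of_nat r + of_nat r * (of_nat n * t)) / 2)
     = R * exp (?E b (of_real (real r + 1) * z) - ?E b w)"
  proof -
    have e: "((of_nat r + 1) * (of_real \<nu> + of_nat n + of_nat n * t) - 2 * of_nat r) / 2 = M * (of_real (real r + 1) * z) + b"
        "((of_nat r + 1) * (of_real \<nu> + of_nat n) - 2 * of_nat r + of_nat r * (of_nat n * t)) / 2 = M * w + b"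
      unfolding nM z_def w_def b_def by (auto simp: field_simps)
    show ?thesis unfolding e G R_def exp_diff times_divide_times_eq ..
  qed
  have eta: "of_nat n * eta r t = M * ((\<rho> + 1) * z * (q + l) - w * m - z * l)"
  proof -
    have "(of_nat r + 1) * (t + 1) = of_real (real r + 1) * z" "of_nat r * (t + 1) + 1 = w" "t + 1 = z"
      by (auto simp: z_def w_def)
    then have e: "eta r t = (of_real (real r + 1) * z) / 2 * (q + l) - w / 2 * m - z / 2 * l"
      unfolding eta_def by (simp only: Ln l_def[symmetric] m_def[symmetric])
    show ?thesis unfolding nM e by (simp add: \<rho>_def field_simps)
  qed
  have lim: "limit_fun r \<nu> t = exp (((1 - of_real \<nu> * (\<rho> + 1)) / 2 - \<rho> * (\<rho> - 1) / 4) * l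
      + (of_real \<nu> * (\<rho> + 1) - 2 * \<rho> - 1) / 2 * (q + l - m))"
  proof -
    have e: "(of_nat r + 1) * (t + 1) / (of_nat r * (t + 1) + 1) = of_real (real r + 1) * z / w"
      by (simp add: z_def w_def add.commute)
    have "complex_of_real (real r + 1) \<noteq> 0" by (simp only: of_real_eq_0_iff)
    then have "of_real (real r + 1) * z / w \<noteq> 0" using nz by simp
    moreover have "Ln (of_real (real r + 1) * z / w) = q + l - m"
      by (simp only: w(2) Ln m_def)
    ultimately have 2: "(of_real (real r + 1) * z / w) powr x = exp (x * (q + l - m))" for x
      by (simp only: powr_def if_False)
    have 1: "(1 + t) powr x = exp (x * l)" for x
      using nz(1) unfolding z_def[symmetric] by (simp add: powr_def l_def)
    show ?thesis
      unfolding limit_fun_def e 1 2 exp_add by (simp add: \<rho>_def)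
  qed
  have w_eq: "w = \<rho> * z + 1" by (simp add: w_def \<rho>_def)
  have bE: "b = ((\<rho> + 1) * of_real \<nu> - 2 * \<rho>) / 2" by (simp add: b_def \<rho>_def)
  have s1: "(\<Sum>i<r. ?E (- of_nat i / 2) z - ?E (- of_nat i / 2) 1) =
      (\<rho> * (M * z - 1 / 2) - \<rho> * (\<rho> - 1) / 4) * (L + l) - (\<rho> * (M - 1 / 2) - \<rho> * (\<rho> - 1) / 4) * L - \<rho> * (M * z - M)"
  proof -
    have "(\<Sum>i<r. ?E (- of_nat i / 2) z - ?E (- of_nat i / 2) 1) =
      (\<Sum>i<r. ((M * z - 1 / 2) - of_nat i / 2)) * (L + l) - (\<Sum>i<r. ((M - 1 / 2) - of_nat i / 2)) * L - (\<Sum>i<r. M * z - M)"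
      unfolding Ln sum_distrib_right sum_subtractf[symmetric] by (intro sum.cong) (auto simp: algebra_simps)
    then show ?thesis unfolding sum_lessThan_half by (simp add: \<rho>_def)
  qed
  \<comment> \<open>All terms with \<open>L\<close> and all terms linear in \<open>M\<close> cancel,
    because the multiples of \<open>M\<close> in the Gamma arguments have equal sums in numerator
    and denominator: \<open>\<rho> * z + (\<rho> + 1) + (\<rho> + 1) * z = \<rho> + (\<rho> + 1) * z
    + w\<close>. The part of order \<open>n\<close> that survives is the cumulant function, the
    bounded part is the limit function.\<close>
  have key: "(\<Sum>i<r. ?E (- of_nat i / 2) z - ?E (- of_nat i / 2) 1)
      + (\<rho> + 1) * (?E (of_real \<nu> / 2) 1 - ?E (of_real \<nu> / 2) z)
      + (?E b (of_real (real r + 1) * z) - ?E b w) - of_nat n * eta r t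
    = ((1 - of_real \<nu> * (\<rho> + 1)) / 2 - \<rho> * (\<rho> - 1) / 4) * l
      + (of_real \<nu> * (\<rho> + 1) - 2 * \<rho> - 1) / 2 * (q + l - m)"
  proof -
    have rr: "of_real (real r + 1) = \<rho> + 1" by (simp add: \<rho>_def)
    show ?thesis unfolding s1 unfolding eta Ln unfolding rr bE w_eq
      by (simp add: field_simps)
  qed
  have "moment_fun r \<nu> n (of_nat n * t) / exp (of_nat n * eta r t) =
     P * Q * R * exp ((\<Sum>i<r. ?E (- of_nat i / 2) z - ?E (- of_nat i / 2) 1)
      + (\<rho> + 1) * (?E (of_real \<nu> / 2) 1 - ?E (of_real \<nu> / 2) z)
      + (?E b (of_real (real r + 1) * z) - ?E b w) - of_nat n * eta r t)"
    unfolding moment_fun_def 1 2 3 exp_add exp_diff[of "_ + _" "of_nat n * eta r t"] by (simp add: mult_ac)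
  also have "\<dots> = P * Q * R * limit_fun r \<nu> t" unfolding key lim ..
  finally show ?thesis unfolding P_def Q_def R_def w_def .
qed

lemma uniform_limit_divide_const:
  fixes a b :: complex
  assumes "uniform_limit K f (\<lambda>_. a) F" "uniform_limit K g (\<lambda>_. b) F" "b \<noteq> 0"
  shows "uniform_limit K (\<lambda>n x. f n x / g n x) (\<lambda>_. a / b) F"
  using assms by (intro uniform_lim_divide[where b = "norm b"]) (auto simp: bounded_iff)

lemma uniform_limit_power_one:
  fixes f :: "'a \<Rightarrow> 'b \<Rightarrow> complex"
  assumes "uniform_limit K f (\<lambda>_. 1) F"
  shows "uniform_limit K (\<lambda>n x. f n x ^ k) (\<lambda>_. 1) F"
proof (induction k)
  case 0
  show ?case by (auto intro: uniform_limit_const)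
next
  case (Suc k)
  have "uniform_limit K (\<lambda>n x. f n x * f n x ^ k) (\<lambda>_. 1 * 1) F"
    by (intro uniform_lim_mult assms Suc) (auto simp: bounded_iff)
  then show ?case by simp
qed

lemma uniform_limit_prod_one:
  fixes f :: "nat \<Rightarrow> 'a \<Rightarrow> 'b \<Rightarrow> complex"
  assumes "\<And>i. uniform_limit K (f i) (\<lambda>_. 1) F"
  shows "uniform_limit K (\<lambda>n x. \<Prod>i<r. f i n x) (\<lambda>_. 1) F"
proof (induction r)
  case 0
  show ?case by (auto intro: uniform_limit_const)
next
  case (Suc r)
  have "uniform_limit K (\<lambda>n x. (\<Prod>i<r. f i n x) * f r n x) (\<lambda>_. 1 * 1) F"
    by (intro uniform_lim_mult assms Suc) (auto simp: bounded_iff)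
  then show ?case by simp
qed

lemma one_plus_notin_nonpos_Reals:
  assumes "t \<notin> complex_of_real ` {..-1}"
  shows "1 + t \<notin> \<real>\<^sub>\<le>\<^sub>0"
proof
  assume "1 + t \<in> \<real>\<^sub>\<le>\<^sub>0"
  then obtain v where "1 + t = complex_of_real v" "v \<le> 0" by (auto elim: nonpos_Reals_cases)
  then have "t = complex_of_real (v - 1)" "v - 1 \<in> {..-1}" by (auto simp: algebra_simps)
  then show False using assms by blast
qed

text \<open>The map from \<open>z\<close> to \<open>(r + 1) * z / (r * z + 1)\<close> keeps the slit
  plane in itself: a value \<open>v \<le> 0\<close> can only come from
  \<open>z = v / (r + 1 - v * r)\<close>, which is again nonpositive.\<close>

lemma limit_fun_analytic: "limit_fun r \<nu> analytic_on UNIV - complex_of_real ` {..-1}"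
proof -
  have "(\<lambda>t. (of_nat r + 1) * (t + 1) / (of_nat r * (t + 1) + 1) :: complex) analytic_on UNIV - complex_of_real ` {..-1}"
  proof (intro analytic_intros)
    fix t assume "t \<in> UNIV - complex_of_real ` {..-1}"
    then have "1 + t \<notin> \<real>\<^sub>\<le>\<^sub>0" by (intro one_plus_notin_nonpos_Reals) auto
    from Ln_divide_affine(1)[OF this, of "real r"] show "of_nat r * (t + 1) + 1 \<noteq> 0"
      by (auto simp: add.commute)
  qed
  moreover have "(of_nat r + 1) * (t + 1) / (of_nat r * (t + 1) + 1) \<notin> \<real>\<^sub>\<le>\<^sub>0"
    if "t \<in> UNIV - complex_of_real ` {..-1}" for t
  proof
    define z where "z = 1 + t"
    define w where "w = of_real (real r) * z + 1"
    have z: "z \<notin> \<real>\<^sub>\<le>\<^sub>0" unfolding z_def using that by (intro one_plus_notin_nonpos_Reals) auto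
    have w: "w \<notin> \<real>\<^sub>\<le>\<^sub>0" unfolding w_def by (rule Ln_divide_affine(1)[OF z]) simp
    assume "(of_nat r + 1) * (t + 1) / (of_nat r * (t + 1) + 1) \<in> \<real>\<^sub>\<le>\<^sub>0"
    then obtain v where v: "(of_nat r + 1) * (t + 1) / (of_nat r * (t + 1) + 1) = complex_of_real v" "v \<le> 0"
      by (auto elim: nonpos_Reals_cases)
    have nw: "w \<noteq> 0" using w by auto
    have "of_real (real r + 1) * z / w = complex_of_real v"
      using v(1) by (simp add: z_def w_def add.commute)
    then have "of_real (real r + 1) * z = complex_of_real v * (of_real (real r) * z + 1)"
      using nw by (simp add: field_simps w_def)
    then have "of_real (real r + 1 - v * real r) * z = complex_of_real v"
      by (simp add: algebra_simps)
    moreover have pos: "real r + 1 - v * real r > 0"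
      using v(2) by (smt (verit) mult_nonneg_nonneg mult_minus_left of_nat_0_le_iff)
    moreover from pos have "complex_of_real (real r + 1 - v * real r) \<noteq> 0" by (simp only: of_real_eq_0_iff)
    ultimately have "z = complex_of_real v / complex_of_real (real r + 1 - v * real r)"
      by (metis nonzero_mult_div_cancel_left)
    then have "z = complex_of_real (v / (real r + 1 - v * real r))" by (simp only: of_real_divide)
    moreover have "v / (real r + 1 - v * real r) \<le> 0" using pos v by (simp add: divide_nonpos_pos)
    ultimately show False using z by (metis nonpos_Reals_of_real_iff)
  qed
  ultimately show ?thesis
    unfolding limit_fun_def[abs_def]
    by (intro analytic_on_mult analytic_on_powr analytic_on_const analytic_on_add analytic_on_ident)
      (auto dest: one_plus_notin_nonpos_Reals)
qed

lemma uniform_limit_moment_fun: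
  assumes K: "compact K" "K \<subseteq> UNIV - complex_of_real ` {..-1}"
  shows "uniform_limit K (\<lambda>n t. moment_fun r \<nu> n (of_nat n * t) / exp (of_nat n * eta r t)) (limit_fun r \<nu>) sequentially"
proof -
  have half: "filterlim (\<lambda>n. real n / 2) at_top sequentially" by real_asymp
  have np: "1 + t \<notin> \<real>\<^sub>\<le>\<^sub>0" if "t \<in> K" for t
    using K that by (intro one_plus_notin_nonpos_Reals) auto
  \<comment> \<open>\<open>h\<close> stands for \<open>1 + t\<close>,
    \<open>(r + 1) * (1 + t)\<close>, \<open>r * (1 + t) + 1\<close> and 1; the images of
    \<open>K\<close> under these maps are compact and avoid the slit.\<close>
  have U: "uniform_limit K (\<lambda>n t. gamma_quot a (real n / 2) (h t)) (\<lambda>_. stirling_const) sequentially"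
    if h: "continuous_on K h" and hn: "\<And>t. t \<in> K \<Longrightarrow> h t \<notin> \<real>\<^sub>\<le>\<^sub>0" for a h
  proof -
    have "compact (h ` K)" by (rule compact_continuous_image[OF h K(1)])
    then have "uniform_limit (h ` K) (gamma_quot a) (\<lambda>_. stirling_const) at_top"
      using hn by (intro uniform_limit_gamma_quot) auto
    then have "uniform_limit (h ` K) (\<lambda>n. gamma_quot a (real n / 2)) (\<lambda>_. stirling_const) sequentially"
      using half by (rule filterlim_compose)
    then show ?thesis by (rule uniform_limit_compose') auto
  qed
  have hz: "continuous_on K (\<lambda>t. 1 + t)" "continuous_on K (\<lambda>t. of_real (real r + 1) * (1 + t))"
      "continuous_on K (\<lambda>t. of_real (real r) * (1 + t) + 1)" "continuous_on K (\<lambda>_. 1 :: complex)"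
    by (intro continuous_intros)+
  have h2: "of_real (real r + 1) * (1 + t) \<notin> \<real>\<^sub>\<le>\<^sub>0" if "t \<in> K" for t
  proof
    assume "of_real (real r + 1) * (1 + t) \<in> \<real>\<^sub>\<le>\<^sub>0"
    then obtain v where v: "of_real (real r + 1) * (1 + t) = complex_of_real v" "v \<le> 0" by (auto elim: nonpos_Reals_cases)
    have nz: "of_real (real r + 1) \<noteq> (0 :: complex)" by (simp only: of_real_eq_0_iff)
    have "1 + t = complex_of_real v / of_real (real r + 1)"
      unfolding v(1)[symmetric] by (rule nonzero_mult_div_cancel_left[OF nz, symmetric])
    then have "1 + t = complex_of_real (v / (real r + 1))" by (simp only: of_real_divide)
    moreover have "v / (real r + 1) \<le> 0" using v by (simp add: divide_nonpos_pos)
    ultimately show False using np[OF that] by (metis nonpos_Reals_of_real_iff)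
  qed
  have Q: "uniform_limit K (\<lambda>n t. f n t / g n t) (\<lambda>_. 1) sequentially"
    if "uniform_limit K f (\<lambda>_. stirling_const) sequentially" "uniform_limit K g (\<lambda>_. stirling_const) sequentially" for f g
    using uniform_limit_divide_const[OF that stirling_const_nonzero] by simp
  have h3: "of_real (real r) * (1 + t) + 1 \<notin> \<real>\<^sub>\<le>\<^sub>0" if "t \<in> K" for t
    by (rule Ln_divide_affine(1)[OF np[OF that]]) simp
  have h4: "1 \<notin> (\<real>\<^sub>\<le>\<^sub>0 :: complex set)" by (simp add: complex_nonpos_Reals_iff)
  define P where "P n t = (\<Prod>i<r. gamma_quot (- of_nat i / 2) (real n / 2) (1 + t) / gamma_quot (- of_nat i / 2) (real n / 2) 1)" for n t
  define Q' where "Q' n t = (gamma_quot (of_real \<nu> / 2) (real n / 2) 1 / gamma_quot (of_real \<nu> / 2) (real n / 2) (1 + t)) ^ (r + 1)" for n t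
  define b where "b = complex_of_real (((real r + 1) * \<nu> - 2 * real r) / 2)"
  define R where "R n t = gamma_quot b (real n / 2) (of_real (real r + 1) * (1 + t)) / gamma_quot b (real n / 2) (of_real (real r) * (1 + t) + 1)" for n t
  have P: "uniform_limit K P (\<lambda>_. 1) sequentially"
    unfolding P_def[abs_def] by (rule uniform_limit_prod_one, rule Q[OF U[OF hz(1) np] U[OF hz(4) h4]])
  have Q': "uniform_limit K Q' (\<lambda>_. 1) sequentially"
    unfolding Q'_def[abs_def] by (rule uniform_limit_power_one, rule Q[OF U[OF hz(4) h4] U[OF hz(1) np]])
  have R: "uniform_limit K R (\<lambda>_. 1) sequentially"
    unfolding R_def[abs_def] by (rule Q[OF U[OF hz(2) h2] U[OF hz(3) h3]])
  have "continuous_on K (limit_fun r \<nu>)"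
    using limit_fun_analytic K by (meson analytic_imp_holomorphic holomorphic_on_imp_continuous_on holomorphic_on_subset)
  then have bd: "bounded (limit_fun r \<nu> ` K)"
    using K compact_continuous_image compact_imp_bounded by blast
  have PQ: "uniform_limit K (\<lambda>n t. P n t * Q' n t) (\<lambda>t. 1 * 1) sequentially"
    by (rule uniform_lim_mult[OF P Q']) (auto simp: bounded_iff)
  have PQR: "uniform_limit K (\<lambda>n t. P n t * Q' n t * R n t) (\<lambda>t. 1 * 1 * 1) sequentially"
    by (rule uniform_lim_mult[OF PQ R]) (auto simp: bounded_iff)
  have "uniform_limit K (\<lambda>n t. P n t * Q' n t * R n t * limit_fun r \<nu> t) (\<lambda>t. 1 * 1 * 1 * limit_fun r \<nu> t) sequentially"
    by (rule uniform_lim_mult[OF PQR uniform_limit_const]) (use bd in \<open>auto simp: bounded_iff\<close>)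
  then have lim: "uniform_limit K (\<lambda>n t. P n t * Q' n t * R n t * limit_fun r \<nu> t) (limit_fun r \<nu>) sequentially" by simp
  have ev: "\<forall>\<^sub>F n in sequentially. \<forall>t\<in>K. P n t * Q' n t * R n t * limit_fun r \<nu> t = moment_fun r \<nu> n (of_nat n * t) / exp (of_nat n * eta r t)"
    using eventually_gt_at_top[of 0]
  proof eventually_elim
    case (elim n)
    show ?case
      unfolding P_def Q'_def R_def b_def
      using K by (intro ballI moment_fun_eq_limit_fun[symmetric] elim) auto
  qed
  show ?thesis
    using lim uniform_limit_cong[OF ev] by simp
qed

section \<open>Poles of the moment function\<close>

text \<open>\<open>rGamma\<close> is entire, so in this form the denominators cause no singularities
  and only the numerators restrict analyticity.\<close>

lemma moment_fun_altdef:
  "moment_fun r \<nu> n s =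
     (\<Prod>i<r. Gamma ((of_nat n + s - of_nat i) / 2) * rGamma ((of_nat n - of_nat i) / 2))
     * (Gamma ((of_nat n + of_real \<nu>) / 2) * rGamma ((of_nat n + of_real \<nu> + s) / 2)) ^ (r + 1)
     * (Gamma (((of_nat r + 1) * (of_real \<nu> + of_nat n + s) - 2 * of_nat r) / 2)
        * rGamma (((of_nat r + 1) * (of_real \<nu> + of_nat n) - 2 * of_nat r + of_nat r * s) / 2))"
  unfolding moment_fun_def rGamma_inverse_Gamma divide_inverse ..

lemma Gamma_meromorphic: "Gamma meromorphic_on (UNIV :: complex set)"
proof -
  have "(\<lambda>z. inverse (rGamma z)) meromorphic_on (UNIV :: complex set)"
    by (intro meromorphic_intros analytic_on_imp_meromorphic_on analytic_rGamma)
  then show ?thesis by (simp add: Gamma_def[abs_def])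
qed

lemma meromorphic_on_prod':
  "(\<And>i. i < (r::nat) \<Longrightarrow> f i meromorphic_on A) \<Longrightarrow> (\<lambda>z. \<Prod>i<r. f i z) meromorphic_on A"
  by (induction r) (auto intro!: meromorphic_intros)

lemma moment_fun_meromorphic: "moment_fun r \<nu> n meromorphic_on UNIV"
proof -
  have G: "(\<lambda>s. Gamma (a + b * s)) meromorphic_on UNIV" for a b :: complex
    by (rule meromorphic_on_compose[OF Gamma_meromorphic]) (auto intro!: analytic_intros)
  have R: "(\<lambda>s. rGamma (a + b * s)) meromorphic_on UNIV" for a b :: complex
    by (intro analytic_on_imp_meromorphic_on analytic_intros)
  have 1: "(of_nat n + s - of_nat i) / 2 = (of_nat n - of_nat i) / 2 + (1 / 2) * s" for i and s :: complex
    by (simp add: field_simps)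
  have 2: "(of_nat n + of_real \<nu> + s) / 2 = (of_nat n + of_real \<nu>) / 2 + (1 / 2) * s" for s :: complex
    by (simp add: field_simps)
  have 3: "((of_nat r + 1) * (of_real \<nu> + of_nat n + s) - 2 * of_nat r) / 2
     = ((of_nat r + 1) * (of_real \<nu> + of_nat n) - 2 * of_nat r) / 2 + (of_nat r + 1) / 2 * s" for s :: complex
    by (simp add: field_simps)
  have 4: "((of_nat r + 1) * (of_real \<nu> + of_nat n) - 2 * of_nat r + of_nat r * s) / 2
     = ((of_nat r + 1) * (of_real \<nu> + of_nat n) - 2 * of_nat r) / 2 + of_nat r / 2 * s" for s :: complex
    by (simp add: field_simps)
  show ?thesis
    unfolding moment_fun_altdef[abs_def] 1 2 3 4
    by (intro meromorphic_intros meromorphic_on_prod' G R)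
qed

lemma analytic_on_prod':
  "(\<And>i. i < (r::nat) \<Longrightarrow> f i analytic_on A) \<Longrightarrow> (\<lambda>z. \<Prod>i<r. f i z) analytic_on A"
  by (induction r) (auto intro!: analytic_intros)

lemma moment_fun_analytic_at:
  assumes "\<And>i. i < r \<Longrightarrow> (of_nat n + s - of_nat i) / 2 \<notin> \<int>\<^sub>\<le>\<^sub>0"
    and "((of_nat r + 1) * (of_real \<nu> + of_nat n + s) - 2 * of_nat r) / 2 \<notin> \<int>\<^sub>\<le>\<^sub>0"
  shows "moment_fun r \<nu> n analytic_on {s}"
  unfolding moment_fun_altdef[abs_def]
  by (intro analytic_intros analytic_on_prod' analytic_on_Gamma') (use assms in auto)

lemma eventually_affine_notin_nonpos_Ints:
  fixes a :: real and K :: "complex set"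
  assumes K: "compact K" "K \<inter> \<real>\<^sub>\<le>\<^sub>0 = {}"
  shows "\<forall>\<^sub>F x in at_top. \<forall>z\<in>K. of_real x * z + of_real a \<notin> \<int>\<^sub>\<le>\<^sub>0"
proof -
  obtain c where c: "c > 0" "c \<le> 1" and lb: "\<And>z x y. z \<in> K \<Longrightarrow> x > 0 \<Longrightarrow> y \<ge> 0 \<Longrightarrow>
     c * (x + y) \<le> norm (complex_of_real x * z + complex_of_real y)"
    using norm_sector_lower_bound[OF K] by blast
  show ?thesis using eventually_gt_at_top[of "\<bar>a\<bar> / c"]
  proof eventually_elim
    case (elim x)
    have x: "x > 0" using elim c by (smt (verit) divide_nonneg_pos)
    show ?case
    proof (intro ballI notI)
      fix z assume z: "z \<in> K" and "of_real x * z + of_real a \<in> \<int>\<^sub>\<le>\<^sub>0"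
      then obtain k where "of_real x * z + of_real a = - complex_of_nat k" by (auto elim: nonpos_Ints_cases')
      then have "of_real x * z + of_real a + of_real a' + of_nat k = of_real a'" for a' by simp
      from this[of "- a"] have "of_real x * z + of_real (real k) = - complex_of_real a" by simp
      then have "c * (x + real k) \<le> \<bar>a\<bar>" using lb[OF z x, of "real k"] by simp
      moreover have "c * x > \<bar>a\<bar>" using elim c by (simp add: field_simps)
      moreover have "c * real k \<ge> 0" using c by simp
      ultimately show False by (simp add: distrib_left)
    qed
  qed
qed

text \<open>The continuation has its singularities removed and is sure to coincide with the Gamma
  quotient only where the latter is analytic. On a compact set this holds for large
  \<open>n\<close>: a Gamma argument equal to a nonpositive integer would contradict the linear
  lower bound on \<open>x * z + k\<close>.\<close>

lemma eventually_moment_fun_analytic: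
  assumes K: "compact K" "K \<subseteq> UNIV - complex_of_real ` {..-1}"
  shows "\<forall>\<^sub>F n in sequentially. \<forall>t\<in>K. moment_fun r \<nu> n analytic_on {of_nat n * t}"
proof -
  have half: "filterlim (\<lambda>n. real n / 2) at_top sequentially" by real_asymp
  have half': "filterlim (\<lambda>n. (real r + 1) * (real n / 2)) at_top sequentially" by real_asymp
  let ?K = "(\<lambda>t. 1 + t) ` K"
  have K': "compact ?K" "?K \<inter> \<real>\<^sub>\<le>\<^sub>0 = {}"
    using K one_plus_notin_nonpos_Reals by (auto intro!: compact_continuous_image continuous_intros)
  have "\<forall>\<^sub>F n in sequentially. \<forall>i<r. \<forall>z\<in>?K. of_real (real n / 2) * z + of_real (- real i / 2) \<notin> \<int>\<^sub>\<le>\<^sub>0"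
  proof -
    have "\<forall>\<^sub>F n in sequentially. \<forall>z\<in>?K. of_real (real n / 2) * z + of_real (- real i / 2) \<notin> \<int>\<^sub>\<le>\<^sub>0" for i
      by (rule eventually_compose_filterlim[OF eventually_affine_notin_nonpos_Ints[OF K'] half])
    then have "\<forall>\<^sub>F n in sequentially. \<forall>i\<in>{..<r}. \<forall>z\<in>?K. of_real (real n / 2) * z + of_real (- real i / 2) \<notin> \<int>\<^sub>\<le>\<^sub>0"
      by (intro eventually_ball_finite) blast+
    then show ?thesis by (simp only: lessThan_iff Ball_def)
  qed
  moreover have "\<forall>\<^sub>F n in sequentially. \<forall>z\<in>?K. of_real ((real r + 1) * (real n / 2)) * z + of_real (((real r + 1) * \<nu> - 2 * real r) / 2) \<notin> \<int>\<^sub>\<le>\<^sub>0"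
    by (rule eventually_compose_filterlim[OF eventually_affine_notin_nonpos_Ints[OF K'] half'])
  ultimately show ?thesis
  proof eventually_elim
    case (elim n)
    show ?case
    proof (intro ballI moment_fun_analytic_at)
      fix t i assume t: "t \<in> K" and i: "i < r"
      have "(of_nat n + of_nat n * t - of_nat i) / 2 = of_real (real n / 2) * (1 + t) + of_real (- real i / 2)"
        by (simp add: field_simps)
      with elim(1) t i show "(of_nat n + of_nat n * t - of_nat i) / 2 \<notin> \<int>\<^sub>\<le>\<^sub>0" by (metis imageI)
    next
      fix t assume t: "t \<in> K"
      have "((of_nat r + 1) * (of_real \<nu> + of_nat n + of_nat n * t) - 2 * of_nat r) / 2
        = of_real ((real r + 1) * (real n / 2)) * (1 + t) + of_real (((real r + 1) * \<nu> - 2 * real r) / 2)"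
        by (simp add: field_simps)
      with elim(2) t show "((of_nat r + 1) * (of_real \<nu> + of_nat n + of_nat n * t) - 2 * of_nat r) / 2 \<notin> \<int>\<^sub>\<le>\<^sub>0" by (metis imageI)
    qed
  qed
qed

section \<open>The infinitely divisible law\<close>

definition eta_real :: "nat \<Rightarrow> real \<Rightarrow> real" where
  "eta_real r t = ((real r + 1) * (t + 1) / 2) * ln ((real r + 1) * (t + 1))
     - ((real r * (t + 1) + 1) / 2) * ln (real r * (t + 1) + 1) - ((t + 1) / 2) * ln (t + 1)"

lemma eta_of_real:
  assumes "t > -1"
  shows "eta r (complex_of_real t) = complex_of_real (eta_real r t)"
proof -
  have 1: "(of_nat r + 1) * (complex_of_real t + 1) = complex_of_real ((real r + 1) * (t + 1))"
    "of_nat r * (complex_of_real t + 1) + 1 = complex_of_real (real r * (t + 1) + 1)"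
    "complex_of_real t + 1 = complex_of_real (t + 1)" by auto
  have "(real r + 1) * (t + 1) > 0" "real r * (t + 1) + 1 > 0" "t + 1 > 0"
    using assms by (auto intro!: mult_pos_pos add_nonneg_pos)
  note 2 = this[THEN Ln_of_real]
  show ?thesis
    unfolding eta_def unfolding 1(1) unfolding 1(2) unfolding 1(3) unfolding 2 eta_real_def by simp
qed

lemma sets_density_lborel_prob:
  "prob_space (density lborel f) \<Longrightarrow> real_distribution (density lborel f)"
  by (simp add: real_distribution_def real_distribution_axioms_def)

section \<open>Gamma laws, compound Poisson laws and the law of the jumps\<close>

text \<open>Shape \<open>p\<close> and rate \<open>c\<close>. The transform is taken at
  \<open>- t\<close> because the variable will enter reflected.\<close>

lemma gamma_law:
  fixes p c :: real
  assumes p: "p > 0" and c: "c > 0"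
  obtains G :: "real measure" where "real_distribution G"
    "\<And>t. t > - c \<Longrightarrow> (\<integral>\<^sup>+x. ennreal (exp (- t * x)) \<partial>G) = ennreal ((c / (c + t)) powr p)"
proof -
  define f where "f x = indicator {0..} x * x powr (p - 1) / exp (c * x) * (c powr p / Gamma p)" for x :: real
  have [measurable]: "f \<in> borel_measurable borel" unfolding f_def by measurable
  have Gp: "Gamma p > 0" using p by (rule Gamma_real_pos)
  define G where "G = density lborel (\<lambda>x. ennreal (f x))"
  have *: "(\<integral>\<^sup>+x. ennreal (exp (- t * x)) \<partial>G) = ennreal ((c / (c + t)) powr p)" if t: "t > - c" for t
  proof -
    let ?g = "\<lambda>u. ennreal (indicator {0..} u * u powr (p - 1) / exp u)"
    have ct: "c + t > 0" using t by simp
    have "(\<integral>\<^sup>+x. ennreal (exp (- t * x)) \<partial>G) = (\<integral>\<^sup>+x. ennreal (f x) * ennreal (exp (- t * x)) \<partial>lborel)"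
      unfolding G_def by (rule nn_integral_density) auto
    also have "\<dots> = (\<integral>\<^sup>+x. ennreal (c powr p / Gamma p / (c + t) powr (p - 1)) * ?g (0 + (c + t) * x) \<partial>lborel)"
    proof (rule nn_integral_cong)
      fix x :: real
      show "ennreal (f x) * ennreal (exp (- t * x)) = ennreal (c powr p / Gamma p / (c + t) powr (p - 1)) * ?g (0 + (c + t) * x)"
      proof (cases "x \<ge> 0")
        case True
        have "- (c + t) * x = - ((c + t) * x)" by (rule minus_mult_left[symmetric])
        then have e: "exp (- (c + t) * x) = inverse (exp ((c + t) * x))" by (simp only: exp_minus)
        have "exp (- (c + t) * x) = exp (- t * x) / exp (c * x)"
          by (simp add: exp_diff[symmetric] algebra_simps)
        then have f1: "f x * exp (- t * x) = c powr p / Gamma p * (x powr (p - 1) * inverse (exp ((c + t) * x)))"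
          unfolding e[symmetric] using True by (simp add: f_def mult_ac)
        have f2: "x powr (p - 1) = ((c + t) * x) powr (p - 1) / (c + t) powr (p - 1)"
          using ct True by (simp add: powr_mult)
        have "indicator {0..} ((c + t) * x) = (1 :: real)" using True ct by simp
        then have "f x * exp (- t * x) = (c powr p / Gamma p / (c + t) powr (p - 1)) * (indicator {0..} ((c + t) * x) * ((c + t) * x) powr (p - 1) / exp ((c + t) * x))"
          unfolding f1 f2 by (simp add: divide_inverse)
        moreover have "f x \<ge> 0" using Gp c by (auto simp: f_def)
        ultimately show ?thesis
          using Gp c True ct by (simp add: ennreal_mult[symmetric])
      next
        case False
        then have "\<not> (c + t) * x \<ge> 0" using ct by (simp add: zero_le_mult_iff)
        then show ?thesis using False by (simp add: f_def)
      qed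
    qed
    also have "\<dots> = ennreal (c powr p / Gamma p / (c + t) powr (p - 1)) * (\<integral>\<^sup>+x. ?g (0 + (c + t) * x) \<partial>lborel)"
      by (rule nn_integral_cmult) measurable
    also have "(\<integral>\<^sup>+x. ?g (0 + (c + t) * x) \<partial>lborel) = ennreal (Gamma p / (c + t))"
    proof -
      have "ennreal (Gamma p) = ennreal (c + t) * (\<integral>\<^sup>+x. ?g (0 + (c + t) * x) \<partial>lborel)"
        using nn_integral_real_affine[of ?g "c + t" 0] ct Gamma_conv_nn_integral_real[OF p] by simp
      then have "ennreal (1 / (c + t)) * ennreal (Gamma p) = ennreal (1 / (c + t)) * ennreal (c + t) * (\<integral>\<^sup>+x. ?g (0 + (c + t) * x) \<partial>lborel)"
        by (simp add: mult.assoc)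
      then show ?thesis using ct Gp by (simp add: ennreal_mult[symmetric])
    qed
    also have "ennreal (c powr p / Gamma p / (c + t) powr (p - 1)) * ennreal (Gamma p / (c + t)) = ennreal ((c / (c + t)) powr p)"
    proof -
      have "(c + t) powr (p - 1) * (c + t) = (c + t) powr p" using ct by (simp add: powr_diff)
      then have "c powr p / Gamma p / (c + t) powr (p - 1) * (Gamma p / (c + t)) = (c / (c + t)) powr p"
        using Gp ct c by (simp add: powr_divide)
      then show ?thesis using Gp ct by (simp add: ennreal_mult[symmetric])
    qed
    finally show ?thesis .
  qed
  have "emeasure G (space G) = 1"
    using *[of 0] c by simp
  then have "prob_space G" by (rule prob_spaceI)
  then show ?thesis using that[of G] * sets_density_lborel_prob unfolding G_def by blast
qed

text \<open>The law is a Poisson mixture over the number of independent jumps. Given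
  \<open>n\<close> jumps the exponential moment is \<open>k ^ n\<close>, and the Poisson weights sum
  these powers to an exponential.\<close>

lemma compound_poisson_law:
  fixes J :: "real measure" and \<kappa> :: real
  assumes J: "real_distribution J" and \<kappa>: "\<kappa> > 0"
  obtains S :: "real measure" where "real_distribution S"
    "\<And>t k. k \<ge> 0 \<Longrightarrow> (\<integral>\<^sup>+x. ennreal (exp (t * x)) \<partial>J) = ennreal k \<Longrightarrow>
       (\<integral>\<^sup>+x. ennreal (exp (t * x)) \<partial>S) = ennreal (exp (\<kappa> * (k - 1)))"
proof -
  interpret J: real_distribution J by fact
  have [measurable_cong, simp]: "sets J = sets borel" by simp
  interpret P: product_sigma_finite "\<lambda>_ :: nat. J" ..
  define K where "K n = distr (PiM {..<n} (\<lambda>_. J)) borel (\<lambda>x. \<Sum>i<n. x i)" for n :: nat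
  have Kp: "prob_space (K n)" for n
    unfolding K_def by (intro prob_space.prob_space_distr prob_space_PiM J.prob_space_axioms) measurable
  have [simp]: "sets (K n) = sets borel" for n by (simp add: K_def)
  have K: "K \<in> measurable (measure_pmf (poisson_pmf \<kappa>)) (subprob_algebra borel)"
    using Kp by (auto simp: space_subprob_algebra prob_space_imp_subprob_space)
  define S where "S = measure_pmf (poisson_pmf \<kappa>) \<bind> K"
  have sS: "sets S = sets borel" unfolding S_def by (rule sets_bind_measurable[OF K]) simp
  have *: "(\<integral>\<^sup>+x. ennreal (exp (t * x)) \<partial>S) = ennreal (exp (\<kappa> * (k - 1)))"
    if k: "k \<ge> 0" and Jk: "(\<integral>\<^sup>+x. ennreal (exp (t * x)) \<partial>J) = ennreal k" for t k
  proof -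
    have Kn: "(\<integral>\<^sup>+x. ennreal (exp (t * x)) \<partial>K n) = ennreal (k ^ n)" for n
    proof -
      have "(\<integral>\<^sup>+x. ennreal (exp (t * x)) \<partial>K n) = (\<integral>\<^sup>+x. ennreal (exp (t * (\<Sum>i<n. x i))) \<partial>PiM {..<n} (\<lambda>_. J))"
        unfolding K_def by (rule nn_integral_distr) measurable
      also have "\<dots> = (\<integral>\<^sup>+x. (\<Prod>i<n. ennreal (exp (t * x i))) \<partial>PiM {..<n} (\<lambda>_. J))"
        by (intro nn_integral_cong) (simp add: prod_ennreal exp_sum sum_distrib_left)
      also have "\<dots> = (\<Prod>i<n. \<integral>\<^sup>+x. ennreal (exp (t * x)) \<partial>J)"
        by (rule P.product_nn_integral_prod) auto
      also have "\<dots> = ennreal (k ^ n)" using k by (simp add: Jk ennreal_power)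
      finally show ?thesis .
    qed
    have "(\<integral>\<^sup>+x. ennreal (exp (t * x)) \<partial>S) = (\<integral>\<^sup>+n. \<integral>\<^sup>+x. ennreal (exp (t * x)) \<partial>K n \<partial>measure_pmf (poisson_pmf \<kappa>))"
      unfolding S_def by (rule nn_integral_bind[OF _ K]) measurable
    also have "\<dots> = (\<Sum>n. ennreal (pmf (poisson_pmf \<kappa>) n) * ennreal (k ^ n))"
      unfolding Kn by (simp add: nn_integral_measure_pmf nn_integral_count_space_nat)
    also have "\<dots> = (\<Sum>n. ennreal (exp (- \<kappa>) * ((\<kappa> * k) ^ n /\<^sub>R fact n)))"
      using \<kappa> k by (intro suminf_cong) (simp add: ennreal_mult[symmetric] power_mult_distrib field_simps)
    also have "\<dots> = ennreal (exp (- \<kappa>) * exp (\<kappa> * k))"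
      using \<kappa> k by (intro suminf_ennreal_eq sums_mult exp_converges) auto
    also have "exp (- \<kappa>) * exp (\<kappa> * k) = exp (\<kappa> * (k - 1))"
      by (simp add: exp_add[symmetric] algebra_simps)
    finally show ?thesis .
  qed
  have "emeasure S (space S) = 1"
    using *[of 1 0] J.emeasure_space_1 by simp
  then have "prob_space S" by (rule prob_spaceI)
  then have "real_distribution S" using sS
    by (simp add: real_distribution_def real_distribution_axioms_def)
  then show ?thesis using that * by blast
qed

lemma nn_integral_exp_neg:
  fixes u :: real
  assumes "u > 0"
  shows "(\<integral>\<^sup>+x. ennreal (exp (- u * x)) * indicator {0..} x \<partial>lborel) = ennreal (1 / u)"
proof -
  have "(\<integral>\<^sup>+x. ennreal (exp (- u * x)) * indicator {0..} x \<partial>lborel) = ennreal (0 - (- exp (- u * 0) / u))"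
  proof (rule nn_integral_FTC_atLeast[where F = "\<lambda>x. - exp (- u * x) / u"])
    show "((\<lambda>x. - exp (- u * x) / u) \<longlongrightarrow> 0) at_top" using assms by real_asymp
  qed (use assms in \<open>auto intro!: derivative_eq_intros\<close>)
  then show ?thesis by simp
qed

text \<open>The integral of \<open>(y - 1) / (y + t)\<close> over \<open>y\<close> from 1 to
  \<open>c\<close>. It is the Laplace transform at \<open>t\<close> of the Levy density whose value
  at a jump \<open>x > 0\<close> is the integral of \<open>(y - 1) * exp (- y * x)\<close> over the
  same range.\<close>

definition jump_integral :: "real \<Rightarrow> real \<Rightarrow> real" where
  "jump_integral c t = (c - 1) - (1 + t) * (ln (c + t) - ln (1 + t))"

lemma nn_integral_jump:
  assumes c: "c > 1" and t: "t > -1"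
  shows "(\<integral>\<^sup>+y. ennreal ((y - 1) / (y + t)) * indicator {1..c} y \<partial>lborel) = ennreal (jump_integral c t)"
proof -
  let ?F = "\<lambda>y. y - (1 + t) * ln (y + t)"
  let ?f = "\<lambda>y. if y \<ge> 1 then (y - 1) / (y + t) else 0"
  have "(\<integral>\<^sup>+y. ennreal (?f y) * indicator {1..c} y \<partial>lborel) = ennreal (?F c - ?F 1)"
  proof (rule nn_integral_FTC_Icc[where f = ?f and F = ?F])
    fix y :: real assume "y \<in> {1..c}"
    then have y: "1 \<le> y" "y \<le> c" by auto
    have "(?F has_real_derivative 1 - (1 + t) * (1 / (y + t))) (at y)"
      using y t by (auto intro!: derivative_eq_intros)
    moreover have "1 - (1 + t) * (1 / (y + t)) = ?f y"
    proof -
      have "y + t \<noteq> 0" using y t by linarith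
      then have "1 - (1 + t) * (1 / (y + t)) = (y + t) / (y + t) - (1 + t) / (y + t)" by simp
      also have "\<dots> = ((y + t) - (1 + t)) / (y + t)" by (rule diff_divide_distrib[symmetric])
      also have "\<dots> = ?f y" using y by simp
      finally show ?thesis .
    qed
    ultimately show "(?F has_real_derivative ?f y) (at y)" by simp
  next
    fix y :: real assume "y \<in> {1..c}"
    then have y: "1 \<le> y" "y \<le> c" by auto
    show "0 \<le> ?f y" using y t by auto
  qed (use c in auto)
  also have "(\<integral>\<^sup>+y. ennreal (?f y) * indicator {1..c} y \<partial>lborel) = (\<integral>\<^sup>+y. ennreal ((y - 1) / (y + t)) * indicator {1..c} y \<partial>lborel)"
    by (intro nn_integral_cong) (auto simp: indicator_def)
  also have "?F c - ?F 1 = jump_integral c t" by (simp add: jump_integral_def algebra_simps)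
  finally show ?thesis .
qed

lemma jump_integral_pos:
  assumes c: "c > 1" and t: "t > -1"
  shows "jump_integral c t > 0"
proof -
  have "(c + t) / (1 + t) > 0" "(c + t) / (1 + t) \<noteq> 1" using c t by auto
  then have "ln ((c + t) / (1 + t)) < (c + t) / (1 + t) - 1"
    using ln_le_minus_one ln_eq_minus_one by (metis less_le)
  also have "\<dots> = (c - 1) / (1 + t)" using t by (simp add: field_simps)
  finally have "(1 + t) * ln ((c + t) / (1 + t)) < c - 1" using t by (simp add: field_simps)
  moreover have "ln ((c + t) / (1 + t)) = ln (c + t) - ln (1 + t)" using c t by (simp add: ln_div)
  ultimately show ?thesis by (simp add: jump_integral_def)
qed

text \<open>The Levy measure divided by its mass: a mixture of exponential laws with rates
  \<open>y\<close> between 1 and \<open>c\<close>. Exchanging the integrals leaves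
  \<open>1 / (y + t)\<close> for each rate.\<close>

lemma jump_law:
  fixes c :: real
  assumes c: "c > 1"
  obtains J :: "real measure" where "real_distribution J"
    "\<And>t. t > - 1 \<Longrightarrow> (\<integral>\<^sup>+x. ennreal (exp (- t * x)) \<partial>J) = ennreal (jump_integral c t / jump_integral c 0)"
proof -
  define I where "I = jump_integral c 0"
  have I: "I > 0" unfolding I_def using jump_integral_pos[OF c] by simp
  let ?h = "\<lambda>x y. ennreal ((y - 1) * exp (- y * x) / I) * indicator {1..c} y * indicator {0..} x :: ennreal"
  define J where "J = density lborel (\<lambda>x::real. \<integral>\<^sup>+y. ?h x y \<partial>lborel)"
  have [measurable]: "(\<lambda>x. \<integral>\<^sup>+y. ?h x y \<partial>lborel) \<in> borel_measurable lborel"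
    by measurable
  have *: "(\<integral>\<^sup>+x. ennreal (exp (- t * x)) \<partial>J) = ennreal (jump_integral c t / I)" if t: "t > - 1" for t
  proof -
    have "(\<integral>\<^sup>+x. ennreal (exp (- t * x)) \<partial>J) = (\<integral>\<^sup>+x. (\<integral>\<^sup>+y. ?h x y \<partial>lborel) * ennreal (exp (- t * x)) \<partial>lborel)"
      unfolding J_def by (rule nn_integral_density) measurable
    also have "\<dots> = (\<integral>\<^sup>+x. (\<integral>\<^sup>+y. ?h x y * ennreal (exp (- t * x)) \<partial>lborel) \<partial>lborel)"
      by (intro nn_integral_cong nn_integral_multc[symmetric]) measurable
    also have "\<dots> = (\<integral>\<^sup>+y. (\<integral>\<^sup>+x. ?h x y * ennreal (exp (- t * x)) \<partial>lborel) \<partial>lborel)"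
      by (rule lborel_pair.Fubini') measurable
    also have "\<dots> = (\<integral>\<^sup>+y. ennreal (1 / I) * (ennreal ((y - 1) / (y + t)) * indicator {1..c} y) \<partial>lborel)"
    proof (rule nn_integral_cong)
      fix y :: real
      show "(\<integral>\<^sup>+x. ?h x y * ennreal (exp (- t * x)) \<partial>lborel) = ennreal (1 / I) * (ennreal ((y - 1) / (y + t)) * indicator {1..c} y)"
      proof (cases "y \<in> {1..c}")
        case True
        have "(\<integral>\<^sup>+x. ?h x y * ennreal (exp (- t * x)) \<partial>lborel) = (\<integral>\<^sup>+x. ennreal ((y - 1) / I) * (ennreal (exp (- (y + t) * x)) * indicator {0..} x) \<partial>lborel)"
          using True I by (intro nn_integral_cong) (auto simp: indicator_def ennreal_mult[symmetric] exp_add[symmetric] algebra_simps)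
        also have "\<dots> = ennreal ((y - 1) / I) * ennreal (1 / (y + t))"
        proof (subst nn_integral_cmult)
          have "y + t > 0" using True t by auto
          then show "ennreal ((y - 1) / I) * (\<integral>\<^sup>+x. ennreal (exp (- (y + t) * x)) * indicator {0..} x \<partial>lborel) = ennreal ((y - 1) / I) * ennreal (1 / (y + t))"
            by (simp only: nn_integral_exp_neg)
        qed measurable
        also have "\<dots> = ennreal (1 / I) * (ennreal ((y - 1) / (y + t)) * indicator {1..c} y)"
          using True I t by (simp add: ennreal_mult[symmetric])
        finally show ?thesis .
      qed auto
    qed
    also have "\<dots> = ennreal (1 / I) * ennreal (jump_integral c t)"
      using nn_integral_jump[OF c t] by (subst nn_integral_cmult) auto
    also have "\<dots> = ennreal (jump_integral c t / I)"
      using I jump_integral_pos[OF c t] by (simp add: ennreal_mult[symmetric])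
    finally show ?thesis .
  qed
  have "emeasure J (space J) = 1"
    using *[of 0] I by (simp add: I_def)
  then have "prob_space J" by (rule prob_spaceI)
  then show ?thesis using that[of J] * sets_density_lborel_prob unfolding J_def I_def by blast
qed

text \<open>The constant \<open>c\<close> comes from \<open>r * (t + 1) + 1 = r * (t + c)\<close>.
  This is a Levy-Khintchine representation in closed form: a drift, a reflected Gamma variable of
  shape 1/2 and rate \<open>c\<close>, and reflected jumps of intensity
  \<open>R / 2 * jump_integral c 0\<close>.\<close>

lemma eta_real_decomposition:
  assumes r: "r > 0" and t: "t > -1"
  defines "R \<equiv> real r" and "c \<equiv> 1 + 1 / real r"
  shows "eta_real r t = ((R + 1) * ln (R + 1) - R * ln R) / 2 * t + (ln c - ln (c + t)) / 2
     + R / 2 * (jump_integral c t - jump_integral c 0)"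
proof -
  have R: "R > 0" using r by (simp add: R_def)
  define z where "z = 1 + t"
  have z: "z > 0" using t by (simp add: z_def)
  have c0: "ln c = ln (R + 1) - ln R"
  proof -
    have "c = (R + 1) / R" using R by (simp add: c_def R_def field_simps)
    then show ?thesis using R by (simp add: ln_div)
  qed
  have ct: "ln (c + t) = ln (R * z + 1) - ln R"
  proof -
    have "c + t = (R * z + 1) / R" using R by (simp add: c_def R_def z_def field_simps)
    moreover have "R * z + 1 > 0" using R z by (simp add: add_pos_pos)
    ultimately show ?thesis using R by (simp add: ln_div)
  qed
  have e1: "eta_real r t = (R + 1) * z / 2 * (ln (R + 1) + ln z) - (R * z + 1) / 2 * ln (R * z + 1) - z / 2 * ln z"
    unfolding eta_real_def using R z by (simp add: R_def[symmetric] z_def add.commute ln_mult)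
  have e2: "jump_integral c t - jump_integral c 0 = - z * (ln (R * z + 1) - ln R - ln z) + (ln (R + 1) - ln R)"
    by (simp add: jump_integral_def ct c0 z_def[symmetric])
  show ?thesis unfolding e1 e2 ct c0 by (simp add: z_def field_simps)
qed

lemma real_distribution_affine_sum:
  fixes A B :: "real measure" and d :: real
  assumes "real_distribution A" "real_distribution B"
  obtains \<mu> :: "real measure" where "real_distribution \<mu>"
    "\<And>t. (\<integral>\<^sup>+x. ennreal (exp (t * x)) \<partial>\<mu>) = ennreal (exp (d * t)) * (\<integral>\<^sup>+x. ennreal (exp (- t * x)) \<partial>A) * (\<integral>\<^sup>+x. ennreal (exp (- t * x)) \<partial>B)"
proof -
  interpret A: real_distribution A by fact
  interpret B: real_distribution B by fact
  interpret AB: pair_prob_space A B ..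
  define \<mu> where "\<mu> = distr (A \<Otimes>\<^sub>M B) borel (\<lambda>(x, y). d - x - y)"
  have [measurable]: "(\<lambda>(x, y). d - x - y) \<in> borel_measurable (A \<Otimes>\<^sub>M B)" by measurable
  have "real_distribution \<mu>"
    unfolding \<mu>_def by (intro AB.real_distribution_distr) measurable
  moreover have "(\<integral>\<^sup>+x. ennreal (exp (t * x)) \<partial>\<mu>) = ennreal (exp (d * t)) * (\<integral>\<^sup>+x. ennreal (exp (- t * x)) \<partial>A) * (\<integral>\<^sup>+x. ennreal (exp (- t * x)) \<partial>B)" for t
  proof -
    have "(\<integral>\<^sup>+x. ennreal (exp (t * x)) \<partial>\<mu>) = (\<integral>\<^sup>+p. ennreal (exp (t * (d - fst p - snd p))) \<partial>(A \<Otimes>\<^sub>M B))"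
      unfolding \<mu>_def by (subst nn_integral_distr) (auto simp: case_prod_beta)
    also have "\<dots> = (\<integral>\<^sup>+x. \<integral>\<^sup>+y. ennreal (exp (t * (d - x - y))) \<partial>B \<partial>A)"
      by (subst B.nn_integral_fst[symmetric]) auto
    also have "\<dots> = (\<integral>\<^sup>+x. \<integral>\<^sup>+y. (ennreal (exp (d * t)) * ennreal (exp (- t * x))) * ennreal (exp (- t * y)) \<partial>B \<partial>A)"
      by (intro nn_integral_cong) (simp add: ennreal_mult[symmetric] exp_add[symmetric] algebra_simps)
    also have "\<dots> = (\<integral>\<^sup>+x. (ennreal (exp (d * t)) * ennreal (exp (- t * x))) * (\<integral>\<^sup>+y. ennreal (exp (- t * y)) \<partial>B) \<partial>A)"
      by (intro nn_integral_cong nn_integral_cmult) measurable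
    also have "\<dots> = (\<integral>\<^sup>+x. (ennreal (exp (d * t)) * ennreal (exp (- t * x))) \<partial>A) * (\<integral>\<^sup>+y. ennreal (exp (- t * y)) \<partial>B)"
      by (rule nn_integral_multc) measurable
    also have "(\<integral>\<^sup>+x. (ennreal (exp (d * t)) * ennreal (exp (- t * x))) \<partial>A) = ennreal (exp (d * t)) * (\<integral>\<^sup>+x. ennreal (exp (- t * x)) \<partial>A)"
      by (rule nn_integral_cmult) measurable
    finally show ?thesis .
  qed
  ultimately show ?thesis using that by blast
qed

lemma eta_law_exists:
  fixes a :: real
  assumes a: "a > 0"
  obtains \<mu> :: "real measure" where "real_distribution \<mu>"
    "\<And>t. t > -1 \<Longrightarrow> (\<integral>\<^sup>+x. ennreal (exp (t * x)) \<partial>\<mu>) = ennreal (exp (a * eta_real r t))"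
\<comment> \<open>For \<open>r = 0\<close> the cumulant function vanishes and the law sits at 0; the
  constant \<open>c = 1 + 1 / r\<close> makes sense for \<open>r > 0\<close> only.\<close>
proof (cases "r = 0")
  case True
  then have "eta_real r t = 0" for t by (simp add: eta_real_def)
  moreover have "real_distribution (return borel (0 :: real))"
    by (simp add: real_distribution_def real_distribution_axioms_def prob_space_return)
  moreover have "(\<integral>\<^sup>+x. ennreal (exp (t * x)) \<partial>return borel (0::real)) = 1" for t
    by (subst nn_integral_return) auto
  ultimately show ?thesis using that by simp
next
  case False
  define R where "R = real r"
  define c where "c = 1 + 1 / R"
  have R: "R > 0" and c: "c > 1" using False by (auto simp: R_def c_def)
  \<comment> \<open>With \<open>k = jump_integral c t / jump_integral c 0\<close>, the exponent
    \<open>\<kappa> * (k - 1)\<close> becomes \<open>a\<close> times the jump term of the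
    decomposition.\<close>
  define \<kappa> where "\<kappa> = a * (R / 2) * jump_integral c 0"
  have I: "jump_integral c 0 > 0" using jump_integral_pos[OF c] by simp
  then have \<kappa>: "\<kappa> > 0" using a R by (simp add: \<kappa>_def)
  obtain G :: "real measure" where G: "real_distribution G"
    "\<And>t. t > - c \<Longrightarrow> (\<integral>\<^sup>+x. ennreal (exp (- t * x)) \<partial>G) = ennreal ((c / (c + t)) powr (a / 2))"
    using gamma_law[of "a / 2" c] a c by auto
  obtain J :: "real measure" where J: "real_distribution J"
    "\<And>t. t > - 1 \<Longrightarrow> (\<integral>\<^sup>+x. ennreal (exp (- t * x)) \<partial>J) = ennreal (jump_integral c t / jump_integral c 0)"
    using jump_law[OF c] by blast
  obtain S :: "real measure" where S: "real_distribution S"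
    "\<And>t k. k \<ge> 0 \<Longrightarrow> (\<integral>\<^sup>+x. ennreal (exp (t * x)) \<partial>J) = ennreal k \<Longrightarrow>
       (\<integral>\<^sup>+x. ennreal (exp (t * x)) \<partial>S) = ennreal (exp (\<kappa> * (k - 1)))"
    using compound_poisson_law[OF J(1) \<kappa>] by blast
  define d where "d = a * (((R + 1) * ln (R + 1) - R * ln R) / 2)"
  obtain \<mu> :: "real measure" where \<mu>: "real_distribution \<mu>"
    "\<And>t. (\<integral>\<^sup>+x. ennreal (exp (t * x)) \<partial>\<mu>) = ennreal (exp (d * t)) * (\<integral>\<^sup>+x. ennreal (exp (- t * x)) \<partial>G) * (\<integral>\<^sup>+x. ennreal (exp (- t * x)) \<partial>S)"
    using real_distribution_affine_sum[OF G(1) S(1)] by blast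
  have "(\<integral>\<^sup>+x. ennreal (exp (t * x)) \<partial>\<mu>) = ennreal (exp (a * eta_real r t))" if t: "t > -1" for t
  proof -
    let ?k = "jump_integral c t / jump_integral c 0"
    have k: "?k \<ge> 0" using I jump_integral_pos[OF c t] by simp
    have "(\<integral>\<^sup>+x. ennreal (exp (t * x)) \<partial>\<mu>) = ennreal (exp (d * t)) * ennreal ((c / (c + t)) powr (a / 2)) * ennreal (exp (\<kappa> * (?k - 1)))"
      using \<mu>(2)[of t] G(2)[of t] S(2)[OF k J(2)[OF t]] t c by simp
    also have "(c / (c + t)) powr (a / 2) = exp (a / 2 * (ln c - ln (c + t)))"
      using c t by (simp add: powr_def ln_div)
    also have "ennreal (exp (d * t)) * ennreal (exp (a / 2 * (ln c - ln (c + t)))) * ennreal (exp (\<kappa> * (?k - 1)))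
       = ennreal (exp (d * t + a / 2 * (ln c - ln (c + t)) + \<kappa> * (?k - 1)))"
      by (simp add: ennreal_mult[symmetric] exp_add)
    also have "\<kappa> * (?k - 1) = a * (R / 2 * (jump_integral c t - jump_integral c 0))"
      using I by (simp add: \<kappa>_def field_simps)
    also have "d * t + a / 2 * (ln c - ln (c + t)) + a * (R / 2 * (jump_integral c t - jump_integral c 0)) = a * eta_real r t"
      unfolding eta_real_decomposition[OF _ t, of r, folded R_def, folded c_def, simplified, OF False[simplified]]
      by (simp add: d_def field_simps)
    finally show ?thesis .
  qed
  then show ?thesis using that \<mu>(1) by blast
qed

section \<open>Complex exponents and infinite divisibility\<close>

lemma eta_analytic: "eta r analytic_on {t. -1 < Re t}"
proof -
  have "(of_nat r + 1) * (t + 1) \<notin> \<real>\<^sub>\<le>\<^sub>0" "of_nat r * (t + 1) + 1 \<notin> \<real>\<^sub>\<le>\<^sub>0" "t + 1 \<notin> \<real>\<^sub>\<le>\<^sub>0"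
    if "-1 < Re t" for t :: complex
  proof -
    have "Re ((of_nat r + 1) * (t + 1)) = (real r + 1) * (Re t + 1)" by simp
    moreover have "(real r + 1) * (Re t + 1) > 0" using that by (intro mult_pos_pos) auto
    ultimately have "Re ((of_nat r + 1) * (t + 1)) > 0" by simp
    then show "(of_nat r + 1) * (t + 1) \<notin> \<real>\<^sub>\<le>\<^sub>0" by (simp only: complex_nonpos_Reals_iff) linarith
    have "Re (of_nat r * (t + 1) + 1) = real r * (Re t + 1) + 1" by simp
    moreover have "real r * (Re t + 1) + 1 > 0" using that by (intro add_nonneg_pos mult_nonneg_nonneg) auto
    ultimately have "Re (of_nat r * (t + 1) + 1) > 0" by simp
    then show "of_nat r * (t + 1) + 1 \<notin> \<real>\<^sub>\<le>\<^sub>0" by (simp only: complex_nonpos_Reals_iff) linarith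
    show "t + 1 \<notin> \<real>\<^sub>\<le>\<^sub>0" using that by (simp add: complex_nonpos_Reals_iff)
  qed
  then show ?thesis
    unfolding eta_def[abs_def] by (intro analytic_intros) auto
qed

text \<open>Both sides are analytic on a strip around \<open>t\<close> and agree at its real points
  by hypothesis.\<close>

lemma eta_law_complex:
  fixes \<mu> :: "real measure"
  assumes \<mu>: "real_distribution \<mu>"
    and mgf: "\<And>t. t > -1 \<Longrightarrow> (\<integral>\<^sup>+x. ennreal (exp (t * x)) \<partial>\<mu>) = ennreal (exp (a * eta_real r t))"
    and t: "Re t > -1"
  shows "integrable \<mu> (\<lambda>x. exp (t * complex_of_real x))"
    and "(LINT x|\<mu>. exp (t * complex_of_real x)) = exp (complex_of_real a * eta r t)"
proof -
  interpret \<mu>: real_distribution \<mu> by fact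
  let ?E = "\<lambda>t. LINT x|\<mu>. exp (t * complex_of_real x)"
  have int: "integrable \<mu> (\<lambda>x. exp (s * x))" if "s > -1" for s
    using mgf[OF that] by (intro integrableI_nn_integral_finite[where x = "exp (a * eta_real r s)"]) auto
  have E: "?E (complex_of_real s) = exp (complex_of_real a * eta r (complex_of_real s))" if s: "s > -1" for s
  proof -
    have "(LINT x|\<mu>. exp (s * x)) = exp (a * eta_real r s)"
      using mgf[OF s] by (subst integral_eq_nn_integral) auto
    moreover have "?E (complex_of_real s) = complex_of_real (LINT x|\<mu>. exp (s * x))"
      by (subst integral_complex_of_real[symmetric]) (simp add: exp_of_real[symmetric])
    ultimately show ?thesis by (simp add: eta_of_real[OF s] exp_of_real[symmetric])
  qed
  \<comment> \<open>\<open>u\<close> is the midpoint of -1 and \<open>Re t\<close>, so the real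
    moments at both edges of the strip are finite.\<close>
  define u v where "u = (Re t - 1) / 2" and "v = Re t + 1"
  have uv: "-1 < u" "u < Re t" "Re t < v" "-1 < v" using t by (auto simp: u_def v_def field_simps)
  show "integrable \<mu> (\<lambda>x. exp (t * complex_of_real x))"
    using uv by (intro integrable_exp_between[OF _ int[of u] int[of v]]) auto
  let ?S = "{t. u < Re t \<and> Re t < v}"
  have anE: "?E analytic_on ?S" using uv by (intro mgf_analytic_at int) auto
  have anX: "(\<lambda>t. exp (complex_of_real a * eta r t)) analytic_on ?S"
    using uv by (intro analytic_intros analytic_on_subset[OF eta_analytic]) auto
  have S_eq: "?S = {t. u < Re t} \<inter> {t. Re t < v}" by auto
  have S: "open ?S" "connected ?S"
    unfolding S_eq by (auto intro!: open_halfspace_Re_gt open_halfspace_Re_lt convex_connected convex_Int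
      convex_halfspace_Re_gt convex_halfspace_Re_lt)
  show "?E t = exp (complex_of_real a * eta r t)"
  proof (rule nicely_meromorphic_on_eqI[where f = ?E and g = "\<lambda>t. exp (complex_of_real a * eta r t)" and A = ?S])
    show "\<exists>\<^sub>F z in at (complex_of_real (Re t)). ?E z = exp (complex_of_real a * eta r z)"
      by (rule frequently_at_of_realI[of "-1"]) (use E t in auto)
  qed (use anE anX S uv analytic_on_imp_nicely_meromorphic_on in auto)
qed

text \<open>The moment generating function continues to the imaginary axis, where it is the
  characteristic function. There the \<open>m\<close>-th power of the transform of the law with
  \<open>a = 1 / m\<close> is the transform of \<open>\<phi>\<close>, and characteristic functions
  determine laws.\<close>

lemma eta_law_infinitely_divisible:
  fixes \<phi> :: "real measure"
  assumes \<phi>: "real_distribution \<phi>"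
    and mgf: "\<And>t. t > -1 \<Longrightarrow> (\<integral>\<^sup>+x. ennreal (exp (t * x)) \<partial>\<phi>) = ennreal (exp (1 * eta_real r t))"
  shows "infinitely_divisible \<phi>"
  unfolding infinitely_divisible_def
proof (intro conjI \<phi> allI impI)
  fix m :: nat assume m: "m \<ge> 1"
  obtain \<mu> :: "real measure" where \<mu>: "real_distribution \<mu>"
    and mgf': "\<And>t. t > -1 \<Longrightarrow> (\<integral>\<^sup>+x. ennreal (exp (t * x)) \<partial>\<mu>) = ennreal (exp ((1 / real m) * eta_real r t))"
    using eta_law_exists[of "1 / real m" r] m by auto
  interpret \<mu>: real_distribution \<mu> by fact
  have [measurable_cong, simp]: "sets \<mu> = sets borel" by simp
  interpret P: product_sigma_finite "\<lambda>_ :: nat. \<mu>" ..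
  let ?D = "distr (PiM {..<m} (\<lambda>_. \<mu>)) borel (\<lambda>x. \<Sum>i<m. x i)"
  have pP: "prob_space (PiM {..<m} (\<lambda>_. \<mu>))" by (intro prob_space_PiM \<mu>.prob_space_axioms)
  have "real_distribution ?D"
    unfolding real_distribution_def real_distribution_axioms_def
    by (auto intro!: prob_space.prob_space_distr[OF pP])
  moreover have "char ?D u = char \<phi> u" for u
  proof -
    have Re: "Re (\<i> * complex_of_real u) > -1" by simp
    have "char ?D u = (LINT x|PiM {..<m} (\<lambda>_. \<mu>). iexp (u * (\<Sum>i<m. x i)))"
      unfolding char_def by (rule integral_distr) measurable
    also have "\<dots> = (LINT x|PiM {..<m} (\<lambda>_. \<mu>). (\<Prod>i<m. exp ((\<i> * complex_of_real u) * complex_of_real (x i))))"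
      by (intro Bochner_Integration.integral_cong) (auto simp: exp_sum[symmetric] sum_distrib_left mult.assoc)
    also have "\<dots> = (\<Prod>i<m. (LINT x|\<mu>. exp ((\<i> * complex_of_real u) * complex_of_real x)))"
      using eta_law_complex(1)[OF \<mu> mgf' Re] by (intro P.product_integral_prod) auto
    also have "\<dots> = exp (complex_of_real (1 / real m) * eta r (\<i> * complex_of_real u)) ^ m"
      using eta_law_complex(2)[OF \<mu> mgf' Re] by simp
    also have "\<dots> = exp (of_nat m * (complex_of_real (1 / real m) * eta r (\<i> * complex_of_real u)))"
      by (rule exp_of_nat_mult[symmetric])
    also have "of_nat m * (complex_of_real (1 / real m) * eta r (\<i> * complex_of_real u)) = complex_of_real 1 * eta r (\<i> * complex_of_real u)"
      using m by simp
    also have "exp \<dots> = (LINT x|\<phi>. exp ((\<i> * complex_of_real u) * complex_of_real x))"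
      using eta_law_complex(2)[OF \<phi> mgf Re] by simp
    also have "\<dots> = char \<phi> u" by (simp add: char_def mult.assoc)
    finally show ?thesis .
  qed
  ultimately have "?D = \<phi>" using \<phi> by (intro Levy_uniqueness ext) auto
  then show "\<exists>\<mu>. real_distribution \<mu> \<and> distr (PiM {..<m} (\<lambda>_. \<mu>)) borel (\<lambda>x. \<Sum>i<m. x i) = \<phi>"
    using \<mu> by blast
qed

lemma infinitely_divisible_with_cumulant_eta:
  "\<exists>\<phi>. infinitely_divisible \<phi> \<and>
        (\<forall>t\<in>strip (-1) \<infinity>. integrable \<phi> (\<lambda>x. exp (t * complex_of_real x)) \<and>
           (LINT x|\<phi>. exp (t * complex_of_real x)) = exp (eta r t))"
proof -
  obtain \<phi> :: "real measure" where \<phi>: "real_distribution \<phi>"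
    and mgf: "\<And>t. t > -1 \<Longrightarrow> (\<integral>\<^sup>+x. ennreal (exp (t * x)) \<partial>\<phi>) = ennreal (exp (1 * eta_real r t))"
    using eta_law_exists[of 1 r] by auto
  show ?thesis
  proof (intro exI conjI ballI)
    show "infinitely_divisible \<phi>" using \<phi> mgf by (rule eta_law_infinitely_divisible)
    fix t assume "t \<in> strip (-1) \<infinity>"
    then have t: "Re t > -1" by (simp add: strip_def one_ereal_def)
    show "integrable \<phi> (\<lambda>x. exp (t * complex_of_real x))" "(LINT x|\<phi>. exp (t * complex_of_real x)) = exp (eta r t)"
      using eta_law_complex[OF \<phi> mgf t] by auto
  qed
qed

section \<open>Gram determinants\<close>

definition ip :: "nat \<Rightarrow> (nat \<Rightarrow> real) \<Rightarrow> (nat \<Rightarrow> real) \<Rightarrow> real" where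
  "ip n x y = (\<Sum>k<n. x k * y k)"

lemma ip_commute: "ip n x y = ip n y x"
  by (simp add: ip_def mult.commute)

lemma ip_add_left: "ip n (\<lambda>k. x k + y k) z = ip n x z + ip n y z"
  by (simp add: ip_def distrib_right sum.distrib)

lemma ip_diff_left: "ip n (\<lambda>k. x k - y k) z = ip n x z - ip n y z"
  by (simp add: ip_def left_diff_distrib sum_subtractf)

lemma ip_scale_left: "ip n (\<lambda>k. c * x k) z = c * ip n x z"
  by (simp add: ip_def sum_distrib_left mult.assoc)

lemma ip_sum_left: "ip n (\<lambda>k. \<Sum>i\<in>A. x i k) z = (\<Sum>i\<in>A. ip n (x i) z)"
  unfolding ip_def sum_distrib_right by (rule sum.swap)

lemma ip_diff_right: "ip n z (\<lambda>k. x k - y k) = ip n z x - ip n z y"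
  by (simp add: ip_diff_left ip_commute[of n z])

lemma ip_scale_right: "ip n z (\<lambda>k. c * x k) = c * ip n z x"
  by (simp add: ip_scale_left ip_commute[of n z])

lemma ip_sum_right: "ip n z (\<lambda>k. \<Sum>i\<in>A. x i k) = (\<Sum>i\<in>A. ip n z (x i))"
  by (simp add: ip_sum_left ip_commute[of n z])

lemma ip_cong: "(\<And>k. k < n \<Longrightarrow> x k = x' k) \<Longrightarrow> (\<And>k. k < n \<Longrightarrow> y k = y' k) \<Longrightarrow> ip n x y = ip n x' y'"
  by (simp add: ip_def)

lemma ip_self_nonneg: "ip n x x \<ge> 0"
  by (simp add: ip_def sum_nonneg)

lemma ip_self_eq_0: "ip n x x = 0 \<Longrightarrow> k < n \<Longrightarrow> x k = 0"
  by (auto simp: ip_def sum_nonneg_eq_0_iff)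

section \<open>Orthonormal frames and QR decomposition\<close>

lemma orthonormal_frame_iff:
  "orthonormal_frame n r e \<longleftrightarrow> (\<forall>i<r. \<forall>j<r. ip n (e i) (e j) = (if i = j then 1 else 0))"
  by (simp add: orthonormal_frame_def ip_def)

lemma orthonormal_frameD:
  "orthonormal_frame n r e \<Longrightarrow> i < r \<Longrightarrow> j < r \<Longrightarrow> ip n (e i) (e j) = (if i = j then 1 else 0)"
  by (simp add: orthonormal_frame_iff)

lemma orthonormal_frame_mono: "orthonormal_frame n r e \<Longrightarrow> s \<le> r \<Longrightarrow> orthonormal_frame n s e"
  by (simp add: orthonormal_frame_def)

definition residual :: "nat \<Rightarrow> nat \<Rightarrow> (nat \<Rightarrow> nat \<Rightarrow> real) \<Rightarrow> (nat \<Rightarrow> real) \<Rightarrow> nat \<Rightarrow> real" where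
  "residual n r e v k = v k - (\<Sum>i<r. ip n v (e i) * e i k)"

lemma ip_residual:
  assumes "orthonormal_frame n r e" "j < r"
  shows "ip n (residual n r e v) (e j) = 0"
proof -
  have "ip n (residual n r e v) (e j) = ip n v (e j) - (\<Sum>i<r. ip n v (e i) * ip n (e i) (e j))"
    by (simp add: residual_def[abs_def] ip_diff_left ip_sum_left ip_scale_left)
  also have "(\<Sum>i<r. ip n v (e i) * ip n (e i) (e j)) = (\<Sum>i<r. if i = j then ip n v (e i) else 0)"
    using assms by (intro sum.cong) (auto simp: orthonormal_frameD)
  finally show ?thesis using assms by simp
qed

lemma norm_residual:
  assumes "orthonormal_frame n r e"
  shows "ip n (residual n r e v) (residual n r e v) = ip n v v - (\<Sum>i<r. (ip n v (e i))\<^sup>2)"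
proof -
  have "ip n (residual n r e v) (residual n r e v) = ip n (residual n r e v) (\<lambda>k. v k - (\<Sum>i<r. ip n v (e i) * e i k))"
    by (simp add: residual_def[abs_def])
  also have "\<dots> = ip n (residual n r e v) v - (\<Sum>i<r. ip n v (e i) * ip n (residual n r e v) (e i))"
    by (simp add: ip_diff_right ip_sum_right ip_scale_right)
  also have "\<dots> = ip n (residual n r e v) v"
    using assms by (simp add: ip_residual)
  also have "\<dots> = ip n v v - (\<Sum>i<r. ip n v (e i) * ip n (e i) v)"
    by (simp add: residual_def[abs_def] ip_diff_left ip_sum_left ip_scale_left)
  finally show ?thesis by (simp add: ip_commute power2_eq_square)
qed

definition coord_vec :: "nat \<Rightarrow> nat \<Rightarrow> real" where
  "coord_vec k l = (if l = k then 1 else 0)"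

lemma ip_coord_vec: "k < n \<Longrightarrow> ip n (coord_vec k) x = x k"
  by (simp add: ip_def coord_vec_def if_distrib[of "\<lambda>c. c * _"] sum.delta cong: if_cong)

text \<open>The sum is the trace of the orthogonal projection onto the complement of the frame. For
  \<open>r < n\<close> it is positive, so some coordinate vector leaves the span and the frame can
  be extended; for \<open>r = n\<close> it is 0, so the frame is complete.\<close>

lemma sum_norm_residual_coord_vec:
  assumes "orthonormal_frame n r e"
  shows "(\<Sum>k<n. ip n (residual n r e (coord_vec k)) (residual n r e (coord_vec k))) = real n - real r"
proof -
  have "(\<Sum>k<n. ip n (residual n r e (coord_vec k)) (residual n r e (coord_vec k))) = (\<Sum>k<n. 1 - (\<Sum>i<r. (e i k)\<^sup>2))"
    using assms by (intro sum.cong) (auto simp: norm_residual ip_coord_vec coord_vec_def)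
  also have "\<dots> = real n - (\<Sum>k<n. \<Sum>i<r. (e i k)\<^sup>2)" by (simp add: sum_subtractf)
  also have "(\<Sum>k<n. \<Sum>i<r. (e i k)\<^sup>2) = (\<Sum>i<r. ip n (e i) (e i))"
    unfolding ip_def power2_eq_square by (rule sum.swap)
  also have "\<dots> = real r" using assms by (simp add: orthonormal_frameD)
  finally show ?thesis .
qed

lemma orthonormal_frame_extend_one:
  assumes e: "orthonormal_frame n r e" and r: "r < n"
  obtains u where "ip n u u = 1" "\<And>i. i < r \<Longrightarrow> ip n u (e i) = 0"
proof -
  have "\<exists>k<n. ip n (residual n r e (coord_vec k)) (residual n r e (coord_vec k)) > 0"
  proof (rule ccontr)
    assume "\<not> ?thesis"
    then have "(\<Sum>k<n. ip n (residual n r e (coord_vec k)) (residual n r e (coord_vec k))) \<le> 0"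
      by (intro sum_nonpos) (metis lessThan_iff not_le)
    then show False using sum_norm_residual_coord_vec[OF e] r by simp
  qed
  then obtain k where k: "ip n (residual n r e (coord_vec k)) (residual n r e (coord_vec k)) > 0" (is "?q > 0") by blast
  define u where "u l = (1 / sqrt ?q) * residual n r e (coord_vec k) l" for l
  have "ip n u u = 1"
    using k unfolding u_def[abs_def] ip_scale_left ip_scale_right
    by (simp add: field_simps flip: power2_eq_square)
  moreover have "ip n u (e i) = 0" if "i < r" for i
    using ip_residual[OF e that] unfolding u_def[abs_def] ip_scale_left by simp
  ultimately show ?thesis using that by blast
qed

text \<open>All coordinate vectors have residual 0, which says that a square matrix with orthonormal
  rows has orthonormal columns.\<close>

lemma orthonormal_frame_columns:
  assumes e: "orthonormal_frame n n e" and kl: "k < n" "l < n"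
  shows "(\<Sum>i<n. e i k * e i l) = (if k = l then 1 else 0)"
proof -
  let ?w = "\<lambda>k. residual n n e (coord_vec k)"
  have "(\<Sum>k<n. ip n (?w k) (?w k)) = 0" using sum_norm_residual_coord_vec[OF e] by simp
  then have "ip n (?w k) (?w k) = 0" using kl by (simp add: sum_nonneg_eq_0_iff ip_self_nonneg)
  then have "?w k l = 0" using kl(2) by (rule ip_self_eq_0)
  then show ?thesis using kl by (simp add: residual_def ip_coord_vec) (auto simp: coord_vec_def)
qed

lemma orthonormal_basis_expansion:
  assumes e: "orthonormal_frame n n e" and k: "k < n"
  shows "x k = (\<Sum>i<n. ip n x (e i) * e i k)"
proof -
  have "(\<Sum>i<n. ip n x (e i) * e i k) = (\<Sum>i<n. \<Sum>l<n. x l * (e i l * e i k))"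
    by (simp add: ip_def sum_distrib_right mult.assoc)
  also have "\<dots> = (\<Sum>l<n. x l * (\<Sum>i<n. e i l * e i k))"
    by (subst sum.swap) (simp add: sum_distrib_left)
  also have "\<dots> = (\<Sum>l<n. if l = k then x l else 0)"
    using e k by (intro sum.cong) (auto simp: orthonormal_frame_columns)
  finally show ?thesis using k by simp
qed

lemma parseval:
  assumes e: "orthonormal_frame n n e"
  shows "ip n x x = (\<Sum>i<n. (ip n x (e i))\<^sup>2)"
proof -
  have "residual n n e x k = 0" if "k < n" for k
    using orthonormal_basis_expansion[OF e that, of x] by (simp add: residual_def)
  then have "ip n (residual n n e x) (residual n n e x) = 0" by (simp add: ip_def)
  then show ?thesis using norm_residual[OF e, of x] by simp
qed

text \<open>Gram-Schmidt without a rank condition. The length \<open>j\<close> of the frame is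
  independent of the number \<open>m\<close> of vectors, so the frame can be continued to a full
  orthonormal basis.\<close>

lemma qr_frame_aux:
  assumes "j \<le> n"
  shows "\<exists>e. orthonormal_frame n j e \<and> (\<forall>l<j. l < m \<longrightarrow> (\<forall>k<n. v l k = (\<Sum>i\<le>l. ip n (v l) (e i) * e i k)))"
  using assms
proof (induction j)
  case 0
  show ?case by (auto simp: orthonormal_frame_def)
next
  case (Suc j)
  then obtain e where e: "orthonormal_frame n j e"
    and v: "\<And>l k. l < j \<Longrightarrow> l < m \<Longrightarrow> k < n \<Longrightarrow> v l k = (\<Sum>i\<le>l. ip n (v l) (e i) * e i k)" by auto
  let ?w = "residual n j e (v j)"
  obtain u where u: "ip n u u = 1" "\<And>i. i < j \<Longrightarrow> ip n u (e i) = 0" "\<And>k. k < n \<Longrightarrow> ?w k = ip n (v j) u * u k"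
  \<comment> \<open>If \<open>v j\<close> lies in the span of the frame so far, any unit vector
    orthogonal to the frame can be appended; the coefficient of \<open>v j\<close> on it is
    0.\<close>
  proof (cases "ip n ?w ?w = 0")
    case True
    obtain u where u: "ip n u u = 1" "\<And>i. i < j \<Longrightarrow> ip n u (e i) = 0"
      using orthonormal_frame_extend_one[OF e] Suc.prems by auto
    have w: "?w k = 0" if "k < n" for k using True that by (rule ip_self_eq_0)
    have "ip n (v j) u = ip n (\<lambda>k. \<Sum>i<j. ip n (v j) (e i) * e i k) u"
      using w by (intro ip_cong) (auto simp: residual_def)
    also have "\<dots> = (\<Sum>i<j. ip n (v j) (e i) * ip n u (e i))"
      by (simp add: ip_sum_left ip_scale_left ip_commute[of n u])
    finally have "ip n (v j) u = 0" using u by simp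
    then show ?thesis using that u w by simp
  next
    case False
    then have q: "ip n ?w ?w > 0" using ip_self_nonneg[of n ?w] by linarith
    define s where "s = sqrt (ip n ?w ?w)"
    have s: "s > 0" "s * s = ip n ?w ?w" using q by (auto simp: s_def)
    define u where "u l = (1 / s) * ?w l" for l
    have uu: "ip n u u = 1"
      unfolding u_def[abs_def] ip_scale_left ip_scale_right s(2)[symmetric] using s(1) by simp
    have ue: "ip n u (e i) = 0" if "i < j" for i
      using ip_residual[OF e that] unfolding u_def[abs_def] ip_scale_left by simp
    have "ip n u (v j) = ip n u (\<lambda>k. ?w k + (\<Sum>i<j. ip n (v j) (e i) * e i k))"
      by (intro ip_cong) (auto simp: residual_def)
    also have "\<dots> = ip n u ?w + (\<Sum>i<j. ip n (v j) (e i) * ip n u (e i))"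
      by (simp add: ip_add_left ip_sum_left ip_scale_left ip_commute[of n u])
    also have "\<dots> = ip n u ?w" using ue by simp
    also have "\<dots> = s" unfolding u_def[abs_def] ip_scale_left s(2)[symmetric] using s(1) by simp
    finally have "ip n (v j) u = s" by (simp add: ip_commute)
    then have "?w k = ip n (v j) u * u k" for k using s by (simp add: u_def)
    then show ?thesis using that uu ue by blast
  qed
  let ?e = "e(j := u)"
  have "orthonormal_frame n (Suc j) ?e"
    unfolding orthonormal_frame_iff
  proof (intro allI impI)
    fix a b assume "a < Suc j" "b < Suc j"
    then show "ip n (?e a) (?e b) = (if a = b then 1 else 0)"
      using u e ip_commute[of n "e a" u] by (cases "a = j"; cases "b = j") (auto simp: orthonormal_frameD)
  qed
  moreover have "v l k = (\<Sum>i\<le>l. ip n (v l) (?e i) * ?e i k)" if l: "l < Suc j" "l < m" and k: "k < n" for l k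
  proof (cases "l = j")
    case True
    have "(\<Sum>i\<le>j. ip n (v j) (?e i) * ?e i k) = (\<Sum>i<j. ip n (v j) (e i) * e i k) + ip n (v j) u * u k"
      by (simp add: lessThan_Suc_atMost[symmetric])
    also have "\<dots> = v j k" using u(3)[OF k] by (simp add: residual_def)
    finally show ?thesis using True by simp
  next
    case False
    then have "(\<Sum>i\<le>l. ip n (v l) (?e i) * ?e i k) = (\<Sum>i\<le>l. ip n (v l) (e i) * e i k)"
      using l by (intro sum.cong) auto
    then show ?thesis using v[of l k] False l k by simp
  qed
  ultimately show ?case by blast
qed

lemma qr_frame:
  assumes "m \<le> n"
  obtains e where "orthonormal_frame n n e"
    "\<And>l k. l < m \<Longrightarrow> k < n \<Longrightarrow> v l k = (\<Sum>i\<le>l. ip n (v l) (e i) * e i k)"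
  using qr_frame_aux[of n n m v] assms by (metis less_le_trans order_refl)

section \<open>Gram determinants\<close>

definition gdet :: "nat \<Rightarrow> nat \<Rightarrow> (nat \<Rightarrow> nat \<Rightarrow> real) \<Rightarrow> real" where
  "gdet m n v = Determinant.det (Matrix.mat m m (\<lambda>(i, j). ip n (v i) (v j)))"

lemma gdet_cong: "(\<And>j k. j < m \<Longrightarrow> k < n \<Longrightarrow> v j k = w j k) \<Longrightarrow> gdet m n v = gdet m n w"
  unfolding gdet_def by (intro arg_cong[where f = Determinant.det] cong_mat) (auto intro!: ip_cong)

text \<open>A Gram matrix is transformed by congruence, so the determinant of \<open>L\<close>
  enters squared.\<close>

lemma gdet_linear:
  assumes v: "\<And>i k. i < m \<Longrightarrow> k < n \<Longrightarrow> v i k = (\<Sum>l<m. L i l * w l k)"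
  shows "gdet m n v = (Determinant.det (Matrix.mat m m (\<lambda>(i, j). L i j)))\<^sup>2 * gdet m n w"
proof -
  let ?L = "Matrix.mat m m (\<lambda>(i, j). L i j)" and ?W = "Matrix.mat m m (\<lambda>(i, j). ip n (w i) (w j))"
  have "Matrix.mat m m (\<lambda>(i, j). ip n (v i) (v j)) = ?L * ?W * transpose_mat ?L"
  proof (rule eq_matI)
    fix i j assume ij: "i < dim_row (?L * ?W * transpose_mat ?L)" "j < dim_col (?L * ?W * transpose_mat ?L)"
    then have ij: "i < m" "j < m" by auto
    have "ip n (v i) (v j) = ip n (\<lambda>k. \<Sum>l<m. L i l * w l k) (\<lambda>k. \<Sum>l<m. L j l * w l k)"
      using ij v by (intro ip_cong) auto
    also have "\<dots> = (\<Sum>b<m. (\<Sum>a<m. L i a * ip n (w a) (w b)) * L j b)"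
      by (simp add: ip_sum_left ip_sum_right ip_scale_left ip_scale_right sum_distrib_left sum_distrib_right mult_ac)
        (rule sum.swap)
    finally show "Matrix.mat m m (\<lambda>(i, j). ip n (v i) (v j)) $$ (i, j) = (?L * ?W * transpose_mat ?L) $$ (i, j)"
      using ij by (simp add: scalar_prod_def lessThan_atLeast0)
  qed auto
  then have "gdet m n v = Determinant.det (?L * ?W * transpose_mat ?L)" by (simp only: gdet_def)
  also have "\<dots> = Determinant.det (?L * ?W) * Determinant.det (transpose_mat ?L)"
    by (rule Determinant.det_mult[of _ m]) auto
  also have "Determinant.det (?L * ?W) = Determinant.det ?L * Determinant.det ?W"
    by (rule Determinant.det_mult[of _ m]) auto
  also have "Determinant.det (transpose_mat ?L) = Determinant.det ?L"
    by (rule Determinant.det_transpose[of _ m]) simp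
  finally show ?thesis by (simp add: gdet_def power2_eq_square)
qed

lemma det_triangular_mat:
  fixes L :: "nat \<Rightarrow> nat \<Rightarrow> real"
  assumes "(\<forall>i j. i < j \<longrightarrow> j < m \<longrightarrow> L i j = 0) \<or> (\<forall>i j. j < i \<longrightarrow> i < m \<longrightarrow> L i j = 0)"
  shows "Determinant.det (Matrix.mat m m (\<lambda>(i, j). L i j)) = (\<Prod>i<m. L i i)"
proof -
  let ?L = "Matrix.mat m m (\<lambda>(i, j). L i j)"
  have diag: "prod_list (diag_mat ?L) = (\<Prod>i<m. L i i)"
    by (simp add: prod_list_diag_prod lessThan_atLeast0)
  from assms show ?thesis
  proof
    assume "\<forall>i j. i < j \<longrightarrow> j < m \<longrightarrow> L i j = 0"
    then show ?thesis using det_lower_triangular[of m ?L] diag by auto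
  next
    assume "\<forall>i j. j < i \<longrightarrow> i < m \<longrightarrow> L i j = 0"
    then have "upper_triangular ?L" by auto
    then show ?thesis using det_upper_triangular[of ?L m] diag by auto
  qed
qed

lemma gdet_orthogonal:
  assumes "\<And>i j. i < m \<Longrightarrow> j < m \<Longrightarrow> i \<noteq> j \<Longrightarrow> ip n (v i) (v j) = 0"
  shows "gdet m n v = (\<Prod>i<m. ip n (v i) (v i))"
  unfolding gdet_def by (rule det_triangular_mat) (use assms in auto)

lemma gdet_triangular:
  assumes e: "orthonormal_frame n m e"
    and v: "\<And>l k. l < m \<Longrightarrow> k < n \<Longrightarrow> v l k = (\<Sum>i\<le>l. T l i * e i k)"
  shows "gdet m n v = (\<Prod>i<m. T i i)\<^sup>2"
proof -
  let ?L = "\<lambda>i j. if j \<le> i then T i j else 0"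
  have "gdet m n v = (Determinant.det (Matrix.mat m m (\<lambda>(i, j). ?L i j)))\<^sup>2 * gdet m n e"
  proof (rule gdet_linear)
    fix l k assume lk: "l < m" "k < n"
    have "(\<Sum>i<m. ?L l i * e i k) = (\<Sum>i\<le>l. ?L l i * e i k)"
      using lk by (intro sum.mono_neutral_right) auto
    then show "v l k = (\<Sum>i<m. ?L l i * e i k)" using v[OF lk] by simp
  qed
  also have "gdet m n e = 1" using e by (subst gdet_orthogonal) (auto simp: orthonormal_frameD)
  also have "Determinant.det (Matrix.mat m m (\<lambda>(i, j). ?L i j)) = (\<Prod>i<m. ?L i i)"
    by (rule det_triangular_mat) auto
  finally show ?thesis by simp
qed

text \<open>Base times height: only the part of \<open>y\<close> orthogonal to the first
  \<open>m\<close> frame vectors counts. There is no rank condition, since for dependent vectors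
  some diagonal entry of \<open>T\<close> is 0 and both sides vanish.\<close>

lemma gdet_height:
  assumes e: "orthonormal_frame n n e" and m: "m < n \<or> m = n"
    and v: "\<And>l k. l < m \<Longrightarrow> k < n \<Longrightarrow> v l k = (\<Sum>i\<le>l. T l i * e i k)"
  shows "gdet (Suc m) n (v(m := y)) = gdet m n v * (\<Sum>j\<in>{m..<n}. (ip n y (e j))\<^sup>2)"
proof -
  have em: "orthonormal_frame n m e" using e m by (auto intro: orthonormal_frame_mono)
  let ?w = "residual n m e y"
  let ?b = "e(m := ?w)"
  \<comment> \<open>The coordinates of the enlarged family in the basis formed by the first
    \<open>m\<close> frame vectors and \<open>?w\<close>. The matrix is triangular with last
    diagonal entry 1, so the height sits entirely in the norm of \<open>?w\<close>.\<close>
  let ?L = "\<lambda>i j. if i < m then (if j \<le> i then T i j else 0) else if j < m then ip n y (e j) else if j = m \<and> i = m then 1 else 0"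
  have "gdet (Suc m) n (v(m := y)) = (Determinant.det (Matrix.mat (Suc m) (Suc m) (\<lambda>(i, j). ?L i j)))\<^sup>2 * gdet (Suc m) n ?b"
  proof (rule gdet_linear)
    fix l k assume lk: "l < Suc m" "k < n"
    show "(v(m := y)) l k = (\<Sum>i<Suc m. ?L l i * ?b i k)"
    proof (cases "l = m")
      case True
      then show ?thesis by (simp add: residual_def)
    next
      case False
      then have l: "l < m" using lk by simp
      have "(\<Sum>i<Suc m. ?L l i * ?b i k) = (\<Sum>i\<le>l. ?L l i * ?b i k)"
        using l by (intro sum.mono_neutral_right) auto
      also have "\<dots> = (\<Sum>i\<le>l. T l i * e i k)" using l by (intro sum.cong) auto
      finally show ?thesis using v[OF l lk(2)] False by simp
    qed
  qed
  also have "Determinant.det (Matrix.mat (Suc m) (Suc m) (\<lambda>(i, j). ?L i j)) = (\<Prod>i<Suc m. ?L i i)"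
    by (rule det_triangular_mat) auto
  also have "\<dots> = (\<Prod>i<m. T i i)" by simp
  also have "gdet (Suc m) n ?b = (\<Prod>i<Suc m. ip n (?b i) (?b i))"
  proof (rule gdet_orthogonal)
    fix i j assume "i < Suc m" "j < Suc m" "i \<noteq> j"
    then show "ip n (?b i) (?b j) = 0"
      using ip_residual[OF em] em ip_commute[of n "e i" ?w] by (cases "i = m"; cases "j = m") (auto simp: orthonormal_frameD)
  qed
  also have "\<dots> = ip n ?w ?w" using em by (simp add: orthonormal_frameD)
  also have "\<dots> = (\<Sum>j\<in>{m..<n}. (ip n y (e j))\<^sup>2)"
  proof -
    have "{..<n} = {..<m} \<union> {m..<n}" using m by auto
    then have "(\<Sum>i<n. (ip n y (e i))\<^sup>2) = (\<Sum>i<m. (ip n y (e i))\<^sup>2) + (\<Sum>j\<in>{m..<n}. (ip n y (e j))\<^sup>2)"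
      by (simp add: sum.union_disjoint ivl_disj_int)
    then show ?thesis using norm_residual[OF em, of y] parseval[OF e, of y] by simp
  qed
  finally show ?thesis using gdet_triangular[OF em v] by (simp del: fun_upd_apply)
qed

lemma gdet_nonneg:
  assumes "m \<le> n"
  shows "gdet m n v \<ge> 0"
proof -
  obtain e where "orthonormal_frame n n e"
    "\<And>l k. l < m \<Longrightarrow> k < n \<Longrightarrow> v l k = (\<Sum>i\<le>l. ip n (v l) (e i) * e i k)"
    using qr_frame[OF assms] by metis
  then have "gdet m n v = (\<Prod>i<m. ip n (v i) (e i))\<^sup>2"
    using assms by (intro gdet_triangular[where e = e]) (auto intro: orthonormal_frame_mono)
  then show ?thesis by simp
qed

lemma gdet_scale: "gdet m n (\<lambda>j k. c * v j k) = (c ^ m)\<^sup>2 * gdet m n v"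
proof -
  let ?L = "\<lambda>i j. if i = j then c else 0"
  have "gdet m n (\<lambda>j k. c * v j k) = (Determinant.det (Matrix.mat m m (\<lambda>(i, j). ?L i j)))\<^sup>2 * gdet m n v"
    by (rule gdet_linear) (simp add: if_distrib[of "\<lambda>c. c * _"] cong: if_cong)
  also have "Determinant.det (Matrix.mat m m (\<lambda>(i, j). ?L i j)) = (\<Prod>i<m. ?L i i)"
    by (rule det_triangular_mat) auto
  finally show ?thesis by simp
qed

text \<open>Subtracting one vertex from all others is a unimodular operation. It relates the
  parallelotope of the points to the edges of the simplex together with one vertex.\<close>

lemma gdet_shift:
  assumes "\<And>j k. j < r \<Longrightarrow> k < n \<Longrightarrow> v j k = d j k + z k" and "\<And>k. k < n \<Longrightarrow> v r k = z k"
  shows "gdet (Suc r) n v = gdet (Suc r) n (d(r := z))"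
proof -
  let ?L = "\<lambda>i j. if i = j then 1 else if j = r then 1 else 0 :: real"
  have "gdet (Suc r) n v = (Determinant.det (Matrix.mat (Suc r) (Suc r) (\<lambda>(i, j). ?L i j)))\<^sup>2 * gdet (Suc r) n (d(r := z))"
  proof (rule gdet_linear)
    fix i k assume "i < Suc r" "k < n"
    then show "v i k = (\<Sum>l<Suc r. ?L i l * (d(r := z)) l k)"
      using assms by (cases "i = r") (auto simp: if_distrib[of "\<lambda>c. c * _"] cong: if_cong)
  qed
  also have "Determinant.det (Matrix.mat (Suc r) (Suc r) (\<lambda>(i, j). ?L i j)) = (\<Prod>i<Suc r. ?L i i)"
    by (rule det_triangular_mat) auto
  finally show ?thesis by (simp del: fun_upd_apply)
qed

section \<open>Lebesgue measure in variable dimension\<close>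

interpretation lborel_product: product_sigma_finite "\<lambda>_ :: nat. lborel :: real measure" ..

lemma sigma_finite_leb: "sigma_finite_measure (leb n)"
  by (rule lborel_product.sigma_finite) simp

interpretation leb_product: product_sigma_finite "\<lambda>_ :: nat. leb n"
  by (intro product_sigma_finite.intro sigma_finite_leb)

interpretation leb_leb: pair_sigma_finite "leb n" "leb m"
  by (intro pair_sigma_finite.intro sigma_finite_leb)

section \<open>Translations and dilations\<close>

text \<open>Each component contributes one factor \<open>c\<close>. The lemma serves two levels: the
  coordinates of one point, with \<open>M = lborel\<close>, and families of points, with
  \<open>M = leb n\<close>.\<close>

lemma nn_integral_PiM_map:
  fixes M :: "'a measure" and I :: "'i set" and T :: "'i \<Rightarrow> 'a \<Rightarrow> 'a" and c :: ennreal
  assumes M: "sigma_finite_measure M" and "finite I"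
    and T[measurable]: "\<And>i. i \<in> I \<Longrightarrow> T i \<in> measurable M M"
    and c: "\<And>i g. i \<in> I \<Longrightarrow> g \<in> borel_measurable M \<Longrightarrow> c * (\<integral>\<^sup>+y. g (T i y) \<partial>M) = (\<integral>\<^sup>+y. g y \<partial>M)"
    and "f \<in> borel_measurable (PiM I (\<lambda>_. M))"
  shows "c ^ card I * (\<integral>\<^sup>+x. f (\<lambda>i\<in>I. T i (x i)) \<partial>PiM I (\<lambda>_. M)) = (\<integral>\<^sup>+x. f x \<partial>PiM I (\<lambda>_. M))"
proof -
  interpret product_sigma_finite "\<lambda>_ :: 'i. M" by (intro product_sigma_finite.intro M)
  show ?thesis
    using \<open>finite I\<close> T c \<open>f \<in> borel_measurable (PiM I (\<lambda>_. M))\<close>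
  proof (induction I arbitrary: f rule: finite_induct)
    case empty
    have "(\<lambda>i\<in>{}. T i (x i)) = (\<lambda>_. undefined)" for x by auto
    then show ?case by (simp add: PiM_empty nn_integral_count_space_finite)
  next
    case (insert i I)
    note [measurable] = insert.prems(1,3)
    have Tm: "(\<lambda>x. \<lambda>j\<in>insert i I. T j (x j)) \<in> measurable (PiM (insert i I) (\<lambda>_. M)) (PiM (insert i I) (\<lambda>_. M))"
      using insert.prems(1) by (intro measurable_restrict measurable_compose[OF measurable_component_singleton]) auto
    have TI: "(\<lambda>x. \<lambda>j\<in>I. T j (x j)) \<in> measurable (PiM I (\<lambda>_. M)) (PiM I (\<lambda>_. M))"
      using insert.prems(1) by (intro measurable_restrict measurable_compose[OF measurable_component_singleton]) auto
    define F where "F x = (\<integral>\<^sup>+y. f (x(i := y)) \<partial>M)" for x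
    have Fm: "F \<in> borel_measurable (PiM I (\<lambda>_. M))"
      unfolding F_def using insert.hyps by measurable
    have upd: "(\<lambda>j\<in>insert i I. T j ((x(i := y)) j)) = (\<lambda>j\<in>I. T j (x j))(i := T i y)" for x y
      using insert.hyps by (auto simp: fun_eq_iff restrict_def)
    have inner: "c * (\<integral>\<^sup>+y. f ((\<lambda>j\<in>I. T j (x j))(i := T i y)) \<partial>M) = F (\<lambda>j\<in>I. T j (x j))"
      if "x \<in> space (PiM I (\<lambda>_. M))" for x
      unfolding F_def
    proof (rule insert.prems(2))
      have "(\<lambda>j\<in>I. T j (x j)) \<in> space (PiM I (\<lambda>_. M))" using measurable_space[OF TI that] .
      then show "(\<lambda>y. f ((\<lambda>j\<in>I. T j (x j))(i := y))) \<in> borel_measurable M"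
        by (rule measurable_compose[OF measurable_component_update insert.prems(3)]) (rule insert.hyps)
    qed simp
    have Fm': "(\<lambda>x. \<integral>\<^sup>+y. f ((\<lambda>j\<in>I. T j (x j))(i := T i y)) \<partial>M) \<in> borel_measurable (PiM I (\<lambda>_. M))"
    proof -
      have "(\<lambda>p. f (\<lambda>j\<in>insert i I. T j (((fst p)(i := snd p)) j))) \<in> borel_measurable (PiM I (\<lambda>_. M) \<Otimes>\<^sub>M M)"
        by (rule measurable_compose[OF _ measurable_compose[OF Tm insert.prems(3)]]) measurable
      then show ?thesis unfolding upd
        by (intro sigma_finite_measure.borel_measurable_nn_integral M) (simp add: case_prod_beta')
    qed
    have "c ^ card (insert i I) * (\<integral>\<^sup>+x. f (\<lambda>j\<in>insert i I. T j (x j)) \<partial>PiM (insert i I) (\<lambda>_. M))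
       = c ^ card I * (c * (\<integral>\<^sup>+x. \<integral>\<^sup>+y. f ((\<lambda>j\<in>I. T j (x j))(i := T i y)) \<partial>M \<partial>PiM I (\<lambda>_. M)))"
      using insert.hyps by (subst product_nn_integral_insert[OF _ _ measurable_compose[OF Tm insert.prems(3)]])
        (simp_all add: upd mult_ac del: fun_upd_apply)
    also have "c * (\<integral>\<^sup>+x. \<integral>\<^sup>+y. f ((\<lambda>j\<in>I. T j (x j))(i := T i y)) \<partial>M \<partial>PiM I (\<lambda>_. M))
       = (\<integral>\<^sup>+x. F (\<lambda>j\<in>I. T j (x j)) \<partial>PiM I (\<lambda>_. M))"
      by (subst nn_integral_cmult[symmetric, OF Fm']) (auto intro!: nn_integral_cong inner)
    also have "c ^ card I * \<dots> = (\<integral>\<^sup>+x. F x \<partial>PiM I (\<lambda>_. M))"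
      using insert.prems(1,2) by (intro insert.IH Fm) auto
    also have "\<dots> = (\<integral>\<^sup>+x. f x \<partial>PiM (insert i I) (\<lambda>_. M))"
      unfolding F_def using insert.hyps insert.prems(3) by (intro product_nn_integral_insert[symmetric]) auto
    finally show ?case .
  qed
qed

lemma nn_integral_lborel_shift:
  fixes f :: "(nat \<Rightarrow> real) \<Rightarrow> ennreal"
  assumes "finite A" "f \<in> borel_measurable (PiM A (\<lambda>_. lborel))"
  shows "(\<integral>\<^sup>+x. f (\<lambda>k\<in>A. x k + a k) \<partial>PiM A (\<lambda>_. lborel)) = (\<integral>\<^sup>+x. f x \<partial>PiM A (\<lambda>_. lborel))"
proof -
  have "1 ^ card A * (\<integral>\<^sup>+x. f (\<lambda>k\<in>A. (\<lambda>k y. y + a k) k (x k)) \<partial>PiM A (\<lambda>_. lborel)) = (\<integral>\<^sup>+x. f x \<partial>PiM A (\<lambda>_. lborel))"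
  proof (rule nn_integral_PiM_map)
    fix k and g :: "real \<Rightarrow> ennreal" assume "g \<in> borel_measurable lborel"
    then show "1 * (\<integral>\<^sup>+y. g (y + a k) \<partial>lborel) = (\<integral>\<^sup>+y. g y \<partial>lborel)"
      using nn_integral_real_affine[of g 1 "a k"] by (simp add: add.commute)
  qed (use assms in \<open>auto simp: lborel.sigma_finite_measure_axioms\<close>)
  then show ?thesis by simp
qed

lemma nn_integral_lborel_scale:
  fixes f :: "(nat \<Rightarrow> real) \<Rightarrow> ennreal" and c :: real
  assumes "finite A" "f \<in> borel_measurable (PiM A (\<lambda>_. lborel))" "c > 0"
  shows "ennreal (c ^ card A) * (\<integral>\<^sup>+x. f (\<lambda>k\<in>A. c * x k) \<partial>PiM A (\<lambda>_. lborel)) = (\<integral>\<^sup>+x. f x \<partial>PiM A (\<lambda>_. lborel))"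
proof -
  have "ennreal c ^ card A * (\<integral>\<^sup>+x. f (\<lambda>k\<in>A. (\<lambda>k y. c * y) k (x k)) \<partial>PiM A (\<lambda>_. lborel)) = (\<integral>\<^sup>+x. f x \<partial>PiM A (\<lambda>_. lborel))"
  proof (rule nn_integral_PiM_map)
    fix k :: nat and g :: "real \<Rightarrow> ennreal" assume "g \<in> borel_measurable lborel"
    then show "ennreal c * (\<integral>\<^sup>+y. g (c * y) \<partial>lborel) = (\<integral>\<^sup>+y. g y \<partial>lborel)"
      using nn_integral_real_affine[of g c 0] assms by simp
  qed (use assms in \<open>auto simp: lborel.sigma_finite_measure_axioms\<close>)
  then show ?thesis using assms by (simp add: ennreal_power)
qed

lemma leb_affine_measurable [measurable]:
  "(\<lambda>x. \<lambda>k\<in>{..<n}. x k + a k) \<in> measurable (leb n) (leb n)"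
  "(\<lambda>x. \<lambda>k\<in>{..<n}. (c::real) * x k) \<in> measurable (leb n) (leb n)"
  by (intro measurable_restrict; measurable)+

lemma nn_integral_block_shift:
  fixes f :: "(nat \<Rightarrow> nat \<Rightarrow> real) \<Rightarrow> ennreal"
  assumes "finite I" "f \<in> borel_measurable (PiM I (\<lambda>_. leb n))"
  shows "(\<integral>\<^sup>+x. f (\<lambda>i\<in>I. \<lambda>k\<in>{..<n}. x i k + a k) \<partial>PiM I (\<lambda>_. leb n)) = (\<integral>\<^sup>+x. f x \<partial>PiM I (\<lambda>_. leb n))"
proof -
  have "1 ^ card I * (\<integral>\<^sup>+x. f (\<lambda>i\<in>I. (\<lambda>i x. \<lambda>k\<in>{..<n}. x k + a k) i (x i)) \<partial>PiM I (\<lambda>_. leb n)) = (\<integral>\<^sup>+x. f x \<partial>PiM I (\<lambda>_. leb n))"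
  proof (rule nn_integral_PiM_map)
    fix i :: nat and g :: "(nat \<Rightarrow> real) \<Rightarrow> ennreal" assume "g \<in> borel_measurable (leb n)"
    then show "1 * (\<integral>\<^sup>+y. g (\<lambda>k\<in>{..<n}. y k + a k) \<partial>leb n) = (\<integral>\<^sup>+y. g y \<partial>leb n)"
      using nn_integral_lborel_shift[of "{..<n}" g a] by simp
  qed (use assms in \<open>simp_all add: sigma_finite_leb leb_affine_measurable del: restrict_apply\<close>)
  then show ?thesis by simp
qed

lemma nn_integral_block_scale:
  fixes f :: "(nat \<Rightarrow> nat \<Rightarrow> real) \<Rightarrow> ennreal" and c :: real
  assumes "finite I" "f \<in> borel_measurable (PiM I (\<lambda>_. leb n))" "c > 0"
  shows "ennreal (c ^ (n * card I)) * (\<integral>\<^sup>+x. f (\<lambda>i\<in>I. \<lambda>k\<in>{..<n}. c * x i k) \<partial>PiM I (\<lambda>_. leb n)) = (\<integral>\<^sup>+x. f x \<partial>PiM I (\<lambda>_. leb n))"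
proof -
  have "ennreal (c ^ n) ^ card I * (\<integral>\<^sup>+x. f (\<lambda>i\<in>I. (\<lambda>i x. \<lambda>k\<in>{..<n}. c * x k) i (x i)) \<partial>PiM I (\<lambda>_. leb n)) = (\<integral>\<^sup>+x. f x \<partial>PiM I (\<lambda>_. leb n))"
  proof (rule nn_integral_PiM_map)
    fix i :: nat and g :: "(nat \<Rightarrow> real) \<Rightarrow> ennreal" assume "g \<in> borel_measurable (leb n)"
    then show "ennreal (c ^ n) * (\<integral>\<^sup>+y. g (\<lambda>k\<in>{..<n}. c * y k) \<partial>leb n) = (\<integral>\<^sup>+y. g y \<partial>leb n)"
      using nn_integral_lborel_scale[of "{..<n}" g c] assms by simp
  qed (use assms in \<open>simp_all add: sigma_finite_leb leb_affine_measurable del: restrict_apply\<close>)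
  then show ?thesis using assms by (simp add: ennreal_power power_mult)
qed

section \<open>Rotation invariance\<close>

definition rot :: "nat \<Rightarrow> (nat \<Rightarrow> nat \<Rightarrow> real) \<Rightarrow> (nat \<Rightarrow> real) \<Rightarrow> nat \<Rightarrow> real" where
  "rot n e x = (\<lambda>k\<in>{..<n}. \<Sum>j<n. x j * e j k)"

lemma rot_measurable [measurable]: "rot n e \<in> measurable (leb n) (leb n)"
  unfolding rot_def[abs_def] by (intro measurable_restrict) measurable

lemma ip_rot:
  assumes "orthonormal_frame n n e" "j < n"
  shows "ip n (rot n e x) (e j) = x j"
proof -
  have "ip n (rot n e x) (e j) = ip n (\<lambda>k. \<Sum>i<n. x i * e i k) (e j)"
    by (intro ip_cong) (auto simp: rot_def)
  also have "\<dots> = (\<Sum>i<n. x i * ip n (e i) (e j))" by (simp add: ip_sum_left ip_scale_left)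
  also have "\<dots> = (\<Sum>i<n. if i = j then x i else 0)"
    using assms by (intro sum.cong) (auto simp: orthonormal_frameD)
  finally show ?thesis using assms by simp
qed

lemma ip_rot_self:
  assumes "orthonormal_frame n n e"
  shows "ip n (rot n e x) (rot n e x) = ip n x x"
proof -
  have "ip n (rot n e x) (rot n e x) = (\<Sum>i<n. (ip n (rot n e x) (e i))\<^sup>2)"
    using assms by (rule parseval)
  also have "\<dots> = (\<Sum>i<n. (x i)\<^sup>2)" using assms by (intro sum.cong) (auto simp: ip_rot)
  finally show ?thesis by (simp add: ip_def power2_eq_square)
qed

lemma measurable_ip [measurable]:
  assumes [measurable]: "\<And>k. k < n \<Longrightarrow> (\<lambda>x. f x k) \<in> borel_measurable M" "\<And>k. k < n \<Longrightarrow> (\<lambda>x. g x k) \<in> borel_measurable M"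
  shows "(\<lambda>x. ip n (f x) (g x)) \<in> borel_measurable M"
  unfolding ip_def by (intro borel_measurable_sum borel_measurable_times) auto

lemma emeasure_leb_unit_ball:
  "emeasure (leb n) {x \<in> space (leb n). ip n x x \<le> 1} = ennreal (unit_ball_vol (real n))"
proof -
  have "{x \<in> space (leb n). ip n x x \<le> 1} = {f. sqrt (\<Sum>i\<in>{..<n}. (f i)\<^sup>2) \<le> 1} \<inter> space (leb n)"
    by (auto simp: ip_def power2_eq_square)
  then show ?thesis using emeasure_cball_aux[of "{..<n}" 1] by simp
qed

definition vadd :: "nat \<Rightarrow> (nat \<Rightarrow> real) \<Rightarrow> (nat \<Rightarrow> real) \<Rightarrow> nat \<Rightarrow> real" where
  "vadd n x y = (\<lambda>k\<in>{..<n}. x k + y k)"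

lemma vadd_measurable:
  assumes "\<And>k. k < n \<Longrightarrow> (\<lambda>p. F p k) \<in> borel_measurable N" "\<And>k. k < n \<Longrightarrow> (\<lambda>p. G p k) \<in> borel_measurable N"
  shows "(\<lambda>p. vadd n (F p) (G p)) \<in> measurable N (leb n)"
  unfolding vadd_def using assms by (intro measurable_restrict) auto

lemma leb_component_measurable:
  assumes "F \<in> measurable N (leb n)" "k < n"
  shows "(\<lambda>p. F p k) \<in> borel_measurable N"
proof -
  have "(\<lambda>x. x k) \<in> measurable (leb n) (lborel :: real measure)"
    using assms by (intro measurable_component_singleton) auto
  from measurable_compose[OF assms(1) this] show ?thesis by simp
qed

lemma vadd_in_space [simp]: "vadd n x y \<in> space (leb n)"
  by (auto simp: vadd_def space_PiM)

lemma rot_in_space [simp]: "rot n e x \<in> space (leb n)"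
  by (auto simp: rot_def space_PiM)

text \<open>The classical proof of uniqueness of translation invariant measures, comparing the
  image of Lebesgue measure with Lebesgue measure through the unit ball.\<close>

lemma nn_integral_leb_rot:
  assumes e: "orthonormal_frame n n e" and f[measurable]: "f \<in> borel_measurable (leb n)"
  shows "(\<integral>\<^sup>+x. f (rot n e x) \<partial>leb n) = (\<integral>\<^sup>+x. f x \<partial>leb n)"
proof -
  define B where "B = {x \<in> space (leb n). ip n x x \<le> 1}"
  have [measurable]: "B \<in> sets (leb n)" unfolding B_def by measurable
  define g where "g x = (indicator B x :: ennreal)" for x
  have g[measurable]: "g \<in> borel_measurable (leb n)" unfolding g_def by measurable
  define c where "c = (\<integral>\<^sup>+x. g x \<partial>leb n)"
  have c: "c = ennreal (unit_ball_vol (real n))"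
    unfolding c_def g_def using emeasure_leb_unit_ball[of n] by (simp add: B_def)
  have c0: "c \<noteq> 0" "c \<noteq> \<infinity>" unfolding c using unit_ball_vol_pos[of "real n"] by (simp_all add: order_less_imp_not_eq2 del: unit_ball_vol_pos)
  let ?Q = "rot n e"
  let ?L = "leb n \<Otimes>\<^sub>M leb n"
  have shift: "(\<integral>\<^sup>+x. h (vadd n x a) \<partial>leb n) = (\<integral>\<^sup>+x. h x \<partial>leb n)"
    if "h \<in> borel_measurable (leb n)" for h :: "(nat \<Rightarrow> real) \<Rightarrow> ennreal" and a
    unfolding vadd_def using that by (intro nn_integral_lborel_shift) auto
  have shiftQ: "(\<integral>\<^sup>+x. h (?Q (vadd n x a)) \<partial>leb n) = (\<integral>\<^sup>+x. h (?Q x) \<partial>leb n)"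
    if "h \<in> borel_measurable (leb n)" for h :: "(nat \<Rightarrow> real) \<Rightarrow> ennreal" and a
    by (rule shift[OF measurable_compose[OF rot_measurable that]])
  have Q_add: "vadd n (?Q x) y = ?Q (vadd n x (\<lambda>j. ip n y (e j)))" for x y
  proof
    fix k
    show "vadd n (?Q x) y k = ?Q (vadd n x (\<lambda>j. ip n y (e j))) k"
      using orthonormal_basis_expansion[OF e, of k y]
      by (auto simp: vadd_def rot_def distrib_right sum.distrib)
  qed
  \<comment> \<open>The ball is symmetric, so \<open>y - ?Q x\<close> may be replaced by its
    negative, which is \<open>?Q\<close> applied to a translate of \<open>x\<close>.\<close>
  have Q_diff: "g (vadd n y (\<lambda>k. - ?Q x k)) = g (?Q (vadd n x (\<lambda>j. - ip n y (e j))))" for x y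
  proof -
    have "vadd n y (\<lambda>k. - ?Q x k) k = - ?Q (vadd n x (\<lambda>j. - ip n y (e j))) k" if "k < n" for k
      using orthonormal_basis_expansion[OF e that, of y] that
      by (auto simp: vadd_def rot_def left_diff_distrib sum_subtractf)
    then have "ip n (vadd n y (\<lambda>k. - ?Q x k)) (vadd n y (\<lambda>k. - ?Q x k)) =
        ip n (?Q (vadd n x (\<lambda>j. - ip n y (e j)))) (?Q (vadd n x (\<lambda>j. - ip n y (e j))))"
      by (simp add: ip_def)
    then show ?thesis by (simp add: g_def B_def indicator_def)
  qed
  have gQ: "(\<integral>\<^sup>+x. g (?Q x) \<partial>leb n) = c"
    unfolding c_def g_def B_def by (intro nn_integral_cong) (auto simp: indicator_def ip_rot_self[OF e])
  have comp: "(\<lambda>p. fst p k) \<in> borel_measurable ?L" "(\<lambda>p. snd p k) \<in> borel_measurable ?L"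
    "(\<lambda>p. ?Q (fst p) k) \<in> borel_measurable ?L" if "k < n" for k
    using that by (intro leb_component_measurable[of _ _ n]; measurable)+
  have M1: "(\<lambda>(x, y). f (?Q x) * g y) \<in> borel_measurable ?L"
    by measurable
  have M2: "(\<lambda>(x, y). f (vadd n (?Q x) y) * g y) \<in> borel_measurable ?L"
    unfolding case_prod_beta'
    by (intro borel_measurable_times_ennreal measurable_compose[OF vadd_measurable f] measurable_compose[OF measurable_snd g] comp)
  have M3: "(\<lambda>(x, y). f y * g (?Q (vadd n x (\<lambda>j. - ip n y (e j))))) \<in> borel_measurable ?L"
    unfolding case_prod_beta'
    by (intro borel_measurable_times_ennreal measurable_compose[OF measurable_snd f]
        measurable_compose[OF measurable_compose[OF vadd_measurable rot_measurable] g] comp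
        borel_measurable_uminus measurable_ip borel_measurable_const)
  \<comment> \<open>Multiplied by \<open>c\<close>, the integral becomes a double integral. A
    translation of \<open>x\<close> turns \<open>f (?Q x)\<close> into \<open>f (?Q x + y)\<close>,
    a translation of \<open>y\<close> then moves the shift into the argument of \<open>g\<close>,
    and integrating \<open>g\<close> over \<open>x\<close> gives \<open>c\<close> once more.\<close>
  have "(\<integral>\<^sup>+x. f (?Q x) \<partial>leb n) * c = (\<integral>\<^sup>+x. (\<integral>\<^sup>+y. f (?Q x) * g y \<partial>leb n) \<partial>leb n)"
    unfolding c_def by (subst nn_integral_multc[symmetric]) (auto intro!: nn_integral_cong nn_integral_cmult[symmetric])
  also have "\<dots> = (\<integral>\<^sup>+y. (\<integral>\<^sup>+x. f (?Q x) * g y \<partial>leb n) \<partial>leb n)"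
    by (rule leb_leb.Fubini'[symmetric, OF M1])
  also have "\<dots> = (\<integral>\<^sup>+y. (\<integral>\<^sup>+x. f (vadd n (?Q x) y) * g y \<partial>leb n) \<partial>leb n)"
  proof (rule nn_integral_cong)
    fix y
    have m: "(\<lambda>x. f (?Q (vadd n x (\<lambda>j. ip n y (e j))))) \<in> borel_measurable (leb n)"
      by (intro measurable_compose[OF measurable_compose[OF vadd_measurable rot_measurable] f]
         leb_component_measurable[of _ _ n] borel_measurable_const) auto
    show "(\<integral>\<^sup>+x. f (?Q x) * g y \<partial>leb n) = (\<integral>\<^sup>+x. f (vadd n (?Q x) y) * g y \<partial>leb n)"
      unfolding Q_add nn_integral_multc[OF m] shiftQ[OF f] by (rule nn_integral_multc) measurable
  qed
  also have "\<dots> = (\<integral>\<^sup>+x. (\<integral>\<^sup>+y. f (vadd n (?Q x) y) * g y \<partial>leb n) \<partial>leb n)"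
    by (rule leb_leb.Fubini'[OF M2])
  also have "\<dots> = (\<integral>\<^sup>+x. (\<integral>\<^sup>+y. f y * g (vadd n y (\<lambda>k. - ?Q x k)) \<partial>leb n) \<partial>leb n)"
  proof (rule nn_integral_cong)
    fix x
    have m: "(\<lambda>y. f y * g (vadd n y (\<lambda>k. - ?Q x k))) \<in> borel_measurable (leb n)"
      by (intro borel_measurable_times_ennreal f measurable_compose[OF vadd_measurable g]
         leb_component_measurable[of _ _ n] borel_measurable_const) auto
    have "(\<integral>\<^sup>+y. f y * g (vadd n y (\<lambda>k. - ?Q x k)) \<partial>leb n) = (\<integral>\<^sup>+y. f (vadd n y (?Q x)) * g (vadd n (vadd n y (?Q x)) (\<lambda>k. - ?Q x k)) \<partial>leb n)"
      by (rule shift[OF m, symmetric])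
    also have "\<dots> = (\<integral>\<^sup>+y. f (vadd n (?Q x) y) * g y \<partial>leb n)"
    proof (rule nn_integral_cong)
      fix y assume y: "y \<in> space (leb n)"
      have "vadd n (vadd n y (?Q x)) (\<lambda>k. - ?Q x k) = y"
        using y by (auto simp: vadd_def space_PiM PiE_def extensional_def fun_eq_iff)
      moreover have "vadd n y (?Q x) = vadd n (?Q x) y" by (simp add: vadd_def add.commute)
      ultimately show "f (vadd n y (?Q x)) * g (vadd n (vadd n y (?Q x)) (\<lambda>k. - ?Q x k)) = f (vadd n (?Q x) y) * g y" by simp
    qed
    finally show "(\<integral>\<^sup>+y. f (vadd n (?Q x) y) * g y \<partial>leb n) = (\<integral>\<^sup>+y. f y * g (vadd n y (\<lambda>k. - ?Q x k)) \<partial>leb n)" ..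
  qed
  also have "\<dots> = (\<integral>\<^sup>+x. (\<integral>\<^sup>+y. f y * g (?Q (vadd n x (\<lambda>j. - ip n y (e j)))) \<partial>leb n) \<partial>leb n)"
    unfolding Q_diff ..
  also have "\<dots> = (\<integral>\<^sup>+y. (\<integral>\<^sup>+x. f y * g (?Q (vadd n x (\<lambda>j. - ip n y (e j)))) \<partial>leb n) \<partial>leb n)"
    by (rule leb_leb.Fubini'[symmetric, OF M3])
  also have "\<dots> = (\<integral>\<^sup>+y. f y * c \<partial>leb n)"
  proof (rule nn_integral_cong)
    fix y
    have m: "(\<lambda>x. g (?Q (vadd n x (\<lambda>j. - ip n y (e j))))) \<in> borel_measurable (leb n)"
      by (intro measurable_compose[OF measurable_compose[OF vadd_measurable rot_measurable] g]
         leb_component_measurable[of _ _ n] borel_measurable_const) auto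
    show "(\<integral>\<^sup>+x. f y * g (?Q (vadd n x (\<lambda>j. - ip n y (e j)))) \<partial>leb n) = f y * c"
      unfolding nn_integral_cmult[OF m] shiftQ[OF g] gQ ..
  qed
  also have "\<dots> = (\<integral>\<^sup>+y. f y \<partial>leb n) * c" by (rule nn_integral_multc) measurable
  finally show ?thesis using c0 by (simp add: mult.commute[of _ c] ennreal_mult_cancel_left)
qed

lemma nn_integral_leb_split:
  assumes r: "r \<le> n" and f: "f \<in> borel_measurable (leb n)"
  shows "(\<integral>\<^sup>+x. f x \<partial>leb n) = (\<integral>\<^sup>+h. (\<integral>\<^sup>+u. f (merge {r..<n} {..<r} (h, u)) \<partial>leb r) \<partial>PiM {r..<n} (\<lambda>_. lborel))"
proof -
  have "{r..<n} \<union> {..<r} = {..<n}" "{r..<n} \<inter> {..<r} = {}" using r by auto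
  then show ?thesis
    using lborel_product.product_nn_integral_fold[of "{r..<n}" "{..<r}" f] f by simp
qed

section \<open>Radial integration\<close>

text \<open>The density of the squared norm in dimension \<open>k\<close>: the derivative of the
  volume of the ball of radius \<open>sqrt q\<close>.\<close>

definition radial_density :: "nat \<Rightarrow> real \<Rightarrow> real" where
  "radial_density k q = (if q > 0 then unit_ball_vol (real k) * (real k / 2) * q powr (real k / 2 - 1) else 0)"

lemma radial_density_measurable [measurable]: "radial_density k \<in> borel_measurable borel"
  unfolding radial_density_def[abs_def] by measurable

lemma emeasure_radial_density:
  assumes "k > 0"
  shows "emeasure (density lborel (\<lambda>q. ennreal (radial_density k q))) {..q} =
    (if q > 0 then ennreal (unit_ball_vol (real k) * q powr (real k / 2)) else 0)"
proof (cases "q > 0")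
  case True
  let ?C = "unit_ball_vol (real k) * (real k / 2)"
  let ?f = "\<lambda>x. if x \<in> {0..q} then ?C * x powr (real k / 2 - 1) else 0"
  have "((\<lambda>x. x powr (real k / 2 - 1)) has_integral (q powr (real k / 2 - 1 + 1) / (real k / 2 - 1 + 1))) {0..q}"
    using assms True by (intro has_integral_powr_from_0) auto
  then have "((\<lambda>x. ?C * x powr (real k / 2 - 1)) has_integral (?C * (q powr (real k / 2) / (real k / 2)))) {0..q}"
    by (intro has_integral_mult_right) simp
  then have "(?f has_integral (?C * (q powr (real k / 2) / (real k / 2)))) UNIV"
    by (simp only: has_integral_restrict_UNIV)
  then have "integral\<^sup>N lborel ?f = ennreal (?C * (q powr (real k / 2) / (real k / 2)))"
    by (intro nn_integral_has_integral_lborel) (auto intro!: mult_nonneg_nonneg)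
  also have "?C * (q powr (real k / 2) / (real k / 2)) = unit_ball_vol (real k) * q powr (real k / 2)"
    using assms by simp
  finally have *: "integral\<^sup>N lborel ?f = ennreal (unit_ball_vol (real k) * q powr (real k / 2))" .
  have "emeasure (density lborel (\<lambda>q. ennreal (radial_density k q))) {..q} = (\<integral>\<^sup>+x. ennreal (radial_density k x) * indicator {..q} x \<partial>lborel)"
    by (subst emeasure_density) auto
  also have "\<dots> = integral\<^sup>N lborel ?f"
    by (intro nn_integral_cong) (auto simp: radial_density_def indicator_def)
  finally show ?thesis using * True by simp
next
  case False
  have "emeasure (density lborel (\<lambda>q. ennreal (radial_density k q))) {..q} = (\<integral>\<^sup>+x. ennreal (radial_density k x) * indicator {..q} x \<partial>lborel)"
    by (subst emeasure_density) auto
  also have "\<dots> = (\<integral>\<^sup>+x. 0 \<partial>(lborel :: real measure))"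
    using False by (intro nn_integral_cong) (auto simp: radial_density_def indicator_def)
  finally show ?thesis using False by simp
qed

lemma emeasure_sum_squares_le:
  fixes A :: "nat set"
  assumes A: "finite A" "A \<noteq> {}"
  shows "emeasure (PiM A (\<lambda>_. lborel)) {x \<in> space (PiM A (\<lambda>_. lborel)). (\<Sum>i\<in>A. (x i)\<^sup>2) \<le> q} =
    (if q > 0 then ennreal (unit_ball_vol (real (card A)) * q powr (real (card A) / 2)) else 0)"
proof -
  let ?P = "PiM A (\<lambda>_. lborel :: real measure)"
  let ?S = "\<lambda>q. {x \<in> space ?P. (\<Sum>i\<in>A. (x i)\<^sup>2) \<le> q}"
  have pos: "emeasure ?P (?S q) = ennreal (unit_ball_vol (real (card A)) * q powr (real (card A) / 2))" if q: "q > 0" for q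
  proof -
    have "?S q = {f. sqrt (\<Sum>i\<in>A. (f i)\<^sup>2) \<le> sqrt q} \<inter> space ?P" by auto
    then have "emeasure ?P (?S q) = ennreal (unit_ball_vol (real (card A)) * sqrt q ^ card A)"
      using emeasure_cball_aux[OF A(1), of "sqrt q"] q by simp
    also have "sqrt q ^ card A = (q powr (1 / 2)) powr real (card A)"
      using q by (simp add: powr_half_sqrt powr_realpow)
    also have "\<dots> = q powr (real (card A) / 2)" by (simp add: powr_powr)
    finally show ?thesis .
  qed
  show ?thesis
  proof (cases "q > 0")
    case False
    have k: "real (card A) / 2 > 0" using A by (simp add: card_gt_0_iff)
    \<comment> \<open>For \<open>q \<le> 0\<close> the set is contained in every ball of radius
      \<open>sqrt \<epsilon>\<close>, whose volume tends to 0.\<close>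
    have "((\<lambda>\<epsilon>. ennreal (unit_ball_vol (real (card A)) * \<epsilon> powr (real (card A) / 2))) \<longlongrightarrow> ennreal (unit_ball_vol (real (card A)) * 0)) (at_right 0)"
    proof (intro tendsto_ennrealI tendsto_mult tendsto_const)
      show "((\<lambda>\<epsilon>. \<epsilon> powr (real (card A) / 2)) \<longlongrightarrow> 0) (at_right 0)"
        using k by (auto intro!: tendsto_eq_intros filterlim_at_withinI simp: eventually_at_right_less eventually_at_filter)
    qed
    moreover have "\<forall>\<^sub>F \<epsilon> in at_right 0. emeasure ?P (?S q) \<le> ennreal (unit_ball_vol (real (card A)) * \<epsilon> powr (real (card A) / 2))"
      using eventually_at_right_less[of 0]
    proof eventually_elim
      case (elim \<epsilon>)
      have "emeasure ?P (?S q) \<le> emeasure ?P (?S \<epsilon>)" using False elim by (intro emeasure_mono) auto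
      then show ?case using pos[OF elim] by simp
    qed
    ultimately have "emeasure ?P (?S q) \<le> 0"
      by (intro tendsto_lowerbound[of "\<lambda>\<epsilon>. ennreal (unit_ball_vol (real (card A)) * \<epsilon> powr (real (card A) / 2))" _ "at_right 0"]) (auto simp: trivial_limit_at_right_real)
    then show ?thesis using False by simp
  qed (simp add: pos)
qed

lemma nn_integral_radial:
  fixes A :: "nat set"
  assumes A: "finite A" "A \<noteq> {}" and \<phi>[measurable]: "\<phi> \<in> borel_measurable borel"
  shows "(\<integral>\<^sup>+x. \<phi> (\<Sum>i\<in>A. (x i)\<^sup>2) \<partial>PiM A (\<lambda>_. lborel)) = (\<integral>\<^sup>+q. ennreal (radial_density (card A) q) * \<phi> q \<partial>lborel)"
proof -
  let ?P = "PiM A (\<lambda>_. lborel :: real measure)"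
  have [measurable]: "(\<lambda>x. \<Sum>i\<in>A. (x i)\<^sup>2) \<in> borel_measurable ?P" by measurable
  have k: "card A > 0" using A by (simp add: card_gt_0_iff)
  have E: "emeasure (distr ?P borel (\<lambda>x. \<Sum>i\<in>A. (x i)\<^sup>2)) {..q} =
    (if q > 0 then ennreal (unit_ball_vol (real (card A)) * q powr (real (card A) / 2)) else 0)" for q
    using emeasure_sum_squares_le[OF A, of q]
    by (subst emeasure_distr) (auto simp: vimage_def Int_def conj_commute)
  have "distr ?P borel (\<lambda>x. \<Sum>i\<in>A. (x i)\<^sup>2) = density lborel (\<lambda>q. ennreal (radial_density (card A) q))"
  proof (rule measure_eqI_generator_eq[where E = "range (\<lambda>a::real. {..a})" and \<Omega> = UNIV and A = "\<lambda>i. {..real i}"])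
    show "Int_stable (range (\<lambda>a::real. {..a}))" by (auto simp: Int_stable_def)
    show "sets (distr ?P borel (\<lambda>x. \<Sum>i\<in>A. (x i)\<^sup>2)) = sigma_sets UNIV (range (\<lambda>a::real. {..a}))"
      by (simp add: borel_eq_atMost)
    show "sets (density lborel (\<lambda>q. ennreal (radial_density (card A) q))) = sigma_sets UNIV (range (\<lambda>a::real. {..a}))"
      by (simp add: borel_eq_atMost)
    show "emeasure (distr ?P borel (\<lambda>x. \<Sum>i\<in>A. (x i)\<^sup>2)) X = emeasure (density lborel (\<lambda>q. ennreal (radial_density (card A) q))) X"
      if "X \<in> range (\<lambda>a::real. {..a})" for X
      using that E emeasure_radial_density[OF k] by auto
    show "(\<Union>i. {..real i}) = UNIV" using real_arch_simple by auto
    show "emeasure (distr ?P borel (\<lambda>x. \<Sum>i\<in>A. (x i)\<^sup>2)) {..real i} \<noteq> \<infinity>" for i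
      unfolding E by auto
  qed auto
  then have "(\<integral>\<^sup>+q. \<phi> q \<partial>distr ?P borel (\<lambda>x. \<Sum>i\<in>A. (x i)\<^sup>2)) = (\<integral>\<^sup>+q. \<phi> q \<partial>density lborel (\<lambda>q. ennreal (radial_density (card A) q)))"
    by simp
  then show ?thesis by (subst (asm) nn_integral_distr) (auto simp: nn_integral_density)
qed

text \<open>The Beta density without its constant, as a function of the squared norm.\<close>

definition ball_power :: "real \<Rightarrow> real \<Rightarrow> real" where
  "ball_power \<beta> q = (if q < 1 then (1 - q) powr \<beta> else 0)"

lemma ball_power_nonneg [simp]: "ball_power \<beta> q \<ge> 0"
  by (simp add: ball_power_def)

lemma ball_power_measurable [measurable]: "ball_power \<beta> \<in> borel_measurable borel"
  unfolding ball_power_def[abs_def] by measurable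

lemma Beta_real_pos:
  fixes a b :: real
  shows "a > 0 \<Longrightarrow> b > 0 \<Longrightarrow> Beta a b > 0"
  by (simp add: Beta_def Gamma_real_pos)

lemma nn_integral_Beta:
  assumes a: "a > 0" and b: "b > 0"
  shows "(\<integral>\<^sup>+q. ennreal (if 0 < q \<and> q < 1 then q powr (a - 1) * (1 - q) powr (b - 1) else 0) \<partial>lborel) = ennreal (Beta a b)"
proof (rule nn_integral_has_integral_lborel)
  have "((\<lambda>q. if q \<in> {0..1} then q powr (a - 1) * (1 - q) powr (b - 1) else 0) has_integral Beta a b) UNIV"
    unfolding has_integral_restrict_UNIV using a b by (rule has_integral_Beta_real)
  moreover have "(\<lambda>q. if q \<in> {0..1} then q powr (a - 1) * (1 - q) powr (b - 1) else 0) = (\<lambda>q. if 0 < q \<and> q < 1 then q powr (a - 1) * (1 - q) powr (b - 1) else 0)"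
    by (auto simp: fun_eq_iff)
  ultimately show "((\<lambda>q. if 0 < q \<and> q < 1 then q powr (a - 1) * (1 - q) powr (b - 1) else 0) has_integral Beta a b) UNIV" by simp
qed auto

lemma nn_integral_ball_power:
  fixes A :: "nat set"
  assumes A: "finite A" "A \<noteq> {}" and p: "p \<ge> 0" and \<beta>: "\<beta> > -1"
  shows "(\<integral>\<^sup>+x. ennreal ((\<Sum>i\<in>A. (x i)\<^sup>2) powr (p / 2)) * ennreal (ball_power \<beta> (\<Sum>i\<in>A. (x i)\<^sup>2)) \<partial>PiM A (\<lambda>_. lborel))
    = ennreal (unit_ball_vol (real (card A)) * (real (card A) / 2) * Beta ((real (card A) + p) / 2) (\<beta> + 1))" (is ?with)
    and "(\<integral>\<^sup>+x. ennreal (ball_power \<beta> (\<Sum>i\<in>A. (x i)\<^sup>2)) \<partial>PiM A (\<lambda>_. lborel))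
    = ennreal (unit_ball_vol (real (card A)) * (real (card A) / 2) * Beta (real (card A) / 2) (\<beta> + 1))" (is ?without)
proof -
  have k: "card A > 0" using A by (simp add: card_gt_0_iff)
  let ?C = "unit_ball_vol (real (card A)) * (real (card A) / 2)"
  have C: "?C \<ge> 0" by simp
  have *: "(\<integral>\<^sup>+q. ennreal ?C * ennreal (if 0 < q \<and> q < 1 then q powr ((real (card A) + p) / 2 - 1) * (1 - q) powr (\<beta> + 1 - 1) else 0) \<partial>lborel)
     = ennreal (?C * Beta ((real (card A) + p) / 2) (\<beta> + 1))" if p: "p \<ge> 0" for p
  proof -
    have "Beta ((real (card A) + p) / 2) (\<beta> + 1) \<ge> 0" using k p \<beta> by (intro less_imp_le Beta_real_pos) auto
    then show ?thesis
      using k p \<beta> C by (subst nn_integral_cmult) (auto simp: nn_integral_Beta ennreal_mult[symmetric])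
  qed
  have "(\<integral>\<^sup>+x. ennreal ((\<Sum>i\<in>A. (x i)\<^sup>2) powr (p / 2)) * ennreal (ball_power \<beta> (\<Sum>i\<in>A. (x i)\<^sup>2)) \<partial>PiM A (\<lambda>_. lborel))
     = (\<integral>\<^sup>+q. ennreal (radial_density (card A) q) * (ennreal (q powr (p / 2)) * ennreal (ball_power \<beta> q)) \<partial>lborel)"
    by (rule nn_integral_radial[OF A, of "\<lambda>q. ennreal (q powr (p / 2)) * ennreal (ball_power \<beta> q)"]) measurable
  also have "\<dots> = (\<integral>\<^sup>+q. ennreal ?C * ennreal (if 0 < q \<and> q < 1 then q powr ((real (card A) + p) / 2 - 1) * (1 - q) powr (\<beta> + 1 - 1) else 0) \<partial>lborel)"
  proof (rule nn_integral_cong)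
    fix q :: real
    have "q powr (real (card A) / 2 - 1) * q powr (p / 2) = q powr ((real (card A) + p) / 2 - 1)" if "q > 0"
    proof -
      have "real (card A) / 2 - 1 + p / 2 = (real (card A) + p) / 2 - 1" by (simp add: field_simps)
      then show ?thesis by (simp only: powr_add[symmetric])
    qed
    then show "ennreal (radial_density (card A) q) * (ennreal (q powr (p / 2)) * ennreal (ball_power \<beta> q)) =
       ennreal ?C * ennreal (if 0 < q \<and> q < 1 then q powr ((real (card A) + p) / 2 - 1) * (1 - q) powr (\<beta> + 1 - 1) else 0)"
      using C by (auto simp: radial_density_def ball_power_def ennreal_mult[symmetric] mult_ac)
  qed
  finally show ?with using *[OF p] by simp
  \<comment> \<open>This is not literally the first claim with \<open>p = 0\<close>, because
    \<open>0 powr 0 = 0\<close> changes the integrand at the origin.\<close>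
  have "(\<integral>\<^sup>+x. ennreal (ball_power \<beta> (\<Sum>i\<in>A. (x i)\<^sup>2)) \<partial>PiM A (\<lambda>_. lborel))
     = (\<integral>\<^sup>+q. ennreal (radial_density (card A) q) * ennreal (ball_power \<beta> q) \<partial>lborel)"
    by (rule nn_integral_radial[OF A, of "\<lambda>q. ennreal (ball_power \<beta> q)"]) measurable
  also have "\<dots> = (\<integral>\<^sup>+q. ennreal ?C * ennreal (if 0 < q \<and> q < 1 then q powr ((real (card A) + 0) / 2 - 1) * (1 - q) powr (\<beta> + 1 - 1) else 0) \<partial>lborel)"
    using C by (intro nn_integral_cong) (auto simp: radial_density_def ball_power_def ennreal_mult[symmetric] mult_ac)
  finally show ?without using *[of 0] by simp
qed

section \<open>Linear substitution\<close>

text \<open>For \<open>r\<close> vectors in dimension \<open>r\<close> the Gram determinant is the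
  square of the determinant. \<open>B\<close> is the transposed inverse, obtained from the adjugate
  matrix.\<close>

lemma gdet_inverse:
  assumes d: "gdet r r d \<noteq> 0"
  obtains B where "\<And>j l. j < r \<Longrightarrow> l < r \<Longrightarrow> (\<Sum>k<r. B j k * d l k) = (if j = l then 1 else 0)"
    "\<And>k l. k < r \<Longrightarrow> l < r \<Longrightarrow> (\<Sum>j<r. B j l * d j k) = (if k = l then 1 else 0)"
proof -
  let ?D = "Matrix.mat r r (\<lambda>(i, j). d i j)"
  let ?A = "adj_mat ?D"
  let ?\<delta> = "Determinant.det ?D"
  have "gdet r r d = ?\<delta>\<^sup>2 * gdet r r coord_vec"
  proof (rule gdet_linear)
    show "d i k = (\<Sum>l<r. d i l * coord_vec l k)" if "k < r" for i k
      using that by (simp add: coord_vec_def if_distrib[of "\<lambda>c. _ * c"] cong: if_cong)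
  qed
  then have \<delta>: "?\<delta> \<noteq> 0" using d by auto
  have D: "?D \<in> carrier_mat r r" by simp
  have A: "?A \<in> carrier_mat r r" by (rule adj_mat(1)[OF D])
  define B where "B j k = ?A $$ (k, j) / ?\<delta>" for j k
  have 1: "(\<Sum>k<r. d l k * ?A $$ (k, j)) = (if l = j then ?\<delta> else 0)" if "l < r" "j < r" for l j
  proof -
    have e: "(?D * ?A) $$ (l, j) = (\<Sum>k<r. d l k * ?A $$ (k, j))"
      using that A by (simp add: scalar_prod_def lessThan_atLeast0)
    have "(?D * ?A) $$ (l, j) = (if l = j then ?\<delta> else 0)"
      unfolding adj_mat(2)[OF D] using that by simp
    then show ?thesis by (rule trans[OF e[symmetric]])
  qed
  have 2: "(\<Sum>j<r. ?A $$ (l, j) * d j k) = (if l = k then ?\<delta> else 0)" if "l < r" "k < r" for l k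
  proof -
    have e: "(?A * ?D) $$ (l, k) = (\<Sum>j<r. ?A $$ (l, j) * d j k)"
      using that A by (simp add: scalar_prod_def lessThan_atLeast0)
    have "(?A * ?D) $$ (l, k) = (if l = k then ?\<delta> else 0)"
      unfolding adj_mat(3)[OF D] using that by simp
    then show ?thesis by (rule trans[OF e[symmetric]])
  qed
  show ?thesis
  proof (rule that[of B])
    fix j l assume "j < r" "l < r"
    then show "(\<Sum>k<r. B j k * d l k) = (if j = l then 1 else 0)"
      using 1[of l j] \<delta> by (simp add: B_def sum_divide_distrib[symmetric] mult.commute)
  next
    fix k l assume "k < r" "l < r"
    then show "(\<Sum>j<r. B j l * d j k) = (if k = l then 1 else 0)"
      using 2[of l k] \<delta> by (simp add: B_def sum_divide_distrib[symmetric] mult.commute)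
  qed
qed

text \<open>The last coefficient \<open>y\<close> is integrated in the outer integral. For fixed
  \<open>y\<close> the remaining coordinates undergo the smaller triangular map followed by a
  translation by \<open>y * T m i\<close>; the outer integral is a one-dimensional dilation by
  \<open>T m m\<close>.\<close>

lemma nn_integral_leb_triangular:
  fixes T :: "nat \<Rightarrow> nat \<Rightarrow> real"
  assumes "\<And>j. j < m \<Longrightarrow> T j j \<noteq> 0" and "f \<in> borel_measurable (leb m)"
  shows "ennreal (\<Prod>j<m. \<bar>T j j\<bar>) * (\<integral>\<^sup>+a. f (\<lambda>i\<in>{..<m}. \<Sum>j\<in>{i..<m}. a j * T j i) \<partial>leb m) = (\<integral>\<^sup>+b. f b \<partial>leb m)"
  using assms
proof (induction m arbitrary: f)
  case 0
  have "(\<lambda>i\<in>{..<0::nat}. g i) = (\<lambda>_. undefined :: real)" for g by auto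
  then show ?case by (simp add: PiM_empty nn_integral_count_space_finite)
next
  case (Suc m)
  note f[measurable] = Suc.prems(2)
  let ?t = "\<lambda>m a. \<lambda>i\<in>{..<m}. \<Sum>j\<in>{i..<m}. a j * T j i"
  have ins: "{..<Suc m} = insert m {..<m}" by auto
  have tm: "?t k \<in> measurable (leb k) (leb k)" for k by (intro measurable_restrict) measurable
  have f_ins: "f \<in> borel_measurable (PiM (insert m {..<m}) (\<lambda>_. lborel))" using f by (simp add: ins)
  have ft_ins: "(\<lambda>a. f (?t (Suc m) a)) \<in> borel_measurable (PiM (insert m {..<m}) (\<lambda>_. lborel))"
    unfolding ins[symmetric] by (rule measurable_compose[OF tm f])
  define G where "G y b = f ((\<lambda>i\<in>{..<m}. b i + y * T m i)(m := y * T m m))" for y b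
  define H where "H y = (\<integral>\<^sup>+b. f (b(m := y)) \<partial>leb m)" for y
  have upd: "(\<lambda>b. b(m := y)) \<in> measurable (leb m) (PiM (insert m {..<m}) (\<lambda>_. lborel))" for y :: real
    by (rule measurable_fun_upd[where J = "{..<m}"]) auto
  have fy: "(\<lambda>b. f (b(m := y))) \<in> borel_measurable (leb m)" for y
    using measurable_compose[OF upd f_ins] .
  have Gm: "G y \<in> borel_measurable (leb m)" for y
    unfolding G_def[abs_def] by (rule measurable_compose[OF leb_affine_measurable(1) fy])
  have Hm: "H \<in> borel_measurable borel"
  proof -
    have "(\<lambda>p. f ((snd p)(m := fst p))) \<in> borel_measurable (lborel \<Otimes>\<^sub>M leb m)"
      by (rule measurable_compose[OF measurable_fun_upd[where J = "{..<m}"] f_ins]) auto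
    then have "(\<lambda>y. \<integral>\<^sup>+b. f (b(m := y)) \<partial>leb m) \<in> borel_measurable lborel"
      by (intro sigma_finite_measure.borel_measurable_nn_integral sigma_finite_leb) (simp add: case_prod_beta')
    then show ?thesis by (simp add: H_def[abs_def])
  qed
  have t_upd: "?t (Suc m) (x(m := y)) = (\<lambda>i\<in>{..<m}. ?t m x i + y * T m i)(m := y * T m m)" for x y
  proof
    fix i
    show "?t (Suc m) (x(m := y)) i = ((\<lambda>i\<in>{..<m}. ?t m x i + y * T m i)(m := y * T m m)) i"
    proof (cases "i < m")
      case True
      then have "{i..<Suc m} = insert m {i..<m}" by auto
      moreover have "(\<Sum>j\<in>{i..<m}. (x(m := y)) j * T j i) = (\<Sum>j\<in>{i..<m}. x j * T j i)"
        by (intro sum.cong) auto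
      ultimately show ?thesis using True by simp
    qed auto
  qed
  have "(\<integral>\<^sup>+a. f (?t (Suc m) a) \<partial>leb (Suc m)) = (\<integral>\<^sup>+y. \<integral>\<^sup>+x. f (?t (Suc m) (x(m := y))) \<partial>leb m \<partial>lborel)"
    unfolding ins by (rule lborel_product.product_nn_integral_insert_rev[OF _ _ ft_ins, unfolded ins]) auto
  also have "\<dots> = (\<integral>\<^sup>+y. \<integral>\<^sup>+x. G y (?t m x) \<partial>leb m \<partial>lborel)"
    unfolding t_upd G_def ..
  finally have "ennreal (\<Prod>j<m. \<bar>T j j\<bar>) * (\<integral>\<^sup>+a. f (?t (Suc m) a) \<partial>leb (Suc m))
      = ennreal (\<Prod>j<m. \<bar>T j j\<bar>) * (\<integral>\<^sup>+y. \<integral>\<^sup>+x. G y (?t m x) \<partial>leb m \<partial>lborel)" by simp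
  also have "\<dots> = (\<integral>\<^sup>+y. ennreal (\<Prod>j<m. \<bar>T j j\<bar>) * (\<integral>\<^sup>+x. G y (?t m x) \<partial>leb m) \<partial>lborel)"
  proof (rule nn_integral_cmult[symmetric])
    have "(\<lambda>p. f (?t (Suc m) ((snd p)(m := fst p)))) \<in> borel_measurable (lborel \<Otimes>\<^sub>M leb m)"
      by (rule measurable_compose[OF measurable_fun_upd[where J = "{..<m}"] ft_ins]) auto
    then show "(\<lambda>y. \<integral>\<^sup>+x. G y (?t m x) \<partial>leb m) \<in> borel_measurable lborel"
      unfolding G_def t_upd by (intro sigma_finite_measure.borel_measurable_nn_integral sigma_finite_leb) (simp add: case_prod_beta')
  qed
  also have "\<dots> = (\<integral>\<^sup>+y. \<integral>\<^sup>+b. G y b \<partial>leb m \<partial>lborel)"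
    using Suc.prems(1) by (intro nn_integral_cong Suc.IH Gm) auto
  also have "\<dots> = (\<integral>\<^sup>+y. H (y * T m m) \<partial>lborel)"
    unfolding G_def H_def by (intro nn_integral_cong nn_integral_lborel_shift[OF _ fy]) auto
  finally have "ennreal \<bar>T m m\<bar> * (ennreal (\<Prod>j<m. \<bar>T j j\<bar>) * (\<integral>\<^sup>+a. f (?t (Suc m) a) \<partial>leb (Suc m)))
     = ennreal \<bar>T m m\<bar> * (\<integral>\<^sup>+y. H (0 + T m m * y) \<partial>lborel)" by (simp add: mult.commute)
  also have "\<dots> = (\<integral>\<^sup>+y. H y \<partial>lborel)"
    using Suc.prems(1)[of m] by (intro nn_integral_real_affine[symmetric] Hm) auto
  also have "\<dots> = (\<integral>\<^sup>+b. f b \<partial>leb (Suc m))"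
    unfolding ins H_def by (rule lborel_product.product_nn_integral_insert_rev[OF _ _ f_ins, symmetric]) auto
  finally have *: "ennreal \<bar>T m m\<bar> * (ennreal (\<Prod>j<m. \<bar>T j j\<bar>) * (\<integral>\<^sup>+a. f (?t (Suc m) a) \<partial>leb (Suc m))) = (\<integral>\<^sup>+b. f b \<partial>leb (Suc m))" .
  have "ennreal (\<Prod>j<Suc m. \<bar>T j j\<bar>) = ennreal \<bar>T m m\<bar> * ennreal (\<Prod>j<m. \<bar>T j j\<bar>)"
    by (simp add: ennreal_mult prod_nonneg mult.commute)
  then show ?case using * by (simp only: mult.assoc)
qed

lemma sum_triangular_swap:
  fixes F :: "nat \<Rightarrow> nat \<Rightarrow> 'a :: comm_monoid_add"
  shows "(\<Sum>j<r. \<Sum>i\<le>j. F j i) = (\<Sum>i<r. \<Sum>j\<in>{i..<r}. F j i)"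
proof -
  have "(\<Sum>j<r. \<Sum>i\<le>j. F j i) = (\<Sum>j<r. \<Sum>i<r. if i \<le> j then F j i else 0)"
    by (intro sum.cong refl sum.mono_neutral_cong_left) auto
  also have "\<dots> = (\<Sum>i<r. \<Sum>j<r. if i \<le> j then F j i else 0)" by (rule sum.swap)
  also have "\<dots> = (\<Sum>i<r. \<Sum>j\<in>{i..<r}. F j i)"
    by (intro sum.cong refl sum.mono_neutral_cong_right) auto
  finally show ?thesis .
qed

text \<open>By QR decomposition the linear map is a triangular map followed by a rotation, and the
  Gram determinant is the square of the product of the diagonal entries.\<close>

lemma nn_integral_leb_linear:
  assumes d: "gdet r r d \<noteq> 0" and f[measurable]: "f \<in> borel_measurable (leb r)"
  shows "ennreal (sqrt (gdet r r d)) * (\<integral>\<^sup>+a. f (\<lambda>k\<in>{..<r}. \<Sum>j<r. a j * d j k) \<partial>leb r) = (\<integral>\<^sup>+b. f b \<partial>leb r)"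
proof -
  obtain e where e: "orthonormal_frame r r e"
    and de: "\<And>l k. l < r \<Longrightarrow> k < r \<Longrightarrow> d l k = (\<Sum>i\<le>l. ip r (d l) (e i) * e i k)"
    using qr_frame[of r r d] by blast
  define T where "T l i = ip r (d l) (e i)" for l i
  have g: "gdet r r d = (\<Prod>i<r. T i i)\<^sup>2"
    using e de unfolding T_def by (rule gdet_triangular)
  then have T0: "T j j \<noteq> 0" if "j < r" for j using d that by (auto simp: prod_zero_iff)
  have sq: "sqrt (gdet r r d) = (\<Prod>j<r. \<bar>T j j\<bar>)" unfolding g by (simp add: abs_prod)
  have eq: "(\<lambda>k\<in>{..<r}. \<Sum>j<r. a j * d j k) = rot r e (\<lambda>i\<in>{..<r}. \<Sum>j\<in>{i..<r}. a j * T j i)" for a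
  proof
    fix k
    show "(\<lambda>k\<in>{..<r}. \<Sum>j<r. a j * d j k) k = rot r e (\<lambda>i\<in>{..<r}. \<Sum>j\<in>{i..<r}. a j * T j i) k"
    proof (cases "k < r")
      case True
      have "(\<Sum>j<r. a j * d j k) = (\<Sum>j<r. \<Sum>i\<le>j. a j * T j i * e i k)"
        using de[OF _ True] by (intro sum.cong) (simp_all add: T_def sum_distrib_left mult.assoc)
      also have "\<dots> = (\<Sum>i<r. \<Sum>j\<in>{i..<r}. a j * T j i * e i k)" by (rule sum_triangular_swap)
      finally show ?thesis using True by (simp add: rot_def sum_distrib_right)
    qed (simp add: rot_def)
  qed
  show ?thesis
    unfolding eq sq using nn_integral_leb_triangular[of r T "\<lambda>b. f (rot r e b)", OF T0]
    by (simp add: nn_integral_leb_rot[OF e f])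
qed

section \<open>Moments of random parallelotopes\<close>

text \<open>Exhibits the Gram determinant as a polynomial in the coordinates, which gives
  measurability and, later, Lipschitz bounds.\<close>

lemma gdet_leibniz:
  "gdet m n v = (\<Sum>p | p permutes {0..<m}. signof p * (\<Prod>i=0..<m. ip n (v i) (v (p i))))"
proof -
  have "gdet m n v = (\<Sum>p | p permutes {0..<m}. signof p * (\<Prod>i=0..<m. Matrix.mat m m (\<lambda>(i, j). ip n (v i) (v j)) $$ (i, p i)))"
    by (simp add: gdet_def Determinant.det_def)
  also have "\<dots> = (\<Sum>p | p permutes {0..<m}. signof p * (\<Prod>i=0..<m. ip n (v i) (v (p i))))"
    by (intro sum.cong refl arg_cong2[where f = "(*)"] prod.cong) (auto dest: permutes_in_image)
  finally show ?thesis .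
qed

lemma gdet_measurable [measurable]:
  assumes "\<And>j k. j < m \<Longrightarrow> k < n \<Longrightarrow> (\<lambda>x. f x j k) \<in> borel_measurable M"
  shows "(\<lambda>x. gdet m n (f x)) \<in> borel_measurable M"
  unfolding gdet_leibniz
proof (intro borel_measurable_sum borel_measurable_times borel_measurable_prod borel_measurable_const measurable_ip assms)
  fix p i k assume "p \<in> {p. p permutes {0..<m}}" "i \<in> {0..<m}" "k < n"
  then show "p i < m" using permutes_in_image[of p "{0..<m}" i] by auto
qed auto

lemma block_component_measurable:
  assumes "F \<in> measurable N (PiM I (\<lambda>_. leb n))" "i \<in> I" "k < n"
  shows "(\<lambda>p. F p i k) \<in> borel_measurable N"
proof -
  have "(\<lambda>p. F p i) \<in> measurable N (leb n)"
    using measurable_compose[OF assms(1) measurable_component_singleton[OF assms(2)]] .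
  then show ?thesis using assms(3) by (rule leb_component_measurable)
qed

lemma borel_measurable_prod_ennreal':
  fixes f :: "'i \<Rightarrow> 'a \<Rightarrow> ennreal"
  assumes "\<And>i. i \<in> S \<Longrightarrow> f i \<in> borel_measurable M"
  shows "(\<lambda>x. \<Prod>i\<in>S. f i x) \<in> borel_measurable M"
proof (cases "finite S")
  case True
  then show ?thesis using assms by (induction S rule: finite_induct) auto
qed simp

definition weight :: "real \<Rightarrow> nat \<Rightarrow> 'i set \<Rightarrow> ('i \<Rightarrow> nat \<Rightarrow> real) \<Rightarrow> ennreal" where
  "weight \<beta> n I x = (\<Prod>i\<in>I. ennreal (ball_power \<beta> (ip n (x i) (x i))))"

lemma weight_measurable:
  assumes "\<And>i k. i \<in> I \<Longrightarrow> k < n \<Longrightarrow> (\<lambda>p. F p i k) \<in> borel_measurable N"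
  shows "(\<lambda>p. weight \<beta> n I (F p)) \<in> borel_measurable N"
  unfolding weight_def
  by (intro borel_measurable_prod_ennreal' measurable_compose[OF _ measurable_ennreal]
    measurable_compose[OF _ ball_power_measurable] measurable_ip assms)

text \<open>The unnormalised moment of the distance of a Beta point from an
  \<open>i\<close>-dimensional subspace, by rotation invariance taken to be the span of the first
  \<open>i\<close> coordinate axes.\<close>

definition par_const :: "nat \<Rightarrow> real \<Rightarrow> real \<Rightarrow> nat \<Rightarrow> ennreal" where
  "par_const n \<beta> s i = (\<integral>\<^sup>+x. ennreal ((\<Sum>j\<in>{i..<n}. (x j)\<^sup>2) powr (s / 2)) * ennreal (ball_power \<beta> (ip n x x)) \<partial>leb n)"

lemma ball_power_ip_measurable: "(\<lambda>y. ennreal (ball_power \<beta> (ip n y y))) \<in> borel_measurable (leb n)"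
  by (intro measurable_compose[OF _ measurable_ennreal] measurable_compose[OF _ ball_power_measurable]
      measurable_ip leb_component_measurable[of _ _ n]) auto

text \<open>Given the first \<open>m\<close> points, the determinant is base times height, and the
  height is the distance of the new point from a subspace contained in the span of \<open>m\<close>
  frame vectors. A rotation moves that span to a coordinate subspace, so the inner integral depends
  on \<open>m\<close> only, not on the points.\<close>

lemma parallelotope_moment:
  assumes "m \<le> n"
  shows "(\<integral>\<^sup>+x. ennreal (gdet m n (\<lambda>j. x (Suc j)) powr (s / 2)) * weight \<beta> n {1..m} x \<partial>PiM {1..m} (\<lambda>_. leb n))
    = (\<Prod>i<m. par_const n \<beta> s i)"
  using assms
proof (induction m)
  case 0
  have "gdet 0 n v = 1" for v by (simp add: gdet_def)
  then show ?case by (simp add: weight_def PiM_empty nn_integral_count_space_finite)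
next
  case (Suc m)
  let ?F = "\<lambda>m x. ennreal (gdet m n (\<lambda>j. x (Suc j)) powr (s / 2)) * weight \<beta> n {1..m} x"
  have Fm: "?F k \<in> borel_measurable (PiM {1..k} (\<lambda>_. leb n))" for k
    by (intro borel_measurable_times_ennreal measurable_compose[OF _ measurable_ennreal] powr_real_measurable
        gdet_measurable weight_measurable borel_measurable_const block_component_measurable[where I = "{1..k}" and n = n]) auto
  have ins: "{1..Suc m} = insert (Suc m) {1..m}" by auto
  have inner: "(\<integral>\<^sup>+y. ?F (Suc m) (x(Suc m := y)) \<partial>leb n) = ?F m x * par_const n \<beta> s m" for x
  proof -
    obtain e where e: "orthonormal_frame n n e"
      and v: "\<And>l k. l < m \<Longrightarrow> k < n \<Longrightarrow> x (Suc l) k = (\<Sum>i\<le>l. ip n (x (Suc l)) (e i) * e i k)"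
      using qr_frame[of m n "\<lambda>j. x (Suc j)"] Suc.prems by auto
    let ?S = "\<lambda>y. \<Sum>j\<in>{m..<n}. (ip n y (e j))\<^sup>2"
    let ?f = "\<lambda>y. ennreal (?S y powr (s / 2)) * ennreal (ball_power \<beta> (ip n y y))"
    have fm: "?f \<in> borel_measurable (leb n)"
      by (intro borel_measurable_times_ennreal ball_power_ip_measurable measurable_compose[OF _ measurable_ennreal] powr_real_measurable
         borel_measurable_sum borel_measurable_power measurable_ip borel_measurable_const leb_component_measurable[of _ _ n]) auto
    have "?F (Suc m) (x(Suc m := y)) = ?F m x * ?f y" for y
    proof -
      have "(\<lambda>j. (x(Suc m := y)) (Suc j)) = (\<lambda>j. x (Suc j))(m := y)" by auto
      then have "gdet (Suc m) n (\<lambda>j. (x(Suc m := y)) (Suc j)) = gdet m n (\<lambda>j. x (Suc j)) * ?S y"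
        using gdet_height[OF e _ v] Suc.prems by (simp only:) auto
      moreover have "gdet m n (\<lambda>j. x (Suc j)) \<ge> 0" using Suc.prems by (intro gdet_nonneg) auto
      moreover have "?S y \<ge> 0" by (intro sum_nonneg) auto
      ultimately have "gdet (Suc m) n (\<lambda>j. (x(Suc m := y)) (Suc j)) powr (s / 2) = gdet m n (\<lambda>j. x (Suc j)) powr (s / 2) * ?S y powr (s / 2)"
        by (simp only: powr_mult)
      moreover have "weight \<beta> n {1..Suc m} (x(Suc m := y)) = ennreal (ball_power \<beta> (ip n y y)) * weight \<beta> n {1..m} x"
      proof -
        have "weight \<beta> n {1..m} (x(Suc m := y)) = weight \<beta> n {1..m} x"
          unfolding weight_def by (intro prod.cong) auto
        then show ?thesis unfolding ins by (simp add: weight_def)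
      qed
      ultimately show ?thesis by (simp add: ennreal_mult mult_ac)
    qed
    then have "(\<integral>\<^sup>+y. ?F (Suc m) (x(Suc m := y)) \<partial>leb n) = ?F m x * (\<integral>\<^sup>+y. ?f y \<partial>leb n)"
      using fm by (simp add: nn_integral_cmult)
    also have "(\<integral>\<^sup>+y. ?f y \<partial>leb n) = (\<integral>\<^sup>+y. ?f (rot n e y) \<partial>leb n)"
      by (rule nn_integral_leb_rot[OF e fm, symmetric])
    also have "\<dots> = par_const n \<beta> s m"
      unfolding par_const_def by (intro nn_integral_cong) (simp add: ip_rot[OF e] ip_rot_self[OF e])
    finally show ?thesis .
  qed
  have "(\<integral>\<^sup>+x. ?F (Suc m) x \<partial>PiM {1..Suc m} (\<lambda>_. leb n)) = (\<integral>\<^sup>+x. \<integral>\<^sup>+y. ?F (Suc m) (x(Suc m := y)) \<partial>leb n \<partial>PiM {1..m} (\<lambda>_. leb n))"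
    using leb_product.product_nn_integral_insert[OF _ _ Fm[of "Suc m", unfolded ins]] unfolding ins by simp
  also have "\<dots> = (\<integral>\<^sup>+x. ?F m x * par_const n \<beta> s m \<partial>PiM {1..m} (\<lambda>_. leb n))"
    unfolding inner ..
  also have "\<dots> = (\<Prod>i<m. par_const n \<beta> s i) * par_const n \<beta> s m"
    using Suc by (subst nn_integral_multc[OF Fm]) simp
  finally show ?case by simp
qed

section \<open>Sections of the weighted ball by flats\<close>

lemma ball_power_scale:
  assumes "H < 1"
  shows "ball_power \<beta> (H + (sqrt (1 - H))\<^sup>2 * q) = (1 - H) powr \<beta> * ball_power \<beta> q"
proof -
  have sq: "(sqrt (1 - H))\<^sup>2 = 1 - H" using assms by simp
  have *: "1 - (H + (1 - H) * q) = (1 - H) * (1 - q)" by (simp add: algebra_simps)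
  have "H + (1 - H) * q < 1 \<longleftrightarrow> q < 1"
  proof -
    have "H + (1 - H) * q < 1 \<longleftrightarrow> 0 < (1 - H) * (1 - q)" using * by linarith
    also have "\<dots> \<longleftrightarrow> q < 1" using assms by (simp add: zero_less_mult_iff)
    finally show ?thesis .
  qed
  then show ?thesis unfolding sq using assms by (auto simp: ball_power_def * powr_mult)
qed

lemma ball_power_eq_0: "q \<ge> 1 \<Longrightarrow> ball_power \<beta> q = 0"
  by (simp add: ball_power_def)

text \<open>An \<open>r\<close>-flat at squared distance \<open>H\<close> from the origin carries a
  configuration of fixed shape \<open>D\<close>. The product of the weights of its points is
  integrated over all translations \<open>u\<close> of the configuration within the flat.\<close>

definition section_integral :: "real \<Rightarrow> nat \<Rightarrow> 'i set \<Rightarrow> real \<Rightarrow> ('i \<Rightarrow> nat \<Rightarrow> real) \<Rightarrow> ennreal" where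
  "section_integral \<beta> r I H D = (\<integral>\<^sup>+u. (\<Prod>i\<in>I. ennreal (ball_power \<beta> (H + (\<Sum>j<r. (u j + D i j)\<^sup>2)))) \<partial>leb r)"

lemma section_integral_measurable_aux:
  "(\<lambda>u. (\<Prod>i\<in>I. ennreal (ball_power \<beta> (H + (\<Sum>j<r. (u j + D i j)\<^sup>2))))) \<in> borel_measurable (leb r)"
  by (intro borel_measurable_prod_ennreal' measurable_compose[OF _ measurable_ennreal]
    measurable_compose[OF _ ball_power_measurable] borel_measurable_add borel_measurable_const
    borel_measurable_sum borel_measurable_power leb_component_measurable[of _ _ r]) auto

text \<open>The flat meets the unit ball in a ball of radius \<open>sqrt (1 - H)\<close>. Rescaling
  it to radius 1 yields \<open>r / 2\<close> in the exponent from Lebesgue measure and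
  \<open>\<beta>\<close> from the weight of each point, and it enlarges the shape
  \<open>D\<close>.\<close>

lemma section_integral_scale:
  assumes H: "H < 1" and I: "finite I"
  shows "section_integral \<beta> r I H D =
    ennreal ((1 - H) powr (real r / 2 + \<beta> * real (card I))) * section_integral \<beta> r I 0 (\<lambda>i j. (1 / sqrt (1 - H)) * D i j)"
proof -
  define c where "c = sqrt (1 - H)"
  have c: "c > 0" "c\<^sup>2 = 1 - H" using H by (auto simp: c_def)
  let ?f = "\<lambda>H D u. \<Prod>i\<in>I. ennreal (ball_power \<beta> (H + (\<Sum>j<r. (u j + D i j)\<^sup>2)))"
  have fm: "?f H D \<in> borel_measurable (leb r)" for H D by (rule section_integral_measurable_aux)
  have "section_integral \<beta> r I H D = ennreal (c ^ r) * (\<integral>\<^sup>+u. ?f H D (\<lambda>k\<in>{..<r}. c * u k) \<partial>leb r)"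
    using nn_integral_lborel_scale[OF _ fm c(1)] by (simp add: section_integral_def)
  also have "(\<lambda>u. ?f H D (\<lambda>k\<in>{..<r}. c * u k)) = (\<lambda>u. ennreal (((1 - H) powr \<beta>) ^ card I) * ?f 0 (\<lambda>i j. (1 / c) * D i j) u)"
  proof
    fix u
    have "?f H D (\<lambda>k\<in>{..<r}. c * u k) = (\<Prod>i\<in>I. ennreal ((1 - H) powr \<beta>) * ennreal (ball_power \<beta> (0 + (\<Sum>j<r. (u j + (1 / c) * D i j)\<^sup>2))))"
    proof (rule prod.cong[OF refl])
      fix i
      have "(\<Sum>j<r. ((\<lambda>k\<in>{..<r}. c * u k) j + D i j)\<^sup>2) = (\<Sum>j<r. c\<^sup>2 * (u j + (1 / c) * D i j)\<^sup>2)"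
        using c(1) by (intro sum.cong) (auto simp: power_mult_distrib[symmetric] distrib_left)
      also have "\<dots> = (sqrt (1 - H))\<^sup>2 * (\<Sum>j<r. (u j + (1 / c) * D i j)\<^sup>2)"
        by (simp add: sum_distrib_left c_def)
      finally have "ball_power \<beta> (H + (\<Sum>j<r. ((\<lambda>k\<in>{..<r}. c * u k) j + D i j)\<^sup>2)) = (1 - H) powr \<beta> * ball_power \<beta> (\<Sum>j<r. (u j + (1 / c) * D i j)\<^sup>2)"
        by (simp only: ball_power_scale[OF H])
      then show "ennreal (ball_power \<beta> (H + (\<Sum>j<r. ((\<lambda>k\<in>{..<r}. c * u k) j + D i j)\<^sup>2))) =
        ennreal ((1 - H) powr \<beta>) * ennreal (ball_power \<beta> (0 + (\<Sum>j<r. (u j + (1 / c) * D i j)\<^sup>2)))"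
        by (simp add: ennreal_mult)
    qed
    then show "?f H D (\<lambda>k\<in>{..<r}. c * u k) = ennreal (((1 - H) powr \<beta>) ^ card I) * ?f 0 (\<lambda>i j. (1 / c) * D i j) u"
      by (simp add: prod.distrib ennreal_power)
  qed
  also have "ennreal (c ^ r) * (\<integral>\<^sup>+u. ennreal (((1 - H) powr \<beta>) ^ card I) * ?f 0 (\<lambda>i j. (1 / c) * D i j) u \<partial>leb r)
    = ennreal (c ^ r * ((1 - H) powr \<beta>) ^ card I) * section_integral \<beta> r I 0 (\<lambda>i j. (1 / c) * D i j)"
    unfolding section_integral_def nn_integral_cmult[OF fm] using c(1) by (simp add: ennreal_mult mult.assoc)
  also have "c ^ r = (1 - H) powr (real r / 2)"
  proof -
    have "c ^ r = ((1 - H) powr (1 / 2)) powr real r"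
      using H c(1) by (simp add: c_def powr_half_sqrt powr_realpow)
    then show ?thesis by (simp add: powr_powr)
  qed
  also have "((1 - H) powr \<beta>) ^ card I = (1 - H) powr (\<beta> * real (card I))"
    using H by (simp add: powr_realpow[symmetric] powr_powr)
  finally show ?thesis by (simp add: powr_add c_def)
qed

lemma sum_merge_split:
  fixes r n :: nat
  assumes "r \<le> n"
  shows "(\<Sum>j<n. F j (merge {r..<n} {..<r} (h, u) j)) = (\<Sum>j\<in>{r..<n}. F j (h j)) + (\<Sum>j<r. F j (u j))"
proof -
  have U: "{..<n} = {r..<n} \<union> {..<r}" using assms by auto
  have "(\<Sum>j<n. F j (merge {r..<n} {..<r} (h, u) j)) =
    (\<Sum>j\<in>{r..<n}. F j (merge {r..<n} {..<r} (h, u) j)) + (\<Sum>j<r. F j (merge {r..<n} {..<r} (h, u) j))"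
    unfolding U by (rule sum.union_disjoint) auto
  also have "(\<Sum>j\<in>{r..<n}. F j (merge {r..<n} {..<r} (h, u) j)) = (\<Sum>j\<in>{r..<n}. F j (h j))"
    by (intro sum.cong) (auto simp: merge_def)
  also have "(\<Sum>j<r. F j (merge {r..<n} {..<r} (h, u) j)) = (\<Sum>j<r. F j (u j))"
    by (intro sum.cong) (auto simp: merge_def)
  finally show ?thesis .
qed

text \<open>Integrating out the first \<open>i\<close> coordinates is a section integral with a
  single point; it raises the exponent from \<open>\<beta>\<close> to \<open>\<beta> + i / 2\<close>
  and leaves a radial integral in dimension \<open>n - i\<close>. The constant \<open>K\<close> is
  common to the moment and the total mass, so it drops out of their quotient.\<close>

lemma par_const_eq:
  assumes i: "i < n" and \<beta>: "\<beta> > -1" and s: "s \<ge> 0"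
  obtains K :: real where "K > 0"
    "par_const n \<beta> s i = ennreal (K * Beta ((real (n - i) + s) / 2) (\<beta> + real i / 2 + 1))"
    "(\<integral>\<^sup>+x. ennreal (ball_power \<beta> (ip n x x)) \<partial>leb n) = ennreal (K * Beta (real (n - i) / 2) (\<beta> + real i / 2 + 1))"
proof -
  let ?P = "PiM {i..<n} (\<lambda>_. lborel :: real measure)"
  define \<xi> where "\<xi> = (\<integral>\<^sup>+u. ennreal (ball_power \<beta> (ip i u u)) \<partial>leb i)"
  have "\<exists>x>0. \<xi> = ennreal x"
  proof (cases "i = 0")
    case True
    have "\<xi> = ennreal 1"
      unfolding \<xi>_def True by (simp add: PiM_empty nn_integral_count_space_finite ip_def ball_power_def)
    then show ?thesis by (intro exI[of _ 1]) simp
  next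
    case False
    have "\<xi> = ennreal (unit_ball_vol (real i) * (real i / 2) * Beta (real i / 2) (\<beta> + 1))"
      using nn_integral_ball_power(2)[of "{..<i}" 0 \<beta>] False \<beta> by (auto simp: \<xi>_def ip_def power2_eq_square)
    moreover have "unit_ball_vol (real i) * (real i / 2) * Beta (real i / 2) (\<beta> + 1) > 0"
      using False \<beta> by (intro mult_pos_pos Beta_real_pos unit_ball_vol_pos) auto
    ultimately show ?thesis by blast
  qed
  then obtain x where x: "x > 0" "\<xi> = ennreal x" by blast
  let ?k = "n - i"
  have card: "card {i..<n} = ?k" "finite {i..<n}" "{i..<n} \<noteq> {}" using i by auto
  have \<beta>': "\<beta> + real i / 2 > -1" using \<beta> by simp
  have merge: "(\<Sum>j\<in>{i..<n}. (merge {i..<n} {..<i} (h, u) j)\<^sup>2) = (\<Sum>j\<in>{i..<n}. (h j)\<^sup>2)"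
    "ip n (merge {i..<n} {..<i} (h, u)) (merge {i..<n} {..<i} (h, u)) = (\<Sum>j\<in>{i..<n}. (h j)\<^sup>2) + ip i u u" for h u :: "nat \<Rightarrow> real"
  proof -
    show "(\<Sum>j\<in>{i..<n}. (merge {i..<n} {..<i} (h, u) j)\<^sup>2) = (\<Sum>j\<in>{i..<n}. (h j)\<^sup>2)"
      by (intro sum.cong) (auto simp: merge_def)
    show "ip n (merge {i..<n} {..<i} (h, u)) (merge {i..<n} {..<i} (h, u)) = (\<Sum>j\<in>{i..<n}. (h j)\<^sup>2) + ip i u u"
      unfolding ip_def power2_eq_square using i by (intro sum_merge_split[of i n "\<lambda>_ x. x * x"]) simp
  qed
  have slice: "(\<integral>\<^sup>+u. ennreal (ball_power \<beta> (H + ip i u u)) \<partial>leb i) = ennreal (ball_power (\<beta> + real i / 2) H) * \<xi>"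
    if "H \<ge> 0" for H
  proof (cases "H < 1")
    case True
    have "(\<integral>\<^sup>+u. ennreal (ball_power \<beta> (H + ip i u u)) \<partial>leb i) = section_integral \<beta> i {0::nat} H (\<lambda>_ _. 0)" for H
      by (simp add: section_integral_def ip_def power2_eq_square)
    from this[of H] this[of 0] section_integral_scale[OF True, of "{0::nat}" \<beta> i "\<lambda>_ _. 0"] True
    show ?thesis by (simp add: \<xi>_def ball_power_def add.commute)
  next
    case False
    have "ball_power \<beta> (H + ip i u u) = 0" for u using False ip_self_nonneg[of i u] by (intro ball_power_eq_0) simp
    then show ?thesis using False by (simp add: ball_power_eq_0)
  qed
  have red: "(\<integral>\<^sup>+x. a (\<Sum>j\<in>{i..<n}. (x j)\<^sup>2) * ennreal (ball_power \<beta> (ip n x x)) \<partial>leb n) =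
     (\<integral>\<^sup>+h. a (\<Sum>j\<in>{i..<n}. (h j)\<^sup>2) * ennreal (ball_power (\<beta> + real i / 2) (\<Sum>j\<in>{i..<n}. (h j)\<^sup>2)) \<partial>?P) * \<xi>"
    if a: "a \<in> borel_measurable borel" for a :: "real \<Rightarrow> ennreal"
  proof -
    have m1: "(\<lambda>x. a (\<Sum>j\<in>{i..<n}. (x j)\<^sup>2) * ennreal (ball_power \<beta> (ip n x x))) \<in> borel_measurable (leb n)"
      by (intro borel_measurable_times_ennreal ball_power_ip_measurable measurable_compose[OF _ a]
         borel_measurable_sum borel_measurable_power leb_component_measurable[of _ _ n]) auto
    have bm: "(\<lambda>u. ennreal (ball_power \<beta> (H + ip i u u))) \<in> borel_measurable (leb i)" for H
      by (intro measurable_compose[OF _ measurable_ennreal] measurable_compose[OF _ ball_power_measurable]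
        borel_measurable_add borel_measurable_const measurable_ip leb_component_measurable[of _ _ i]) auto
    have "(\<integral>\<^sup>+x. a (\<Sum>j\<in>{i..<n}. (x j)\<^sup>2) * ennreal (ball_power \<beta> (ip n x x)) \<partial>leb n) =
      (\<integral>\<^sup>+h. (\<integral>\<^sup>+u. a (\<Sum>j\<in>{i..<n}. (h j)\<^sup>2) * ennreal (ball_power \<beta> ((\<Sum>j\<in>{i..<n}. (h j)\<^sup>2) + ip i u u)) \<partial>leb i) \<partial>?P)"
      using i by (subst nn_integral_leb_split[OF _ m1, of i]) (auto simp: merge)
    also have "\<dots> = (\<integral>\<^sup>+h. (a (\<Sum>j\<in>{i..<n}. (h j)\<^sup>2) * ennreal (ball_power (\<beta> + real i / 2) (\<Sum>j\<in>{i..<n}. (h j)\<^sup>2))) * \<xi> \<partial>?P)"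
      by (intro nn_integral_cong) (simp add: nn_integral_cmult[OF bm] slice sum_nonneg mult.assoc)
    also have "\<dots> = (\<integral>\<^sup>+h. a (\<Sum>j\<in>{i..<n}. (h j)\<^sup>2) * ennreal (ball_power (\<beta> + real i / 2) (\<Sum>j\<in>{i..<n}. (h j)\<^sup>2)) \<partial>?P) * \<xi>"
    proof (rule nn_integral_multc)
      have sm: "(\<lambda>h. \<Sum>j\<in>{i..<n}. (h j)\<^sup>2) \<in> borel_measurable ?P" by measurable
      show "(\<lambda>h. a (\<Sum>j\<in>{i..<n}. (h j)\<^sup>2) * ennreal (ball_power (\<beta> + real i / 2) (\<Sum>j\<in>{i..<n}. (h j)\<^sup>2))) \<in> borel_measurable ?P"
        by (intro borel_measurable_times_ennreal measurable_compose[OF sm a] measurable_compose[OF _ measurable_ennreal]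
          measurable_compose[OF sm ball_power_measurable])
    qed
    finally show ?thesis .
  qed
  define K where "K = unit_ball_vol (real ?k) * (real ?k / 2) * x"
  have B: "Beta ((real ?k + p) / 2) (\<beta> + real i / 2 + 1) > 0" if "p \<ge> 0" for p
    using i \<beta> that by (intro Beta_real_pos) auto
  have C: "unit_ball_vol (real ?k) * (real ?k / 2) > 0" using i by (intro mult_pos_pos unit_ball_vol_pos) auto
  show ?thesis
  proof (rule that[of K])
    show "K > 0" unfolding K_def by (rule mult_pos_pos[OF C x(1)])
    have "par_const n \<beta> s i = ennreal (unit_ball_vol (real ?k) * (real ?k / 2) * Beta ((real ?k + s) / 2) (\<beta> + real i / 2 + 1)) * \<xi>"
      unfolding par_const_def using red[of "\<lambda>q. ennreal (q powr (s / 2))"] nn_integral_ball_power(1)[OF card(2,3) s \<beta>'] card(1)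
      by simp
    then show "par_const n \<beta> s i = ennreal (K * Beta ((real ?k + s) / 2) (\<beta> + real i / 2 + 1))"
      using C x B[OF s] by (simp add: K_def ennreal_mult[symmetric] mult_ac)
    have "(\<integral>\<^sup>+x. ennreal (ball_power \<beta> (ip n x x)) \<partial>leb n) = ennreal (unit_ball_vol (real ?k) * (real ?k / 2) * Beta (real ?k / 2) (\<beta> + real i / 2 + 1)) * \<xi>"
      using red[of "\<lambda>q. 1"] nn_integral_ball_power(2)[OF card(2,3) s \<beta>'] card(1) by simp
    then show "(\<integral>\<^sup>+x. ennreal (ball_power \<beta> (ip n x x)) \<partial>leb n) = ennreal (K * Beta (real ?k / 2) (\<beta> + real i / 2 + 1))"
      using C x B[of 0] by (simp add: K_def ennreal_mult[symmetric] mult_ac)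
  qed
qed

section \<open>The distance of a random affine hull from the origin\<close>

text \<open>The squared distance of the point \<open>z\<close> from the span of the points \<open>d 1, \<dots>, d r\<close>, hence
  of the origin from the affine hull of \<open>z\<close> and the points \<open>d i + z\<close>.\<close>

definition sq_height :: "nat \<Rightarrow> nat \<Rightarrow> (nat \<Rightarrow> nat \<Rightarrow> real) \<Rightarrow> (nat \<Rightarrow> real) \<Rightarrow> real" where
  "sq_height r n d z = gdet (Suc r) n ((\<lambda>l. d (Suc l))(r := z)) / gdet r n (\<lambda>l. d (Suc l))"

text \<open>The vertices are \<open>d i + z\<close> and, for \<open>i = Suc r\<close>, the point
  \<open>z\<close> itself. The squared norm of a vertex is split into the squared height of the flat
  and the rest, and \<open>c\<close> acts on the height: the identity yields the weights of the
  simplex, the zero function those of its parallel translate through the origin.\<close>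

definition flat_integrand :: "(real \<Rightarrow> ennreal) \<Rightarrow> (real \<Rightarrow> real) \<Rightarrow> real \<Rightarrow> nat \<Rightarrow> nat \<Rightarrow> (nat \<Rightarrow> nat \<Rightarrow> real) \<Rightarrow> (nat \<Rightarrow> real) \<Rightarrow> ennreal" where
  "flat_integrand a c \<beta> r n d z = a (sq_height r n d z) * (\<Prod>i\<in>{1..Suc r}. ennreal (ball_power \<beta>
     (c (sq_height r n d z) + (ip n (vadd n ((d(Suc r := \<lambda>_. 0)) i) z) (vadd n ((d(Suc r := \<lambda>_. 0)) i) z) - sq_height r n d z))))"

lemma flat_integrand_measurable:
  assumes F: "F \<in> measurable N (PiM {1..r} (\<lambda>_. leb n))" and Z: "Z \<in> measurable N (leb n)"
    and a: "a \<in> borel_measurable borel" and c: "c \<in> borel_measurable borel"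
  shows "(\<lambda>p. flat_integrand a c \<beta> r n (F p) (Z p)) \<in> borel_measurable N"
proof -
  have Fc: "(\<lambda>p. F p i k) \<in> borel_measurable N" if "i \<in> {1..r}" "k < n" for i k
    using block_component_measurable[OF F that] .
  have Zc: "(\<lambda>p. Z p k) \<in> borel_measurable N" if "k < n" for k
    using leb_component_measurable[OF Z that] .
  have g1: "(\<lambda>p. gdet r n (\<lambda>l. F p (Suc l))) \<in> borel_measurable N"
    by (intro gdet_measurable Fc) auto
  have g2: "(\<lambda>p. gdet (Suc r) n ((\<lambda>l. F p (Suc l))(r := Z p))) \<in> borel_measurable N"
  proof (intro gdet_measurable)
    fix l k assume "l < Suc r" "k < n"
    then show "(\<lambda>p. ((\<lambda>l. F p (Suc l))(r := Z p)) l k) \<in> borel_measurable N"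
      using Fc[of "Suc l" k] Zc[of k] by (cases "l = r") auto
  qed
  have h: "(\<lambda>p. sq_height r n (F p) (Z p)) \<in> borel_measurable N"
    unfolding sq_height_def by (intro borel_measurable_divide g1 g2)
  have v: "(\<lambda>p. vadd n (((F p)(Suc r := \<lambda>_. 0)) i) (Z p) k) \<in> borel_measurable N" if "i \<in> {1..Suc r}" "k < n" for i k
    using Fc[of i k] Zc[of k] that by (cases "i = Suc r") (auto simp: vadd_def)
  show ?thesis
    unfolding flat_integrand_def
    by (intro borel_measurable_times_ennreal measurable_compose[OF h a] borel_measurable_prod_ennreal'
      measurable_compose[OF _ measurable_ennreal] measurable_compose[OF _ ball_power_measurable]
      borel_measurable_add borel_measurable_diff measurable_compose[OF h c] h measurable_ip v)
qed

definition flat_integral :: "(real \<Rightarrow> ennreal) \<Rightarrow> (real \<Rightarrow> real) \<Rightarrow> real \<Rightarrow> nat \<Rightarrow> nat \<Rightarrow> (nat \<Rightarrow> nat \<Rightarrow> real) \<Rightarrow> ennreal" where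
  "flat_integral a c \<beta> r n d = (\<integral>\<^sup>+z. flat_integrand a c \<beta> r n d z \<partial>leb n)"

lemma flat_integral_measurable:
  assumes F: "F \<in> measurable N (PiM {1..r} (\<lambda>_. leb n))"
    and a: "a \<in> borel_measurable borel" and c: "c \<in> borel_measurable borel"
  shows "(\<lambda>p. flat_integral a c \<beta> r n (F p)) \<in> borel_measurable N"
  unfolding flat_integral_def
proof (rule sigma_finite_measure.borel_measurable_nn_integral[OF sigma_finite_leb])
  show "(\<lambda>(p, z). flat_integrand a c \<beta> r n (F p) z) \<in> borel_measurable (N \<Otimes>\<^sub>M leb n)"
    unfolding case_prod_beta' by (rule flat_integrand_measurable[OF measurable_compose[OF measurable_fst F] measurable_snd a c])
qed

lemma ip_vadd_left: "ip n (vadd n x y) w = ip n x w + ip n y w"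
  by (simp add: ip_def vadd_def distrib_right sum.distrib)

text \<open>The outcome of QR decomposition: the vectors \<open>d 1\<close> to \<open>d r\<close>
  lie in the span of the first \<open>r\<close> frame vectors, so the remaining coordinates of a
  point measure its height.\<close>

definition adapted :: "nat \<Rightarrow> nat \<Rightarrow> (nat \<Rightarrow> nat \<Rightarrow> real) \<Rightarrow> (nat \<Rightarrow> nat \<Rightarrow> real) \<Rightarrow> bool" where
  "adapted r n e d \<longleftrightarrow> orthonormal_frame n n e \<and>
     (\<forall>l<r. \<forall>k<n. d (Suc l) k = (\<Sum>i\<le>l. ip n (d (Suc l)) (e i) * e i k))"

lemma sq_height_adapted:
  assumes e: "adapted r n e d" and r: "r \<le> n" and G: "gdet r n (\<lambda>l. d (Suc l)) \<noteq> 0"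
  shows "sq_height r n d z = (\<Sum>j\<in>{r..<n}. (ip n z (e j))\<^sup>2)"
proof -
  have "gdet (Suc r) n ((\<lambda>l. d (Suc l))(r := z)) = gdet r n (\<lambda>l. d (Suc l)) * (\<Sum>j\<in>{r..<n}. (ip n z (e j))\<^sup>2)"
    by (rule gdet_height) (use e r in \<open>auto simp: adapted_def\<close>)
  then show ?thesis using G by (simp add: sq_height_def del: fun_upd_apply)
qed

text \<open>After rotation to the adapted frame the coordinates split: those from \<open>r\<close>
  on are common to all vertices and give the height, the first \<open>r\<close> describe the
  position within the flat.\<close>

lemma flat_integral_eq_section:
  assumes e: "adapted r n e d" and r: "r \<le> n" and G: "gdet r n (\<lambda>l. d (Suc l)) \<noteq> 0"
    and d: "d \<in> space (PiM {1..r} (\<lambda>_. leb n))"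
    and a: "a \<in> borel_measurable borel" and c: "c \<in> borel_measurable borel"
  shows "flat_integral a c \<beta> r n d = (\<integral>\<^sup>+h. a (\<Sum>j\<in>{r..<n}. (h j)\<^sup>2) *
      section_integral \<beta> r {1..Suc r} (c (\<Sum>j\<in>{r..<n}. (h j)\<^sup>2)) (\<lambda>i j. ip n ((d(Suc r := \<lambda>_. 0)) i) (e j)) \<partial>PiM {r..<n} (\<lambda>_. lborel))"
proof -
  have on: "orthonormal_frame n n e" using e by (simp add: adapted_def)
  let ?dd = "d(Suc r := \<lambda>_. 0)"
  let ?D = "\<lambda>i j. ip n (?dd i) (e j)"
  let ?H = "\<lambda>h. \<Sum>j\<in>{r..<n}. (h j)\<^sup>2"
  have D0: "?D i j = 0" if i: "i \<in> {1..Suc r}" and j: "j \<in> {r..<n}" for i j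
  proof (cases "i = Suc r")
    case True
    then show ?thesis by (simp add: ip_def)
  next
    case False
    then obtain l where l: "i = Suc l" "l < r" using i by (cases i) auto
    have "ip n (d (Suc l)) (e j) = ip n (\<lambda>k. \<Sum>i\<le>l. ip n (d (Suc l)) (e i) * e i k) (e j)"
      using e l by (intro ip_cong) (auto simp: adapted_def)
    also have "\<dots> = (\<Sum>i\<le>l. ip n (d (Suc l)) (e i) * ip n (e i) (e j))"
      by (simp add: ip_sum_left ip_scale_left)
    also have "\<dots> = 0" using l j r by (intro sum.neutral) (auto simp: orthonormal_frameD[OF on])
    finally show ?thesis using l by simp
  qed
  have fm: "flat_integrand a c \<beta> r n d \<in> borel_measurable (leb n)"
    using flat_integrand_measurable[OF measurable_const[OF d] measurable_ident a c] by (simp add: id_def)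
  have eq: "flat_integrand a c \<beta> r n d (rot n e (merge {r..<n} {..<r} (h, u))) = a (?H h) *
     (\<Prod>i\<in>{1..Suc r}. ennreal (ball_power \<beta> (c (?H h) + (\<Sum>j<r. (u j + ?D i j)\<^sup>2))))" for h u
  proof -
    let ?z = "merge {r..<n} {..<r} (h, u)"
    have ipz: "ip n (rot n e ?z) (e j) = ?z j" if "j < n" for j by (rule ip_rot[OF on that])
    have sh: "sq_height r n d (rot n e ?z) = ?H h"
    proof -
      have "?z j = h j" if "j \<in> {r..<n}" for j using that by (auto simp: merge_def)
      then show ?thesis unfolding sq_height_adapted[OF e r G] by (intro sum.cong) (auto simp: ipz)
    qed
    have "ip n (vadd n (?dd i) (rot n e ?z)) (vadd n (?dd i) (rot n e ?z)) = ?H h + (\<Sum>j<r. (u j + ?D i j)\<^sup>2)"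
      if i: "i \<in> {1..Suc r}" for i
    proof -
      have "ip n (vadd n (?dd i) (rot n e ?z)) (vadd n (?dd i) (rot n e ?z)) = (\<Sum>j<n. (?D i j + ?z j)\<^sup>2)"
        unfolding parseval[OF on] by (intro sum.cong) (auto simp: ip_vadd_left ipz)
      also have "\<dots> = (\<Sum>j\<in>{r..<n}. (?D i j + h j)\<^sup>2) + (\<Sum>j<r. (?D i j + u j)\<^sup>2)"
        by (rule sum_merge_split[OF r, of "\<lambda>j x. (?D i j + x)\<^sup>2"])
      also have "(\<Sum>j\<in>{r..<n}. (?D i j + h j)\<^sup>2) = ?H h" using D0[OF i] by (intro sum.cong) auto
      finally show ?thesis by (simp add: add.commute)
    qed
    then show ?thesis unfolding flat_integrand_def sh by (intro arg_cong2[where f = "(*)"] prod.cong) auto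
  qed
  have "flat_integral a c \<beta> r n d = (\<integral>\<^sup>+z. flat_integrand a c \<beta> r n d (rot n e z) \<partial>leb n)"
    unfolding flat_integral_def by (rule nn_integral_leb_rot[OF on fm, symmetric])
  also have "\<dots> = (\<integral>\<^sup>+h. (\<integral>\<^sup>+u. flat_integrand a c \<beta> r n d (rot n e (merge {r..<n} {..<r} (h, u))) \<partial>leb r) \<partial>PiM {r..<n} (\<lambda>_. lborel))"
    by (rule nn_integral_leb_split[OF r measurable_compose[OF rot_measurable fm]])
  also have "\<dots> = (\<integral>\<^sup>+h. a (?H h) * section_integral \<beta> r {1..Suc r} (c (?H h)) ?D \<partial>PiM {r..<n} (\<lambda>_. lborel))"
    unfolding eq section_integral_def by (intro nn_integral_cong nn_integral_cmult section_integral_measurable_aux)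
  finally show ?thesis .
qed

definition scale_points :: "nat \<Rightarrow> nat \<Rightarrow> real \<Rightarrow> (nat \<Rightarrow> nat \<Rightarrow> real) \<Rightarrow> nat \<Rightarrow> nat \<Rightarrow> real" where
  "scale_points r n c d = (\<lambda>i\<in>{1..r}. \<lambda>k\<in>{..<n}. c * d i k)"

lemma scale_points_in_space: "scale_points r n c d \<in> space (PiM {1..r} (\<lambda>_. leb n))"
  by (auto simp: scale_points_def space_PiM)

lemma gdet_scale_points: "gdet r n (\<lambda>l. scale_points r n c d (Suc l)) = (c ^ r)\<^sup>2 * gdet r n (\<lambda>l. d (Suc l))"
proof -
  have "gdet r n (\<lambda>l. scale_points r n c d (Suc l)) = gdet r n (\<lambda>l k. c * d (Suc l) k)"
    by (rule gdet_cong) (simp add: scale_points_def)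
  then show ?thesis by (simp add: gdet_scale)
qed

lemma ip_scale_points: "i \<in> {1..r} \<Longrightarrow> ip n (scale_points r n c d i) w = c * ip n (d i) w"
  by (simp add: scale_points_def ip_def sum_distrib_left mult.assoc)

lemma adapted_scale_points:
  assumes "adapted r n e d"
  shows "adapted r n e (scale_points r n c d)"
  using assms unfolding adapted_def
proof (intro conjI allI impI; (elim conjE)?)
  fix l k assume l: "l < r" and k: "k < n"
    and a: "\<forall>l<r. \<forall>k<n. d (Suc l) k = (\<Sum>i\<le>l. ip n (d (Suc l)) (e i) * e i k)"
  have "scale_points r n c d (Suc l) k = c * d (Suc l) k" using l k by (simp add: scale_points_def)
  also have "d (Suc l) k = (\<Sum>i\<le>l. ip n (d (Suc l)) (e i) * e i k)" using a l k by blast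
  also have "c * \<dots> = (\<Sum>i\<le>l. ip n (scale_points r n c d (Suc l)) (e i) * e i k)"
    using l by (simp add: ip_scale_points sum_distrib_left mult.assoc)
  finally show "scale_points r n c d (Suc l) k = (\<Sum>i\<le>l. ip n (scale_points r n c d (Suc l)) (e i) * e i k)" .
qed

text \<open>Serves as \<open>a\<close> when the flat is moved to the origin. The weights then no
  longer depend on the height coordinates, and the indicator of the unit ball keeps the integral
  over these coordinates finite.\<close>

definition ball_indicator :: "real \<Rightarrow> ennreal" where
  "ball_indicator q = (if q < 1 then 1 else 0)"

lemma ball_indicator_measurable [measurable]: "ball_indicator \<in> borel_measurable borel"
  unfolding ball_indicator_def[abs_def] by measurable

text \<open>The section integral refers to a frame chosen separately for each \<open>d\<close>,
  without any measurability of the choice, so it cannot simply be integrated over \<open>d\<close>.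
  The factor on the left, a ball volume, allows it to be replaced by
  \<open>flat_integral ball_indicator\<close>, which mentions no frame and is measurable in
  \<open>d\<close>.\<close>

lemma flat_integral_factor:
  assumes r: "r \<le> n" and G: "gdet r n (\<lambda>l. d (Suc l)) \<noteq> 0"
    and d: "d \<in> space (PiM {1..r} (\<lambda>_. leb n))" and a: "a \<in> borel_measurable borel"
  shows "(\<integral>\<^sup>+h. ball_indicator (\<Sum>j\<in>{r..<n}. (h j)\<^sup>2) \<partial>PiM {r..<n} (\<lambda>_. lborel)) * flat_integral a (\<lambda>q. q) \<beta> r n d =
    (\<integral>\<^sup>+h. a (\<Sum>j\<in>{r..<n}. (h j)\<^sup>2) * ennreal (ball_power (real r / 2 + \<beta> * real (Suc r)) (\<Sum>j\<in>{r..<n}. (h j)\<^sup>2)) *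
      flat_integral ball_indicator (\<lambda>_. 0) \<beta> r n (scale_points r n (1 / sqrt (1 - (\<Sum>j\<in>{r..<n}. (h j)\<^sup>2))) d) \<partial>PiM {r..<n} (\<lambda>_. lborel))"
proof -
  obtain e where e: "adapted r n e d"
    using qr_frame[OF r, of "\<lambda>l. d (Suc l)"] unfolding adapted_def by metis
  let ?P = "PiM {r..<n} (\<lambda>_. lborel :: real measure)"
  let ?H = "\<lambda>h. \<Sum>j\<in>{r..<n}. (h j)\<^sup>2"
  let ?I = "{1..Suc r}"
  let ?D = "\<lambda>i j. ip n ((d(Suc r := \<lambda>_. 0)) i) (e j)"
  have Hm: "?H \<in> borel_measurable ?P" by measurable
  define V where "V = (\<integral>\<^sup>+h. ball_indicator (?H h) \<partial>?P)"
  have am: "(\<lambda>h. a (?H h)) \<in> borel_measurable ?P" by (rule measurable_compose[OF Hm a])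
  have sc: "flat_integral ball_indicator (\<lambda>_. 0) \<beta> r n (scale_points r n c d) = V * section_integral \<beta> r ?I 0 (\<lambda>i j. c * ?D i j)"
    if c: "c > 0" for c
  proof -
    have G': "gdet r n (\<lambda>l. scale_points r n c d (Suc l)) \<noteq> 0" using G c by (simp add: gdet_scale_points)
    have "section_integral \<beta> r ?I 0 (\<lambda>i j. ip n (((scale_points r n c d)(Suc r := \<lambda>_. 0)) i) (e j)) = section_integral \<beta> r ?I 0 (\<lambda>i j. c * ?D i j)"
      unfolding section_integral_def
    proof (intro nn_integral_cong prod.cong refl)
      fix u i assume i: "i \<in> ?I"
      have "ip n (((scale_points r n c d)(Suc r := \<lambda>_. 0)) i) (e j) = c * ?D i j" for j
        using i ip_scale_points[of i r n c d "e j"] by (cases "i = Suc r") (auto simp: ip_def)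
      then show "ennreal (ball_power \<beta> (0 + (\<Sum>j<r. (u j + ip n (((scale_points r n c d)(Suc r := \<lambda>_. 0)) i) (e j))\<^sup>2))) =
        ennreal (ball_power \<beta> (0 + (\<Sum>j<r. (u j + c * ?D i j)\<^sup>2)))" by simp
    qed
    then show ?thesis
      unfolding flat_integral_eq_section[OF adapted_scale_points[OF e] r G' scale_points_in_space ball_indicator_measurable borel_measurable_const]
      unfolding V_def by (subst nn_integral_multc) (auto intro: measurable_compose[OF Hm ball_indicator_measurable])
  qed
  have "V * flat_integral a (\<lambda>q. q) \<beta> r n d = V * (\<integral>\<^sup>+h. a (?H h) * section_integral \<beta> r ?I (?H h) ?D \<partial>?P)"
    using flat_integral_eq_section[OF e r G d a measurable_ident[unfolded id_def]] by simp
  also have "\<dots> = (\<integral>\<^sup>+h. V * (a (?H h) * section_integral \<beta> r ?I (?H h) ?D) \<partial>?P)"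
  proof (rule nn_integral_cmult[symmetric])
    have "(\<lambda>(h, u). \<Prod>i\<in>?I. ennreal (ball_power \<beta> (?H h + (\<Sum>j<r. (u j + ?D i j)\<^sup>2)))) \<in> borel_measurable (?P \<Otimes>\<^sub>M leb r)"
      unfolding case_prod_beta'
      by (intro borel_measurable_prod_ennreal' measurable_compose[OF _ measurable_ennreal]
        measurable_compose[OF _ ball_power_measurable] borel_measurable_add borel_measurable_const
        borel_measurable_sum borel_measurable_power measurable_compose[OF measurable_fst Hm] leb_component_measurable[OF measurable_snd]) auto
    then have "(\<lambda>h. section_integral \<beta> r ?I (?H h) ?D) \<in> borel_measurable ?P"
      unfolding section_integral_def by (rule sigma_finite_measure.borel_measurable_nn_integral[OF sigma_finite_leb])
    then show "(\<lambda>h. a (?H h) * section_integral \<beta> r ?I (?H h) ?D) \<in> borel_measurable ?P"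
      by (intro borel_measurable_times_ennreal am)
  qed
  also have "\<dots> = (\<integral>\<^sup>+h. a (?H h) * ennreal (ball_power (real r / 2 + \<beta> * real (Suc r)) (?H h)) *
      flat_integral ball_indicator (\<lambda>_. 0) \<beta> r n (scale_points r n (1 / sqrt (1 - ?H h)) d) \<partial>?P)"
  proof (rule nn_integral_cong)
    fix h :: "nat \<Rightarrow> real"
    show "V * (a (?H h) * section_integral \<beta> r ?I (?H h) ?D) = a (?H h) * ennreal (ball_power (real r / 2 + \<beta> * real (Suc r)) (?H h)) *
      flat_integral ball_indicator (\<lambda>_. 0) \<beta> r n (scale_points r n (1 / sqrt (1 - ?H h)) d)"
    proof (cases "?H h < 1")
      case True
      have "section_integral \<beta> r ?I (?H h) ?D = ennreal ((1 - ?H h) powr (real r / 2 + \<beta> * real (card ?I))) *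
          section_integral \<beta> r ?I 0 (\<lambda>i j. (1 / sqrt (1 - ?H h)) * ?D i j)"
        by (rule section_integral_scale[OF True]) simp
      moreover have "flat_integral ball_indicator (\<lambda>_. 0) \<beta> r n (scale_points r n (1 / sqrt (1 - ?H h)) d) = V * section_integral \<beta> r ?I 0 (\<lambda>i j. (1 / sqrt (1 - ?H h)) * ?D i j)"
        using True by (intro sc) simp
      moreover have "ball_power (real r / 2 + \<beta> * real (Suc r)) (?H h) = (1 - ?H h) powr (real r / 2 + \<beta> * real (card ?I))"
        using True by (simp add: ball_power_def)
      ultimately show ?thesis by (simp only: mult_ac)
    next
      case False
      have "section_integral \<beta> r ?I (?H h) ?D = (\<integral>\<^sup>+u. 0 \<partial>leb r)"
        unfolding section_integral_def
      proof (rule nn_integral_cong)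
        fix u
        have "ball_power \<beta> (?H h + (\<Sum>j<r. (u j + ?D (Suc r) j)\<^sup>2)) = 0"
          using False by (intro ball_power_eq_0) (simp add: sum_nonneg add_increasing2)
        then have "ennreal (ball_power \<beta> (?H h + (\<Sum>j<r. (u j + ?D (Suc r) j)\<^sup>2))) = 0" by simp
        then show "(\<Prod>i\<in>?I. ennreal (ball_power \<beta> (?H h + (\<Sum>j<r. (u j + ?D i j)\<^sup>2)))) = 0"
          by (intro prod_zero) (auto intro: bexI[of _ "Suc r"])
      qed
      then show ?thesis using False by (simp add: ball_power_eq_0)
    qed
  qed
  finally show ?thesis by (simp add: V_def)
qed

lemma leb_block_pair:
  shows "pair_sigma_finite (PiM {1..r} (\<lambda>_. leb n)) (PiM {r..<n} (\<lambda>_. lborel :: real measure))"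
    and "pair_sigma_finite (PiM {1..r} (\<lambda>_. leb n)) (leb n)"
proof -
  have 1: "sigma_finite_measure (PiM {1..r} (\<lambda>_. leb n))" by (rule leb_product.sigma_finite) simp
  have 2: "sigma_finite_measure (PiM {r..<n} (\<lambda>_. lborel :: real measure))" by (rule lborel_product.sigma_finite) simp
  show "pair_sigma_finite (PiM {1..r} (\<lambda>_. leb n)) (PiM {r..<n} (\<lambda>_. lborel :: real measure))"
    by (rule pair_sigma_finite.intro[OF 1 2])
  show "pair_sigma_finite (PiM {1..r} (\<lambda>_. leb n)) (leb n)"
    by (rule pair_sigma_finite.intro[OF 1 sigma_finite_leb])
qed

lemma scale_points_measurable:
  assumes C: "C \<in> borel_measurable N" and F: "F \<in> measurable N (PiM {1..r} (\<lambda>_. leb n))"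
  shows "(\<lambda>p. scale_points r n (C p) (F p)) \<in> measurable N (PiM {1..r} (\<lambda>_. leb n))"
  unfolding scale_points_def
proof (intro measurable_restrict)
  fix i k assume "i \<in> {1..r}" "k \<in> {..<n}"
  then show "(\<lambda>p. C p * F p i k) \<in> measurable N lborel"
    using C block_component_measurable[OF F, of i k] by simp
qed

text \<open>The square of \<open>r!\<close> times the volume of the simplex, with the last vertex as
  base point of the edges.\<close>

definition diff_gdet :: "nat \<Rightarrow> nat \<Rightarrow> (nat \<Rightarrow> nat \<Rightarrow> real) \<Rightarrow> real" where
  "diff_gdet r n x = gdet r n (\<lambda>j k. x (Suc j) k - x (Suc r) k)"

lemma diff_gdet_measurable:
  assumes F: "F \<in> measurable N (PiM {1..Suc r} (\<lambda>_. leb n))"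
  shows "(\<lambda>p. diff_gdet r n (F p)) \<in> borel_measurable N"
  unfolding diff_gdet_def
  by (intro gdet_measurable borel_measurable_diff block_component_measurable[OF F]) auto

lemma powr_measurable_const: "f \<in> borel_measurable M \<Longrightarrow> (\<lambda>x. f x powr (c::real)) \<in> borel_measurable M"
  by (intro powr_real_measurable borel_measurable_const)

text \<open>The substitution passes from the points to the edges \<open>d\<close> and the last
  vertex \<open>z\<close>. It preserves Lebesgue measure, and by \<open>gdet_shift\<close> the
  quotient of the two Gram determinants is the squared height.\<close>

lemma nn_integral_diff_gdet_flat:
  assumes \<phi>: "\<phi> \<in> borel_measurable borel"
  shows "(\<integral>\<^sup>+x. ennreal (diff_gdet r n x powr s) * \<phi> (gdet (Suc r) n (\<lambda>j. x (Suc j)) / diff_gdet r n x) * weight \<beta> n {1..Suc r} x \<partial>PiM {1..Suc r} (\<lambda>_. leb n))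
    = (\<integral>\<^sup>+d. ennreal (gdet r n (\<lambda>l. d (Suc l)) powr s) * flat_integral \<phi> (\<lambda>q. q) \<beta> r n d \<partial>PiM {1..r} (\<lambda>_. leb n))"
proof -
  let ?F = "\<lambda>x. ennreal (diff_gdet r n x powr s) * \<phi> (gdet (Suc r) n (\<lambda>j. x (Suc j)) / diff_gdet r n x) * weight \<beta> n {1..Suc r} x"
  let ?B = "PiM {1..r} (\<lambda>_. leb n)"
  interpret pair_sigma_finite ?B "leb n" by (rule leb_block_pair(2))
  have ins: "{1..Suc r} = insert (Suc r) {1..r}" by auto
  have Fm: "?F \<in> borel_measurable (PiM {1..Suc r} (\<lambda>_. leb n))"
  proof -
    have c: "(\<lambda>x. x i k) \<in> borel_measurable (PiM {1..Suc r} (\<lambda>_. leb n))" if "i \<in> {1..Suc r}" "k < n" for i k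
      using that by (intro block_component_measurable[where I = "{1..Suc r}" and n = n]) auto
    have d: "diff_gdet r n \<in> borel_measurable (PiM {1..Suc r} (\<lambda>_. leb n))"
      using diff_gdet_measurable[OF measurable_ident] by (simp add: id_def)
    show ?thesis
      by (intro borel_measurable_times_ennreal measurable_compose[OF powr_measurable_const[OF d] measurable_ennreal]
        measurable_compose[OF borel_measurable_divide[OF gdet_measurable d] \<phi>] weight_measurable c) auto
  qed
  define S where "S d z = (\<lambda>i\<in>{1..r}. \<lambda>k\<in>{..<n}. d i k + z k)(Suc r := z)" for d :: "nat \<Rightarrow> nat \<Rightarrow> real" and z
  have pt: "?F (S d z) = ennreal (gdet r n (\<lambda>l. d (Suc l)) powr s) * flat_integrand \<phi> (\<lambda>q. q) \<beta> r n d z" for d z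
  proof -
    have D: "diff_gdet r n (S d z) = gdet r n (\<lambda>l. d (Suc l))"
      unfolding diff_gdet_def by (rule gdet_cong) (simp add: S_def)
    have P: "gdet (Suc r) n (\<lambda>j. S d z (Suc j)) = gdet (Suc r) n ((\<lambda>l. d (Suc l))(r := z))"
      by (rule gdet_shift) (auto simp: S_def)
    have "weight \<beta> n {1..Suc r} (S d z) = (\<Prod>i\<in>{1..Suc r}. ennreal (ball_power \<beta>
     (sq_height r n d z + (ip n (vadd n ((d(Suc r := \<lambda>_. 0)) i) z) (vadd n ((d(Suc r := \<lambda>_. 0)) i) z) - sq_height r n d z))))"
      unfolding weight_def
    proof (rule prod.cong[OF refl])
      fix i assume i: "i \<in> {1..Suc r}"
      have "ip n (S d z i) (S d z i) = ip n (vadd n ((d(Suc r := \<lambda>_. 0)) i) z) (vadd n ((d(Suc r := \<lambda>_. 0)) i) z)"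
        using i by (intro ip_cong) (auto simp: S_def vadd_def)
      then show "ennreal (ball_power \<beta> (ip n (S d z i) (S d z i))) = ennreal (ball_power \<beta>
     (sq_height r n d z + (ip n (vadd n ((d(Suc r := \<lambda>_. 0)) i) z) (vadd n ((d(Suc r := \<lambda>_. 0)) i) z) - sq_height r n d z)))" by simp
    qed
    then show ?thesis unfolding D P flat_integrand_def sq_height_def[symmetric] by (simp only: mult.assoc)
  qed
  have fI: "(\<lambda>(d, z). flat_integrand \<phi> (\<lambda>q. q) \<beta> r n d z) \<in> borel_measurable (?B \<Otimes>\<^sub>M leb n)"
    unfolding case_prod_beta' by (rule flat_integrand_measurable[OF measurable_fst measurable_snd \<phi> measurable_ident[unfolded id_def]])
  have Gm: "(\<lambda>d. ennreal (gdet r n (\<lambda>l. d (Suc l)) powr s)) \<in> borel_measurable ?B"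
    by (intro measurable_compose[OF _ measurable_ennreal] powr_measurable_const gdet_measurable block_component_measurable[where I = "{1..r}" and n = n]) auto
  have "(\<integral>\<^sup>+x. ?F x \<partial>PiM {1..Suc r} (\<lambda>_. leb n)) = (\<integral>\<^sup>+z. (\<integral>\<^sup>+x. ?F (x(Suc r := z)) \<partial>?B) \<partial>leb n)"
    using leb_product.product_nn_integral_insert_rev[OF _ _ Fm[unfolded ins]] unfolding ins by simp
  also have "\<dots> = (\<integral>\<^sup>+z. (\<integral>\<^sup>+d. ?F (S d z) \<partial>?B) \<partial>leb n)"
  proof (rule nn_integral_cong)
    fix z assume z: "z \<in> space (leb n)"
    have "(\<lambda>x. x(Suc r := z)) \<in> measurable ?B (PiM {1..Suc r} (\<lambda>_. leb n))"
      unfolding ins using z by (intro measurable_fun_upd[where J = "{1..r}"]) auto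
    from nn_integral_block_shift[OF _ measurable_compose[OF this Fm], of z]
    show "(\<integral>\<^sup>+x. ?F (x(Suc r := z)) \<partial>?B) = (\<integral>\<^sup>+d. ?F (S d z) \<partial>?B)"
      unfolding S_def by simp
  qed
  also have "\<dots> = (\<integral>\<^sup>+z. (\<integral>\<^sup>+d. ennreal (gdet r n (\<lambda>l. d (Suc l)) powr s) * flat_integrand \<phi> (\<lambda>q. q) \<beta> r n d z \<partial>?B) \<partial>leb n)"
    unfolding pt ..
  also have "\<dots> = (\<integral>\<^sup>+d. (\<integral>\<^sup>+z. ennreal (gdet r n (\<lambda>l. d (Suc l)) powr s) * flat_integrand \<phi> (\<lambda>q. q) \<beta> r n d z \<partial>leb n) \<partial>?B)"
  proof (rule Fubini')
    show "(\<lambda>(d, z). ennreal (gdet r n (\<lambda>l. d (Suc l)) powr s) * flat_integrand \<phi> (\<lambda>q. q) \<beta> r n d z) \<in> borel_measurable (?B \<Otimes>\<^sub>M leb n)"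
      using fI measurable_compose[OF measurable_fst Gm] unfolding case_prod_beta' by (intro borel_measurable_times_ennreal)
  qed
  also have "\<dots> = (\<integral>\<^sup>+d. ennreal (gdet r n (\<lambda>l. d (Suc l)) powr s) * flat_integral \<phi> (\<lambda>q. q) \<beta> r n d \<partial>?B)"
    unfolding flat_integral_def
  proof (intro nn_integral_cong nn_integral_cmult)
    fix d assume "d \<in> space ?B"
    then show "flat_integrand \<phi> (\<lambda>q. q) \<beta> r n d \<in> borel_measurable (leb n)"
      using flat_integrand_measurable[OF measurable_const measurable_ident \<phi> measurable_ident[unfolded id_def]] by (simp add: id_def)
  qed
  finally show ?thesis .
qed

lemma scale_points_inverse:
  assumes d: "d \<in> space (PiM {1..r} (\<lambda>_. leb n))" and c: "c \<noteq> 0"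
  shows "scale_points r n (1 / c) (scale_points r n c d) = d"
proof (intro ext)
  fix i k
  show "scale_points r n (1 / c) (scale_points r n c d) i k = d i k"
  proof (cases "i \<in> {1..r}")
    case True
    then have "d i \<in> space (leb n)" using d by (auto simp: space_PiM)
    then show ?thesis using True c by (auto simp: scale_points_def space_PiM PiE_def extensional_def)
  next
    case False
    then show ?thesis using d by (auto simp: scale_points_def space_PiM PiE_def extensional_def)
  qed
qed

text \<open>Under the law of the points tilted by a power of the volume of the simplex, the squared
  distance of the origin from the affine hull has a Beta density: this is the scaling of a section
  of the unit ball by a flat at distance \<open>h\<close> with the factor \<open>sqrt (1 - h^2)\<close>.\<close>

lemma tilted_height_integral:
  fixes n r :: nat and \<beta> s :: real and \<phi> :: "real \<Rightarrow> ennreal"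
  assumes r: "r \<le> n" and s: "s > 0" and \<phi>: "\<phi> \<in> borel_measurable borel"
  defines "\<kappa> \<equiv> real r / 2 + \<beta> * real (Suc r) + (real (n * r) / 2 + real r * s)"
  defines "C \<equiv> (\<integral>\<^sup>+d. ennreal (gdet r n (\<lambda>l. d (Suc l)) powr s) * flat_integral ball_indicator (\<lambda>_. 0) \<beta> r n d \<partial>PiM {1..r} (\<lambda>_. leb n))"
  shows "(\<integral>\<^sup>+h. ball_indicator (\<Sum>j\<in>{r..<n}. (h j)\<^sup>2) \<partial>PiM {r..<n} (\<lambda>_. lborel)) *
     (\<integral>\<^sup>+x. ennreal (diff_gdet r n x powr s) * \<phi> (gdet (Suc r) n (\<lambda>j. x (Suc j)) / diff_gdet r n x) * weight \<beta> n {1..Suc r} x \<partial>PiM {1..Suc r} (\<lambda>_. leb n))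
   = (\<integral>\<^sup>+h. \<phi> (\<Sum>j\<in>{r..<n}. (h j)\<^sup>2) * ennreal (ball_power \<kappa> (\<Sum>j\<in>{r..<n}. (h j)\<^sup>2)) \<partial>PiM {r..<n} (\<lambda>_. lborel)) * C"
proof -
  let ?P = "PiM {r..<n} (\<lambda>_. lborel :: real measure)"
  let ?B = "PiM {1..r} (\<lambda>_. leb n)"
  let ?H = "\<lambda>h. \<Sum>j\<in>{r..<n}. (h j)\<^sup>2"
  let ?G = "\<lambda>d. ennreal (gdet r n (\<lambda>l. d (Suc l)) powr s)"
  let ?X = "flat_integral ball_indicator (\<lambda>_. 0) \<beta> r n"
  let ?\<kappa>0 = "real r / 2 + \<beta> * real (Suc r)"
  let ?w = "\<lambda>h. \<phi> (?H h) * ennreal (ball_power ?\<kappa>0 (?H h))"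
  let ?sc = "\<lambda>h d. scale_points r n (1 / sqrt (1 - ?H h)) d"
  interpret pair_sigma_finite ?B ?P by (rule leb_block_pair(1))
  define V where "V = (\<integral>\<^sup>+h. ball_indicator (?H h) \<partial>?P)"
  have Hm: "?H \<in> borel_measurable ?P" by measurable
  have Gm: "?G \<in> borel_measurable ?B"
    by (intro measurable_compose[OF _ measurable_ennreal] powr_measurable_const gdet_measurable block_component_measurable[where I = "{1..r}" and n = n]) auto
  have wm: "?w \<in> borel_measurable ?P"
    by (intro borel_measurable_times_ennreal measurable_compose[OF Hm \<phi>] measurable_compose[OF _ measurable_ennreal] measurable_compose[OF Hm ball_power_measurable])
  have XJ: "(\<lambda>p. ?X (?sc (snd p) (fst p))) \<in> borel_measurable (?B \<Otimes>\<^sub>M ?P)"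
  proof (rule flat_integral_measurable[OF scale_points_measurable ball_indicator_measurable borel_measurable_const])
    have "(\<lambda>h. 1 / sqrt (1 - ?H h)) \<in> borel_measurable ?P" using Hm by measurable
    then show "(\<lambda>p. 1 / sqrt (1 - ?H (snd p))) \<in> borel_measurable (?B \<Otimes>\<^sub>M ?P)"
      by (rule measurable_compose[OF measurable_snd])
  qed measurable
  have fm: "flat_integral \<phi> (\<lambda>q. q) \<beta> r n \<in> borel_measurable ?B"
    using flat_integral_measurable[OF measurable_ident \<phi> measurable_ident[unfolded id_def]] by (simp add: id_def)
  have Xm: "?X \<in> borel_measurable ?B"
    using flat_integral_measurable[OF measurable_ident ball_indicator_measurable borel_measurable_const] by (simp add: id_def)
  have "V * (\<integral>\<^sup>+d. ?G d * flat_integral \<phi> (\<lambda>q. q) \<beta> r n d \<partial>?B) = (\<integral>\<^sup>+d. V * (?G d * flat_integral \<phi> (\<lambda>q. q) \<beta> r n d) \<partial>?B)"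
    by (intro nn_integral_cmult[symmetric] borel_measurable_times_ennreal Gm fm)
  also have "\<dots> = (\<integral>\<^sup>+d. (\<integral>\<^sup>+h. ?w h * (?G d * ?X (?sc h d)) \<partial>?P) \<partial>?B)"
  proof (rule nn_integral_cong)
    fix d assume d: "d \<in> space ?B"
    show "V * (?G d * flat_integral \<phi> (\<lambda>q. q) \<beta> r n d) = (\<integral>\<^sup>+h. ?w h * (?G d * ?X (?sc h d)) \<partial>?P)"
    \<comment> \<open>Dependent edges contribute 0 on both sides, as
      \<open>0 powr s = 0\<close>.\<close>
    proof (cases "gdet r n (\<lambda>l. d (Suc l)) = 0")
      case False
      have m: "(\<lambda>h. ?w h * ?X (?sc h d)) \<in> borel_measurable ?P"
        using measurable_compose[OF measurable_Pair1'[OF d] XJ] by (intro borel_measurable_times_ennreal wm) simp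
      have "V * (?G d * flat_integral \<phi> (\<lambda>q. q) \<beta> r n d) = ?G d * (V * flat_integral \<phi> (\<lambda>q. q) \<beta> r n d)"
        by (simp only: mult_ac)
      also have "\<dots> = ?G d * (\<integral>\<^sup>+h. ?w h * ?X (?sc h d) \<partial>?P)"
        unfolding V_def flat_integral_factor[OF r False d \<phi>] ..
      also have "\<dots> = (\<integral>\<^sup>+h. ?G d * (?w h * ?X (?sc h d)) \<partial>?P)"
        by (rule nn_integral_cmult[symmetric, OF m])
      finally show ?thesis by (simp only: mult_ac)
    qed simp
  qed
  also have "\<dots> = (\<integral>\<^sup>+h. (\<integral>\<^sup>+d. ?w h * (?G d * ?X (?sc h d)) \<partial>?B) \<partial>?P)"
  proof (rule Fubini'[symmetric])
    show "(\<lambda>(d, h). ?w h * (?G d * ?X (?sc h d))) \<in> borel_measurable (?B \<Otimes>\<^sub>M ?P)"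
      unfolding case_prod_beta'
      by (intro borel_measurable_times_ennreal[OF _ borel_measurable_times_ennreal] measurable_compose[OF measurable_snd wm] measurable_compose[OF measurable_fst Gm] XJ)
  qed
  also have "\<dots> = (\<integral>\<^sup>+h. \<phi> (?H h) * ennreal (ball_power \<kappa> (?H h)) * C \<partial>?P)"
  proof (rule nn_integral_cong)
    fix h assume h: "h \<in> space ?P"
    have m: "(\<lambda>d. ?G d * ?X (?sc h d)) \<in> borel_measurable ?B"
      using measurable_compose[OF measurable_Pair2'[OF h] XJ] by (intro borel_measurable_times_ennreal Gm) simp
    show "(\<integral>\<^sup>+d. ?w h * (?G d * ?X (?sc h d)) \<partial>?B) = \<phi> (?H h) * ennreal (ball_power \<kappa> (?H h)) * C"
    proof (cases "?H h < 1")
      case True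
      \<comment> \<open>The edges are scaled back by \<open>c\<close>. Beyond the exponent from the
        section, Lebesgue measure in dimension \<open>n * r\<close> contributes
        \<open>n * r / 2\<close> and the power of the Gram determinant contributes
        \<open>r * s\<close>; together these form \<open>\<kappa>\<close>.\<close>
      define c where "c = sqrt (1 - ?H h)"
      have c: "c > 0" "c\<^sup>2 = 1 - ?H h" using True by (auto simp: c_def)
      let ?g = "\<lambda>d. ?G d * ?X (scale_points r n (1 / c) d)"
      have gm: "?g \<in> borel_measurable ?B" using m by (simp add: c_def)
      have cpow: "c ^ k = (1 - ?H h) powr (real k / 2)" for k
      proof -
        have "c ^ k = ((1 - ?H h) powr (1 / 2)) powr real k"
          using True c(1) by (simp add: c_def powr_half_sqrt powr_realpow)
        then show ?thesis by (simp add: powr_powr)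
      qed
      have "(\<integral>\<^sup>+d. ?g d \<partial>?B) = ennreal (c ^ (n * r)) * (\<integral>\<^sup>+d. ?g (scale_points r n c d) \<partial>?B)"
        using nn_integral_block_scale[OF _ gm c(1)] by (simp add: scale_points_def)
      also have "(\<integral>\<^sup>+d. ?g (scale_points r n c d) \<partial>?B) = (\<integral>\<^sup>+d. ennreal ((1 - ?H h) powr (real r * s)) * (?G d * ?X d) \<partial>?B)"
      proof (rule nn_integral_cong)
        fix d assume d: "d \<in> space ?B"
        have "gdet r n (\<lambda>l. d (Suc l)) \<ge> 0" using r by (rule gdet_nonneg)
        then have "gdet r n (\<lambda>l. scale_points r n c d (Suc l)) powr s = ((c ^ r)\<^sup>2) powr s * gdet r n (\<lambda>l. d (Suc l)) powr s"
          unfolding gdet_scale_points by (simp add: powr_mult)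
        also have "((c ^ r)\<^sup>2) powr s = (1 - ?H h) powr (real r * s)"
        proof -
          have "(c ^ r)\<^sup>2 = (1 - ?H h) powr real r"
            using True c(2) by (simp add: power_mult[symmetric] mult.commute[of r 2] power_mult powr_realpow)
          then show ?thesis by (simp add: powr_powr)
        qed
        finally show "?g (scale_points r n c d) = ennreal ((1 - ?H h) powr (real r * s)) * (?G d * ?X d)"
          using c(1) by (simp add: scale_points_inverse[OF d] ennreal_mult mult.assoc)
      qed
      also have "\<dots> = ennreal ((1 - ?H h) powr (real r * s)) * C"
        unfolding C_def by (intro nn_integral_cmult borel_measurable_times_ennreal Gm Xm)
      finally have gi: "(\<integral>\<^sup>+d. ?g d \<partial>?B) = ennreal (c ^ (n * r)) * (ennreal ((1 - ?H h) powr (real r * s)) * C)" .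
      have "(\<integral>\<^sup>+d. ?w h * (?G d * ?X (?sc h d)) \<partial>?B) = ?w h * (\<integral>\<^sup>+d. ?g d \<partial>?B)"
        unfolding c_def by (rule nn_integral_cmult[OF m])
      also have "\<dots> = \<phi> (?H h) * (ennreal (ball_power ?\<kappa>0 (?H h)) * ennreal (c ^ (n * r)) * ennreal ((1 - ?H h) powr (real r * s))) * C"
        unfolding gi by (simp only: mult_ac)
      also have "ennreal (ball_power ?\<kappa>0 (?H h)) * ennreal (c ^ (n * r)) * ennreal ((1 - ?H h) powr (real r * s)) = ennreal (ball_power \<kappa> (?H h))"
      proof -
        have "ball_power ?\<kappa>0 (?H h) * c ^ (n * r) * (1 - ?H h) powr (real r * s) = ball_power \<kappa> (?H h)"
          unfolding cpow \<kappa>_def using True by (simp add: ball_power_def powr_add mult.assoc)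
        then show ?thesis using c(1) by (simp add: ennreal_mult[symmetric])
      qed
      finally show ?thesis .
    qed (simp add: ball_power_eq_0)
  qed
  also have "\<dots> = (\<integral>\<^sup>+h. \<phi> (?H h) * ennreal (ball_power \<kappa> (?H h)) \<partial>?P) * C"
    by (intro nn_integral_multc borel_measurable_times_ennreal measurable_compose[OF Hm \<phi>] measurable_compose[OF _ measurable_ennreal] measurable_compose[OF Hm ball_power_measurable])
  finally show ?thesis
    unfolding V_def nn_integral_diff_gdet_flat[OF \<phi>] .
qed

section \<open>Moments of random simplices\<close>

definition moment_real :: "nat \<Rightarrow> real \<Rightarrow> nat \<Rightarrow> real \<Rightarrow> real" where
  "moment_real r \<nu> n s =
     (\<Prod>i<r. Gamma ((real n + s - real i) / 2) / Gamma ((real n - real i) / 2))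
     * (Gamma ((real n + \<nu>) / 2) / Gamma ((real n + \<nu> + s) / 2)) ^ (r + 1)
     * (Gamma (((real r + 1) * (\<nu> + real n + s) - 2 * real r) / 2)
        / Gamma (((real r + 1) * (\<nu> + real n) - 2 * real r + real r * s) / 2))"

text \<open>The normalised moment is a quotient of two Beta functions. The sum of the arguments in
  each of them does not depend on \<open>i\<close>, since
  \<open>(n - i) / 2 + (\<nu> + i) / 2 = (n + \<nu>) / 2\<close>; this explains why one Gamma
  quotient of the moment function occurs as a power.\<close>

lemma par_const_ratio:
  assumes i: "i < n" and \<nu>: "\<nu> > 0" and s: "s > 0" and c: "c > 0"
    and total: "(\<integral>\<^sup>+x. ennreal (ball_power ((\<nu> - 2) / 2) (ip n x x)) \<partial>leb n) = ennreal c"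
  shows "par_const n ((\<nu> - 2) / 2) s i = ennreal (c * (Gamma ((real n + s - real i) / 2) / Gamma ((real n - real i) / 2)
     * (Gamma ((real n + \<nu>) / 2) / Gamma ((real n + \<nu> + s) / 2))))"
proof -
  obtain K where K: "K > 0"
    "par_const n ((\<nu> - 2) / 2) s i = ennreal (K * Beta ((real (n - i) + s) / 2) ((\<nu> - 2) / 2 + real i / 2 + 1))"
    "(\<integral>\<^sup>+x. ennreal (ball_power ((\<nu> - 2) / 2) (ip n x x)) \<partial>leb n) = ennreal (K * Beta (real (n - i) / 2) ((\<nu> - 2) / 2 + real i / 2 + 1))"
    using par_const_eq[OF i, of "(\<nu> - 2) / 2" s] \<nu> s by auto
  have b: "(\<nu> - 2) / 2 + real i / 2 + 1 = (\<nu> + real i) / 2" by (simp add: field_simps)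
  have ni: "real (n - i) = real n - real i" "real n - real i > 0" using i by auto
  define B0 where "B0 = Beta ((real n - real i) / 2) ((\<nu> + real i) / 2)"
  define Bs where "Bs = Beta ((real n - real i + s) / 2) ((\<nu> + real i) / 2)"
  have B0: "B0 > 0" unfolding B0_def using ni \<nu> by (intro Beta_real_pos) auto
  have cK: "c = K * B0"
  proof -
    have "ennreal c = ennreal (K * B0)" using total K(3) unfolding b ni(1) B0_def by simp
    then show ?thesis using c K(1) B0 by simp
  qed
  have e: "(real n - real i) / 2 + (\<nu> + real i) / 2 = (real n + \<nu>) / 2"
    "(real n + s - real i) / 2 + (\<nu> + real i) / 2 = (real n + \<nu> + s) / 2"
    "(real n - real i + s) / 2 = (real n + s - real i) / 2" by (simp_all add: field_simps)
  have g: "Gamma ((\<nu> + real i) / 2) > 0" "Gamma ((real n - real i) / 2) > 0" "Gamma ((real n + \<nu>) / 2) > 0" "Gamma ((real n + \<nu> + s) / 2) > 0"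
    using \<nu> ni s by (auto intro!: Gamma_real_pos)
  have "Bs / B0 = Gamma ((real n + s - real i) / 2) / Gamma ((real n - real i) / 2) * (Gamma ((real n + \<nu>) / 2) / Gamma ((real n + \<nu> + s) / 2))"
  proof -
    have "(x * g / y) / (z * g / w) = x / z * (w / y)" if "g > 0" "y > 0" "z > 0" "w > 0" for x g y z w :: real
      using that by (simp add: field_simps)
    from this[OF g(1,4,2,3)] show ?thesis unfolding Bs_def B0_def Beta_def e .
  qed
  moreover have "K * Bs = c * (Bs / B0)" using cK B0 by simp
  ultimately show ?thesis using K(2) unfolding b ni(1) Bs_def by simp
qed

text \<open>The height formula is used twice, with the function 1 for the simplex and with
  \<open>q powr (s / 2)\<close> for the parallelotope. The two results differ only by a quotient of
  Beta functions, so the known parallelotope moment yields that of the simplex.\<close>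

lemma simplex_moment_unnormalized:
  assumes r: "r < n" and \<nu>: "\<nu> > 0" and s: "s > 0"
  obtains c :: real where "c > 0"
    "(\<integral>\<^sup>+x. ennreal (ball_power ((\<nu> - 2) / 2) (ip n x x)) \<partial>leb n) = ennreal c"
    "(\<integral>\<^sup>+x. ennreal (diff_gdet r n x powr (s / 2)) * weight ((\<nu> - 2) / 2) n {1..Suc r} x \<partial>PiM {1..Suc r} (\<lambda>_. leb n))
      = ennreal (c ^ Suc r * moment_real r \<nu> n s)"
proof -
  let ?\<beta> = "(\<nu> - 2) / 2"
  let ?W = "weight ?\<beta> n {1..Suc r}"
  let ?M = "PiM {1..Suc r} (\<lambda>_. leb n)"
  let ?P = "PiM {r..<n} (\<lambda>_. lborel :: real measure)"
  obtain K0 where K0: "K0 > 0"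
    "(\<integral>\<^sup>+x. ennreal (ball_power ?\<beta> (ip n x x)) \<partial>leb n) = ennreal (K0 * Beta (real (n - 0) / 2) (?\<beta> + real 0 / 2 + 1))"
    using par_const_eq[of 0 n ?\<beta> s] r \<nu> s by auto
  define c where "c = K0 * Beta (real (n - 0) / 2) (?\<beta> + real 0 / 2 + 1)"
  have c: "c > 0" unfolding c_def using K0(1) r \<nu> by (intro mult_pos_pos Beta_real_pos) (auto simp: field_simps)
  have total: "(\<integral>\<^sup>+x. ennreal (ball_power ?\<beta> (ip n x x)) \<partial>leb n) = ennreal c" using K0(2) by (simp only: c_def)
  define \<rho> where "\<rho> i = Gamma ((real n + s - real i) / 2) / Gamma ((real n - real i) / 2) * (Gamma ((real n + \<nu>) / 2) / Gamma ((real n + \<nu> + s) / 2))" for i :: nat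
  have \<rho>0: "\<rho> i > 0" if "i < n" for i
    unfolding \<rho>_def using that \<nu> s by (auto intro!: mult_pos_pos divide_pos_pos Gamma_real_pos)
  define J1 where "J1 = (\<integral>\<^sup>+x. ennreal (diff_gdet r n x powr (s / 2)) * ?W x \<partial>?M)"
  define JP where "JP = (\<integral>\<^sup>+x. ennreal (gdet (Suc r) n (\<lambda>j. x (Suc j)) powr (s / 2)) * ?W x \<partial>?M)"
  define p where "p = (\<Prod>i<Suc r. \<rho> i)"
  have p0: "p > 0" unfolding p_def using \<rho>0 r by (intro prod_pos) auto
  have JP: "JP = ennreal (c ^ Suc r * p)"
  proof -
    have "JP = (\<Prod>i<Suc r. par_const n ?\<beta> s i)"
      unfolding JP_def using r by (intro parallelotope_moment) simp
    also have "\<dots> = (\<Prod>i<Suc r. ennreal (c * \<rho> i))"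
      unfolding \<rho>_def using r by (intro prod.cong par_const_ratio \<nu> s c total) auto
    also have "\<dots> = ennreal (\<Prod>i<Suc r. c * \<rho> i)"
      using c \<rho>0 r by (intro prod_ennreal) (auto intro!: mult_nonneg_nonneg less_imp_le)
    also have "(\<Prod>i<Suc r. c * \<rho> i) = c ^ Suc r * p"
      unfolding p_def prod.distrib by simp
    finally show ?thesis .
  qed
  define \<kappa> where "\<kappa> = real r / 2 + ?\<beta> * real (Suc r) + (real (n * r) / 2 + real r * (s / 2))"
  have \<kappa>1: "\<kappa> + 1 = ((real r + 1) * \<nu> - real r + real r * (real n + s)) / 2"
    by (simp add: \<kappa>_def field_simps)
  have \<kappa>: "\<kappa> > -1"
  proof -
    have "real r * 1 \<le> real r * (real n + s)" using r s by (intro mult_left_mono) auto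
    moreover have "(real r + 1) * \<nu> > 0" using \<nu> by simp
    ultimately have "\<kappa> + 1 > 0" unfolding \<kappa>1 by simp
    then show ?thesis by simp
  qed
  have A: "finite {r..<n}" "{r..<n} \<noteq> {}" "card {r..<n} = n - r" using r by auto
  have nr: "real (n - r) = real n - real r" "real n - real r > 0" using r by auto
  let ?u = "unit_ball_vol (real (n - r)) * (real (n - r) / 2)"
  have u: "?u > 0" using r by (intro mult_pos_pos unit_ball_vol_pos) auto
  define B0 where "B0 = Beta ((real n - real r) / 2) (\<kappa> + 1)"
  define Bs where "Bs = Beta ((real n - real r + s) / 2) (\<kappa> + 1)"
  have B: "B0 > 0" "Bs > 0" unfolding B0_def Bs_def using nr \<kappa> s by (auto intro!: Beta_real_pos)
  define V where "V = (\<integral>\<^sup>+h. ball_indicator (\<Sum>j\<in>{r..<n}. (h j)\<^sup>2) \<partial>?P)"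
  have V: "V \<noteq> 0" "V \<noteq> \<infinity>"
  proof -
    have "V = (\<integral>\<^sup>+h. ennreal (ball_power 0 (\<Sum>j\<in>{r..<n}. (h j)\<^sup>2)) \<partial>?P)"
      unfolding V_def by (intro nn_integral_cong) (simp add: ball_indicator_def ball_power_def)
    also have "\<dots> = ennreal (?u * Beta ((real n - real r) / 2) 1)"
      using nn_integral_ball_power(2)[OF A(1,2), of 0 0] A(3) nr by simp
    finally have "V = ennreal (?u * Beta ((real n - real r) / 2) 1)" .
    moreover have "?u * Beta ((real n - real r) / 2) 1 > 0" using u nr by (intro mult_pos_pos[OF u] Beta_real_pos) auto
    ultimately obtain q where "q > 0" "V = ennreal q" by blast
    then show "V \<noteq> 0" "V \<noteq> \<infinity>" by auto
  qed
  define C where "C = (\<integral>\<^sup>+d. ennreal (gdet r n (\<lambda>l. d (Suc l)) powr (s / 2)) * flat_integral ball_indicator (\<lambda>_. 0) ?\<beta> r n d \<partial>PiM {1..r} (\<lambda>_. leb n))"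
  have s2: "s / 2 > 0" using s by simp
  have "V * J1 = ennreal (?u * B0) * C"
  proof -
    have "V * J1 = (\<integral>\<^sup>+h. 1 * ennreal (ball_power \<kappa> (\<Sum>j\<in>{r..<n}. (h j)\<^sup>2)) \<partial>?P) * C"
      using tilted_height_integral[OF less_imp_le[OF r] s2, of "\<lambda>_. 1" ?\<beta>]
      unfolding V_def J1_def C_def \<kappa>_def by simp
    then show ?thesis using nn_integral_ball_power(2)[OF A(1,2) _ \<kappa>, of 0] A(3) nr by (simp add: B0_def)
  qed
  moreover have "V * JP = ennreal (?u * Bs) * C"
  proof -
    have "JP = (\<integral>\<^sup>+x. ennreal (diff_gdet r n x powr (s / 2)) * ennreal ((gdet (Suc r) n (\<lambda>j. x (Suc j)) / diff_gdet r n x) powr (s / 2)) * ?W x \<partial>?M)"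
      unfolding JP_def
    proof (rule nn_integral_cong)
      fix x
      have D: "diff_gdet r n x \<ge> 0" unfolding diff_gdet_def using r by (intro gdet_nonneg) simp
      have G: "gdet (Suc r) n (\<lambda>j. x (Suc j)) \<ge> 0" using r by (intro gdet_nonneg) simp
      show "ennreal (gdet (Suc r) n (\<lambda>j. x (Suc j)) powr (s / 2)) * ?W x =
        ennreal (diff_gdet r n x powr (s / 2)) * ennreal ((gdet (Suc r) n (\<lambda>j. x (Suc j)) / diff_gdet r n x) powr (s / 2)) * ?W x"
      \<comment> \<open>If the edges are dependent, base times height makes the larger Gram
        determinant vanish as well, so the division by 0 is harmless.\<close>
      proof (cases "diff_gdet r n x = 0")
        case True
        let ?d = "\<lambda>j k. x (Suc j) k - x (Suc r) k"
        obtain e where e: "orthonormal_frame n n e"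
          "\<And>l k. l < r \<Longrightarrow> k < n \<Longrightarrow> ?d l k = (\<Sum>i\<le>l. ip n (?d l) (e i) * e i k)"
          using qr_frame[of r n ?d] r by auto
        have "gdet (Suc r) n (\<lambda>j. x (Suc j)) = gdet (Suc r) n (?d(r := x (Suc r)))"
          by (rule gdet_shift) auto
        also have "\<dots> = gdet r n ?d * (\<Sum>j\<in>{r..<n}. (ip n (x (Suc r)) (e j))\<^sup>2)"
          using r by (intro gdet_height[OF e(1) _ e(2)]) auto
        also have "\<dots> = 0" using True by (simp add: diff_gdet_def)
        finally show ?thesis using True by simp
      next
        case False
        then have "gdet (Suc r) n (\<lambda>j. x (Suc j)) = diff_gdet r n x * (gdet (Suc r) n (\<lambda>j. x (Suc j)) / diff_gdet r n x)" by simp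
        then have "gdet (Suc r) n (\<lambda>j. x (Suc j)) powr (s / 2) = diff_gdet r n x powr (s / 2) * (gdet (Suc r) n (\<lambda>j. x (Suc j)) / diff_gdet r n x) powr (s / 2)"
          using D G by (metis divide_nonneg_nonneg powr_mult)
        then show ?thesis by (simp add: ennreal_mult)
      qed
    qed
    then have "V * JP = (\<integral>\<^sup>+h. ennreal ((\<Sum>j\<in>{r..<n}. (h j)\<^sup>2) powr (s / 2)) * ennreal (ball_power \<kappa> (\<Sum>j\<in>{r..<n}. (h j)\<^sup>2)) \<partial>?P) * C"
      using tilted_height_integral[OF less_imp_le[OF r] s2, of "\<lambda>q. ennreal (q powr (s / 2))" ?\<beta>]
      unfolding V_def C_def \<kappa>_def by simp
    then show ?thesis using nn_integral_ball_power(1)[OF A(1,2) less_imp_le[OF s] \<kappa>] A(3) nr by (simp add: Bs_def)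
  qed
  \<comment> \<open>The comparison is made by cross-multiplication, so the common factor
    \<open>C\<close> is allowed to be any extended value; \<open>V\<close> is positive and finite
    and can be cancelled.\<close>
  ultimately have "V * (J1 * ennreal Bs) = V * (JP * ennreal B0)"
  proof -
    assume 1: "V * J1 = ennreal (?u * B0) * C" and 2: "V * JP = ennreal (?u * Bs) * C"
    have uB0: "ennreal (?u * B0) = ennreal ?u * ennreal B0"
      by (rule ennreal_mult[OF less_imp_le[OF u] less_imp_le[OF B(1)]])
    have uBs: "ennreal (?u * Bs) = ennreal ?u * ennreal Bs"
      by (rule ennreal_mult[OF less_imp_le[OF u] less_imp_le[OF B(2)]])
    have "V * (J1 * ennreal Bs) = (V * J1) * ennreal Bs" by (simp only: mult.assoc)
    also have "\<dots> = ennreal ?u * ennreal B0 * ennreal Bs * C" unfolding 1 uB0 by (simp only: mult_ac)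
    finally have "V * (J1 * ennreal Bs) = ennreal ?u * ennreal B0 * ennreal Bs * C" .
    moreover have "V * (JP * ennreal B0) = ennreal ?u * ennreal B0 * ennreal Bs * C"
    proof -
      have "V * (JP * ennreal B0) = (V * JP) * ennreal B0" by (simp only: mult.assoc)
      also have "\<dots> = ennreal ?u * ennreal B0 * ennreal Bs * C" unfolding 2 uBs by (simp only: mult_ac)
      finally show ?thesis .
    qed
    ultimately show ?thesis by simp
  qed
  then have J: "J1 * ennreal Bs = JP * ennreal B0" using V by (simp add: ennreal_mult_cancel_left)
  have "J1 = J1 * (ennreal Bs * ennreal (1 / Bs))" using B by (simp add: ennreal_mult[symmetric])
  also have "\<dots> = ennreal (c ^ Suc r * p) * ennreal B0 * ennreal (1 / Bs)" using J JP by (simp add: mult.assoc[symmetric])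
  also have "\<dots> = ennreal (c ^ Suc r * (p * (B0 / Bs)))" using B c p0 by (simp add: ennreal_mult[symmetric] mult.assoc)
  also have "p * (B0 / Bs) = moment_real r \<nu> n s"
  proof -
    let ?X = "((real r + 1) * (\<nu> + real n + s) - 2 * real r) / 2"
    let ?Y = "((real r + 1) * (\<nu> + real n) - 2 * real r + real r * s) / 2"
    \<comment> \<open>\<open>?X\<close> and \<open>?Y\<close> are the sums of the arguments of the
      two Beta functions. Their common factor \<open>Gamma (\<kappa> + 1)\<close> cancels, and what
      remains cancels the factor \<open>i = r\<close> of the parallelotope moment.\<close>
    have e: "(real n - real r) / 2 + (\<kappa> + 1) = ?Y" "(real n - real r + s) / 2 + (\<kappa> + 1) = ?X"
      "(real n - real r + s) / 2 = (real n + s - real r) / 2"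
      unfolding \<kappa>1 by (simp_all add: field_simps)
    have h: "(real n - real r) / 2 > 0" "(real n + s - real r) / 2 > 0" "\<kappa> + 1 > 0" using nr s \<kappa> by auto
    have pos: "?X > 0" "?Y > 0" using e h by linarith+
    have g: "Gamma ?X > 0" "Gamma ?Y > 0" "Gamma (\<kappa> + 1) > 0" "Gamma ((real n - real r) / 2) > 0" "Gamma ((real n + s - real r) / 2) > 0"
      using pos \<kappa> nr s by (auto intro!: Gamma_real_pos)
    have BB: "B0 / Bs = Gamma ((real n - real r) / 2) / Gamma ((real n + s - real r) / 2) * (Gamma ?X / Gamma ?Y)"
      unfolding B0_def Bs_def Beta_def e(1,2) unfolding e(3) using g by (simp add: field_simps)
    have pp: "p = (\<Prod>i<r. Gamma ((real n + s - real i) / 2) / Gamma ((real n - real i) / 2))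
      * (Gamma ((real n + s - real r) / 2) / Gamma ((real n - real r) / 2))
      * (Gamma ((real n + \<nu>) / 2) / Gamma ((real n + \<nu> + s) / 2)) ^ (r + 1)"
      unfolding p_def \<rho>_def prod.distrib[of _ "\<lambda>i. Gamma ((real n + \<nu>) / 2) / Gamma ((real n + \<nu> + s) / 2)"] by simp
    show ?thesis unfolding pp BB moment_real_def using g by simp
  qed
  finally show ?thesis using that[of c] c total by (simp add: J1_def)
qed

lemma moment_fun_of_real: "moment_fun r \<nu> n (complex_of_real s) = complex_of_real (moment_real r \<nu> n s)"
proof -
  have G: "complex_of_real (Gamma x) = Gamma (complex_of_real x)" for x
    by (rule Gamma_complex_of_real[symmetric])
  show ?thesis
    unfolding moment_fun_def moment_real_def of_real_mult of_real_power of_real_prod of_real_divide[of "Gamma _"] G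
    by simp
qed

section \<open>The volume of a simplex\<close>

text \<open>The weight of the last vertex is eliminated; the remaining weights range over the
  standard simplex.\<close>

lemma simplex_hull_eq:
  "simplex_hull n {1..r+1} x = {(\<lambda>k\<in>{..<n}. (\<Sum>j<r. a j * (x (Suc j) k - x (Suc r) k)) + x (Suc r) k) | a. (\<forall>j<r. 0 \<le> a j) \<and> sum a {..<r} \<le> 1}"
    (is "?L = ?R")
proof -
  have I: "{1..r+1} = insert (Suc r) (Suc ` {..<r})" by (auto simp: image_iff Bex_def) presburger
  have sum_I: "(\<Sum>i\<in>{1..r+1}. f i) = f (Suc r) + (\<Sum>j<r. f (Suc j))" for f :: "nat \<Rightarrow> real"
    unfolding I by (subst sum.insert) (auto simp: sum.reindex)
  have pt: "(\<Sum>i\<in>{1..r+1}. u i * x i k) = (\<Sum>j<r. u (Suc j) * (x (Suc j) k - x (Suc r) k)) + x (Suc r) k"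
    if "sum u {1..r+1} = 1" for u k
  proof -
    have "u (Suc r) = 1 - (\<Sum>j<r. u (Suc j))" using that unfolding sum_I by simp
    then have "u (Suc r) * x (Suc r) k = x (Suc r) k - (\<Sum>j<r. u (Suc j) * x (Suc r) k)"
      by (simp add: left_diff_distrib sum_distrib_right)
    then show ?thesis unfolding sum_I by (simp add: right_diff_distrib sum_subtractf)
  qed
  show ?thesis
  proof (intro equalityI subsetI)
    fix y assume "y \<in> ?L"
    then obtain u where u: "y = (\<lambda>k\<in>{..<n}. \<Sum>i\<in>{1..r+1}. u i * x i k)" "\<forall>i\<in>{1..r+1}. 0 \<le> u i" "sum u {1..r+1} = 1"
      by (auto simp: simplex_hull_def)
    have "0 \<le> u (Suc r)" using u(2) by auto
    then have "(\<Sum>j<r. u (Suc j)) \<le> 1" using u(3) unfolding sum_I by linarith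
    moreover have "\<forall>j<r. 0 \<le> u (Suc j)" using u(2) by auto
    ultimately show "y \<in> ?R" unfolding u(1) pt[OF u(3)] by (intro CollectI exI[of _ "\<lambda>j. u (Suc j)"]) auto
  next
    fix y assume "y \<in> ?R"
    then obtain a where a: "y = (\<lambda>k\<in>{..<n}. (\<Sum>j<r. a j * (x (Suc j) k - x (Suc r) k)) + x (Suc r) k)"
      "\<forall>j<r. 0 \<le> a j" "sum a {..<r} \<le> 1" by auto
    define u where "u i = (if i = Suc r then 1 - sum a {..<r} else a (i - 1))" for i
    have us: "u (Suc j) = a j" if "j < r" for j using that by (simp add: u_def)
    have s: "sum u {1..r+1} = 1" unfolding sum_I using us by (simp add: u_def)
    have "\<forall>i\<in>{1..r+1}. 0 \<le> u i" using a(2,3) by (auto simp: u_def)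
    moreover have "y = (\<lambda>k\<in>{..<n}. \<Sum>i\<in>{1..r+1}. u i * x i k)"
      unfolding a(1) pt[OF s] using us by (intro restrict_ext) simp
    ultimately show "y \<in> ?L" using s unfolding simplex_hull_def by blast
  qed
qed

lemma null_sets_hyperplane:
  assumes k: "k < r" and v: "v k \<noteq> 0"
  shows "{b \<in> space (leb r). ip r b v = s} \<in> null_sets (leb r)"
proof -
  let ?H = "{b \<in> space (leb r). ip r b v = s}"
  have Hm: "?H \<in> sets (leb r)"
  proof -
    have "(\<lambda>b. ip r b v) \<in> borel_measurable (leb r)"
      by (intro measurable_ip leb_component_measurable[of _ _ r] borel_measurable_const) auto
    then show ?thesis by measurable
  qed
  have ins: "{..<r} = insert k ({..<r} - {k})" using k by auto
  have indm: "(indicator ?H :: _ \<Rightarrow> ennreal) \<in> borel_measurable (PiM (insert k ({..<r} - {k})) (\<lambda>_. lborel))"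
    unfolding ins[symmetric] using Hm by measurable
  have "emeasure (leb r) ?H = (\<integral>\<^sup>+b. indicator ?H b \<partial>leb r)" using Hm by simp
  also have "\<dots> = (\<integral>\<^sup>+x. (\<integral>\<^sup>+y. indicator ?H (x(k := y)) \<partial>lborel) \<partial>PiM ({..<r} - {k}) (\<lambda>_. lborel))"
    using lborel_product.product_nn_integral_insert[OF _ _ indm] unfolding ins[symmetric] by simp
  also have "\<dots> = (\<integral>\<^sup>+x. 0 \<partial>PiM ({..<r} - {k}) (\<lambda>_. lborel :: real measure))"
  proof (rule nn_integral_cong)
    fix x :: "nat \<Rightarrow> real"
    let ?c = "(s - (\<Sum>l\<in>{..<r} - {k}. x l * v l)) / v k"
    have "ip r (x(k := y)) v = y * v k + (\<Sum>l\<in>{..<r} - {k}. x l * v l)" for y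
      unfolding ip_def using k by (subst sum.remove[of _ k]) (auto intro!: sum.cong)
    then have le: "indicator ?H (x(k := y)) \<le> (indicator {?c} y :: ennreal)" for y
      using v by (auto simp: indicator_def field_simps)
    have "(\<integral>\<^sup>+y. indicator ?H (x(k := y)) \<partial>lborel) \<le> (\<integral>\<^sup>+y. indicator {?c} y \<partial>lborel)"
      by (intro nn_integral_mono le)
    also have "\<dots> = 0" by simp
    finally show "(\<integral>\<^sup>+y. indicator ?H (x(k := y)) \<partial>lborel) = 0" by simp
  qed
  finally show ?thesis using Hm by (simp add: null_sets_def)
qed

lemma gdet_zero_normal:
  assumes "gdet r r d = 0"
  obtains v k where "k < r" "v k \<noteq> 0" "\<And>j. j < r \<Longrightarrow> ip r (d j) v = 0"
proof -
  let ?D = "Matrix.mat r r (\<lambda>(i, j). d i j)"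
  have "gdet r r d = (Determinant.det ?D)\<^sup>2 * gdet r r coord_vec"
  proof (rule gdet_linear)
    show "d i k = (\<Sum>l<r. d i l * coord_vec l k)" if "k < r" for i k
      using that by (simp add: coord_vec_def if_distrib[of "\<lambda>c. _ * c"] cong: if_cong)
  qed
  moreover have "gdet r r coord_vec = (\<Prod>i<r. ip r (coord_vec i) (coord_vec i))"
    by (rule gdet_orthogonal) (simp add: ip_coord_vec coord_vec_def[of _ _])
  then have "gdet r r coord_vec = 1" by (simp add: ip_coord_vec) (simp add: coord_vec_def)
  ultimately have "Determinant.det ?D = 0" using assms by simp
  then obtain w where w: "w \<in> carrier_vec r" "w \<noteq> 0\<^sub>v r" "?D *\<^sub>v w = 0\<^sub>v r"
    using det_0_iff_vec_prod_zero[of ?D r] by auto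
  obtain k where k: "k < r" "w $ k \<noteq> 0"
    using w(1,2) by (metis carrier_vecD eq_vecI index_zero_vec(1) index_zero_vec(2))
  have "ip r (d j) (\<lambda>k. w $ k) = 0" if "j < r" for j
  proof -
    have "(?D *\<^sub>v w) $ j = ip r (d j) (\<lambda>k. w $ k)"
      using that w(1) by (simp add: ip_def scalar_prod_def lessThan_atLeast0)
    then show ?thesis using w(3) that by simp
  qed
  then show ?thesis using that[of k "\<lambda>k. w $ k"] k by blast
qed

text \<open>An affine image of the standard simplex, whose volume is \<open>1 / fact r\<close>. In
  the degenerate case the hull lies in a hyperplane.\<close>

lemma measure_simplex_hull:
  "measure (leb r) (simplex_hull r {1..r+1} c) = sqrt (diff_gdet r r c) / fact r"
proof -
  define d where "d j k = c (Suc j) k - c (Suc r) k" for j k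
  define z where "z = c (Suc r)"
  let ?std = "\<lambda>a :: nat \<Rightarrow> real. (\<forall>j<r. 0 \<le> a j) \<and> sum a {..<r} \<le> 1"
  let ?W = "simplex_hull r {1..r+1} c"
  have W: "?W = {(\<lambda>k\<in>{..<r}. (\<Sum>j<r. a j * d j k) + z k) | a. ?std a}"
    unfolding d_def z_def by (rule simplex_hull_eq)
  have G: "diff_gdet r r c = gdet r r d" unfolding diff_gdet_def d_def[abs_def] by (rule refl)
  show ?thesis
  proof (cases "gdet r r d = 0")
    case True
    obtain v k where v: "k < r" "v k \<noteq> 0" "\<And>j. j < r \<Longrightarrow> ip r (d j) v = 0"
      by (rule gdet_zero_normal[OF True, of thesis]) metis
    have "?W \<subseteq> {b \<in> space (leb r). ip r b v = ip r z v}"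
    proof
      fix b assume "b \<in> ?W"
      then obtain a where a: "b = (\<lambda>k\<in>{..<r}. (\<Sum>j<r. a j * d j k) + z k)" unfolding W by blast
      have "ip r b v = ip r (\<lambda>k. (\<Sum>j<r. a j * d j k) + z k) v" unfolding a by (intro ip_cong) auto
      also have "\<dots> = ip r z v" using v(3) by (simp add: ip_add_left ip_sum_left ip_scale_left)
      finally show "b \<in> {b \<in> space (leb r). ip r b v = ip r z v}" using a by (auto simp: space_PiM)
    qed
    moreover have null: "{b \<in> space (leb r). ip r b v = ip r z v} \<in> null_sets (leb r)"
      using v(1,2) by (rule null_sets_hyperplane)
    \<comment> \<open>Measurable or not, the degenerate hull has measure 0: outside the
      sigma-algebra \<open>measure\<close> is 0 by default.\<close>
    ultimately have "measure (leb r) ?W = 0"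
    proof (cases "?W \<in> sets (leb r)")
      case True
      then have "?W \<in> null_sets (leb r)" using null_sets_subset[OF null] \<open>?W \<subseteq> _\<close> by blast
      then show ?thesis by (simp add: measure_def null_sets_def)
    qed (simp add: measure_notin_sets)
    then show ?thesis using True G by simp
  next
    case False
    obtain B where B: "\<And>j l. j < r \<Longrightarrow> l < r \<Longrightarrow> (\<Sum>k<r. B j k * d l k) = (if j = l then 1 else 0)"
      "\<And>k l. k < r \<Longrightarrow> l < r \<Longrightarrow> (\<Sum>j<r. B j l * d j k) = (if k = l then 1 else 0)"
    proof (rule gdet_inverse[OF False])
      fix B assume f1: "\<And>j l. j < r \<Longrightarrow> l < r \<Longrightarrow> (\<Sum>k<r. B j k * d l k) = (if j = l then 1 else 0)"
        and f2: "\<And>k l. k < r \<Longrightarrow> l < r \<Longrightarrow> (\<Sum>j<r. B j l * d j k) = (if k = l then 1 else 0)"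
      show thesis by (rule that[OF f1 f2])
    qed
    \<comment> \<open>The weights of \<open>b\<close>, obtained by inverting the affine
      parametrisation. They turn membership in the hull into finitely many measurable
      inequalities.\<close>
    define cf where "cf b j = (\<Sum>k<r. B j k * (b k - z k))" for b j
    have cf_pt: "cf (\<lambda>k\<in>{..<r}. (\<Sum>j<r. a j * d j k) + z k) j = a j" if j: "j < r" for a j
    proof -
      have "cf (\<lambda>k\<in>{..<r}. (\<Sum>j<r. a j * d j k) + z k) j = (\<Sum>k<r. \<Sum>l<r. a l * (B j k * d l k))"
        unfolding cf_def by (intro sum.cong) (auto simp: sum_distrib_left mult_ac)
      also have "\<dots> = (\<Sum>l<r. a l * (\<Sum>k<r. B j k * d l k))"
        by (subst sum.swap) (simp add: sum_distrib_left)
      also have "\<dots> = (\<Sum>l<r. if j = l then a l else 0)" using B(1)[OF j] by (intro sum.cong) auto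
      finally show ?thesis using j by simp
    qed
    have pt_cf: "(\<lambda>k\<in>{..<r}. (\<Sum>j<r. cf b j * d j k) + z k) = b" if b: "b \<in> space (leb r)" for b
    proof
      fix k
      show "(\<lambda>k\<in>{..<r}. (\<Sum>j<r. cf b j * d j k) + z k) k = b k"
      proof (cases "k < r")
        case True
        have "(\<Sum>j<r. cf b j * d j k) = (\<Sum>j<r. \<Sum>l<r. (b l - z l) * (B j l * d j k))"
          unfolding cf_def sum_distrib_right by (intro sum.cong refl) (simp add: mult_ac)
        also have "\<dots> = (\<Sum>l<r. (b l - z l) * (\<Sum>j<r. B j l * d j k))"
          by (subst sum.swap) (simp add: sum_distrib_left)
        also have "\<dots> = (\<Sum>l<r. if k = l then b l - z l else 0)" using B(2)[OF True] by (intro sum.cong) auto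
        finally show ?thesis using True by simp
      next
        case False
        then show ?thesis using b by (auto simp: space_PiM PiE_def extensional_def)
      qed
    qed
    have std_cong: "?std a \<longleftrightarrow> ?std a'" if "\<And>j. j < r \<Longrightarrow> a j = a' j" for a a'
      using that by (metis (mono_tags, lifting) lessThan_iff sum.cong)
    have W': "?W = {b \<in> space (leb r). ?std (cf b)}"
    proof (intro equalityI subsetI)
      fix b assume "b \<in> ?W"
      then obtain a where a: "b = (\<lambda>k\<in>{..<r}. (\<Sum>j<r. a j * d j k) + z k)" "?std a" unfolding W by blast
      then have "b \<in> space (leb r)" by (auto simp: space_PiM)
      moreover have "?std (cf b)" using std_cong[of "cf b" a] cf_pt a by simp
      ultimately show "b \<in> {b \<in> space (leb r). ?std (cf b)}" by blast
    next
      fix b assume b: "b \<in> {b \<in> space (leb r). ?std (cf b)}"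
      then show "b \<in> ?W" unfolding W using pt_cf[of b] by (intro CollectI exI[of _ "cf b"]) auto
    qed
    have cfm: "(\<lambda>b. cf b j) \<in> borel_measurable (leb r)" for j
      unfolding cf_def by (intro borel_measurable_sum borel_measurable_times borel_measurable_diff borel_measurable_const leb_component_measurable[of _ _ r]) auto
    have stdm: "{b \<in> space (leb r). ?std (f b)} \<in> sets (leb r)" if "\<And>j. j < r \<Longrightarrow> (\<lambda>b. f b j) \<in> borel_measurable (leb r)" for f
    proof -
      have S: "(\<lambda>b. sum (f b) {..<r}) \<in> borel_measurable (leb r)" using that by (intro borel_measurable_sum) auto
      have "{b \<in> space (leb r). sum (f b) {..<r} \<le> 1} \<in> sets (leb r)"
        by (rule borel_measurable_le[OF S borel_measurable_const])
      moreover have "{b \<in> space (leb r). \<forall>j\<in>{..<r}. 0 \<le> f b j} \<in> sets (leb r)"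
        using that by (intro sets.sets_Collect_finite_All borel_measurable_le borel_measurable_const) auto
      ultimately have "{b \<in> space (leb r). \<forall>j\<in>{..<r}. 0 \<le> f b j} \<inter> {b \<in> space (leb r). sum (f b) {..<r} \<le> 1} \<in> sets (leb r)"
        by (intro sets.Int)
      also have "{b \<in> space (leb r). \<forall>j\<in>{..<r}. 0 \<le> f b j} \<inter> {b \<in> space (leb r). sum (f b) {..<r} \<le> 1} = {b \<in> space (leb r). ?std (f b)}"
        by auto
      finally show ?thesis .
    qed
    have Wm: "?W \<in> sets (leb r)" unfolding W' by (rule stdm[OF cfm])
    define f where "f b = (indicator ?W (\<lambda>k\<in>{..<r}. b k + z k) :: ennreal)" for b
    have indm: "(indicator ?W :: _ \<Rightarrow> ennreal) \<in> borel_measurable (leb r)" using Wm by simp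
    have fm: "f \<in> borel_measurable (leb r)"
      unfolding f_def[abs_def] by (rule measurable_compose[OF leb_affine_measurable(1) indm])
    have "emeasure (leb r) ?W = (\<integral>\<^sup>+b. indicator ?W b \<partial>leb r)" using Wm by simp
    also have "\<dots> = (\<integral>\<^sup>+b. f b \<partial>leb r)"
      unfolding f_def by (rule nn_integral_lborel_shift[symmetric, OF _ indm]) simp
    also have "\<dots> = ennreal (sqrt (gdet r r d)) * (\<integral>\<^sup>+a. f (\<lambda>k\<in>{..<r}. \<Sum>j<r. a j * d j k) \<partial>leb r)"
      by (rule nn_integral_leb_linear[OF False fm, symmetric])
    also have "(\<integral>\<^sup>+a. f (\<lambda>k\<in>{..<r}. \<Sum>j<r. a j * d j k) \<partial>leb r) = (\<integral>\<^sup>+a. indicator {a \<in> space (leb r). ?std a} a \<partial>leb r)"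
    proof (rule nn_integral_cong)
      fix a assume a: "a \<in> space (leb r)"
      let ?p = "\<lambda>k\<in>{..<r}. (\<Sum>j<r. a j * d j k) + z k"
      have "(\<lambda>k\<in>{..<r}. (\<lambda>k\<in>{..<r}. \<Sum>j<r. a j * d j k) k + z k) = ?p" by (auto simp: restrict_def)
      moreover have "?p \<in> ?W \<longleftrightarrow> ?std a"
      proof -
        have "?p \<in> space (leb r)" by (auto simp: space_PiM)
        then have "?p \<in> ?W \<longleftrightarrow> ?std (cf ?p)" unfolding W' by blast
        also have "\<dots> \<longleftrightarrow> ?std a" by (rule std_cong) (rule cf_pt)
        finally show ?thesis .
      qed
      ultimately show "f (\<lambda>k\<in>{..<r}. \<Sum>j<r. a j * d j k) = indicator {a \<in> space (leb r). ?std a} a"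
        using a unfolding f_def by (simp only: indicator_def mem_Collect_eq simp_thms)
    qed
    also have "\<dots> = emeasure (leb r) {a \<in> space (leb r). ?std a}"
      by (rule nn_integral_indicator, rule stdm) (auto intro!: leb_component_measurable[of _ _ r])
    also have "{a \<in> space (leb r). ?std a} = {x. (\<forall>i\<in>{..<r}. 0 \<le> x i) \<and> sum x {..<r} \<le> 1} \<inter> space (leb r)" by auto
    also have "emeasure (leb r) \<dots> = ennreal (1 ^ card {..<r} / fact (card {..<r}))"
      using emeasure_std_simplex_aux[of "{..<r}" 1] by simp
    also have "ennreal (sqrt (gdet r r d)) * ennreal (1 ^ card {..<r} / fact (card {..<r})) = ennreal (sqrt (gdet r r d) / fact r)"
      by (simp add: ennreal_mult[symmetric] gdet_nonneg)
    finally have "emeasure (leb r) ?W = ennreal (sqrt (gdet r r d) / fact r)" .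
    then show ?thesis by (simp add: measure_def G gdet_nonneg)
  qed
qed

lemma flat_point_frame:
  assumes e: "orthonormal_frame n r e"
  shows "ip n (\<lambda>k. \<Sum>j<r. a j * e j k) (\<lambda>k. \<Sum>j<r. b j * e j k) = ip r a b"
proof -
  have "ip n (\<lambda>k. \<Sum>j<r. a j * e j k) (\<lambda>k. \<Sum>j<r. b j * e j k) = (\<Sum>j<r. b j * (\<Sum>i<r. a i * ip n (e i) (e j)))"
    by (simp add: ip_sum_left ip_sum_right ip_scale_left ip_scale_right sum_distrib_left mult_ac) (rule sum.swap)
  also have "\<dots> = (\<Sum>j<r. b j * (\<Sum>i<r. if i = j then a i else 0))"
    by (intro sum.cong arg_cong2[where f = "(*)"]) (auto simp: orthonormal_frameD[OF e])
  also have "\<dots> = ip r a b" by (simp add: ip_def mult.commute)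
  finally show ?thesis .
qed

lemma flat_point_inj:
  assumes e: "orthonormal_frame n r e" and c: "c \<in> space (leb r)" "c' \<in> space (leb r)"
    and eq: "flat_point n r p e c = flat_point n r p e c'"
  shows "c = c'"
proof
  fix i
  show "c i = c' i"
  proof (cases "i < r")
    case True
    have "(\<Sum>j<r. (c j - c' j) * e j k) = 0" if "k < n" for k
      using fun_cong[OF eq, of k] that by (simp add: flat_point_def left_diff_distrib sum_subtractf)
    then have "ip n (\<lambda>k. \<Sum>j<r. (c j - c' j) * e j k) (\<lambda>k. \<Sum>j<r. (c j - c' j) * e j k) = 0" by (simp add: ip_def)
    then have "ip r (\<lambda>j. c j - c' j) (\<lambda>j. c j - c' j) = 0" unfolding flat_point_frame[OF e] .
    from ip_self_eq_0[OF this True] show ?thesis by simp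
  next
    case False
    then show ?thesis using c by (auto simp: space_PiM PiE_def extensional_def)
  qed
qed

text \<open>For the description by \<open>THE\<close>, every admissible choice of base point and
  frame has to give the same value. In the coordinates of any such frame the inner products of the
  edges are the same as in the ambient space, hence so is the Gram determinant. QR decomposition of
  the edges provides one admissible frame.\<close>

lemma flat_volume_simplex_hull:
  assumes r: "r \<le> n" and x: "\<And>i. i \<in> {1..r+1} \<Longrightarrow> x i \<in> space (leb n)"
  shows "flat_volume n r (simplex_hull n {1..r+1} x) = sqrt (diff_gdet r n x) / fact r"
proof -
  let ?S = "simplex_hull n {1..r+1} x"
  have vol: "measure (leb r) {c \<in> space (leb r). flat_point n r p e c \<in> ?S} = sqrt (diff_gdet r n x) / fact r"
    if e: "orthonormal_frame n r e" and S: "?S \<subseteq> flat_point n r p e ` space (leb r)" for p e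
  proof -
    have xS: "x i \<in> ?S" if i: "i \<in> {1..r+1}" for i
    proof -
      let ?u = "\<lambda>l. if l = i then 1 else 0 :: real"
      have "x i = (\<lambda>k\<in>{..<n}. \<Sum>l\<in>{1..r+1}. ?u l * x l k)"
      proof
        fix k
        have "(\<Sum>l\<in>{1..r+1}. ?u l * x l k) = (\<Sum>l\<in>{1..r+1}. if l = i then x l k else 0)" by (intro sum.cong) auto
        also have "\<dots> = x i k" by (subst sum.delta) (use i in auto)
        finally have eq: "(\<Sum>l\<in>{1..r+1}. ?u l * x l k) = x i k" .
        show "x i k = (\<lambda>k\<in>{..<n}. \<Sum>l\<in>{1..r+1}. ?u l * x l k) k"
        proof (cases "k < n")
          case True
          then show ?thesis unfolding restrict_apply eq by simp
        next
          case False
          then show ?thesis using x[OF i] unfolding restrict_apply eq by (simp add: space_PiM PiE_def extensional_def)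
        qed
      qed
      moreover have "sum ?u {1..r+1} = 1" by (subst sum.delta) (use i in auto)
      moreover have "\<forall>l\<in>{1..r+1}. 0 \<le> ?u l" by simp
      ultimately show ?thesis unfolding simplex_hull_def mem_Collect_eq by (intro exI[of _ ?u] conjI)
    qed
    have "\<forall>i\<in>{1..r+1}. \<exists>c. c \<in> space (leb r) \<and> x i = flat_point n r p e c"
      using xS S by blast
    then obtain c where c: "\<And>i. i \<in> {1..r+1} \<Longrightarrow> c i \<in> space (leb r)" "\<And>i. i \<in> {1..r+1} \<Longrightarrow> x i = flat_point n r p e (c i)"
      by metis
    have comb: "(\<lambda>k\<in>{..<n}. \<Sum>i\<in>{1..r+1}. u i * x i k) = flat_point n r p e (\<lambda>k\<in>{..<r}. \<Sum>i\<in>{1..r+1}. u i * c i k)"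
      if u: "sum u {1..r+1} = 1" for u
    proof
      fix k
      show "(\<lambda>k\<in>{..<n}. \<Sum>i\<in>{1..r+1}. u i * x i k) k = flat_point n r p e (\<lambda>k\<in>{..<r}. \<Sum>i\<in>{1..r+1}. u i * c i k) k"
      proof (cases "k < n")
        case True
        have "(\<Sum>i\<in>{1..r+1}. u i * x i k) = (\<Sum>i\<in>{1..r+1}. u i * p k + (\<Sum>j<r. u i * c i j * e j k))"
          using True by (intro sum.cong) (simp_all add: c(2) flat_point_def distrib_left sum_distrib_left mult.assoc)
        also have "\<dots> = p k + (\<Sum>i\<in>{1..r+1}. \<Sum>j<r. u i * c i j * e j k)"
          using u by (simp only: sum.distrib sum_distrib_right[symmetric] mult_1)
        also have "(\<Sum>i\<in>{1..r+1}. \<Sum>j<r. u i * c i j * e j k) = (\<Sum>j<r. (\<Sum>i\<in>{1..r+1}. u i * c i j) * e j k)"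
          by (subst sum.swap) (simp only: sum_distrib_right)
        finally show ?thesis using True by (simp add: flat_point_def)
      qed (simp add: flat_point_def)
    qed
    have hullc: "{c' \<in> space (leb r). flat_point n r p e c' \<in> ?S} = simplex_hull r {1..r+1} c"
    proof (intro equalityI subsetI)
      fix c' assume "c' \<in> {c' \<in> space (leb r). flat_point n r p e c' \<in> ?S}"
      then have c': "c' \<in> space (leb r)" "flat_point n r p e c' \<in> ?S" by auto
      then obtain u where u: "flat_point n r p e c' = (\<lambda>k\<in>{..<n}. \<Sum>i\<in>{1..r+1}. u i * x i k)" "\<forall>i\<in>{1..r+1}. 0 \<le> u i" "sum u {1..r+1} = 1"
        unfolding simplex_hull_def by blast
      have "c' = (\<lambda>k\<in>{..<r}. \<Sum>i\<in>{1..r+1}. u i * c i k)"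
        using u(1) unfolding comb[OF u(3)] by (intro flat_point_inj[OF e c'(1)]) (auto simp: space_PiM)
      then show "c' \<in> simplex_hull r {1..r+1} c" using u(2,3) unfolding simplex_hull_def by blast
    next
      fix c' assume "c' \<in> simplex_hull r {1..r+1} c"
      then obtain u where u: "c' = (\<lambda>k\<in>{..<r}. \<Sum>i\<in>{1..r+1}. u i * c i k)" "\<forall>i\<in>{1..r+1}. 0 \<le> u i" "sum u {1..r+1} = 1"
        unfolding simplex_hull_def by blast
      have "flat_point n r p e c' \<in> ?S"
        unfolding u(1) comb[OF u(3), symmetric] simplex_hull_def using u(2,3) by blast
      moreover have "c' \<in> space (leb r)" unfolding u(1) by (auto simp: space_PiM)
      ultimately show "c' \<in> {c' \<in> space (leb r). flat_point n r p e c' \<in> ?S}" by blast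
    qed
    have "diff_gdet r n x = diff_gdet r r c"
      unfolding diff_gdet_def gdet_def
    proof (intro arg_cong[where f = Determinant.det] cong_mat refl)
      fix i j assume ij: "i < r" "j < r"
      have d: "x (Suc l) k - x (Suc r) k = (\<Sum>j<r. (c (Suc l) j - c (Suc r) j) * e j k)" if "l < r" "k < n" for l k
        using that by (simp add: c(2) flat_point_def left_diff_distrib sum_subtractf)
      have "ip n (\<lambda>k. x (Suc i) k - x (Suc r) k) (\<lambda>k. x (Suc j) k - x (Suc r) k) =
        ip n (\<lambda>k. \<Sum>l<r. (c (Suc i) l - c (Suc r) l) * e l k) (\<lambda>k. \<Sum>l<r. (c (Suc j) l - c (Suc r) l) * e l k)"
        using ij by (intro ip_cong d) auto
      also have "\<dots> = ip r (\<lambda>l. c (Suc i) l - c (Suc r) l) (\<lambda>l. c (Suc j) l - c (Suc r) l)"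
        by (rule flat_point_frame[OF e])
      finally show "(case (i, j) of (i, j) \<Rightarrow> ip n (\<lambda>k. x (Suc i) k - x (Suc r) k) (\<lambda>k. x (Suc j) k - x (Suc r) k)) =
         (case (i, j) of (i, j) \<Rightarrow> ip r (\<lambda>l. c (Suc i) l - c (Suc r) l) (\<lambda>l. c (Suc j) l - c (Suc r) l))" by simp
    qed
    then show ?thesis unfolding hullc measure_simplex_hull by simp
  qed
  have ex: "\<exists>p e. orthonormal_frame n r e \<and> ?S \<subseteq> flat_point n r p e ` space (leb r)"
  proof -
    let ?d = "\<lambda>j k. x (Suc j) k - x (Suc r) k"
    obtain e where e: "orthonormal_frame n n e"
      and d: "\<And>l k. l < r \<Longrightarrow> k < n \<Longrightarrow> ?d l k = (\<Sum>i\<le>l. ip n (?d l) (e i) * e i k)"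
    proof (rule qr_frame[OF r])
      fix e assume f1: "orthonormal_frame n n e"
        and f2: "\<And>l k. l < r \<Longrightarrow> k < n \<Longrightarrow> ?d l k = (\<Sum>i\<le>l. ip n (?d l) (e i) * e i k)"
      show thesis by (rule that[OF f1 f2])
    qed
    have "?S \<subseteq> flat_point n r (x (Suc r)) e ` space (leb r)"
    proof
      fix y assume "y \<in> ?S"
      then obtain a where a: "y = (\<lambda>k\<in>{..<n}. (\<Sum>j<r. a j * ?d j k) + x (Suc r) k)"
        unfolding simplex_hull_eq by blast
      let ?c = "\<lambda>i\<in>{..<r}. \<Sum>j\<in>{i..<r}. a j * ip n (?d j) (e i)"
      have "y = flat_point n r (x (Suc r)) e ?c"
      proof
        fix k
        show "y k = flat_point n r (x (Suc r)) e ?c k"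
        proof (cases "k < n")
          case True
          have "(\<Sum>j<r. a j * ?d j k) = (\<Sum>j<r. \<Sum>i\<le>j. a j * ip n (?d j) (e i) * e i k)"
            using d[OF _ True] by (intro sum.cong) (simp_all add: sum_distrib_left mult.assoc)
          also have "\<dots> = (\<Sum>i<r. \<Sum>j\<in>{i..<r}. a j * ip n (?d j) (e i) * e i k)" by (rule sum_triangular_swap)
          also have "\<dots> = (\<Sum>i<r. ?c i * e i k)" by (intro sum.cong) (simp_all add: sum_distrib_right)
          finally show ?thesis using True unfolding a flat_point_def by simp
        qed (simp add: a flat_point_def)
      qed
      moreover have "?c \<in> space (leb r)" by (auto simp: space_PiM)
      ultimately show "y \<in> flat_point n r (x (Suc r)) e ` space (leb r)" by blast
    qed
    then show ?thesis using orthonormal_frame_mono[OF e r] by blast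
  qed
  show ?thesis
    unfolding flat_volume_def
  proof (rule the_equality)
    obtain p e where pe: "orthonormal_frame n r e" "?S \<subseteq> flat_point n r p e ` space (leb r)" using ex by blast
    show "\<exists>p e. orthonormal_frame n r e \<and> ?S \<subseteq> flat_point n r p e ` space (leb r) \<and>
      sqrt (diff_gdet r n x) / fact r = measure (leb r) {c \<in> space (leb r). flat_point n r p e c \<in> ?S}"
      by (rule exI[of _ p], rule exI[of _ e], intro conjI) (rule pe, rule pe, rule vol[OF pe, symmetric])
  next
    fix v
    assume "\<exists>p e. orthonormal_frame n r e \<and> ?S \<subseteq> flat_point n r p e ` space (leb r) \<and>
      v = measure (leb r) {c \<in> space (leb r). flat_point n r p e c \<in> ?S}"
    then obtain p e where pe: "orthonormal_frame n r e" "?S \<subseteq> flat_point n r p e ` space (leb r)"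
      and v: "v = measure (leb r) {c \<in> space (leb r). flat_point n r p e c \<in> ?S}" by (elim exE conjE)
    show "v = sqrt (diff_gdet r n x) / fact r" unfolding v by (rule vol[OF pe])
  qed
qed

section \<open>The Beta model\<close>

lemma density_PiM:
  fixes M :: "'a measure" and I :: "'i set" and g :: "'a \<Rightarrow> ennreal"
  assumes M: "sigma_finite_measure M" and I: "finite I" and g: "g \<in> borel_measurable M"
    and p: "prob_space (density M g)"
  shows "PiM I (\<lambda>_. density M g) = density (PiM I (\<lambda>_. M)) (\<lambda>x. \<Prod>i\<in>I. g (x i))"
proof -
  interpret S: sigma_finite_measure M by fact
  interpret P: prob_space "density M g" by fact
  interpret D: product_sigma_finite "\<lambda>_ :: 'i. density M g" by unfold_locales
  interpret L: product_sigma_finite "\<lambda>_ :: 'i. M" by unfold_locales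
  have gm: "(\<lambda>x. \<Prod>i\<in>I. g (x i)) \<in> borel_measurable (PiM I (\<lambda>_. M))"
    by (intro borel_measurable_prod_ennreal' measurable_compose[OF _ g] measurable_component_singleton)
  have "density (PiM I (\<lambda>_. M)) (\<lambda>x. \<Prod>i\<in>I. g (x i)) = PiM I (\<lambda>_. density M g)"
  proof (rule D.PiM_eqI[OF I])
    show "sets (density (PiM I (\<lambda>_. M)) (\<lambda>x. \<Prod>i\<in>I. g (x i))) = sets (PiM I (\<lambda>_. density M g))"
      unfolding sets_density by (rule sets_PiM_cong) auto
    fix A assume "\<And>i. i \<in> I \<Longrightarrow> A i \<in> sets (density M g)"
    then have A: "A i \<in> sets M" if "i \<in> I" for i using that by simp
    have "emeasure (density (PiM I (\<lambda>_. M)) (\<lambda>x. \<Prod>i\<in>I. g (x i))) (Pi\<^sub>E I A)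
      = (\<integral>\<^sup>+x. (\<Prod>i\<in>I. g (x i)) * indicator (Pi\<^sub>E I A) x \<partial>PiM I (\<lambda>_. M))"
      by (rule emeasure_density[OF gm]) (use A I in \<open>intro sets_PiM_I_finite\<close>)
    also have "\<dots> = (\<integral>\<^sup>+x. (\<Prod>i\<in>I. g (x i) * indicator (A i) (x i)) \<partial>PiM I (\<lambda>_. M))"
    proof (rule nn_integral_cong)
      fix x assume x: "x \<in> space (PiM I (\<lambda>_. M))"
      have "indicator (Pi\<^sub>E I A) x = (\<Prod>i\<in>I. indicator (A i) (x i) :: ennreal)"
      proof (cases "x \<in> Pi\<^sub>E I A")
        case True
        then show ?thesis by (auto simp: PiE_def Pi_def intro!: prod.neutral[symmetric])
      next
        case False
        then obtain j where "j \<in> I" "x j \<notin> A j" using x by (auto simp: space_PiM PiE_def)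
        then have "(\<Prod>i\<in>I. indicator (A i) (x i) :: ennreal) = 0" using I by (intro prod_zero bexI[of _ j]) auto
        then show ?thesis using False by simp
      qed
      then show "(\<Prod>i\<in>I. g (x i)) * indicator (Pi\<^sub>E I A) x = (\<Prod>i\<in>I. g (x i) * indicator (A i) (x i))"
        by (simp only: prod.distrib)
    qed
    also have "\<dots> = (\<Prod>i\<in>I. \<integral>\<^sup>+y. g y * indicator (A i) y \<partial>M)"
      using I A g by (intro L.product_nn_integral_prod borel_measurable_times_ennreal borel_measurable_indicator) auto
    also have "\<dots> = (\<Prod>i\<in>I. emeasure (density M g) (A i))"
      using A g by (intro prod.cong refl emeasure_density[symmetric]) auto
    finally show "emeasure (density (PiM I (\<lambda>_. M)) (\<lambda>x. \<Prod>i\<in>I. g (x i))) (Pi\<^sub>E I A) = (\<Prod>i\<in>I. emeasure (density M g) (A i))" .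
  qed
  then show ?thesis by (rule sym)
qed

text \<open>The total mass of the unnormalised density, hence the reciprocal of the constant of the
  Beta model.\<close>

definition ball_const :: "real \<Rightarrow> nat \<Rightarrow> real" where
  "ball_const \<nu> n = unit_ball_vol (real n) * (real n / 2) * Beta (real n / 2) (\<nu> / 2)"

definition ball_law :: "real \<Rightarrow> nat \<Rightarrow> (nat \<Rightarrow> real) measure" where
  "ball_law \<nu> n = density (leb n) (\<lambda>x. ennreal (ball_power ((\<nu> - 2) / 2) (ip n x x) / ball_const \<nu> n))"

lemma enorm_eq_ip: "enorm n x = sqrt (ip n x x)"
  by (simp add: L2_set_def ip_def power2_eq_square)

lemma ball_const_pos:
  assumes "n \<ge> 1" "\<nu> > 0"
  shows "ball_const \<nu> n > 0"
  unfolding ball_const_def using assms by (intro mult_pos_pos Beta_real_pos) auto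

lemma nn_integral_ball_const:
  assumes n: "n \<ge> 1" and \<nu>: "\<nu> > 0"
  shows "(\<integral>\<^sup>+x. ennreal (ball_power ((\<nu> - 2) / 2) (ip n x x)) \<partial>leb n) = ennreal (ball_const \<nu> n)"
proof -
  have A: "finite {..<n}" "{..<n} \<noteq> {}" using n by (simp_all add: lessThan_empty_iff)
  have e: "(\<nu> - 2) / 2 + 1 = \<nu> / 2" by (simp add: field_simps)
  have "(\<nu> - 2) / 2 > -1" using \<nu> by simp
  from nn_integral_ball_power(2)[OF A order_refl this] show ?thesis
    unfolding ball_const_def e ip_def power2_eq_square by simp
qed

lemma ball_density_measurable:
  "(\<lambda>x. ennreal (ball_power \<beta> (ip n x x) / c)) \<in> borel_measurable (leb n)"
  by (intro measurable_compose[OF _ measurable_ennreal] borel_measurable_divide borel_measurable_const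
      measurable_compose[OF _ ball_power_measurable] measurable_ip leb_component_measurable[of _ _ n]) auto

lemma sets_ball_law [simp, measurable_cong]: "sets (ball_law \<nu> n) = sets (leb n)"
  by (simp add: ball_law_def)

lemma space_ball_law [simp]: "space (ball_law \<nu> n) = space (leb n)"
  by (simp add: ball_law_def)

lemma nn_integral_ball_law:
  assumes n: "n \<ge> 1" and \<nu>: "\<nu> > 0" and f: "f \<in> borel_measurable (leb n)"
  shows "(\<integral>\<^sup>+x. f x \<partial>ball_law \<nu> n) =
    ennreal (1 / ball_const \<nu> n) * (\<integral>\<^sup>+x. ennreal (ball_power ((\<nu> - 2) / 2) (ip n x x)) * f x \<partial>leb n)"
proof -
  have "(\<integral>\<^sup>+x. f x \<partial>ball_law \<nu> n) = (\<integral>\<^sup>+x. ennreal (ball_power ((\<nu> - 2) / 2) (ip n x x) / ball_const \<nu> n) * f x \<partial>leb n)"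
    unfolding ball_law_def by (rule nn_integral_density[OF ball_density_measurable f])
  also have "\<dots> = (\<integral>\<^sup>+x. ennreal (1 / ball_const \<nu> n) * (ennreal (ball_power ((\<nu> - 2) / 2) (ip n x x)) * f x) \<partial>leb n)"
  proof (rule nn_integral_cong)
    fix x
    have "ennreal (ball_power ((\<nu> - 2) / 2) (ip n x x) / ball_const \<nu> n)
      = ennreal (1 / ball_const \<nu> n) * ennreal (ball_power ((\<nu> - 2) / 2) (ip n x x))"
      using ball_const_pos[OF n \<nu>] by (simp add: ennreal_mult[symmetric])
    then show "ennreal (ball_power ((\<nu> - 2) / 2) (ip n x x) / ball_const \<nu> n) * f x
      = ennreal (1 / ball_const \<nu> n) * (ennreal (ball_power ((\<nu> - 2) / 2) (ip n x x)) * f x)"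
      by (simp only: mult.assoc)
  qed
  also have "\<dots> = ennreal (1 / ball_const \<nu> n) * (\<integral>\<^sup>+x. ennreal (ball_power ((\<nu> - 2) / 2) (ip n x x)) * f x \<partial>leb n)"
    by (intro nn_integral_cmult borel_measurable_times_ennreal ball_power_ip_measurable f)
  finally show ?thesis .
qed

lemma prob_space_ball_law:
  assumes n: "n \<ge> 1" and \<nu>: "\<nu> > 0"
  shows "prob_space (ball_law \<nu> n)"
proof
  have "emeasure (ball_law \<nu> n) (space (ball_law \<nu> n)) = (\<integral>\<^sup>+x. 1 \<partial>ball_law \<nu> n)" by simp
  also have "\<dots> = ennreal (1 / ball_const \<nu> n) * ennreal (ball_const \<nu> n)"
    using nn_integral_ball_law[OF n \<nu>, of "\<lambda>_. 1"] nn_integral_ball_const[OF n \<nu>] by simp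
  also have "\<dots> = 1" using ball_const_pos[OF n \<nu>] by (simp add: ennreal_mult[symmetric])
  finally show "emeasure (ball_law \<nu> n) (space (ball_law \<nu> n)) = 1" .
qed

lemma beta_model_eq:
  assumes n: "n \<ge> 1" and \<nu>: "\<nu> > 0"
  shows "beta_model \<nu> n = ball_law \<nu> n"
proof -
  have G: "Gamma (real n / 2) > 0" "Gamma (\<nu> / 2) > 0" "Gamma ((real n + \<nu>) / 2) > 0"
    using n \<nu> by (auto intro!: Gamma_real_pos)
  have G0: "Gamma (real n / 2) \<noteq> 0" using G(1) by linarith
  have "Gamma (real n / 2 + 1) = real n / 2 * Gamma (real n / 2)"
    using n by (intro Gamma_plus1) (auto elim!: nonpos_Ints_cases)
  moreover have "real n / 2 + \<nu> / 2 = (real n + \<nu>) / 2" by (simp add: field_simps)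
  ultimately have bc: "ball_const \<nu> n = pi powr (real n / 2) * (Gamma (\<nu> / 2) / Gamma ((real n + \<nu>) / 2))"
    unfolding ball_const_def unit_ball_vol_def Beta_def using G G0 n by (simp add: field_simps)
  have pm: "pi powr (- real n / 2) = 1 / pi powr (real n / 2)"
    using powr_minus_divide[of pi "real n / 2"] by simp
  have "1 / ball_const \<nu> n = pi powr (- real n / 2) * (Gamma ((real n + \<nu>) / 2) / Gamma (\<nu> / 2))"
    unfolding bc pm by simp
  then have c: "pi powr (- real n / 2) * (Gamma ((real n + \<nu>) / 2) / Gamma (\<nu> / 2)) * b = b / ball_const \<nu> n" for b
    by (metis mult.commute times_divide_eq_right mult.right_neutral)
  have "(if enorm n x < 1 then pi powr (- real n / 2) * (Gamma ((real n + \<nu>) / 2) / Gamma (\<nu> / 2)) * (1 - (enorm n x)\<^sup>2) powr ((\<nu> - 2) / 2) else 0)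
    = ball_power ((\<nu> - 2) / 2) (ip n x x) / ball_const \<nu> n" for x
    unfolding c enorm_eq_ip ball_power_def by (simp add: ip_self_nonneg)
  then show ?thesis unfolding beta_model_def ball_law_def by simp
qed

lemma ball_law_moment:
  assumes r: "r < n" and \<nu>: "\<nu> > 0" and s: "s > 0"
  shows "(\<integral>\<^sup>+x. ennreal (diff_gdet r n x powr (s / 2)) \<partial>PiM {1..Suc r} (\<lambda>_. ball_law \<nu> n)) = ennreal (moment_real r \<nu> n s)"
proof -
  let ?f = "\<lambda>x. ennreal (diff_gdet r n x powr (s / 2))" and ?\<beta> = "(\<nu> - 2) / 2"
  let ?L = "PiM {1..Suc r} (\<lambda>_. leb n)" and ?c = "ball_const \<nu> n"
  have n: "n \<ge> 1" using r by simp
  have c0: "?c > 0" by (rule ball_const_pos[OF n \<nu>])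
  obtain c where c: "c > 0"
    "(\<integral>\<^sup>+x. ennreal (ball_power ?\<beta> (ip n x x)) \<partial>leb n) = ennreal c"
    "(\<integral>\<^sup>+x. ?f x * weight ?\<beta> n {1..Suc r} x \<partial>?L) = ennreal (c ^ Suc r * moment_real r \<nu> n s)"
    by (rule simplex_moment_unnormalized[OF r \<nu> s])
  have cc: "c = ?c" using c(1,2) nn_integral_ball_const[OF n \<nu>] c0 by simp
  have fm: "?f \<in> borel_measurable ?L"
    by (intro measurable_compose[OF _ measurable_ennreal] powr_measurable_const diff_gdet_measurable[of "\<lambda>x. x" _ r n]) simp
  have wm: "weight ?\<beta> n {1..Suc r} \<in> borel_measurable ?L"
    using weight_measurable[of "{1..Suc r}" n "\<lambda>x. x" ?L ?\<beta>] block_component_measurable[of "\<lambda>x. x" ?L "{1..Suc r}" n] by simp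
  have gm: "(\<lambda>x. \<Prod>i\<in>{1..Suc r}. ennreal (ball_power ?\<beta> (ip n (x i) (x i)) / ?c)) \<in> borel_measurable ?L"
    by (intro borel_measurable_prod_ennreal' measurable_compose[OF _ ball_density_measurable] measurable_component_singleton)
  have w: "(\<Prod>i\<in>{1..Suc r}. ennreal (ball_power ?\<beta> (ip n (x i) (x i)) / ?c)) = ennreal ((1 / ?c) ^ Suc r) * weight ?\<beta> n {1..Suc r} x" for x
  proof -
    have "ennreal (ball_power ?\<beta> (ip n (x i) (x i)) / ?c) = ennreal (1 / ?c) * ennreal (ball_power ?\<beta> (ip n (x i) (x i)))" for i
      using c0 by (simp add: ennreal_mult[symmetric])
    then have "(\<Prod>i\<in>{1..Suc r}. ennreal (ball_power ?\<beta> (ip n (x i) (x i)) / ?c)) = (\<Prod>i\<in>{1..Suc r}. ennreal (1 / ?c)) * weight ?\<beta> n {1..Suc r} x"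
      by (simp only: prod.distrib weight_def)
    also have "(\<Prod>i\<in>{1..Suc r}. ennreal (1 / ?c)) = ennreal ((1 / ?c) ^ Suc r)"
      by (subst prod_constant) (use c0 in \<open>simp add: ennreal_power del: power_Suc\<close>)
    finally show ?thesis .
  qed
  have "(\<integral>\<^sup>+x. ?f x \<partial>PiM {1..Suc r} (\<lambda>_. ball_law \<nu> n))
    = (\<integral>\<^sup>+x. (\<Prod>i\<in>{1..Suc r}. ennreal (ball_power ?\<beta> (ip n (x i) (x i)) / ?c)) * ?f x \<partial>?L)"
    unfolding ball_law_def
    by (subst density_PiM[OF sigma_finite_leb _ ball_density_measurable prob_space_ball_law[OF n \<nu>, unfolded ball_law_def]])
      (simp_all only: finite_atLeastAtMost nn_integral_density[OF gm fm])
  also have "\<dots> = (\<integral>\<^sup>+x. ennreal ((1 / ?c) ^ Suc r) * (?f x * weight ?\<beta> n {1..Suc r} x) \<partial>?L)"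
    unfolding w by (simp only: mult_ac)
  also have "\<dots> = ennreal ((1 / ?c) ^ Suc r) * ennreal (?c ^ Suc r * moment_real r \<nu> n s)"
    unfolding c(3)[symmetric, unfolded cc] by (intro nn_integral_cmult borel_measurable_times_ennreal fm wm)
  also have "\<dots> = ennreal ((1 / ?c) ^ Suc r * (?c ^ Suc r * moment_real r \<nu> n s))"
    using c0 by (intro ennreal_mult'[symmetric]) simp
  also have "(1 / ?c) ^ Suc r * (?c ^ Suc r * moment_real r \<nu> n s) = moment_real r \<nu> n s"
    using c0 by (simp add: power_one_over)
  finally show ?thesis .
qed

text \<open>The factor \<open>1 - q\<close> raises the parameter from \<open>\<nu>\<close> to
  \<open>\<nu> + 2\<close>, so the mean is a quotient of two normalising constants. It tends to 0
  with \<open>\<nu>\<close>: the Beta model concentrates near the sphere.\<close>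

lemma ball_law_deficit:
  assumes n: "n \<ge> 1" and \<nu>: "\<nu> > 0"
  shows "(\<integral>\<^sup>+x. ennreal (1 - ip n x x) \<partial>ball_law \<nu> n) = ennreal (\<nu> / (real n + \<nu>))"
proof -
  have \<nu>2: "\<nu> + 2 > 0" using \<nu> by simp
  have B: "Beta (real n / 2) (\<nu> / 2) > 0" using n \<nu> by (intro Beta_real_pos) auto
  have m: "(\<lambda>x. ennreal (1 - ip n x x)) \<in> borel_measurable (leb n)"
    by (intro measurable_compose[OF _ measurable_ennreal] borel_measurable_diff borel_measurable_const measurable_ip leb_component_measurable[of _ _ n]) auto
  have p: "ball_power ((\<nu> - 2) / 2) q * max 0 (1 - q) = ball_power ((\<nu> + 2 - 2) / 2) q" for q
  proof (cases "q < 1")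
    case True
    then have "(1 - q) powr ((\<nu> - 2) / 2) * (1 - q) = (1 - q) powr ((\<nu> - 2) / 2 + 1)"
      by (simp add: powr_add)
    also have "(\<nu> - 2) / 2 + 1 = (\<nu> + 2 - 2) / 2" by (simp add: field_simps)
    finally show ?thesis using True by (simp add: ball_power_def)
  qed (simp add: ball_power_def)
  have "(\<integral>\<^sup>+x. ennreal (1 - ip n x x) \<partial>ball_law \<nu> n)
    = ennreal (1 / ball_const \<nu> n) * (\<integral>\<^sup>+x. ennreal (ball_power ((\<nu> - 2) / 2) (ip n x x)) * ennreal (1 - ip n x x) \<partial>leb n)"
    by (rule nn_integral_ball_law[OF n \<nu> m])
  also have "(\<integral>\<^sup>+x. ennreal (ball_power ((\<nu> - 2) / 2) (ip n x x)) * ennreal (1 - ip n x x) \<partial>leb n)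
    = (\<integral>\<^sup>+x. ennreal (ball_power ((\<nu> + 2 - 2) / 2) (ip n x x)) \<partial>leb n)"
  proof (rule nn_integral_cong)
    fix x
    have "ennreal (1 - ip n x x) = ennreal (max 0 (1 - ip n x x))" by (simp add: ennreal_eq_0_iff max_def)
    then show "ennreal (ball_power ((\<nu> - 2) / 2) (ip n x x)) * ennreal (1 - ip n x x) = ennreal (ball_power ((\<nu> + 2 - 2) / 2) (ip n x x))"
      unfolding p[symmetric] by (simp only: ennreal_mult[OF ball_power_nonneg max.cobounded1])
  qed
  also have "\<dots> = ennreal (ball_const (\<nu> + 2) n)" by (rule nn_integral_ball_const[OF n \<nu>2])
  also have "ennreal (1 / ball_const \<nu> n) * ennreal (ball_const (\<nu> + 2) n) = ennreal (ball_const (\<nu> + 2) n / ball_const \<nu> n)"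
    using ball_const_pos[OF n \<nu>] ball_const_pos[OF n \<nu>2] by (simp add: ennreal_mult[symmetric])
  also have "ball_const (\<nu> + 2) n / ball_const \<nu> n = \<nu> / (real n + \<nu>)"
  proof -
    obtain u where u: "u = unit_ball_vol (real n)" "u > 0" by simp
    have "(real n / 2 + \<nu> / 2) * Beta (real n / 2) (\<nu> / 2 + 1) = \<nu> / 2 * Beta (real n / 2) (\<nu> / 2)"
      using n \<nu> by (intro Beta_plus1_right) (auto elim!: nonpos_Ints_cases)
    then have Beq: "Beta (real n / 2) (\<nu> / 2 + 1) = \<nu> / (real n + \<nu>) * Beta (real n / 2) (\<nu> / 2)"
      using n \<nu> by (simp add: field_simps)
    have e: "(\<nu> + 2) / 2 = \<nu> / 2 + 1" by simp
    have gen: "a * (k * b) / (a * b) = k" if "a \<noteq> 0" "b \<noteq> 0" for a b k :: real using that by simp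
    have "u * (real n / 2) \<noteq> 0" using u(2) n by simp
    moreover have "Beta (real n / 2) (\<nu> / 2) \<noteq> 0" using B by linarith
    ultimately show ?thesis unfolding ball_const_def u(1)[symmetric] e Beq by (rule gen)
  qed
  finally show ?thesis .
qed

section \<open>The spherical model\<close>

definition direction :: "nat \<Rightarrow> (nat \<Rightarrow> real) \<Rightarrow> nat \<Rightarrow> real" where
  "direction n x = (\<lambda>i\<in>{..<n}. x i / enorm n x)"

lemma direction_measurable: "direction n \<in> measurable (leb n) (leb n)"
  unfolding direction_def[abs_def] enorm_eq_ip
  by (intro measurable_restrict) (auto intro!: borel_measurable_divide borel_measurable_sqrt measurable_ip leb_component_measurable[of _ _ n])

lemma direction_scale:
  assumes "c > 0"
  shows "direction n (\<lambda>k\<in>{..<n}. c * x k) = direction n x"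
proof -
  have "ip n (\<lambda>k\<in>{..<n}. c * x k) (\<lambda>k\<in>{..<n}. c * x k) = c\<^sup>2 * ip n x x"
    by (simp add: ip_def sum_distrib_left power2_eq_square mult_ac)
  then have "enorm n (\<lambda>k\<in>{..<n}. c * x k) = c * enorm n x"
    using assms by (simp add: enorm_eq_ip real_sqrt_mult)
  then show ?thesis using assms by (auto simp: direction_def restrict_def)
qed

text \<open>Up to the volume of the unit ball this is the uniform measure of a set of
  directions.\<close>

definition cone_volume :: "nat \<Rightarrow> (nat \<Rightarrow> real) set \<Rightarrow> ennreal" where
  "cone_volume n A = emeasure (leb n) {x \<in> space (leb n). ip n x x < 1 \<and> direction n x \<in> A}"

lemma ip_leb_measurable: "(\<lambda>x. ip n x x) \<in> borel_measurable (leb n)"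
  by (intro measurable_ip leb_component_measurable[of _ _ n]) auto

lemma cone_sets:
  assumes A: "A \<in> sets (leb n)"
  shows "{x \<in> space (leb n). ip n x x < q \<and> direction n x \<in> A} \<in> sets (leb n)"
proof -
  have "{x \<in> space (leb n). ip n x x < q} \<in> sets (leb n)"
    by (rule borel_measurable_less[OF ip_leb_measurable borel_measurable_const])
  moreover have "direction n -` A \<inter> space (leb n) \<in> sets (leb n)"
    by (rule measurable_sets[OF direction_measurable A])
  ultimately have "{x \<in> space (leb n). ip n x x < q} \<inter> (direction n -` A \<inter> space (leb n)) \<in> sets (leb n)" by (rule sets.Int)
  also have "{x \<in> space (leb n). ip n x x < q} \<inter> (direction n -` A \<inter> space (leb n)) = {x \<in> space (leb n). ip n x x < q \<and> direction n x \<in> A}" by auto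
  finally show ?thesis .
qed

lemma cone_volume_scale:
  assumes A: "A \<in> sets (leb n)" and q: "q > 0"
  shows "emeasure (leb n) {x \<in> space (leb n). ip n x x < q \<and> direction n x \<in> A} = ennreal (sqrt q ^ n) * cone_volume n A"
proof -
  let ?C = "\<lambda>q. {x \<in> space (leb n). ip n x x < q \<and> direction n x \<in> A}"
  have f: "(indicator (?C q) :: _ \<Rightarrow> ennreal) \<in> borel_measurable (leb n)" using cone_sets[OF A] by simp
  have "emeasure (leb n) (?C q) = (\<integral>\<^sup>+x. indicator (?C q) x \<partial>leb n)" using cone_sets[OF A] by simp
  also have "\<dots> = ennreal (sqrt q ^ card {..<n}) * (\<integral>\<^sup>+x. indicator (?C q) (\<lambda>k\<in>{..<n}. sqrt q * x k) \<partial>leb n)"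
    by (rule nn_integral_lborel_scale[OF _ f, symmetric]) (use q in auto)
  also have "(\<integral>\<^sup>+x. indicator (?C q) (\<lambda>k\<in>{..<n}. sqrt q * x k) \<partial>leb n) = (\<integral>\<^sup>+x. (indicator (?C 1) x :: ennreal) \<partial>leb n)"
  proof (rule nn_integral_cong)
    fix x assume x: "x \<in> space (leb n)"
    have "ip n (\<lambda>k\<in>{..<n}. sqrt q * x k) (\<lambda>k\<in>{..<n}. sqrt q * x k) = (\<Sum>k<n. (sqrt q * sqrt q) * (x k * x k))"
      unfolding ip_def by (intro sum.cong) (auto simp: mult_ac)
    also have "\<dots> = q * ip n x x" using q by (simp add: ip_def sum_distrib_left)
    finally have "ip n (\<lambda>k\<in>{..<n}. sqrt q * x k) (\<lambda>k\<in>{..<n}. sqrt q * x k) < q \<longleftrightarrow> ip n x x < 1" using q by simp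
    moreover have "direction n (\<lambda>k\<in>{..<n}. sqrt q * x k) = direction n x" using q by (intro direction_scale) simp
    moreover have "(\<lambda>k\<in>{..<n}. sqrt q * x k) \<in> space (leb n)" by (auto simp: space_PiM)
    ultimately have "(\<lambda>k\<in>{..<n}. sqrt q * x k) \<in> ?C q \<longleftrightarrow> x \<in> ?C 1" using x by simp
    then show "indicator (?C q) (\<lambda>k\<in>{..<n}. sqrt q * x k) = (indicator (?C 1) x :: ennreal)" by (simp only: indicator_def)
  qed
  also have "\<dots> = cone_volume n A" unfolding cone_volume_def using cone_sets[OF A] by simp
  finally show ?thesis by simp
qed

lemma direction_in_space: "direction n x \<in> space (leb n)"
  by (auto simp: direction_def space_PiM)

lemma cone_volume_finite: "cone_volume n A < \<infinity>"
proof -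
  have m: "{x \<in> space (leb n). ip n x x \<le> 1} \<in> sets (leb n)"
    by (rule borel_measurable_le[OF ip_leb_measurable borel_measurable_const])
  have "cone_volume n A \<le> emeasure (leb n) {x \<in> space (leb n). ip n x x \<le> 1}"
    unfolding cone_volume_def by (intro emeasure_mono m) auto
  then show ?thesis unfolding emeasure_leb_unit_ball by (simp add: le_less_trans[OF _ ennreal_less_top])
qed

text \<open>Under Lebesgue measure direction and norm are independent, because a cone cut off at
  squared norm \<open>q\<close> has a volume proportional to \<open>sqrt q ^ n\<close>, whatever its
  directions. Cross-multiplication by the cone volumes avoids divisions.\<close>

lemma polar_factor:
  assumes A: "A \<in> sets (leb n)" and \<phi>: "\<phi> \<in> borel_measurable borel"
  shows "cone_volume n (space (leb n)) * (\<integral>\<^sup>+x. indicator A (direction n x) * \<phi> (ip n x x) \<partial>leb n)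
    = cone_volume n A * (\<integral>\<^sup>+x. \<phi> (ip n x x) \<partial>leb n)"
proof -
  \<comment> \<open>The sign makes the half lines \<open>{y<..}\<close> correspond to balls, whose
    measure is finite.\<close>
  let ?T = "\<lambda>x. - ip n x x"
  have S: "space (leb n) \<in> sets (leb n)" by (rule sets.top)
  have Tm: "?T \<in> borel_measurable (leb n)" using ip_leb_measurable by (intro borel_measurable_uminus)
  define D where "D c A = density (leb n) (\<lambda>x. c * indicator A (direction n x))" for c :: ennreal and A
  have gm: "(\<lambda>x. c * indicator A (direction n x)) \<in> borel_measurable (leb n)" if "A \<in> sets (leb n)" for c :: ennreal and A
    using that by (intro borel_measurable_times_ennreal borel_measurable_const measurable_compose[OF direction_measurable]) simp
  have TD: "?T \<in> borel_measurable (D c A)" for c A using Tm by (simp add: D_def)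
  have em: "emeasure (distr (D c A) borel ?T) {y<..} = c * emeasure (leb n) {x \<in> space (leb n). ip n x x < - y \<and> direction n x \<in> A}"
    if A: "A \<in> sets (leb n)" for c A y
  proof -
    have s: "?T -` {y<..} \<inter> space (leb n) \<in> sets (leb n)" by (rule measurable_sets[OF Tm]) simp
    have "emeasure (distr (D c A) borel ?T) {y<..} = emeasure (D c A) (?T -` {y<..} \<inter> space (leb n))"
      by (subst emeasure_distr[OF TD]) (simp_all add: D_def)
    also have "\<dots> = (\<integral>\<^sup>+x. c * indicator A (direction n x) * indicator (?T -` {y<..} \<inter> space (leb n)) x \<partial>leb n)"
      unfolding D_def by (rule emeasure_density[OF gm[OF A] s])
    also have "\<dots> = (\<integral>\<^sup>+x. c * indicator {x \<in> space (leb n). ip n x x < - y \<and> direction n x \<in> A} x \<partial>leb n)"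
      by (rule nn_integral_cong) (auto simp: indicator_def)
    also have "\<dots> = c * emeasure (leb n) {x \<in> space (leb n). ip n x x < - y \<and> direction n x \<in> A}"
      by (rule nn_integral_cmult_indicator[OF cone_sets[OF A]])
    finally show ?thesis .
  qed
  let ?V = "cone_volume n (space (leb n))" and ?N = "cone_volume n A"
  have eq: "distr (D ?V A) borel ?T = distr (D ?N (space (leb n))) borel ?T"
  proof (rule measure_eqI_lessThan)
    fix y :: real
    have "emeasure (distr (D ?V A) borel ?T) {y<..} = (if y < 0 then ?V * (ennreal (sqrt (- y) ^ n) * ?N) else 0)"
    proof (cases "y < 0")
      case True
      then show ?thesis unfolding em[OF A] using cone_volume_scale[OF A, of "- y"] by simp
    next
      case False
      then have E: "{x \<in> space (leb n). ip n x x < - y \<and> direction n x \<in> A} = {}" using ip_self_nonneg[of n] by (smt (verit) Collect_empty_eq)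
      show ?thesis using False unfolding em[OF A] E by simp
    qed
    moreover have "emeasure (distr (D ?N (space (leb n))) borel ?T) {y<..} = (if y < 0 then ?N * (ennreal (sqrt (- y) ^ n) * ?V) else 0)"
    proof (cases "y < 0")
      case True
      then show ?thesis unfolding em[OF S] using cone_volume_scale[OF S, of "- y"] by simp
    next
      case False
      then have E: "{x \<in> space (leb n). ip n x x < - y \<and> direction n x \<in> space (leb n)} = {}" using ip_self_nonneg[of n] by (smt (verit) Collect_empty_eq)
      show ?thesis using False unfolding em[OF S] E by simp
    qed
    ultimately show "emeasure (distr (D ?V A) borel ?T) {y<..} = emeasure (distr (D ?N (space (leb n))) borel ?T) {y<..}"
      and "emeasure (distr (D ?V A) borel ?T) {y<..} < \<infinity>"
      using cone_volume_finite[of n A] cone_volume_finite[of n "space (leb n)"]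
      by (auto simp: mult_ac ennreal_mult_less_top)
  qed simp_all
  have int: "(\<integral>\<^sup>+y. \<phi> (- y) \<partial>distr (D c A) borel ?T) = c * (\<integral>\<^sup>+x. indicator A (direction n x) * \<phi> (ip n x x) \<partial>leb n)"
    if A: "A \<in> sets (leb n)" for c A
  proof -
    have \<phi>m: "(\<lambda>y. \<phi> (- y)) \<in> borel_measurable borel" by (rule measurable_compose[OF _ \<phi>]) simp
    have \<phi>i: "(\<lambda>x. \<phi> (ip n x x)) \<in> borel_measurable (leb n)" by (rule measurable_compose[OF ip_leb_measurable \<phi>])
    have im: "(\<lambda>x. indicator A (direction n x) :: ennreal) \<in> borel_measurable (leb n)" using gm[OF A, of 1] by simp
    have "(\<integral>\<^sup>+y. \<phi> (- y) \<partial>distr (D c A) borel ?T) = (\<integral>\<^sup>+x. \<phi> (- ?T x) \<partial>D c A)"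
      by (rule nn_integral_distr[OF TD]) (simp add: \<phi>m)
    also have "\<dots> = (\<integral>\<^sup>+x. c * indicator A (direction n x) * \<phi> (- ?T x) \<partial>leb n)"
      unfolding D_def by (rule nn_integral_density[OF gm[OF A]]) (simp add: \<phi>i)
    also have "\<dots> = (\<integral>\<^sup>+x. c * (indicator A (direction n x) * \<phi> (ip n x x)) \<partial>leb n)" by (simp add: mult.assoc)
    also have "\<dots> = c * (\<integral>\<^sup>+x. indicator A (direction n x) * \<phi> (ip n x x) \<partial>leb n)"
      by (intro nn_integral_cmult borel_measurable_times_ennreal im \<phi>i)
    finally show ?thesis .
  qed
  have "?V * (\<integral>\<^sup>+x. indicator A (direction n x) * \<phi> (ip n x x) \<partial>leb n)
    = ?N * (\<integral>\<^sup>+x. indicator (space (leb n)) (direction n x) * \<phi> (ip n x x) \<partial>leb n)"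
    unfolding int[OF A, symmetric] int[OF S, symmetric] eq by simp
  then show ?thesis using direction_in_space[of n] by simp
qed

lemma cone_volume_pos:
  assumes n: "n \<ge> 1"
  shows "cone_volume n (space (leb n)) \<noteq> 0"
proof
  assume 0: "cone_volume n (space (leb n)) = 0"
  have "emeasure (leb n) {x \<in> space (leb n). ip n x x \<le> 1} \<le> emeasure (leb n) {x \<in> space (leb n). ip n x x < 2 \<and> direction n x \<in> space (leb n)}"
    by (intro emeasure_mono cone_sets sets.top) (auto simp: direction_in_space)
  also have "\<dots> = 0" by (subst cone_volume_scale[OF sets.top]) (simp_all add: 0)
  finally have "ennreal (unit_ball_vol (real n)) = 0" unfolding emeasure_leb_unit_ball by simp
  then have "unit_ball_vol (real n) \<le> 0" by (simp only: ennreal_eq_0_iff)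
  moreover have "unit_ball_vol (real n) > 0" by (rule unit_ball_vol_pos) simp
  ultimately show False by linarith
qed

text \<open>The Beta density depends on the norm only, so for every \<open>\<nu> > 0\<close> the
  direction of a Beta point is uniform. This realises the spherical model on the same space as each
  Beta model.\<close>

lemma spherical_model_eq:
  assumes n: "n \<ge> 1" and \<nu>: "\<nu> > 0"
  shows "spherical_model n = distr (ball_law \<nu> n) (leb n) (direction n)"
proof (rule measure_eqI)
  let ?B = "{x \<in> space (leb n). enorm n x < 1}"
  let ?V = "cone_volume n (space (leb n))"
  have B: "?B = {x \<in> space (leb n). ip n x x < 1 \<and> direction n x \<in> space (leb n)}"
    by (simp add: enorm_eq_ip direction_in_space)
  have Bm: "?B \<in> sets (leb n)" unfolding B by (rule cone_sets[OF sets.top])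
  fix A assume "A \<in> sets (spherical_model n)"
  then have A: "A \<in> sets (leb n)" by (simp add: spherical_model_def)
  let ?N = "cone_volume n A"
  have dm: "direction n \<in> measurable (uniform_measure (leb n) ?B) (leb n)" using direction_measurable by simp
  have dA: "direction n -` A \<inter> space (leb n) \<in> sets (leb n)" by (rule measurable_sets[OF direction_measurable A])
  have sd: "spherical_model n = distr (uniform_measure (leb n) ?B) (leb n) (direction n)"
    unfolding spherical_model_def direction_def[abs_def] ..
  have "emeasure (spherical_model n) A = emeasure (uniform_measure (leb n) ?B) (direction n -` A \<inter> space (leb n))"
    unfolding sd by (subst emeasure_distr[OF dm A]) simp
  also have "\<dots> = emeasure (leb n) (?B \<inter> (direction n -` A \<inter> space (leb n))) / emeasure (leb n) ?B"
    by (rule emeasure_uniform_measure[OF Bm dA])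
  also have "?B \<inter> (direction n -` A \<inter> space (leb n)) = {x \<in> space (leb n). ip n x x < 1 \<and> direction n x \<in> A}"
    by (auto simp: enorm_eq_ip)
  also have "emeasure (leb n) {x \<in> space (leb n). ip n x x < 1 \<and> direction n x \<in> A} / emeasure (leb n) ?B = ?N / ?V"
    unfolding B cone_volume_def ..
  finally have 1: "emeasure (spherical_model n) A = ?N / ?V" .
  let ?\<phi> = "\<lambda>q. ennreal (ball_power ((\<nu> - 2) / 2) q)"
  have \<phi>: "?\<phi> \<in> borel_measurable borel"
    by (intro measurable_compose[OF _ measurable_ennreal] measurable_compose[OF _ ball_power_measurable]) simp
  have dm': "direction n \<in> measurable (ball_law \<nu> n) (leb n)" using direction_measurable by (simp cong: measurable_cong_sets)
  have im: "(\<lambda>x. indicator A (direction n x) :: ennreal) \<in> borel_measurable (leb n)"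
    using A by (intro measurable_compose[OF direction_measurable]) simp
  have "emeasure (distr (ball_law \<nu> n) (leb n) (direction n)) A = emeasure (ball_law \<nu> n) (direction n -` A \<inter> space (leb n))"
    by (subst emeasure_distr[OF dm' A]) simp
  also have "\<dots> = (\<integral>\<^sup>+x. indicator (direction n -` A \<inter> space (leb n)) x \<partial>ball_law \<nu> n)" using dA by simp
  also have "\<dots> = (\<integral>\<^sup>+x. indicator A (direction n x) \<partial>ball_law \<nu> n)"
    by (rule nn_integral_cong) (simp add: indicator_def)
  also have "\<dots> = ennreal (1 / ball_const \<nu> n) * (\<integral>\<^sup>+x. ?\<phi> (ip n x x) * indicator A (direction n x) \<partial>leb n)"
    by (rule nn_integral_ball_law[OF n \<nu> im])
  also have "(\<integral>\<^sup>+x. ?\<phi> (ip n x x) * indicator A (direction n x) \<partial>leb n) = (\<integral>\<^sup>+x. indicator A (direction n x) * ?\<phi> (ip n x x) \<partial>leb n)"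
    by (simp only: mult.commute)
  finally have e: "emeasure (distr (ball_law \<nu> n) (leb n) (direction n)) A
    = ennreal (1 / ball_const \<nu> n) * (\<integral>\<^sup>+x. indicator A (direction n x) * ?\<phi> (ip n x x) \<partial>leb n)" .
  have "?V * emeasure (distr (ball_law \<nu> n) (leb n) (direction n)) A
    = ennreal (1 / ball_const \<nu> n) * (?V * (\<integral>\<^sup>+x. indicator A (direction n x) * ?\<phi> (ip n x x) \<partial>leb n))"
    unfolding e by (simp only: mult_ac)
  also have "\<dots> = ennreal (1 / ball_const \<nu> n) * (?N * ennreal (ball_const \<nu> n))"
    unfolding polar_factor[OF A \<phi>] nn_integral_ball_const[OF n \<nu>] ..
  also have "\<dots> = (ennreal (1 / ball_const \<nu> n) * ennreal (ball_const \<nu> n)) * ?N" by (simp only: mult_ac)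
  also have "ennreal (1 / ball_const \<nu> n) * ennreal (ball_const \<nu> n) = 1"
    using ball_const_pos[OF n \<nu>] by (simp add: ennreal_mult[symmetric])
  finally have 2: "?V * emeasure (distr (ball_law \<nu> n) (leb n) (direction n)) A = ?N" by simp
  have V: "?V \<noteq> 0" "?V < \<infinity>" using cone_volume_pos[OF n] cone_volume_finite[of n "space (leb n)"] by auto
  show "emeasure (spherical_model n) A = emeasure (distr (ball_law \<nu> n) (leb n) (direction n)) A"
    unfolding 1 2[symmetric] using V by (metis ennreal_mult_divide_eq mult.commute infinity_ennreal_def less_top)
qed (simp add: spherical_model_def)

section \<open>Lipschitz bounds for powers of the Gram determinant\<close>

definition cube_close :: "'i set \<Rightarrow> nat \<Rightarrow> real \<Rightarrow> ('i \<Rightarrow> nat \<Rightarrow> real) \<Rightarrow> ('i \<Rightarrow> nat \<Rightarrow> real) \<Rightarrow> bool" where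
  "cube_close I n \<delta> x y \<longleftrightarrow> \<delta> \<ge> 0 \<and>
     (\<forall>i\<in>I. \<forall>k<n. \<bar>x i k\<bar> \<le> 1 \<and> \<bar>y i k\<bar> \<le> 1 \<and> \<bar>x i k - y i k\<bar> \<le> \<delta>)"

lemma cube_close_sym: "cube_close I n \<delta> x y \<Longrightarrow> cube_close I n \<delta> y x"
  unfolding cube_close_def by (metis abs_minus_commute)

text \<open>Bound and Lipschitz constant are carried together so that products stay in the class.
  The cube is the natural domain since the coordinates of the points are at most 1 in absolute value
  in both models.\<close>

definition lipschitz_on_cube :: "'i set \<Rightarrow> nat \<Rightarrow> real \<Rightarrow> real \<Rightarrow> (('i \<Rightarrow> nat \<Rightarrow> real) \<Rightarrow> real) \<Rightarrow> bool" where
  "lipschitz_on_cube I n B L f \<longleftrightarrow> B \<ge> 0 \<and> L \<ge> 0 \<and>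
     (\<forall>x y \<delta>. cube_close I n \<delta> x y \<longrightarrow> \<bar>f x\<bar> \<le> B \<and> \<bar>f x - f y\<bar> \<le> L * \<delta>)"

lemma lipschitz_on_cubeI:
  assumes "B \<ge> 0" "L \<ge> 0"
    and "\<And>x y \<delta>. cube_close I n \<delta> x y \<Longrightarrow> \<bar>f x\<bar> \<le> B \<and> \<bar>f x - f y\<bar> \<le> L * \<delta>"
  shows "lipschitz_on_cube I n B L f"
  using assms unfolding lipschitz_on_cube_def by simp

lemma lipschitz_on_cubeD:
  assumes "lipschitz_on_cube I n B L f" "cube_close I n \<delta> x y"
  shows "\<bar>f x\<bar> \<le> B" "\<bar>f x - f y\<bar> \<le> L * \<delta>"
  using assms unfolding lipschitz_on_cube_def by simp_all

lemma lipschitz_on_cube_const: "lipschitz_on_cube I n \<bar>c\<bar> 0 (\<lambda>_. c)"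
  by (rule lipschitz_on_cubeI) auto

lemma lipschitz_on_cube_component: "i \<in> I \<Longrightarrow> k < n \<Longrightarrow> lipschitz_on_cube I n 1 1 (\<lambda>x. x i k)"
  by (rule lipschitz_on_cubeI) (auto simp: cube_close_def)

lemma lipschitz_on_cube_add:
  assumes f: "lipschitz_on_cube I n B L f" and g: "lipschitz_on_cube I n B' L' g"
  shows "lipschitz_on_cube I n (B + B') (L + L') (\<lambda>x. f x + g x)"
proof (rule lipschitz_on_cubeI)
  show "B + B' \<ge> 0" "L + L' \<ge> 0" using f g unfolding lipschitz_on_cube_def by auto
  fix x y \<delta> assume *: "cube_close I n \<delta> x y"
  have "(L + L') * \<delta> = L * \<delta> + L' * \<delta>" by (simp add: algebra_simps)
  then show "\<bar>f x + g x\<bar> \<le> B + B' \<and> \<bar>f x + g x - (f y + g y)\<bar> \<le> (L + L') * \<delta>"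
    using lipschitz_on_cubeD(1,2)[OF f *] lipschitz_on_cubeD(1,2)[OF g *] by linarith
qed

lemma lipschitz_on_cube_mult:
  assumes f: "lipschitz_on_cube I n B L f" and g: "lipschitz_on_cube I n B' L' g"
  shows "lipschitz_on_cube I n (B * B') (B * L' + B' * L) (\<lambda>x. f x * g x)"
proof (rule lipschitz_on_cubeI)
  have nn: "B \<ge> 0" "L \<ge> 0" "B' \<ge> 0" "L' \<ge> 0" using f g unfolding lipschitz_on_cube_def by auto
  show "B * B' \<ge> 0" "B * L' + B' * L \<ge> 0" using nn by auto
  fix x y \<delta> assume *: "cube_close I n \<delta> x y"
  have **: "cube_close I n \<delta> y x"
    using * by (rule cube_close_sym)
  note F = lipschitz_on_cubeD(1,2)[OF f *] and G = lipschitz_on_cubeD(1,2)[OF g *] and G' = lipschitz_on_cubeD(1)[OF g **]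
  have "\<bar>f x * g x\<bar> \<le> B * B'" unfolding abs_mult using F(1) G(1) by (intro mult_mono) auto
  moreover have "\<bar>f x * g x - f y * g y\<bar> \<le> (B * L' + B' * L) * \<delta>"
  proof -
    have e: "f x * g x - f y * g y = f x * (g x - g y) + g y * (f x - f y)" by (simp add: algebra_simps)
    have "\<bar>f x * g x - f y * g y\<bar> \<le> \<bar>f x\<bar> * \<bar>g x - g y\<bar> + \<bar>g y\<bar> * \<bar>f x - f y\<bar>"
      unfolding e abs_mult[symmetric] by (rule abs_triangle_ineq)
    also have "\<dots> \<le> B * (L' * \<delta>) + B' * (L * \<delta>)"
      using F G G' nn by (intro add_mono mult_mono) auto
    finally show ?thesis by (simp add: algebra_simps)
  qed
  ultimately show "\<bar>f x * g x\<bar> \<le> B * B' \<and> \<bar>f x * g x - f y * g y\<bar> \<le> (B * L' + B' * L) * \<delta>" ..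
qed

lemma lipschitz_on_cube_sum:
  assumes "finite S" "\<And>s. s \<in> S \<Longrightarrow> \<exists>B L. lipschitz_on_cube I n B L (f s)"
  shows "\<exists>B L. lipschitz_on_cube I n B L (\<lambda>x. \<Sum>s\<in>S. f s x)"
  using assms
proof (induction S)
  case empty
  then show ?case using lipschitz_on_cube_const[of I n 0] by auto
next
  case (insert a S)
  then obtain B L B' L' where "lipschitz_on_cube I n B L (f a)" "lipschitz_on_cube I n B' L' (\<lambda>x. \<Sum>s\<in>S. f s x)" by (metis insertCI)
  from lipschitz_on_cube_add[OF this] insert.hyps show ?case by auto
qed

lemma lipschitz_on_cube_prod:
  assumes "finite S" "\<And>s. s \<in> S \<Longrightarrow> \<exists>B L. lipschitz_on_cube I n B L (f s)"
  shows "\<exists>B L. lipschitz_on_cube I n B L (\<lambda>x. \<Prod>s\<in>S. f s x)"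
  using assms
proof (induction S)
  case empty
  then show ?case using lipschitz_on_cube_const[of I n 1] by auto
next
  case (insert a S)
  then obtain B L B' L' where "lipschitz_on_cube I n B L (f a)" "lipschitz_on_cube I n B' L' (\<lambda>x. \<Prod>s\<in>S. f s x)" by (metis insertCI)
  from lipschitz_on_cube_mult[OF this] insert.hyps show ?case by auto
qed

lemma lipschitz_on_cube_diff_gdet:
  "\<exists>B L. lipschitz_on_cube {1..Suc r} n B L (diff_gdet r n)"
proof -
  have d: "\<exists>B L. lipschitz_on_cube {1..Suc r} n B L (\<lambda>x. x (Suc j) k - x (Suc r) k)" if "j < r" "k < n" for j k
  proof -
    have m: "lipschitz_on_cube {1..Suc r} n (\<bar>-1\<bar> * 1) (\<bar>-1\<bar> * 1 + 1 * 0) (\<lambda>x. -1 * x (Suc r) k)"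
      using that by (intro lipschitz_on_cube_mult lipschitz_on_cube_const lipschitz_on_cube_component) auto
    have c: "lipschitz_on_cube {1..Suc r} n 1 1 (\<lambda>x. x (Suc j) k)"
      using that by (intro lipschitz_on_cube_component) auto
    have e: "(\<lambda>x. x (Suc j) k + - 1 * x (Suc r) k) = (\<lambda>x. x (Suc j) k - x (Suc r) k :: real)" by simp
    show ?thesis using lipschitz_on_cube_add[OF c m] unfolding e by blast
  qed
  have i: "\<exists>B L. lipschitz_on_cube {1..Suc r} n B L (\<lambda>x. ip n (\<lambda>k. x (Suc i) k - x (Suc r) k) (\<lambda>k. x (Suc j) k - x (Suc r) k))"
    if ij: "i < r" "j < r" for i j
    unfolding ip_def
  proof (rule lipschitz_on_cube_sum)
    fix k assume "k \<in> {..<n}"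
    then have k: "k < n" by simp
    obtain B L where 1: "lipschitz_on_cube {1..Suc r} n B L (\<lambda>x. x (Suc i) k - x (Suc r) k)" using d[OF ij(1) k] by blast
    obtain B' L' where 2: "lipschitz_on_cube {1..Suc r} n B' L' (\<lambda>x. x (Suc j) k - x (Suc r) k)" using d[OF ij(2) k] by blast
    show "\<exists>B L. lipschitz_on_cube {1..Suc r} n B L (\<lambda>x. (x (Suc i) k - x (Suc r) k) * (x (Suc j) k - x (Suc r) k))"
      using lipschitz_on_cube_mult[OF 1 2] by blast
  qed simp
  show ?thesis
    unfolding diff_gdet_def[abs_def] gdet_leibniz
  proof (rule lipschitz_on_cube_sum)
    show "finite {p. p permutes {0..<r}}" by (rule finite_permutations) simp
    fix p assume "p \<in> {p. p permutes {0..<r}}"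
    then have p: "p permutes {0..<r}" by simp
    have "\<exists>B L. lipschitz_on_cube {1..Suc r} n B L (\<lambda>x. \<Prod>i=0..<r. ip n (\<lambda>k. x (Suc i) k - x (Suc r) k) (\<lambda>k. x (Suc (p i)) k - x (Suc r) k))"
    proof (rule lipschitz_on_cube_prod)
      fix j assume "j \<in> {0..<r}"
      then have "j < r" "p j < r" using permutes_in_image[OF p, of j] by auto
      then show "\<exists>B L. lipschitz_on_cube {1..Suc r} n B L (\<lambda>x. ip n (\<lambda>k. x (Suc j) k - x (Suc r) k) (\<lambda>k. x (Suc (p j)) k - x (Suc r) k))" by (rule i)
    qed simp
    then obtain B L where 1: "lipschitz_on_cube {1..Suc r} n B L (\<lambda>x. \<Prod>i=0..<r. ip n (\<lambda>k. x (Suc i) k - x (Suc r) k) (\<lambda>k. x (Suc (p i)) k - x (Suc r) k))" by (elim exE)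
    show "\<exists>B L. lipschitz_on_cube {1..Suc r} n B L (\<lambda>x. signof p * (\<Prod>i=0..<r. ip n (\<lambda>k. x (Suc i) k - x (Suc r) k) (\<lambda>k. x (Suc (p i)) k - x (Suc r) k)))"
      by (rule exI, rule exI, rule lipschitz_on_cube_mult[OF lipschitz_on_cube_const 1])
  qed
qed

text \<open>For \<open>\<sigma> < 1\<close> the power is not Lipschitz at 0. Applied with
  \<open>\<sigma> = s / 2\<close>, this is why the spherical moments are computed for
  \<open>s \<ge> 2\<close>.\<close>

lemma powr_lipschitz:
  fixes a b B \<sigma> :: real
  assumes "0 \<le> a" "a \<le> B" "0 \<le> b" "b \<le> B" and \<sigma>: "\<sigma> \<ge> 1"
  shows "\<bar>a powr \<sigma> - b powr \<sigma>\<bar> \<le> \<sigma> * B powr (\<sigma> - 1) * \<bar>a - b\<bar>"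
proof -
  have *: "b powr \<sigma> - a powr \<sigma> \<le> \<sigma> * B powr (\<sigma> - 1) * (b - a)" if ab: "0 \<le> a" "a < b" "b \<le> B" for a b
  proof (cases "a = 0")
    case True
    have "b powr \<sigma> = b powr (\<sigma> - 1) * b" using ab by (simp add: powr_diff)
    also have "\<dots> \<le> B powr (\<sigma> - 1) * b" using ab \<sigma> by (intro mult_right_mono powr_mono2) auto
    also have "\<dots> \<le> \<sigma> * (B powr (\<sigma> - 1) * b)" using ab \<sigma> mult_right_mono[of 1 \<sigma> "B powr (\<sigma> - 1) * b"] by simp
    finally show ?thesis using True \<sigma> by (simp add: mult_ac)
  next
    case False
    then have a: "a > 0" using ab by simp
    have "\<exists>z>a. z < b \<and> b powr \<sigma> - a powr \<sigma> = (b - a) * (\<sigma> * z powr (\<sigma> - 1))"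
      using a ab by (intro MVT2) (auto intro!: has_real_derivative_powr)
    then obtain z where z: "a < z" "z < b" "b powr \<sigma> - a powr \<sigma> = (b - a) * (\<sigma> * z powr (\<sigma> - 1))" by blast
    have "z powr (\<sigma> - 1) \<le> B powr (\<sigma> - 1)" using z a ab \<sigma> by (intro powr_mono2) auto
    then have "(b - a) * (\<sigma> * z powr (\<sigma> - 1)) \<le> (b - a) * (\<sigma> * B powr (\<sigma> - 1))"
      using ab \<sigma> by (intro mult_left_mono) auto
    then show ?thesis unfolding z(3) by (simp add: mult_ac)
  qed
  have mono: "a powr \<sigma> \<le> b powr \<sigma>" if "0 \<le> a" "a \<le> b" for a b using that \<sigma> by (intro powr_mono2) auto
  consider "a < b" | "b < a" | "a = b" by linarith
  then show ?thesis
  proof cases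
    case 1
    then show ?thesis using *[of a b] mono[of a b] assms by simp
  next
    case 2
    then show ?thesis using *[of b a] mono[of b a] assms by simp
  qed simp
qed

lemma lipschitz_on_cube_diff_gdet_powr:
  assumes r: "r \<le> n" and \<sigma>: "\<sigma> \<ge> 1"
  shows "\<exists>B L. lipschitz_on_cube {1..Suc r} n B L (\<lambda>x. diff_gdet r n x powr \<sigma>)"
proof -
  obtain B L where f: "lipschitz_on_cube {1..Suc r} n B L (diff_gdet r n)" using lipschitz_on_cube_diff_gdet by blast
  then have BL: "B \<ge> 0" "L \<ge> 0" unfolding lipschitz_on_cube_def by auto
  have "lipschitz_on_cube {1..Suc r} n (B powr \<sigma>) (\<sigma> * B powr (\<sigma> - 1) * L) (\<lambda>x. diff_gdet r n x powr \<sigma>)"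
  proof (rule lipschitz_on_cubeI)
    show "B powr \<sigma> \<ge> 0" "\<sigma> * B powr (\<sigma> - 1) * L \<ge> 0" using BL \<sigma> by auto
    fix x y \<delta> assume *: "cube_close {1..Suc r} n \<delta> x y"
    have **: "cube_close {1..Suc r} n \<delta> y x"
    using * by (rule cube_close_sym)
    note F = lipschitz_on_cubeD(1,2)[OF f *] and F' = lipschitz_on_cubeD(1)[OF f **]
    have nn: "diff_gdet r n x \<ge> 0" "diff_gdet r n y \<ge> 0" unfolding diff_gdet_def using r by (auto intro!: gdet_nonneg)
    have "\<bar>diff_gdet r n x powr \<sigma> - diff_gdet r n y powr \<sigma>\<bar> \<le> \<sigma> * B powr (\<sigma> - 1) * \<bar>diff_gdet r n x - diff_gdet r n y\<bar>"
      using F F' nn by (intro powr_lipschitz \<sigma>) auto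
    also have "\<dots> \<le> \<sigma> * B powr (\<sigma> - 1) * (L * \<delta>)" using F(2) \<sigma> by (intro mult_left_mono) auto
    finally have "\<bar>diff_gdet r n x powr \<sigma> - diff_gdet r n y powr \<sigma>\<bar> \<le> \<sigma> * B powr (\<sigma> - 1) * L * \<delta>" by (simp add: mult.assoc)
    moreover have "\<bar>diff_gdet r n x powr \<sigma>\<bar> \<le> B powr \<sigma>" using F(1) nn \<sigma> by (simp add: powr_mono2)
    ultimately show "\<bar>diff_gdet r n x powr \<sigma>\<bar> \<le> B powr \<sigma> \<and>
        \<bar>diff_gdet r n x powr \<sigma> - diff_gdet r n y powr \<sigma>\<bar> \<le> \<sigma> * B powr (\<sigma> - 1) * L * \<delta>" by simp
  qed
  then show ?thesis by blast
qed

text \<open>The critical case is \<open>\<nu> = 0\<close>, where \<open>n \<ge> 2\<close> yields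
  \<open>(r + 1) * n > 2 * r\<close>.\<close>

lemma moment_real_args_pos:
  fixes r n :: nat and \<nu> s :: real
  assumes n: "r < n" "2 \<le> n" and \<nu>: "\<nu> \<ge> 0" and s: "s \<ge> 0"
  shows "((real r + 1) * (\<nu> + real n + s) - 2 * real r) / 2 > 0"
    and "((real r + 1) * (\<nu> + real n) - 2 * real r + real r * s) / 2 > 0"
proof -
  have "real r * real n + real n > 2 * real r"
  proof (cases "r = 0")
    case False
    have "real r * real n \<ge> real r * 2" using n by (intro mult_left_mono) auto
    then show ?thesis using n by simp
  qed (use n in auto)
  then have q: "0 < real r * real n + real n - 2 * real r" by (simp only: diff_gt_0_iff_gt)
  have p: "(real r + 1) * (\<nu> + s) \<ge> 0" "(real r + 1) * \<nu> + real r * s \<ge> 0" using \<nu> s by auto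
  have e: "(real r + 1) * (\<nu> + real n + s) - 2 * real r = (real r * real n + real n - 2 * real r) + (real r + 1) * (\<nu> + s)"
    "(real r + 1) * (\<nu> + real n) - 2 * real r + real r * s = (real r * real n + real n - 2 * real r) + ((real r + 1) * \<nu> + real r * s)"
    by (simp_all add: algebra_simps)
  show "((real r + 1) * (\<nu> + real n + s) - 2 * real r) / 2 > 0"
    unfolding e(1) by (rule half_gt_zero[OF add_pos_nonneg[OF q p(1)]])
  show "((real r + 1) * (\<nu> + real n) - 2 * real r + real r * s) / 2 > 0"
    unfolding e(2) by (rule half_gt_zero[OF add_pos_nonneg[OF q p(2)]])
qed

lemma moment_real_tendsto:
  assumes n: "r < n" "2 \<le> n" and s: "s \<ge> 0"
  shows "((\<lambda>\<nu>. moment_real r \<nu> n s) \<longlongrightarrow> moment_real r 0 n s) (at_right 0)"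
proof -
  have g: "((\<lambda>\<nu>. Gamma (f \<nu>)) \<longlongrightarrow> Gamma (f 0)) (at_right 0)"
    if "(f \<longlongrightarrow> f 0) (at_right 0)" "f 0 > 0" for f :: "real \<Rightarrow> real"
    using that by (intro tendsto_Gamma) (auto elim!: nonpos_Ints_cases)
  note pos = moment_real_args_pos(2,1)[OF n order_refl s]
  have pos': "(real n + 0 + s) / 2 > 0" using n s by simp
  have ne: "Gamma ((real n + 0 + s) / 2) \<noteq> 0" "Gamma (((real r + 1) * (0 + real n) - 2 * real r + real r * s) / 2) \<noteq> 0"
    using Gamma_real_pos[OF pos(1)] Gamma_real_pos[OF pos'] by linarith+
  show ?thesis
    unfolding moment_real_def
  proof (intro tendsto_mult tendsto_const tendsto_power tendsto_divide)
    show "((\<lambda>\<nu>. Gamma ((real n + \<nu>) / 2)) \<longlongrightarrow> Gamma ((real n + 0) / 2)) (at_right 0)"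
      using n by (intro g) (auto intro!: tendsto_eq_intros)
    show "((\<lambda>\<nu>. Gamma ((real n + \<nu> + s) / 2)) \<longlongrightarrow> Gamma ((real n + 0 + s) / 2)) (at_right 0)"
      using n s by (intro g) (auto intro!: tendsto_eq_intros)
    show "((\<lambda>\<nu>. Gamma (((real r + 1) * (\<nu> + real n + s) - 2 * real r) / 2)) \<longlongrightarrow> Gamma (((real r + 1) * (0 + real n + s) - 2 * real r) / 2)) (at_right 0)"
      using pos by (intro g) (auto intro!: tendsto_eq_intros)
    show "((\<lambda>\<nu>. Gamma (((real r + 1) * (\<nu> + real n) - 2 * real r + real r * s) / 2)) \<longlongrightarrow> Gamma (((real r + 1) * (0 + real n) - 2 * real r + real r * s) / 2)) (at_right 0)"
      using pos by (intro g) (auto intro!: tendsto_eq_intros)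
  qed (use ne in auto)
qed

section \<open>Coupling of the two models\<close>

text \<open>Radial projection moves a point of the ball by at most \<open>1 - norm\<close>, which is
  at most \<open>1 - norm^2\<close>, the quantity with an explicit mean. At the origin the direction
  is 0, by division by 0, and the bounds persist.\<close>

lemma direction_bound:
  assumes k: "k < n"
  shows "\<bar>direction n x k\<bar> \<le> 1"
    and "ip n x x < 1 \<Longrightarrow> \<bar>x k\<bar> \<le> 1"
    and "ip n x x < 1 \<Longrightarrow> \<bar>x k - direction n x k\<bar> \<le> 1 - ip n x x"
proof -
  define e where "e = enorm n x"
  have e2: "ip n x x = e\<^sup>2" unfolding e_def enorm_eq_ip using ip_self_nonneg[of n x] by simp
  have e0: "e \<ge> 0" unfolding e_def enorm_eq_ip using ip_self_nonneg[of n x] by simp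
  have "(x k)\<^sup>2 \<le> (\<Sum>i<n. (x i)\<^sup>2)" using k by (intro member_le_sum) auto
  then have "(x k)\<^sup>2 \<le> e\<^sup>2" unfolding e2[symmetric] by (simp add: ip_def power2_eq_square)
  then have xk: "\<bar>x k\<bar> \<le> e" using e0 by (metis abs_le_square_iff abs_of_nonneg)
  have d: "direction n x k = x k / e" using k by (simp add: direction_def e_def)
  show d1: "\<bar>direction n x k\<bar> \<le> 1"
    unfolding d using xk e0 by (cases "e = 0") (simp_all add: abs_divide divide_le_eq_1)
  assume "ip n x x < 1"
  then have e1: "e < 1" unfolding e2 using e0 by (simp add: power_less_one_iff)
  show "\<bar>x k\<bar> \<le> 1" using xk e1 by linarith
  have "x k = direction n x k * e" unfolding d using xk e0 by (cases "e = 0") auto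
  then have "x k - direction n x k = - (direction n x k * (1 - e))" by (simp add: algebra_simps)
  then have "\<bar>x k - direction n x k\<bar> = \<bar>direction n x k\<bar> * (1 - e)" using e1 by (simp add: abs_mult)
  also have "\<dots> \<le> 1 * (1 - e)" using d1 e1 by (intro mult_right_mono) auto
  also have "\<dots> \<le> 1 - e\<^sup>2" using e0 e1 by (simp add: power2_eq_square mult_left_le)
  finally show "\<bar>x k - direction n x k\<bar> \<le> 1 - ip n x x" unfolding e2 .
qed

lemma AE_ball_law: "AE x in ball_law \<nu> n. ip n x x < 1"
  unfolding ball_law_def
  by (subst AE_density[OF ball_density_measurable]) (auto simp: ball_power_def)

lemma PiM_spherical_model:
  assumes n: "n \<ge> 1" and \<nu>: "\<nu> > 0" and I: "finite I"
  shows "PiM I (\<lambda>_. spherical_model n) =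
    distr (PiM I (\<lambda>_. ball_law \<nu> n)) (PiM I (\<lambda>_. leb n)) (\<lambda>x. \<lambda>i\<in>I. direction n (x i))"
proof -
  have dm: "direction n \<in> measurable (ball_law \<nu> n) (leb n)" using direction_measurable by (simp cong: measurable_cong_sets)
  have s: "sets (spherical_model n) = sets (leb n)" by (simp add: spherical_model_def)
  have dm': "direction n \<in> measurable (ball_law \<nu> n) (spherical_model n)" using dm by (simp cong: measurable_cong_sets add: s)
  have p: "prob_space (ball_law \<nu> n)" by (rule prob_space_ball_law[OF n \<nu>])
  have p': "prob_space (spherical_model n)"
    unfolding spherical_model_eq[OF n \<nu>] by (rule prob_space.prob_space_distr[OF p dm])
  have e: "distr (ball_law \<nu> n) (spherical_model n) (direction n) = spherical_model n"
    unfolding spherical_model_eq[OF n \<nu>] by (rule distr_cong) simp_all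
  have "distr (PiM I (\<lambda>_. ball_law \<nu> n)) (PiM I (\<lambda>_. spherical_model n)) (compose I (direction n))
    = PiM I (\<lambda>_. distr (ball_law \<nu> n) (spherical_model n) (direction n))"
    by (rule distr_PiM_finite_prob_space'[OF I p p' dm'])
  also have "\<dots> = PiM I (\<lambda>_. spherical_model n)" unfolding e ..
  finally have "PiM I (\<lambda>_. spherical_model n) = distr (PiM I (\<lambda>_. ball_law \<nu> n)) (PiM I (\<lambda>_. spherical_model n)) (compose I (direction n))" ..
  also have "\<dots> = distr (PiM I (\<lambda>_. ball_law \<nu> n)) (PiM I (\<lambda>_. leb n)) (\<lambda>x. \<lambda>i\<in>I. direction n (x i))"
    by (intro distr_cong sets_PiM_cong s) (simp_all add: compose_def)
  finally show ?thesis .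
qed

lemma directions_measurable:
  "(\<lambda>x. \<lambda>i\<in>I. direction n (x i)) \<in> measurable (PiM I (\<lambda>_. leb n)) (PiM I (\<lambda>_. leb n))"
  by (intro measurable_restrict measurable_compose[OF _ direction_measurable] measurable_component_singleton)

lemma enn2real_ennreal_max: "enn2real (ennreal m) = max 0 m"
  by (cases "m \<ge> 0") (auto simp: ennreal_neg max_def)

lemma expected_deficit:
  assumes n: "n \<ge> 1" and \<nu>: "\<nu> > 0" and I: "finite I"
  shows "has_bochner_integral (PiM I (\<lambda>_. ball_law \<nu> n)) (\<lambda>x. \<Sum>i\<in>I. 1 - ip n (x i) (x i)) (\<Sum>i\<in>I. \<nu> / (real n + \<nu>))"
proof (rule has_bochner_integral_sum)
  fix i assume i: "i \<in> I"
  let ?B = "\<lambda>_. ball_law \<nu> n"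
  have p: "prob_space (ball_law \<nu> n)" by (rule prob_space_ball_law[OF n \<nu>])
  have cm: "(\<lambda>x. x i) \<in> measurable (PiM I ?B) (ball_law \<nu> n)" using i by (rule measurable_component_singleton)
  have im: "(\<lambda>x. 1 - ip n x x) \<in> borel_measurable (ball_law \<nu> n)"
    using ip_leb_measurable[of n] by (simp cong: measurable_cong_sets)
  have eim: "(\<lambda>x. ennreal (1 - ip n x x)) \<in> borel_measurable (ball_law \<nu> n)"
    by (rule measurable_compose[OF im measurable_ennreal])
  show "has_bochner_integral (PiM I ?B) (\<lambda>x. 1 - ip n (x i) (x i)) (\<nu> / (real n + \<nu>))"
  proof (rule has_bochner_integral_nn_integral)
    show "(\<lambda>x. 1 - ip n (x i) (x i)) \<in> borel_measurable (PiM I ?B)"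
      by (rule measurable_compose[OF cm im])
    have "AE x in PiM I ?B. ip n (x i) (x i) < 1" by (rule AE_PiM_component[OF p i AE_ball_law])
    then show "AE x in PiM I ?B. 0 \<le> 1 - ip n (x i) (x i)" by eventually_elim simp
    show "0 \<le> \<nu> / (real n + \<nu>)" using \<nu> by simp
    have "(\<integral>\<^sup>+x. ennreal (1 - ip n (x i) (x i)) \<partial>PiM I ?B) = (\<integral>\<^sup>+x. ennreal (1 - ip n x x) \<partial>distr (PiM I ?B) (ball_law \<nu> n) (\<lambda>x. x i))"
      by (rule nn_integral_distr[symmetric, OF cm]) (simp add: eim)
    also have "distr (PiM I ?B) (ball_law \<nu> n) (\<lambda>x. x i) = ball_law \<nu> n" by (rule distr_PiM_component[OF p i])
    also have "(\<integral>\<^sup>+x. ennreal (1 - ip n x x) \<partial>ball_law \<nu> n) = ennreal (\<nu> / (real n + \<nu>))" by (rule ball_law_deficit[OF n \<nu>])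
    finally show "(\<integral>\<^sup>+x. ennreal (1 - ip n (x i) (x i)) \<partial>PiM I ?B) = ennreal (\<nu> / (real n + \<nu>))" .
  qed
qed

text \<open>The left-hand side does not involve \<open>\<nu>\<close>. For each
  \<open>\<nu> > 0\<close> it is compared with the Beta moment by projecting the same points: the
  difference is at most the Lipschitz constant times the expected total deficit, which tends to 0
  with \<open>\<nu>\<close>, while the Beta moments tend to the formula at
  \<open>\<nu> = 0\<close>.\<close>

lemma spherical_moment:
  assumes r: "r < n" and n2: "2 \<le> n" and s: "s \<ge> 2"
  shows "(\<integral>\<^sup>+x. ennreal (diff_gdet r n x powr (s / 2)) \<partial>PiM {1..Suc r} (\<lambda>_. spherical_model n)) = ennreal (moment_real r 0 n s)"
proof -
  let ?I = "{1..Suc r}"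
  let ?L = "PiM ?I (\<lambda>_. leb n)"
  define f where "f x = diff_gdet r n x powr (s / 2)" for x
  define dirs where "dirs x = (\<lambda>i\<in>?I. direction n (x i))" for x :: "nat \<Rightarrow> nat \<Rightarrow> real"
  let ?Q = "\<lambda>\<nu>. PiM ?I (\<lambda>_. ball_law \<nu> n)"
  have n: "n \<ge> 1" using n2 by simp
  have \<sigma>: "s / 2 \<ge> 1" using s by simp
  obtain B L where lip: "lipschitz_on_cube ?I n B L f"
    using lipschitz_on_cube_diff_gdet_powr[OF less_imp_le[OF r] \<sigma>] unfolding f_def[abs_def] by blast
  then have BL: "B \<ge> 0" "L \<ge> 0" unfolding lipschitz_on_cube_def by auto
  have f0: "f x \<ge> 0" for x by (simp add: f_def)
  have fm: "f \<in> borel_measurable ?L"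
    unfolding f_def[abs_def] by (intro powr_measurable_const diff_gdet_measurable[of "\<lambda>x. x" _ r n]) simp
  have dirm: "dirs \<in> measurable ?L ?L" unfolding dirs_def[abs_def] by (rule directions_measurable)
  have QL: "sets (?Q \<nu>) = sets ?L" for \<nu> by (rule sets_PiM_cong) simp_all
  have fmQ: "f \<in> borel_measurable (?Q \<nu>)" "(\<lambda>x. f (dirs x)) \<in> borel_measurable (?Q \<nu>)" for \<nu>
    using fm measurable_compose[OF dirm fm] by (simp_all cong: measurable_cong_sets add: QL)
  have dirmQ: "dirs \<in> measurable (?Q \<nu>) ?L" for \<nu> using dirm by (simp cong: measurable_cong_sets add: QL)
  define S where "S = (\<integral>\<^sup>+x. ennreal (f x) \<partial>PiM ?I (\<lambda>_. spherical_model n))"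
  define M where "M = enn2real S"
  have main: "S = ennreal M \<and> norm (max 0 (moment_real r \<nu> n s) - M) \<le> L * (\<Sum>i\<in>?I. \<nu> / (real n + \<nu>))" if \<nu>: "\<nu> > 0" for \<nu>
  proof -
    have p: "prob_space (ball_law \<nu> n)" by (rule prob_space_ball_law[OF n \<nu>])
    interpret Q: prob_space "?Q \<nu>" by (intro prob_space_PiM p)
    let ?\<delta> = "\<lambda>x :: nat \<Rightarrow> nat \<Rightarrow> real. \<Sum>i\<in>?I. 1 - ip n (x i) (x i)"
    have "AE x in ?Q \<nu>. \<forall>i\<in>?I. ip n (x i) (x i) < 1"
      by (intro AE_finite_allI) (auto intro!: AE_PiM_component[OF p] AE_ball_law)
    then have close: "AE x in ?Q \<nu>. cube_close ?I n (?\<delta> x) x (dirs x)"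
    proof eventually_elim
      case (elim x)
      have nn: "1 - ip n (x i) (x i) \<ge> 0" if "i \<in> ?I" for i using elim that by (simp add: less_imp_le)
      show ?case
        unfolding cube_close_def
      proof (intro conjI ballI allI impI)
        show "?\<delta> x \<ge> 0" using nn by (intro sum_nonneg)
        fix i k assume ik: "i \<in> ?I" "k < n"
        have i1: "ip n (x i) (x i) < 1" using elim ik by blast
        show "\<bar>x i k\<bar> \<le> 1" by (rule direction_bound(2)[OF ik(2) i1])
        show "\<bar>dirs x i k\<bar> \<le> 1" using ik direction_bound(1)[OF ik(2), of "x i"] by (simp add: dirs_def)
        have "\<bar>x i k - dirs x i k\<bar> \<le> 1 - ip n (x i) (x i)"
          using ik(1) direction_bound(3)[OF ik(2) i1] by (simp add: dirs_def)
        also have "\<dots> \<le> ?\<delta> x" using nn ik(1) by (intro member_le_sum) auto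
        finally show "\<bar>x i k - dirs x i k\<bar> \<le> ?\<delta> x" .
      qed
    qed
    have i1: "integrable (?Q \<nu>) f"
      by (rule Q.integrable_const_bound[of _ B, OF _ fmQ(1)])
        (use close in eventually_elim, use lipschitz_on_cubeD(1)[OF lip] in auto)
    have i2: "integrable (?Q \<nu>) (\<lambda>x. f (dirs x))"
      by (rule Q.integrable_const_bound[of _ B, OF _ fmQ(2)])
        (use close in eventually_elim, use lipschitz_on_cubeD(1)[OF lip cube_close_sym] in auto)
    have d: "integrable (?Q \<nu>) ?\<delta>" "(LINT x|?Q \<nu>. ?\<delta> x) = (\<Sum>i\<in>?I. \<nu> / (real n + \<nu>))"
      using expected_deficit[OF n \<nu>, of ?I] by (simp_all add: has_bochner_integral_iff)
    have "S = (\<integral>\<^sup>+x. ennreal (f x) \<partial>distr (?Q \<nu>) ?L dirs)"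
      unfolding S_def dirs_def[abs_def] by (subst PiM_spherical_model[OF n \<nu>]) simp_all
    also have "\<dots> = (\<integral>\<^sup>+x. ennreal (f (dirs x)) \<partial>?Q \<nu>)"
      by (rule nn_integral_distr[OF dirmQ]) (use measurable_compose[OF fm measurable_ennreal] in simp)
    also have "\<dots> = ennreal (LINT x|?Q \<nu>. f (dirs x))"
      by (rule nn_integral_eq_integral[OF i2]) (simp add: f0)
    finally have S: "S = ennreal (LINT x|?Q \<nu>. f (dirs x))" .
    have nn: "(LINT x|?Q \<nu>. f (dirs x)) \<ge> 0" by (intro integral_nonneg_AE AE_I2 f0)
    have M: "M = (LINT x|?Q \<nu>. f (dirs x))" unfolding M_def S using nn by simp
    \<comment> \<open>The moment is known as an extended nonnegative number, where
      \<open>ennreal\<close> truncates at 0; hence the maximum, which is continuous and survives the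
      limit.\<close>
    have "(LINT x|?Q \<nu>. f x) = max 0 (moment_real r \<nu> n s)"
      using integral_eq_nn_integral[OF fmQ(1) AE_I2[OF f0]] ball_law_moment[OF r \<nu>, of s] s
      by (simp add: f_def enn2real_ennreal_max)
    then have "norm (max 0 (moment_real r \<nu> n s) - M) = norm (LINT x|?Q \<nu>. f x - f (dirs x))"
      unfolding M using i1 i2 by simp
    also have "\<dots> \<le> (LINT x|?Q \<nu>. norm (f x - f (dirs x)))" by (rule integral_norm_bound)
    also have "\<dots> \<le> (LINT x|?Q \<nu>. L * ?\<delta> x)"
    proof (rule integral_mono_AE)
      show "integrable (?Q \<nu>) (\<lambda>x. norm (f x - f (dirs x)))"
        by (intro integrable_norm Bochner_Integration.integrable_diff i1 i2)
      show "integrable (?Q \<nu>) (\<lambda>x. L * ?\<delta> x)" using d(1) by (rule integrable_mult_right)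
      show "AE x in ?Q \<nu>. norm (f x - f (dirs x)) \<le> L * ?\<delta> x"
        using close by eventually_elim (use lipschitz_on_cubeD(2)[OF lip] in simp)
    qed
    also have "\<dots> = L * (\<Sum>i\<in>?I. \<nu> / (real n + \<nu>))" using d by simp
    finally show ?thesis using S M by simp
  qed
  have "((\<lambda>\<nu>. max 0 (moment_real r \<nu> n s) - M) \<longlongrightarrow> 0) (at_right 0)"
  proof (rule Lim_null_comparison)
    show "\<forall>\<^sub>F \<nu> in at_right 0. norm (max 0 (moment_real r \<nu> n s) - M) \<le> L * (\<Sum>i\<in>?I. \<nu> / (real n + \<nu>))"
      using main by (simp add: eventually_at_filter)
    have "((\<lambda>\<nu>. L * (\<Sum>i\<in>?I. \<nu> / (real n + \<nu>))) \<longlongrightarrow> L * (\<Sum>i\<in>?I. 0 / (real n + 0))) (at_right 0)"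
      using n by (intro tendsto_intros) auto
    then show "((\<lambda>\<nu>. L * (\<Sum>i\<in>?I. \<nu> / (real n + \<nu>))) \<longlongrightarrow> 0) (at_right 0)" by simp
  qed
  moreover have "((\<lambda>\<nu>. max 0 (moment_real r \<nu> n s) - M) \<longlongrightarrow> max 0 (moment_real r 0 n s) - M) (at_right 0)"
    using s by (intro tendsto_diff tendsto_max tendsto_const moment_real_tendsto[OF r n2]) simp
  ultimately have "max 0 (moment_real r 0 n s) - M = 0" using tendsto_unique trivial_limit_at_right_real by blast
  moreover have "S = ennreal M" using main[of 1] by simp
  ultimately have "S = ennreal (max 0 (moment_real r 0 n s))" by simp
  also have "\<dots> = ennreal (moment_real r 0 n s)" by (simp add: max_def ennreal_neg)
  finally show ?thesis unfolding S_def f_def .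
qed

section \<open>Mod-phi convergence\<close>

lemma AE_model_bounded:
  assumes model: "\<nu> > 0 \<and> P = beta_model \<nu> \<or> \<nu> = 0 \<and> P = spherical_model" and n: "1 \<le> n"
  shows "AE x in P n. \<forall>k<n. \<bar>x k\<bar> \<le> 1"
  using model
proof
  assume "\<nu> > 0 \<and> P = beta_model \<nu>"
  then have P: "P n = ball_law \<nu> n" using beta_model_eq[OF n] by simp
  show ?thesis
    unfolding P using AE_ball_law[where \<nu> = \<nu> and n = n] by eventually_elim (simp add: direction_bound(2))
next
  assume "\<nu> = 0 \<and> P = spherical_model"
  then have P: "P n = distr (ball_law 1 n) (leb n) (direction n)" using spherical_model_eq[OF n, of 1] by simp
  have dm: "direction n \<in> measurable (ball_law 1 n) (leb n)" using direction_measurable by (simp cong: measurable_cong_sets)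
  have "{x \<in> space (leb n). \<forall>k\<in>{..<n}. \<bar>x k\<bar> \<le> 1} \<in> sets (leb n)"
    by (intro sets.sets_Collect_finite_All borel_measurable_le borel_measurable_const borel_measurable_abs leb_component_measurable[of _ _ n]) auto
  then have m: "{x \<in> space (leb n). \<forall>k<n. \<bar>x k\<bar> \<le> 1} \<in> sets (leb n)" by (simp only: Ball_def lessThan_iff)
  show ?thesis unfolding P AE_distr_iff[OF dm m] by (simp add: direction_bound(1))
qed

lemma model_moment:
  assumes model: "\<nu> > 0 \<and> P = beta_model \<nu> \<or> \<nu> = 0 \<and> P = spherical_model"
    and r: "r < n" and n: "2 \<le> n" and s: "s \<ge> 2"
  shows "(\<integral>\<^sup>+x. ennreal (diff_gdet r n x powr (s / 2)) \<partial>PiM {1..Suc r} (\<lambda>_. P n)) = ennreal (moment_real r \<nu> n s)"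
  using model
proof
  assume m: "\<nu> > 0 \<and> P = beta_model \<nu>"
  then have P: "P n = ball_law \<nu> n" using beta_model_eq[of n \<nu>] n by simp
  show ?thesis unfolding P by (rule ball_law_moment[OF r]) (use m s in auto)
next
  assume "\<nu> = 0 \<and> P = spherical_model"
  then show ?thesis using spherical_moment[OF r n s] by simp
qed

lemma moment_real_nonneg:
  assumes n: "r < n" "2 \<le> n" and \<nu>: "\<nu> \<ge> 0" and s: "s \<ge> 0"
  shows "moment_real r \<nu> n s \<ge> 0"
proof -
  have G: "x > 0 \<Longrightarrow> Gamma x \<ge> 0" for x :: real using Gamma_real_pos[of x] by linarith
  note p = moment_real_args_pos[OF n \<nu> s]
  show ?thesis
    unfolding moment_real_def
  proof (intro mult_nonneg_nonneg prod_nonneg zero_le_power divide_nonneg_nonneg G p)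
    show "0 < (real n + \<nu>) / 2" "0 < (real n + \<nu> + s) / 2" using n \<nu> s by auto
  qed (use n s in auto)
qed

lemma moment_real_0:
  assumes n: "r < n" "2 \<le> n" and \<nu>: "\<nu> \<ge> 0"
  shows "moment_real r \<nu> n 0 = 1"
proof -
  have G: "x > 0 \<Longrightarrow> Gamma x \<noteq> 0" for x :: real using Gamma_real_pos[of x] by linarith
  have 1: "Gamma ((real n + 0 - real i) / 2) / Gamma ((real n - real i) / 2) = 1" if "i < r" for i
    using G[of "(real n - real i) / 2"] that n by simp
  have 2: "Gamma ((real n + \<nu>) / 2) / Gamma ((real n + \<nu> + 0) / 2) = 1"
    using G[of "(real n + \<nu>) / 2"] n \<nu> by simp
  have 3: "Gamma (((real r + 1) * (\<nu> + real n + 0) - 2 * real r) / 2) / Gamma (((real r + 1) * (\<nu> + real n) - 2 * real r + real r * 0) / 2) = 1"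
    using G[OF moment_real_args_pos(1)[OF n \<nu> order_refl]] by simp
  show ?thesis unfolding moment_real_def 2 3 using 1 by simp
qed

lemma moment_fun_analytic_at_0:
  assumes n: "r < n" "2 \<le> n" and \<nu>: "\<nu> \<ge> 0"
  shows "moment_fun r \<nu> n analytic_on {0}"
proof (rule moment_fun_analytic_at)
  have Re_le: "Re z \<le> 0" if "z \<in> \<int>\<^sub>\<le>\<^sub>0" for z :: complex
    using that by (elim nonpos_Ints_cases) simp
  show "(of_nat n + 0 - of_nat i) / 2 \<notin> (\<int>\<^sub>\<le>\<^sub>0 :: complex set)" if "i < r" for i
    using Re_le[of "(of_nat n + 0 - of_nat i) / 2"] that n by auto
  have "((of_nat r + 1) * (of_real \<nu> + of_nat n + 0) - 2 * of_nat r) / 2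
    = complex_of_real (((real r + 1) * (\<nu> + real n + 0) - 2 * real r) / 2)" by simp
  then have "Re (((of_nat r + 1) * (of_real \<nu> + of_nat n + 0) - 2 * of_nat r) / 2) = ((real r + 1) * (\<nu> + real n + 0) - 2 * real r) / 2"
    by (simp only: Re_complex_of_real)
  then show "((of_nat r + 1) * (of_real \<nu> + of_nat n + 0) - 2 * of_nat r) / 2 \<notin> (\<int>\<^sub>\<le>\<^sub>0 :: complex set)"
    using Re_le[of "((of_nat r + 1) * (of_real \<nu> + of_nat n + 0) - 2 * of_nat r) / 2"] moment_real_args_pos(1)[OF n \<nu> order_refl] by linarith
qed

text \<open>By independence the joint law of the points is the product of the model laws, so
  \<open>D\<close>, which is \<open>r!\<close> times the volume, has the computed moments.
  Regularity of the Gamma quotient at 0 with value 1 then supplies positivity of \<open>D\<close>,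
  and with it the continuation.\<close>

lemma simplex_mgf_continuation:
  fixes r n :: nat and X :: "nat \<Rightarrow> 'a \<Rightarrow> nat \<Rightarrow> real"
  assumes model: "\<nu> > 0 \<and> P = beta_model \<nu> \<or> \<nu> = 0 \<and> P = spherical_model"
    and r: "r < n" and n: "2 \<le> n" and M: "prob_space M"
    and indep: "prob_space.indep_vars M (\<lambda>_. leb n) X {1..r+1}"
    and law: "\<And>i. i \<in> {1..r+1} \<Longrightarrow> distr M (leb n) (X i) = P n"
    and Y: "\<And>\<omega>. Y \<omega> = real n * log_volume n r (\<lambda>i. X i \<omega>)"
  shows "mgf_continuation M Y (remove_sings (\<lambda>t. moment_fun r \<nu> n (complex_of_real (real n) * t)))"
    and "\<exists>!F. mgf_continuation M Y F"
proof -
  interpret prob_space M by fact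
  let ?I = "{1..Suc r}"
  have I: "{1..r+1} = ?I" by simp
  have \<nu>: "\<nu> \<ge> 0" using model by auto
  have rv: "X i \<in> measurable M (leb n)" if "i \<in> ?I" for i
    using indep that unfolding I indep_vars_def by blast
  define XI where "XI \<omega> = (\<lambda>i\<in>?I. X i \<omega>)" for \<omega>
  have XIm: "XI \<in> measurable M (PiM ?I (\<lambda>_. leb n))"
    unfolding XI_def[abs_def] using rv by (rule measurable_restrict)
  have joint: "distr M (PiM ?I (\<lambda>_. leb n)) XI = PiM ?I (\<lambda>_. P n)"
  proof -
    have "distr M (PiM ?I (\<lambda>_. leb n)) XI = PiM ?I (\<lambda>i. distr M (leb n) (X i))"
      using indep_vars_iff_distr_eq_PiM'[of ?I X "\<lambda>_. leb n"] rv indep unfolding I XI_def[abs_def] by simp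
    also have "\<dots> = PiM ?I (\<lambda>_. P n)" by (rule PiM_cong[OF refl law]) simp
    finally show ?thesis .
  qed
  define \<Delta> where "\<Delta> \<omega> = diff_gdet r n (\<lambda>i. X i \<omega>)" for \<omega>
  have \<Delta>XI: "\<Delta> \<omega> = diff_gdet r n (XI \<omega>)" for \<omega>
    unfolding \<Delta>_def diff_gdet_def gdet_def by (intro arg_cong[where f = Determinant.det] cong_mat refl) (simp add: XI_def)
  have \<Delta>0: "\<Delta> \<omega> \<ge> 0" for \<omega>
    unfolding \<Delta>_def diff_gdet_def using r by (intro gdet_nonneg) simp
  have \<Delta>m: "\<Delta> \<in> borel_measurable M" unfolding \<Delta>XI[abs_def] by (rule diff_gdet_measurable[OF XIm])
  define D where "D \<omega> = sqrt (\<Delta> \<omega>)" for \<omega>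
  have Dm: "D \<in> borel_measurable M" unfolding D_def[abs_def] using \<Delta>m by measurable
  obtain B L where lip: "lipschitz_on_cube ?I n B L (diff_gdet r n)" using lipschitz_on_cube_diff_gdet by blast
  have bnd: "AE \<omega> in M. D \<omega> \<le> sqrt B"
  proof -
    have "AE \<omega> in M. \<forall>i\<in>?I. \<forall>k<n. \<bar>X i \<omega> k\<bar> \<le> 1"
    proof (intro AE_finite_allI)
      fix i assume i: "i \<in> ?I"
      have lw: "distr M (leb n) (X i) = P n" using law[of i] i by simp
      have "AE x in distr M (leb n) (X i). \<forall>k<n. \<bar>x k\<bar> \<le> 1"
        unfolding lw by (rule AE_model_bounded[OF model]) (use n in simp)
      then show "AE \<omega> in M. \<forall>k<n. \<bar>X i \<omega> k\<bar> \<le> 1" by (rule AE_distrD[OF rv[OF i]])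
    qed simp
    then show ?thesis
    proof eventually_elim
      case (elim \<omega>)
      \<comment> \<open>The configuration is compared with itself, at distance 0, to extract the
        bound \<open>B\<close> alone.\<close>
      then have "cube_close ?I n 0 (\<lambda>i. X i \<omega>) (\<lambda>i. X i \<omega>)" unfolding cube_close_def by simp
      from lipschitz_on_cubeD(1)[OF lip this] show ?case unfolding D_def \<Delta>_def by simp
    qed
  qed
  have mom: "moment_fun r \<nu> n (complex_of_real s) = complex_of_real (LINT \<omega>|M. D \<omega> powr s)" if s: "s \<ge> 2" for s
  proof -
    have Ds: "D \<omega> powr s = \<Delta> \<omega> powr (s / 2)" for \<omega>
      unfolding D_def powr_half_sqrt[OF \<Delta>0, symmetric] powr_powr by simp
    have fm: "(\<lambda>x. ennreal (diff_gdet r n x powr (s / 2))) \<in> borel_measurable (PiM ?I (\<lambda>_. leb n))"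
      by (intro measurable_compose[OF _ measurable_ennreal] powr_measurable_const diff_gdet_measurable[of "\<lambda>x. x" _ r n]) simp
    have "(\<integral>\<^sup>+\<omega>. ennreal (\<Delta> \<omega> powr (s / 2)) \<partial>M) = (\<integral>\<^sup>+x. ennreal (diff_gdet r n x powr (s / 2)) \<partial>distr M (PiM ?I (\<lambda>_. leb n)) XI)"
      unfolding \<Delta>XI by (rule nn_integral_distr[OF XIm, symmetric]) (use fm in simp)
    also have "\<dots> = ennreal (moment_real r \<nu> n s)" unfolding joint by (rule model_moment[OF model r n s])
    finally have nn: "(\<integral>\<^sup>+\<omega>. ennreal (\<Delta> \<omega> powr (s / 2)) \<partial>M) = ennreal (moment_real r \<nu> n s)" .
    have pm: "(\<lambda>\<omega>. \<Delta> \<omega> powr (s / 2)) \<in> borel_measurable M" using \<Delta>m by (rule powr_measurable_const)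
    have s0: "s \<ge> 0" using s by simp
    have "(LINT \<omega>|M. D \<omega> powr s) = enn2real (\<integral>\<^sup>+\<omega>. ennreal (\<Delta> \<omega> powr (s / 2)) \<partial>M)"
      unfolding Ds by (rule integral_eq_nn_integral[OF pm]) simp
    also have "\<dots> = moment_real r \<nu> n s" unfolding nn by (rule enn2real_ennreal[OF moment_real_nonneg[OF r n \<nu> s0]])
    finally show ?thesis by (simp only: moment_fun_of_real)
  qed
  have YD: "Y \<omega> = real n * ln (D \<omega>)" if \<omega>: "\<omega> \<in> space M" for \<omega>
  proof -
    have "X i \<omega> \<in> space (leb n)" if "i \<in> {1..r+1}" for i
      using measurable_space[OF rv \<omega>, of i] that by simp
    from flat_volume_simplex_hull[OF less_imp_le[OF r] this, of "\<lambda>i. i"]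
    have "flat_volume n r (simplex_hull n {1..r+1} (\<lambda>i. X i \<omega>)) = sqrt (diff_gdet r n (\<lambda>i. X i \<omega>)) / fact r" by simp
    then show ?thesis unfolding Y log_volume_def D_def \<Delta>_def by simp
  qed
  have G0: "moment_fun r \<nu> n 0 = 1" using moment_fun_of_real[of r \<nu> n 0] moment_real_0[OF r n \<nu>] by simp
  have c: "real n > 0" using n by simp
  have D0: "0 \<le> D \<omega>" for \<omega> unfolding D_def using \<Delta>0 by simp
  note R = mgf_continuation_of_moments[OF M Dm D0 bnd moment_fun_meromorphic moment_fun_analytic_at_0[OF r n \<nu>] G0 mom YD c]
  show "mgf_continuation M Y (remove_sings (\<lambda>t. moment_fun r \<nu> n (complex_of_real (real n) * t)))" by (rule R(1))
  show "\<exists>!F. mgf_continuation M Y F" by (rule R(2))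
qed

theorem proposition4p4:
  fixes r :: nat and \<nu> :: real
    and P :: "nat \<Rightarrow> (nat \<Rightarrow> real) measure"
    and M :: "nat \<Rightarrow> 'a measure"
    and X :: "nat \<Rightarrow> nat \<Rightarrow> 'a \<Rightarrow> nat \<Rightarrow> real"
    and Y :: "nat \<Rightarrow> 'a \<Rightarrow> real"
  assumes model: "\<nu> > 0 \<and> P = beta_model \<nu> \<or> \<nu> = 0 \<and> P = spherical_model"
    and prob: "\<And>n. r \<le> n \<Longrightarrow> (\<nu> = 0 \<longrightarrow> 2 \<le> n) \<Longrightarrow> prob_space (M n)"
    and indep: "\<And>n. r \<le> n \<Longrightarrow> (\<nu> = 0 \<longrightarrow> 2 \<le> n) \<Longrightarrow>
                  prob_space.indep_vars (M n) (\<lambda>_. leb n) (X n) {1..r+1}"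
    and law: "\<And>n i. r \<le> n \<Longrightarrow> (\<nu> = 0 \<longrightarrow> 2 \<le> n) \<Longrightarrow> i \<in> {1..r+1} \<Longrightarrow>
                  distr (M n) (leb n) (X n i) = P n"
    and Y: "\<And>n \<omega>. Y n \<omega> = real n * log_volume n r (\<lambda>i. X n i \<omega>)"
  shows "(\<forall>\<^sub>F n in sequentially. \<exists>!F. mgf_continuation (M n) (Y n) F)
    \<and> mod_phi_converges M Y (eta r) real (-1) \<infinity> (limit_fun r \<nu>)
    \<and> (\<forall>K. compact K \<and> K \<subseteq> UNIV - complex_of_real ` {..-1} \<longrightarrow>
         uniform_limit K
           (\<lambda>n t. ext_mgf (M n) (Y n) t / exp (of_nat n * eta r t))
           (limit_fun r \<nu>) sequentially)"
proof (intro conjI)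
  \<comment> \<open>The moment formula is available for \<open>n > r\<close> and
    \<open>n \<ge> 2\<close>; all three claims concern large \<open>n\<close>.\<close>
  have ev: "\<forall>\<^sub>F n in sequentially. r < n \<and> 2 \<le> n"
    by (intro eventually_conj eventually_gt_at_top eventually_ge_at_top)
  have cont: "mgf_continuation (M n) (Y n) (remove_sings (\<lambda>t. moment_fun r \<nu> n (complex_of_real (real n) * t)))"
    "\<exists>!F. mgf_continuation (M n) (Y n) F" if n: "r < n" "2 \<le> n" for n
    using simplex_mgf_continuation[OF model n prob indep law Y] n by simp_all
  show "\<forall>\<^sub>F n in sequentially. \<exists>!F. mgf_continuation (M n) (Y n) F"
    using ev by (rule eventually_mono) (rule cont(2), simp_all)
  have lim: "uniform_limit K (\<lambda>n t. ext_mgf (M n) (Y n) t / exp (of_nat n * eta r t)) (limit_fun r \<nu>) sequentially"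
    if K: "compact K" "K \<subseteq> UNIV - complex_of_real ` {..-1}" for K
  proof -
    \<comment> \<open>For large \<open>n\<close> the Gamma quotient is analytic at every point of
      \<open>K\<close>, so the removal of singularities leaves its values there unchanged.\<close>
    have "\<forall>\<^sub>F n in sequentially. \<forall>t\<in>K. ext_mgf (M n) (Y n) t / exp (of_nat n * eta r t) = moment_fun r \<nu> n (of_nat n * t) / exp (of_nat n * eta r t)"
      using ev eventually_moment_fun_analytic[OF K, of r \<nu>]
    proof eventually_elim
      case (elim n)
      show ?case
      proof
        fix t assume t: "t \<in> K"
        have "(moment_fun r \<nu> n \<circ> (\<lambda>t. complex_of_real (real n) * t)) analytic_on {t}"
          using elim t by (intro analytic_on_compose analytic_intros) simp
        then have "(\<lambda>t. moment_fun r \<nu> n (complex_of_real (real n) * t)) analytic_on {t}" by (simp add: o_def)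
        then have "remove_sings (\<lambda>t. moment_fun r \<nu> n (complex_of_real (real n) * t)) t = moment_fun r \<nu> n (of_nat n * t)"
          by (simp add: remove_sings_at_analytic)
        moreover have "ext_mgf (M n) (Y n) = remove_sings (\<lambda>t. moment_fun r \<nu> n (complex_of_real (real n) * t))"
          unfolding ext_mgf_def using cont elim by (intro the1_equality) auto
        ultimately show "ext_mgf (M n) (Y n) t / exp (of_nat n * eta r t) = moment_fun r \<nu> n (of_nat n * t) / exp (of_nat n * eta r t)" by simp
      qed
    qed
    from uniform_limit_cong[OF this refl] show ?thesis using uniform_limit_moment_fun[OF K] by (rule iffD2)
  qed
  then show "\<forall>K. compact K \<and> K \<subseteq> UNIV - complex_of_real ` {..-1} \<longrightarrow>
      uniform_limit K (\<lambda>n t. ext_mgf (M n) (Y n) t / exp (of_nat n * eta r t)) (limit_fun r \<nu>) sequentially"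
    by blast
  have strip: "strip (-1) \<infinity> \<subseteq> UNIV - complex_of_real ` {..-1}"
    by (auto simp: strip_def one_ereal_def)
  show "mod_phi_converges M Y (eta r) real (-1) \<infinity> (limit_fun r \<nu>)"
    unfolding mod_phi_converges_def
  proof (intro conjI allI impI)
    show "(-1 :: ereal) < \<infinity>" by (simp add: one_ereal_def)
    show "filterlim real at_top sequentially" by (rule filterlim_real_sequentially)
    show "\<exists>\<phi>. infinitely_divisible \<phi> \<and>
        (\<forall>t\<in>strip (-1) \<infinity>. integrable \<phi> (\<lambda>x. exp (t * complex_of_real x)) \<and>
           (LINT x|\<phi>. exp (t * complex_of_real x)) = exp (eta r t))"
      by (rule infinitely_divisible_with_cumulant_eta)
    show "limit_fun r \<nu> analytic_on strip (-1) \<infinity>"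
      by (rule analytic_on_subset[OF limit_fun_analytic strip])
    fix K assume "compact K \<and> K \<subseteq> strip (-1) \<infinity>"
    then have "compact K" "K \<subseteq> UNIV - complex_of_real ` {..-1}" using strip by auto
    from lim[OF this] show "uniform_limit K (\<lambda>n t. ext_mgf (M n) (Y n) t / exp (complex_of_real (real n) * eta r t)) (limit_fun r \<nu>) sequentially"
      by simp
  qed
qed

end
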